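(* Let $X\in\mathcal S_{\rm mid}$, $Y\in\mathcal S_{\rm top}\cup\mathcal S_{\rm mid}$, $(U,D)\in\mathcal E_X$ with $D\in\mathcal D_{\mathsf J_1}$, and $(V,\Lambda)\in\mathcal E_Y$, where if $Y\in\mathcal S_{\rm mid}$ then $\Lambda\in\mathcal D_{\mathsf J_1}$. Let $z,w$, the classes $l$ with their data-triples $(\zeta,r_U,r_V)$, the sets of curves $\mathcal M_l=\mathcal M_l([(U,D)],[(V,\Lambda)])$, and the numbers $\ell_{\rm id},\ell_{(13)},\ell_{(12)}$ be as defined in the context. (i) Except for $\mathcal M_{{\rm C}'}$, every class $\mathcal M_l$, when defined, consists of a single curve $\chi_l=\chi_l([(U,D)],[(V,\Lambda)])$. The class $\mathcal M_{{\rm C}'}$, which is defined only when $w=0$ or $z=0$, is an infinite family of scaling-rotation curves, in natural one-to-one correspondence with a circle. The class $\mathcal M_{{\rm C}'}$ does not depend on the choice of the components $[(U,D)],[(V,\Lambda)]\subset SO(3)\times\mathcal D_{\mathsf J_1}$ of the fibers, so it can unambiguously be written as $\mathcal M_{{\rm C}'}(X,Y)$. (ii) For any data-triple $(\zeta,r_U,r_V)$ of a class $l$, put $R_U=\phi(r_U)$, $R_V=\phi(r_V)$. Both for $Y\in\mathcal S_{\rm top}$ and for $Y\in\mathcal S_{\rm mid}$, for each class $l$ whose curve(s) are listed in (iii) or (iv) below as belonging to $\mathcal M(X,Y)$, the pair $$((UR_U,D),\ (VR_V\phi(\zeta)^{-1},\ \pi_\zeta\cdot\Lambda))\in\mathcal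 E_X\times\mathcal E_Y$$ is a minimal pair, with $(UR_U,D)$ lying in the connected component $[(U,D)]$ of $\mathcal E_X$. Conversely, every minimal pair in $\mathcal E_X\times\mathcal E_Y$ whose first point lies in $[(U,D)]$ is given in this way by a data-triple of one of the classes listed in (iii) or (iv) for the given data. (iii) Let $Y\in\mathcal S_{\rm top}$. Define - $\mathcal A=\{\chi_{{\rm A}_1}\}$ if $|z|>|w|$, $\{\chi_{{\rm A}_2}\}$ if $|z|<|w|$, $\{\chi_{{\rm A}_1},\chi_{{\rm A}_2}\}$ if $|z|=|w|$; - $\mathcal B=\{\chi_{{\rm B}_1}\}$ if $\mathrm{Re}(\bar zw)>0$, $\{\chi_{{\rm B}_2}\}$ if $\mathrm{Re}(\bar zw)<0$, $\{\chi_{{\rm B}_1},\chi_{{\rm B}_2}\}$ if $\mathrm{Re}(\bar zw)=0$; - $\mathcal C=\{\chi_{{\rm C}_1}\}$ if $\mathrm{Im}(\bar zw)>0$, $\{\chi_{{\rm C}_2}\}$ if $\mathrm{Im}(\bar zw)<0$, $\{\chi_{{\rm C}_1},\chi_{{\rm C}_2}\}$ if $\mathrm{Im}(\bar zw)=0$. Then the set $\mathcal M(X,Y)$ of MSSR curves from $X$ to $Y$ is - $\mathcal A$ if $\ell_{\rm id}<\min\{\ell_{(13)},\ell_{(12)}\}$; - $\mathcal B$ if $\ell_{(13)}<\min\{\ell_{\rm id},\ell_{(12)}\}$; - $\mathcal C$ if $\ell_{(12)}<\min\{\ell_{\rm id},\ell_{(13)}\}$; - $\mathcal A\cup\mathcal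 B$ if $\ell_{\rm id}=\ell_{(13)}<\ell_{(12)}$, in which case $|z|=|w|$ and $\mathrm{Re}(\bar zw)=0$ cannot both hold; - $\mathcal A\cup\mathcal C$ if $\ell_{\rm id}=\ell_{(12)}<\ell_{(13)}$, in which case $|z|=|w|$ and $\mathrm{Im}(\bar zw)=0$ cannot both hold; - $\mathcal B\cup\mathcal C$ if $\ell_{(13)}=\ell_{(12)}<\ell_{\rm id}$, in which case $\mathrm{Re}(\bar zw)=0$ and $\mathrm{Im}(\bar zw)=0$ cannot both hold; - $\mathcal A\cup\mathcal B\cup\mathcal C$ if $\ell_{\rm id}=\ell_{(13)}=\ell_{(12)}$, in which case at most one of $|z|=|w|$, $\mathrm{Re}(\bar zw)=0$, $\mathrm{Im}(\bar zw)=0$ holds. In every case the curves $\chi_l$ listed for distinct $l$ are distinct, so that $|\mathcal M(X,Y)|\in\{1,2,3,4\}$ is the number of labels $l$ listed. In particular $|\mathcal M(X,Y)|=1$ means precisely that there is a unique MSSR curve from $X$ to $Y$. (iv) Let $Y\in\mathcal S_{\rm mid}$. Then $\mathcal M(X,Y)$ consists of one, two, three, or infinitely many curves, as follows. Define $\mathcal A'=\{\chi_{{\rm A}_1'}\}$ if $|z|>|w|$, $\{\chi_{{\rm A}_2'}\}$ if $|z|<|w|$, $\{\chi_{{\rm A}_1'},\chi_{{\rm A}_2'}\}$ if $|z|=|w|$. Then - if $\ell_{\rm id}<\ell_{(13)}$: $\mathcal M(X,Y)=\mathcal A'$, with $|\mathcal M(X,Y)|=1$ if $|z|\ne|w|$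 and $2$ if $|z|=|w|$; - if $\ell_{\rm id}>\ell_{(13)}$: $\mathcal M(X,Y)=\{\chi_{{\rm B}'}\}$ (one curve) if $z\ne0\ne w$, and $\mathcal M(X,Y)=\mathcal M_{{\rm C}'}$ (infinite) if $w=0$ or $z=0$; - if $\ell_{\rm id}=\ell_{(13)}$: $\mathcal M(X,Y)=\mathcal A'\cup\{\chi_{{\rm B}'}\}$ if $z\neq0\neq w$, with $|\mathcal M(X,Y)|=2$ if $|z|\ne|w|$ and $3$ if $|z|=|w|$; $\mathcal M(X,Y)=\{\chi_{{\rm A}_1'}\}\cup\mathcal M_{{\rm C}'}$ (infinite) if $w=0$; $\mathcal M(X,Y)=\{\chi_{{\rm A}_2'}\}\cup\mathcal M_{{\rm C}'}$ (infinite) if $z=0$. When $|z|\ge|w|$ (respectively $|z|\le|w|$), all minimal pairs in class ${\rm A}_1'$ (respectively ${\rm A}_2'$) determine the same MSSR curve, so to write down this curve it suffices to take $r=1$ in the data-triple for this class.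
   Context: $\mathrm{Sym}^+(3)$ is the set of real symmetric positive-definite $3\times3$ matrices, $\mathrm{Diag}^+(3)$ the set of diagonal $3\times 3$ matrices with positive diagonal entries, $M=SO(3)\times\mathrm{Diag}^+(3)$, $F:M\to\mathrm{Sym}^+(3)$, $F(U,D)=UDU^T$, $\mathcal E_X=F^{-1}(X)$; $[(U,D)]$ is the connected component of $\mathcal E_X$ containing $(U,D)$. Metric on $M$: $g_M((A_1,L_1),(A_2,L_2))|_{(U,D)}=-\frac k2\mathrm{tr}(A_1U^{-1}A_2U^{-1})+\mathrm{tr}(D^{-1}L_1D^{-1}L_2)$, with $k>0$ fixed; geodesic distance $d_M((U,D),(V,\Lambda))^2=\frac k2\|\log(U^{-1}V)\|^2+\|\log(D^{-1}\Lambda)\|^2$ (Frobenius norms; $\log R$ is a smallest-norm antisymmetric $A$ with $\exp A=R$). $d_{\mathcal{SR}}(X,Y)=\inf d_M((U,D),(V,\Lambda))$ over $(U,D)\in\mathcal E_X,(V,\Lambda)\in\mathcal E_Y$. A smooth scaling-rotation curve is $F\circ\gamma$ for a geodesic $\gamma$ of $M$. A minimal pair is the endpoint pair $(\gamma(0),\gamma(1))\in\mathcal E_X\times\mathcal E_Y$ of a geodesic $\gamma:[0,1]\to M$ of length $d_{\mathcal{SR}}(X,Y)$; then $F\circ\gamma$ is a minimal smooth scaling-rotation (MSSR) curve from $X$ to $Y$ corresponding to (determined by) this pair. $\mathcal M(X,Y)$ is the set of all MSSR curves from $X$ to $Y$. $\mathcal S_{\rm top},\mathcal S_{\rm mid}\subset\mathrm{Sym}^+(3)$: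 matrices with exactly three, respectively exactly two, distinct eigenvalues. $\mathcal D_{\mathsf J_1}=\{\mathrm{diag}(d_1,d_2,d_2):d_1,d_2>0,d_1\ne d_2\}$. For $\pi\in S_3$, $\pi\cdot\mathrm{diag}(d_1,d_2,d_3)=\mathrm{diag}(d_{\pi^{-1}(1)},d_{\pi^{-1}(2)},d_{\pi^{-1}(3)})$; $\pi_{ab}$ is the transposition $(ab)$. A signed permutation matrix $P$ has entries $P_{ij}=\pm\delta_{i,\pi(j)}$ for a unique permutation $\pi=\pi_P$. Quaternions: $\mathbf C=\{a+bi\}\subset\mathbf H$; $S^1_{\mathbf C}$ is the unit circle in $\mathbf C$; $S^3_{\mathbf H}$ is the group of unit quaternions; $\phi:S^3_{\mathbf H}\to SO(3)$ is the two-to-one homomorphism $\phi(q)(x)=qx\bar q$ on $\mathrm{Im}\,\mathbf H\cong\mathbf R^3$ (basis $i,j,k$). If $q\in\phi^{-1}(U^{-1}V)$, write $q=z+wj$ with $z,w\in\mathbf C$, $|z|^2+|w|^2=1$; $(z,w)$ is determined up to overall sign. For $0\neq\xi\in\mathbf C$, $\hat\xi=\xi/|\xi|$, and $\xi^{1/2}$ is an arbitrary choice of one of the two square roots. Put $\zeta_{j,\pm}=\frac{1\pm j}{\sqrt2}$, $\zeta_{k,\pm}=\frac{1\pm k}{\sqrt2}$ (here $k$ is the quaternion unit). All of $\phi(1),\phi(j),\phi(\zeta_{j,\pm}),\phi(\zeta_{k,\pm})$ are signed permutation matrices of determinant $1$, and $\pi_\zeta:=\pi_{\phi(\zeta)}$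 is: the identity for $\zeta=1,j$; $\pi_{13}$ for $\zeta_{j,\pm}$; $\pi_{12}$ for $\zeta_{k,\pm}$. Classes and their data-triples $(\zeta,r_U,r_V)$. A class in which some $\hat\xi$ appears is defined only if $\xi\ne0$. For $Y\in\mathcal S_{\rm top}$: ${\rm A}_1$: $(1,\pm\hat z,1)$; ${\rm A}_2$: $(j,\pm\hat w,1)$; ${\rm B}_1$: $(\zeta_{j,+},\pm\widehat{(z+w)},1)$; ${\rm B}_2$: $(\zeta_{j,-},\pm\widehat{(z-w)},1)$; ${\rm C}_1$: $(\zeta_{k,+},\pm\widehat{(z-iw)},1)$; ${\rm C}_2$: $(\zeta_{k,-},\pm\widehat{(z+iw)},1)$. For $Y\in\mathcal S_{\rm mid}$: ${\rm A}_1'$: $(1,r,\pm r\bar{\hat z})$, $r\in S^1_{\mathbf C}$; ${\rm A}_2'$: $(j,r,\pm\bar r\hat w)$, $r\in S^1_{\mathbf C}$; ${\rm B}'$: $(\zeta_{j,+},\pm(\hat w\hat z)^{1/2},\pm(\hat w\bar{\hat z})^{1/2})$ (all sign combinations); ${\rm C}'$ (defined only if $w=0$ or $z=0$): all $(\zeta_{j,+},r_U,r_V)$ with $r_U,r_V\in S^1_{\mathbf C}$ and $r_V\bar r_U=\pm\bar z$ if $w=0$, respectively $r_Vr_U=\pm w$ if $z=0$ (so if $(z,w)=(1,0)$ the triples are $(\zeta_{j,+},r,\pm r)$, $r\in S^1_{\mathbf C}$). $\mathcal M_l([(U,D)],[(V,\Lambda)])$ is the set of smooth scaling-rotation curves $F\circ\gamma$,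 where $\gamma:[0,1]\to M$ is the minimal-length geodesic from $(U\phi(r_U),D)$ to $(V\phi(r_V)\phi(\zeta)^{-1},\pi_\zeta\cdot\Lambda)$, with $(\zeta,r_U,r_V)$ ranging over the triples of class $l$. If $\mathcal M_l$ consists of a single curve, that curve is denoted $\chi_l$. Lengths (here $k$ is the metric parameter): let $\varphi=\cos^{-1}(\max\{|z|,|w|\})$, $\beta=\frac12\cos^{-1}(2|\mathrm{Re}(\bar zw)|)$, $\beta'=\frac12\cos^{-1}(2|\mathrm{Im}(\bar zw)|)$. Set $\ell_{\rm id}=\sqrt{4k\varphi^2+\|\log(\Lambda D^{-1})\|^2}$. For $Y\in\mathcal S_{\rm top}$: $\ell_{(13)}=\sqrt{4k\beta^2+\|\log((\pi_{13}\cdot\Lambda)D^{-1})\|^2}$, $\ell_{(12)}=\sqrt{4k(\beta')^2+\|\log((\pi_{12}\cdot\Lambda)D^{-1})\|^2}$. For $Y\in\mathcal S_{\rm mid}$: $\ell_{(13)}=\sqrt{4k(\frac\pi4-\varphi)^2+\|\log((\pi_{13}\cdot\Lambda)D^{-1})\|^2}$.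
   Formalization: The converse in (ii) fails literally (multiply both frames by φ(i)⁻¹). It is proved up to a determinant-1 signed permutation matrix acting on both points, and literally when the second point lies in a component [(Vφ(ζ)⁻¹, π_ζ·Λ)] for a ζ of the classes. *)

theory Defs
  imports "HOL-Analysis.Analysis" "HOL-Library.FuncSet"
begin

type_synonym mat3 = "real^3^3"
type_synonym mpoint = "mat3 \<times> mat3"


section \<open>The bundle of eigen-decompositions\<close>

definition diag3 :: "real \<Rightarrow> real \<Rightarrow> real \<Rightarrow> mat3" where
  "diag3 a b c = (\<chi> i j. if i = j then vector [a, b, c] $ i else 0)"

definition SymPos :: "mat3 set" where
  "SymPos = {X. transpose X = X \<and> (\<forall>v. v \<noteq> 0 \<longrightarrow> v \<bullet> (X *v v) > 0)}"

definition DiagPos :: "mat3 set" where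
  "DiagPos = {D. (\<forall>i j. i \<noteq> j \<longrightarrow> D $ i $ j = 0) \<and> (\<forall>i. D $ i $ i > 0)}"

definition SO3 :: "mat3 set" where
  "SO3 = {U. rotation_matrix U}"

definition Mspace :: "mpoint set" where
  "Mspace = SO3 \<times> DiagPos"

definition Fmap :: "mpoint \<Rightarrow> mat3" where
  "Fmap p = fst p ** snd p ** transpose (fst p)"

definition fiber :: "mat3 \<Rightarrow> mpoint set" where
  "fiber X = {p \<in> Mspace. Fmap p = X}"

definition fiber_component :: "mat3 \<Rightarrow> mpoint \<Rightarrow> mpoint set" where
  "fiber_component X p = connected_component_set (fiber X) p"

definition eigvals :: "mat3 \<Rightarrow> real set" where
  "eigvals X = {e. \<exists>v. v \<noteq> 0 \<and> X *v v = e *\<^sub>R v}"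

definition S_top :: "mat3 set" where
  "S_top = {X \<in> SymPos. card (eigvals X) = 3}"

definition S_mid :: "mat3 set" where
  "S_mid = {X \<in> SymPos. card (eigvals X) = 2}"

definition D_J1 :: "mat3 set" where
  "D_J1 = {diag3 a b b | a b. a > 0 \<and> b > 0 \<and> a \<noteq> b}"


section \<open>Metric, geodesic distance and geodesics\<close>

definition gM :: "real \<Rightarrow> mpoint \<Rightarrow> mpoint \<Rightarrow> mpoint \<Rightarrow> real" where
  "gM k p v1 v2 =
     (case (p, v1, v2) of ((U, D), (A1, L1), (A2, L2)) \<Rightarrow>
        - (k / 2) * trace (A1 ** matrix_inv U ** A2 ** matrix_inv U)
        + trace (matrix_inv D ** L1 ** matrix_inv D ** L2))"

text \<open>The class operation \<open>*\<close> on \<^typ>\<open>mat3\<close> is componentwise, so the library's \<open>exp\<close> is not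
  available for the matrix exponential.\<close>

definition mat_exp :: "mat3 \<Rightarrow> mat3" where
  "mat_exp A = (\<Sum>n. (1 / fact n) *\<^sub>R (((**) A ^^ n) (mat 1)))"

text \<open>A smallest-norm antisymmetric logarithm; only its norm is used, which does not depend on
  the choice. The norm on \<^typ>\<open>mat3\<close> is the Frobenius norm.\<close>

definition rot_log :: "mat3 \<Rightarrow> mat3" where
  "rot_log R = arg_min norm (\<lambda>A. transpose A = - A \<and> mat_exp A = R)"

definition diag_log :: "mat3 \<Rightarrow> mat3" where
  "diag_log D = (\<chi> i j. if i = j then ln (D $ i $ i) else 0)"

definition dM :: "real \<Rightarrow> mpoint \<Rightarrow> mpoint \<Rightarrow> real" where
  "dM k p q = sqrt (k / 2 * (norm (rot_log (matrix_inv (fst p) ** fst q)))\<^sup>2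
                    + (norm (diag_log (matrix_inv (snd p) ** snd q)))\<^sup>2)"

definition dSR :: "real \<Rightarrow> mat3 \<Rightarrow> mat3 \<Rightarrow> real" where
  "dSR k X Y = (INF pq \<in> fiber X \<times> fiber Y. dM k (fst pq) (snd pq))"

definition speed :: "real \<Rightarrow> (real \<Rightarrow> mpoint) \<Rightarrow> real \<Rightarrow> real \<Rightarrow> real \<Rightarrow> real" where
  "speed k \<gamma> a b t =
     (let v = vector_derivative \<gamma> (at t within {a..b}) in sqrt (gM k (\<gamma> t) v v))"

definition curve_length :: "real \<Rightarrow> (real \<Rightarrow> mpoint) \<Rightarrow> real \<Rightarrow> real \<Rightarrow> real" where
  "curve_length k \<gamma> a b = integral {a..b} (speed k \<gamma> a b)"

text \<open>Geodesics of \<open>(M, gM k)\<close> parametrised by \<open>[0,1]\<close>: continuously differentiable curves of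
  constant speed which locally realise the geodesic distance. Constant curves are included.\<close>

definition geodesic :: "real \<Rightarrow> (real \<Rightarrow> mpoint) \<Rightarrow> bool" where
  "geodesic k \<gamma> \<longleftrightarrow>
     \<gamma> ` {0..1} \<subseteq> Mspace \<and>
     (\<exists>\<gamma>'. continuous_on {0..1} \<gamma>' \<and>
           (\<forall>t\<in>{0..1}. (\<gamma> has_vector_derivative \<gamma>' t) (at t within {0..1}))) \<and>
     (\<exists>c. \<forall>t\<in>{0..1}. speed k \<gamma> 0 1 t = c) \<and>
     (\<forall>t\<in>{0..1}. \<exists>\<epsilon>>0. \<forall>a\<in>{0..1}. \<forall>b\<in>{0..1}.
        \<bar>a - t\<bar> < \<epsilon> \<longrightarrow> \<bar>b - t\<bar> < \<epsilon> \<longrightarrow> a \<le> b \<longrightarrow>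
        curve_length k \<gamma> a b = dM k (\<gamma> a) (\<gamma> b))"

definition minimal_geodesic ::
    "real \<Rightarrow> (real \<Rightarrow> mpoint) \<Rightarrow> mpoint \<Rightarrow> mpoint \<Rightarrow> bool" where
  "minimal_geodesic k \<gamma> p q \<longleftrightarrow>
     geodesic k \<gamma> \<and> \<gamma> 0 = p \<and> \<gamma> 1 = q \<and>
     (\<forall>\<delta>. geodesic k \<delta> \<and> \<delta> 0 = p \<and> \<delta> 1 = q \<longrightarrow> curve_length k \<gamma> 0 1 \<le> curve_length k \<delta> 0 1)"

text \<open>Curves in \<^const>\<open>SymPos\<close> are functions restricted to \<open>[0,1]\<close> (\<^const>\<open>undefined\<close> elsewhere),
  so that equality and counting of curves refer to their values on \<open>[0,1]\<close> only.\<close>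

definition scaling_rotation_curve :: "(real \<Rightarrow> mpoint) \<Rightarrow> (real \<Rightarrow> mat3)" where
  "scaling_rotation_curve \<gamma> = restrict (Fmap \<circ> \<gamma>) {0..1}"

definition minimal_pair :: "real \<Rightarrow> mat3 \<Rightarrow> mat3 \<Rightarrow> mpoint \<Rightarrow> mpoint \<Rightarrow> bool" where
  "minimal_pair k X Y p q \<longleftrightarrow>
     p \<in> fiber X \<and> q \<in> fiber Y \<and>
     (\<exists>\<gamma>. geodesic k \<gamma> \<and> \<gamma> 0 = p \<and> \<gamma> 1 = q \<and> curve_length k \<gamma> 0 1 = dSR k X Y)"

definition MSSR :: "real \<Rightarrow> mat3 \<Rightarrow> mat3 \<Rightarrow> (real \<Rightarrow> mat3) set" where
  "MSSR k X Y =
     {scaling_rotation_curve \<gamma> | \<gamma>.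
        geodesic k \<gamma> \<and> \<gamma> 0 \<in> fiber X \<and> \<gamma> 1 \<in> fiber Y \<and> curve_length k \<gamma> 0 1 = dSR k X Y}"


section \<open>Signed permutation matrices\<close>

definition signed_perm_of :: "mat3 \<Rightarrow> (3 \<Rightarrow> 3) \<Rightarrow> bool" where
  "signed_perm_of P \<pi> \<longleftrightarrow>
     \<pi> permutes UNIV \<and>
     (\<forall>i j. if i = \<pi> j then P $ i $ j = 1 \<or> P $ i $ j = -1 else P $ i $ j = 0)"

definition mat_perm :: "mat3 \<Rightarrow> (3 \<Rightarrow> 3)" where
  "mat_perm P = (THE \<pi>. signed_perm_of P \<pi>)"

definition perm_act :: "(3 \<Rightarrow> 3) \<Rightarrow> mat3 \<Rightarrow> mat3" where
  "perm_act \<pi> D = (\<chi> i j. if i = j then D $ (inv \<pi> i) $ (inv \<pi> i) else 0)"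

definition swap12 :: "3 \<Rightarrow> 3" where "swap12 = Transposition.transpose 1 2"
definition swap13 :: "3 \<Rightarrow> 3" where "swap13 = Transposition.transpose 1 3"

text \<open>Signed permutation matrices of determinant 1, and their action on \<open>M\<close>, which preserves the
  metric and the fibers.\<close>

definition signed_perms :: "mat3 set" where
  "signed_perms = {P. (\<exists>\<pi>. signed_perm_of P \<pi>) \<and> det P = 1}"

definition sp_act :: "mat3 \<Rightarrow> mpoint \<Rightarrow> mpoint" where
  "sp_act P p = (fst p ** matrix_inv P, perm_act (mat_perm P) (snd p))"


section \<open>Quaternions\<close>

datatype quat = Quat (q1: real) (qi: real) (qj: real) (qk: real)

instantiation quat :: "{one, plus, times}"
begin

definition one_quat :: quat where
  "1 = Quat 1 0 0 0"

definition plus_quat :: "quat \<Rightarrow> quat \<Rightarrow> quat" where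
  "p + q = Quat (q1 p + q1 q) (qi p + qi q) (qj p + qj q) (qk p + qk q)"

definition times_quat :: "quat \<Rightarrow> quat \<Rightarrow> quat" where
  "p * q = Quat (q1 p * q1 q - qi p * qi q - qj p * qj q - qk p * qk q)
                (q1 p * qi q + qi p * q1 q + qj p * qk q - qk p * qj q)
                (q1 p * qj q - qi p * qk q + qj p * q1 q + qk p * qi q)
                (q1 p * qk q + qi p * qj q - qj p * qi q + qk p * q1 q)"

instance ..

end

definition qcnj :: "quat \<Rightarrow> quat" where
  "qcnj q = Quat (q1 q) (- qi q) (- qj q) (- qk q)"

definition of_complex :: "complex \<Rightarrow> quat" where
  "of_complex z = Quat (Re z) (Im z) 0 0"

definition unit_j :: quat where
  "unit_j = Quat 0 0 1 0"

definition quat_zw :: "complex \<Rightarrow> complex \<Rightarrow> quat" where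
  "quat_zw z w = of_complex z + of_complex w * unit_j"

definition zeta_jp :: quat where "zeta_jp = Quat (1 / sqrt 2) 0 (1 / sqrt 2) 0"
definition zeta_jm :: quat where "zeta_jm = Quat (1 / sqrt 2) 0 (- 1 / sqrt 2) 0"
definition zeta_kp :: quat where "zeta_kp = Quat (1 / sqrt 2) 0 0 (1 / sqrt 2)"
definition zeta_km :: quat where "zeta_km = Quat (1 / sqrt 2) 0 0 (- 1 / sqrt 2)"

definition im_quat :: "real^3 \<Rightarrow> quat" where
  "im_quat x = Quat 0 (x $ 1) (x $ 2) (x $ 3)"

definition quat_im :: "quat \<Rightarrow> real^3" where
  "quat_im q = vector [qi q, qj q, qk q]"

definition phi :: "quat \<Rightarrow> mat3" where
  "phi q = matrix (\<lambda>x. quat_im (q * im_quat x * qcnj q))"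


section \<open>Classes, data-triples and their curves\<close>

datatype label = A1 | A2 | B1 | B2 | C1 | C2 | A1' | A2' | B' | C'

definition top_classes :: "label set" where
  "top_classes = {A1, A2, B1, B2, C1, C2}"

definition mid_classes :: "label set" where
  "mid_classes = {A1', A2', B', C'}"

definition zetas_top :: "quat set" where
  "zetas_top = {1, unit_j, zeta_jp, zeta_jm, zeta_kp, zeta_km}"

definition zetas_mid :: "quat set" where
  "zetas_mid = {1, unit_j, zeta_jp}"

fun class_defined :: "complex \<Rightarrow> complex \<Rightarrow> label \<Rightarrow> bool" where
  "class_defined z w A1 \<longleftrightarrow> z \<noteq> 0"
| "class_defined z w A2 \<longleftrightarrow> w \<noteq> 0"
| "class_defined z w B1 \<longleftrightarrow> z + w \<noteq> 0"
| "class_defined z w B2 \<longleftrightarrow> z - w \<noteq> 0"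
| "class_defined z w C1 \<longleftrightarrow> z - \<i> * w \<noteq> 0"
| "class_defined z w C2 \<longleftrightarrow> z + \<i> * w \<noteq> 0"
| "class_defined z w A1' \<longleftrightarrow> z \<noteq> 0"
| "class_defined z w A2' \<longleftrightarrow> w \<noteq> 0"
| "class_defined z w B' \<longleftrightarrow> z \<noteq> 0 \<and> w \<noteq> 0"
| "class_defined z w C' \<longleftrightarrow> w = 0 \<or> z = 0"

type_synonym triple = "quat \<times> complex \<times> complex"

text \<open>\<^const>\<open>sgn\<close> on \<^typ>\<open>complex\<close> is normalisation to modulus 1. In class \<open>B'\<close> both square roots
  of the given unit numbers occur, so they are described as the solutions of \<open>r\<^sup>2 = \<xi>\<close>.\<close>

fun class_triples :: "complex \<Rightarrow> complex \<Rightarrow> label \<Rightarrow> triple set" where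
  "class_triples z w A1 = {(1, s * sgn z, 1) | s. s \<in> {1, -1}}"
| "class_triples z w A2 = {(unit_j, s * sgn w, 1) | s. s \<in> {1, -1}}"
| "class_triples z w B1 = {(zeta_jp, s * sgn (z + w), 1) | s. s \<in> {1, -1}}"
| "class_triples z w B2 = {(zeta_jm, s * sgn (z - w), 1) | s. s \<in> {1, -1}}"
| "class_triples z w C1 = {(zeta_kp, s * sgn (z - \<i> * w), 1) | s. s \<in> {1, -1}}"
| "class_triples z w C2 = {(zeta_km, s * sgn (z + \<i> * w), 1) | s. s \<in> {1, -1}}"
| "class_triples z w A1' = {(1, r, s * r * cnj (sgn z)) | r s. cmod r = 1 \<and> s \<in> {1, -1}}"
| "class_triples z w A2' = {(unit_j, r, s * cnj r * sgn w) | r s. cmod r = 1 \<and> s \<in> {1, -1}}"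
| "class_triples z w B' =
     {(zeta_jp, rU, rV) | rU rV. rU\<^sup>2 = sgn w * sgn z \<and> rV\<^sup>2 = sgn w * cnj (sgn z)}"
| "class_triples z w C' =
     {(zeta_jp, rU, rV) | rU rV. cmod rU = 1 \<and> cmod rV = 1 \<and>
        (w = 0 \<and> rV * cnj rU \<in> {cnj z, - cnj z} \<or> z = 0 \<and> rV * rU \<in> {w, - w})}"

definition triples :: "complex \<Rightarrow> complex \<Rightarrow> label \<Rightarrow> triple set" where
  "triples z w l = (if class_defined z w l then class_triples z w l else {})"

definition first_point :: "mat3 \<Rightarrow> mat3 \<Rightarrow> triple \<Rightarrow> mpoint" where
  "first_point U D \<tau> = (case \<tau> of (\<zeta>, rU, rV) \<Rightarrow> (U ** phi (of_complex rU), D))"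

definition second_point :: "mat3 \<Rightarrow> mat3 \<Rightarrow> triple \<Rightarrow> mpoint" where
  "second_point V \<Lambda> \<tau> =
     (case \<tau> of (\<zeta>, rU, rV) \<Rightarrow>
        (V ** phi (of_complex rV) ** matrix_inv (phi \<zeta>), perm_act (mat_perm (phi \<zeta>)) \<Lambda>))"

definition triple_curves ::
    "real \<Rightarrow> mat3 \<Rightarrow> mat3 \<Rightarrow> mat3 \<Rightarrow> mat3 \<Rightarrow> triple \<Rightarrow> (real \<Rightarrow> mat3) set" where
  "triple_curves k U D V \<Lambda> \<tau> =
     {scaling_rotation_curve \<gamma> | \<gamma>. minimal_geodesic k \<gamma> (first_point U D \<tau>) (second_point V \<Lambda> \<tau>)}"

definition class_curves ::
    "real \<Rightarrow> mat3 \<Rightarrow> mat3 \<Rightarrow> mat3 \<Rightarrow> mat3 \<Rightarrow> complex \<Rightarrow> complex \<Rightarrow> label \<Rightarrow> (real \<Rightarrow> mat3) set" where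
  "class_curves k U D V \<Lambda> z w l = (\<Union>\<tau>\<in>triples z w l. triple_curves k U D V \<Lambda> \<tau>)"

text \<open>\<open>z + w j\<close> is one of the two unit quaternions covering \<open>U\<^sup>-\<^sup>1 V\<close>.\<close>

definition covers :: "complex \<Rightarrow> complex \<Rightarrow> mat3 \<Rightarrow> mat3 \<Rightarrow> bool" where
  "covers z w U V \<longleftrightarrow>
     (cmod z)\<^sup>2 + (cmod w)\<^sup>2 = 1 \<and> phi (quat_zw z w) = matrix_inv U ** V"


section \<open>Lengths and lists of minimal classes\<close>

definition angle_id :: "complex \<Rightarrow> complex \<Rightarrow> real" where
  "angle_id z w = arccos (max (cmod z) (cmod w))"

definition angle_13 :: "complex \<Rightarrow> complex \<Rightarrow> real" where
  "angle_13 z w = arccos (2 * \<bar>Re (cnj z * w)\<bar>) / 2"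

definition angle_12 :: "complex \<Rightarrow> complex \<Rightarrow> real" where
  "angle_12 z w = arccos (2 * \<bar>Im (cnj z * w)\<bar>) / 2"

definition len_id :: "real \<Rightarrow> mat3 \<Rightarrow> mat3 \<Rightarrow> complex \<Rightarrow> complex \<Rightarrow> real" where
  "len_id k D \<Lambda> z w =
     sqrt (4 * k * (angle_id z w)\<^sup>2 + (norm (diag_log (\<Lambda> ** matrix_inv D)))\<^sup>2)"

definition len_13_top :: "real \<Rightarrow> mat3 \<Rightarrow> mat3 \<Rightarrow> complex \<Rightarrow> complex \<Rightarrow> real" where
  "len_13_top k D \<Lambda> z w =
     sqrt (4 * k * (angle_13 z w)\<^sup>2 + (norm (diag_log (perm_act swap13 \<Lambda> ** matrix_inv D)))\<^sup>2)"

definition len_12_top :: "real \<Rightarrow> mat3 \<Rightarrow> mat3 \<Rightarrow> complex \<Rightarrow> complex \<Rightarrow> real" where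
  "len_12_top k D \<Lambda> z w =
     sqrt (4 * k * (angle_12 z w)\<^sup>2 + (norm (diag_log (perm_act swap12 \<Lambda> ** matrix_inv D)))\<^sup>2)"

definition len_13_mid :: "real \<Rightarrow> mat3 \<Rightarrow> mat3 \<Rightarrow> complex \<Rightarrow> complex \<Rightarrow> real" where
  "len_13_mid k D \<Lambda> z w =
     sqrt (4 * k * (pi / 4 - angle_id z w)\<^sup>2
           + (norm (diag_log (perm_act swap13 \<Lambda> ** matrix_inv D)))\<^sup>2)"

definition labels_A :: "complex \<Rightarrow> complex \<Rightarrow> label set" where
  "labels_A z w =
     (if cmod z > cmod w then {A1} else if cmod z < cmod w then {A2} else {A1, A2})"

definition labels_B :: "complex \<Rightarrow> complex \<Rightarrow> label set" where
  "labels_B z w =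
     (if Re (cnj z * w) > 0 then {B1} else if Re (cnj z * w) < 0 then {B2} else {B1, B2})"

definition labels_C :: "complex \<Rightarrow> complex \<Rightarrow> label set" where
  "labels_C z w =
     (if Im (cnj z * w) > 0 then {C1} else if Im (cnj z * w) < 0 then {C2} else {C1, C2})"

definition labels_A' :: "complex \<Rightarrow> complex \<Rightarrow> label set" where
  "labels_A' z w =
     (if cmod z > cmod w then {A1'} else if cmod z < cmod w then {A2'} else {A1', A2'})"

definition listed_top :: "real \<Rightarrow> real \<Rightarrow> real \<Rightarrow> complex \<Rightarrow> complex \<Rightarrow> label set" where
  "listed_top l_id l_13 l_12 z w =
     (if l_id < min l_13 l_12 then labels_A z w
      else if l_13 < min l_id l_12 then labels_B z w
      else if l_12 < min l_id l_13 then labels_C z w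
      else if l_id = l_13 \<and> l_13 < l_12 then labels_A z w \<union> labels_B z w
      else if l_id = l_12 \<and> l_12 < l_13 then labels_A z w \<union> labels_C z w
      else if l_13 = l_12 \<and> l_12 < l_id then labels_B z w \<union> labels_C z w
      else labels_A z w \<union> labels_B z w \<union> labels_C z w)"

definition listed_mid :: "real \<Rightarrow> real \<Rightarrow> complex \<Rightarrow> complex \<Rightarrow> label set" where
  "listed_mid l_id l_13 z w =
     (if l_id < l_13 then labels_A' z w
      else if l_id > l_13 then (if z \<noteq> 0 \<and> w \<noteq> 0 then {B'} else {C'})
      else if z \<noteq> 0 \<and> w \<noteq> 0 then labels_A' z w \<union> {B'}
      else if w = 0 then {A1', C'}
      else {A2', C'})"

end

theory Submission
  imports Defs
begin

text \<open>A point of \<open>M\<close> is written \<open>(phi g, expdiag x)\<close> with a unit quaternion \<open>g\<close>, determined up to sign,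
  and the vector \<open>x\<close> of logarithms of the diagonal entries. In these coordinates the distance is
  \<open>sqrt (4 * k * \<alpha>\<^sup>2 + \<bar>x - y\<bar>\<^sup>2)\<close>, where \<open>\<alpha> = arccos \<bar>\<langle>g, h\<rangle>\<bar>\<close> is the angle between the quaternions
  (\<open>dM_eq\<close>), so that \<open>M\<close> is a product of a projective space of quaternions and a Euclidean space. As
  long as \<open>\<langle>g, h\<rangle> \<noteq> 0\<close> the equality case of the triangle inequality leaves only one geodesic of
  minimal length, a great-circle arc in the first factor run at the same pace as a segment in the second
  (\<open>minimal_geodesic_unique\<close>); its projection is called \<open>src g x h y\<close>.

  The group of signed permutation matrices acts on \<open>M\<close> by isometries that preserve the projection \<open>F\<close>,
  and hence on pairs of points of the fibers of \<open>X\<close> and \<open>Y\<close>. It moves the first point of every pair into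
  the chosen component, and the subgroup that is then still available brings the second point into the
  form that a data-triple prescribes; the quaternions \<open>\<zeta>\<close> are the representatives needed for this
  (\<open>reduction_top\<close>, \<open>reduction_mid\<close>). Minimising the distance over the fibers therefore means minimising it
  over the triples \<open>(\<zeta>, r, s)\<close>. For fixed \<open>\<zeta>\<close> the diagonal part of the distance is fixed too, and the
  angle depends on \<open>r\<close> and \<open>s\<close> through the real number \<open>overlap z w (\<zeta>, r, s)\<close>, a sum of terms such as
  \<open>Re (cnj r * z)\<close>. Its absolute value is largest exactly for the triples of the class belonging to \<open>\<zeta>\<close>
  (\<open>overlap_top_le\<close>, \<open>overlap_mid_le\<close>). So each class has one length, the minimal pairs are, up to the action, the triples of
  the classes of smallest length, and these are the classes listed in the theorem
  (\<open>listed_top_minimal\<close>, \<open>listed_mid_minimal\<close>, \<open>MSSR_eq\<close>). The optimal overlap is positive, which puts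
  all minimal pairs off the cut locus.

  It remains to count curves. Two lifts of one curve differ at each time by a matrix whose \<open>(i, j)\<close> entry
  can be nonzero only where two eigenvalues agree; the logarithms of the eigenvalues are affine in time,
  so at the entries with different end values the entry vanishes throughout (\<open>src_eq_imp\<close>). This separates
  the classes, and inside class \<open>C'\<close> it separates triples with different \<open>r\<^sup>2\<close>, which makes that class a
  circle (\<open>C'_circle\<close>). In the other classes the triples differ by signs, which \<open>phi\<close> does not see, or,
  for \<open>A1'\<close> and \<open>A2'\<close>, by a rotation commuting with all diagonal matrices along the curve. Finally a tie
  between two lengths whose angles are both \<open>\<pi> / 4\<close> would force two different arrangements of the
  eigenvalues of \<open>Y\<close> to be equally far from those of \<open>X\<close>, which is impossible (\<open>no_double_ties\<close>).\<close>

section \<open>Unit quaternions and rotations\<close>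

lemmas mat3_eq_iff = vec_eq_iff forall_3

lemma mat3_mult_nth: "((A::mat3) ** B) $ i $ j = A$i$1 * B$1$j + A$i$2 * B$2$j + A$i$3 * B$3$j"
  by (simp add: matrix_matrix_mult_def sum_3)

lemma mat1_nth: "(mat 1 :: mat3) $ i $ j = (if i = j then 1 else 0)"
  by (simp add: mat_def)

lemma transpose_nth: "transpose A $ i $ j = A $ j $ i"
  by (simp add: transpose_def)

lemma phi_nth:
  "phi q $ 1 $ 1 = (q1 q)\<^sup>2 + (qi q)\<^sup>2 - (qj q)\<^sup>2 - (qk q)\<^sup>2"
  "phi q $ 1 $ 2 = 2 * (qi q * qj q - q1 q * qk q)"
  "phi q $ 1 $ 3 = 2 * (qi q * qk q + q1 q * qj q)"
  "phi q $ 2 $ 1 = 2 * (qi q * qj q + q1 q * qk q)"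
  "phi q $ 2 $ 2 = (q1 q)\<^sup>2 - (qi q)\<^sup>2 + (qj q)\<^sup>2 - (qk q)\<^sup>2"
  "phi q $ 2 $ 3 = 2 * (qj q * qk q - q1 q * qi q)"
  "phi q $ 3 $ 1 = 2 * (qi q * qk q - q1 q * qj q)"
  "phi q $ 3 $ 2 = 2 * (qj q * qk q + q1 q * qi q)"
  "phi q $ 3 $ 3 = (q1 q)\<^sup>2 - (qi q)\<^sup>2 - (qj q)\<^sup>2 + (qk q)\<^sup>2"
  by (simp_all add: phi_def matrix_def quat_im_def im_quat_def times_quat_def qcnj_def axis_def
      power2_eq_square)

instance quat :: monoid_mult
  by intro_classes (auto simp: times_quat_def one_quat_def algebra_simps)

lemma phi_mult: "phi (p * q) = phi p ** phi q"
  by (simp add: mat3_eq_iff mat3_mult_nth phi_nth times_quat_def; safe?; simp add: algebra_simps power2_eq_square)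

lemma phi_one [simp]: "phi 1 = mat 1"
  by (simp add: mat3_eq_iff mat1_nth phi_nth one_quat_def)

lemma phi_qcnj: "phi (qcnj q) = transpose (phi q)"
  by (simp add: mat3_eq_iff transpose_nth phi_nth qcnj_def)

definition qinner :: "quat \<Rightarrow> quat \<Rightarrow> real" where
  "qinner p q = q1 p * q1 q + qi p * qi q + qj p * qj q + qk p * qk q"

definition unit_quats :: "quat set" where
  "unit_quats = {q. qinner q q = 1}"

lemma qinner_translate:
  "qinner (g * p) (g * q) = qinner g g * qinner p q"
  "qinner (p * g) (q * g) = qinner g g * qinner p q"
  by (simp_all add: qinner_def times_quat_def algebra_simps)

lemma qinner_qcnj_mult: "q1 (qcnj p * q) = qinner p q"
  by (simp add: qinner_def times_quat_def qcnj_def)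

lemma qinner_commute: "qinner p q = qinner q p"
  by (simp add: qinner_def algebra_simps)

lemma qcnj_simps [simp]: "qcnj (qcnj q) = q" "qcnj (p * q) = qcnj q * qcnj p" "qcnj 1 = 1"
  by (simp_all add: qcnj_def times_quat_def one_quat_def algebra_simps)

lemma qinner_qcnj [simp]: "qinner (qcnj p) (qcnj q) = qinner p q"
  by (simp add: qinner_def qcnj_def)

lemma unit_mult [intro, simp]: "p \<in> unit_quats \<Longrightarrow> q \<in> unit_quats \<Longrightarrow> p * q \<in> unit_quats"
  by (simp add: unit_quats_def qinner_translate)

lemma unit_one [simp]: "1 \<in> unit_quats"
  by (simp add: unit_quats_def qinner_def one_quat_def)

lemma unit_qcnj [simp]: "qcnj p \<in> unit_quats \<longleftrightarrow> p \<in> unit_quats"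
  by (simp add: unit_quats_def)

lemma unit_inverse:
  assumes "q \<in> unit_quats"
  shows "qcnj q * q = 1" "q * qcnj q = 1"
  using assms
  by (auto simp: unit_quats_def qinner_def times_quat_def qcnj_def one_quat_def algebra_simps)

lemma unit_cancel [simp]:
  assumes "q \<in> unit_quats"
  shows "qcnj q * (q * p) = p" "q * (qcnj q * p) = p" "p * q * qcnj q = p" "p * qcnj q * q = p"
  using unit_inverse[OF assms] by (simp_all add: mult.assoc flip: mult.assoc[of _ q] mult.assoc[of _ "qcnj q"])

lemma phi_in_SO3:
  assumes "q \<in> unit_quats"
  shows "phi q \<in> SO3"
proof -
  have orth: "transpose (phi q) ** phi q = mat 1"
    by (metis assms phi_mult phi_one phi_qcnj unit_inverse(1))
  have "det (phi q) = (qinner q q) ^ 3"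
    by (simp add: det_3 phi_nth qinner_def power2_eq_square power3_eq_cube) algebra
  with orth assms show ?thesis
    by (simp add: SO3_def rotation_matrix_def orthogonal_matrix unit_quats_def)
qed

lemma matrix_inv_eqI:
  assumes "(A::mat3) ** B = mat 1" "B ** A = mat 1"
  shows "matrix_inv A = B"
proof -
  have "A ** matrix_inv A = mat 1 \<and> matrix_inv A ** A = mat 1"
    unfolding matrix_inv_def by (rule someI[of _ B]) (use assms in simp)
  thus ?thesis by (metis assms(2) matrix_mul_assoc matrix_mul_lid matrix_mul_rid)
qed

lemma matrix_inv_SO3:
  assumes "U \<in> SO3"
  shows "matrix_inv U = transpose U" "transpose U ** U = mat 1" "U ** transpose U = mat 1"
proof -
  show a: "transpose U ** U = mat 1" and b: "U ** transpose U = mat 1"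
    using assms by (simp_all add: SO3_def rotation_matrix_def orthogonal_matrix_def)
  show "matrix_inv U = transpose U"
    by (rule matrix_inv_eqI[OF b a])
qed

lemma SO3_mult [intro]: "U \<in> SO3 \<Longrightarrow> V \<in> SO3 \<Longrightarrow> U ** V \<in> SO3"
  by (auto simp: SO3_def rotation_matrix_def orthogonal_matrix_mul det_mul)

lemma SO3_transpose [simp]: "transpose U \<in> SO3 \<longleftrightarrow> U \<in> SO3"
  by (auto simp: SO3_def rotation_matrix_def)

lemma matrix_inv_phi: "q \<in> unit_quats \<Longrightarrow> matrix_inv (phi q) = phi (qcnj q)"
  by (simp add: matrix_inv_SO3 phi_in_SO3 phi_qcnj)

lemma unit_of_complex [simp]: "of_complex r \<in> unit_quats \<longleftrightarrow> cmod r = 1"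
  by (simp add: unit_quats_def qinner_def of_complex_def cmod_def power2_eq_square)

lemma of_complex_mult: "of_complex (r * s) = of_complex r * of_complex s"
  by (simp add: of_complex_def times_quat_def)

lemma of_complex_one [simp]: "of_complex 1 = 1"
  by (simp add: of_complex_def one_quat_def)

lemma qcnj_of_complex: "qcnj (of_complex r) = of_complex (cnj r)"
  by (simp add: of_complex_def qcnj_def)

lemma unit_quat_zw [simp]: "quat_zw z w \<in> unit_quats \<longleftrightarrow> (cmod z)\<^sup>2 + (cmod w)\<^sup>2 = 1"
  by (simp add: unit_quats_def qinner_def quat_zw_def of_complex_def plus_quat_def times_quat_def
      unit_j_def cmod_def power2_eq_square add.assoc)

lemma quat_zw_eq: "quat_zw z w = Quat (Re z) (Im z) (Re w) (Im w)"
  by (simp add: quat_zw_def of_complex_def plus_quat_def times_quat_def unit_j_def)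

lemma quat_zw_mult:
  "quat_zw a b * quat_zw c d = quat_zw (a * c - b * cnj d) (a * d + b * cnj c)"
  by (simp add: quat_zw_eq times_quat_def algebra_simps)

text \<open>The rotations fixing the first axis form the circle \<open>phi ` S\<^sup>1\<close>, and \<open>phi (of_complex r)\<close>
  turns through twice the argument of \<open>r\<close>; hence the square root.\<close>

lemma SO3_stabilizer:
  assumes "R \<in> SO3" "R $ 1 $ 1 = 1"
  obtains r where "cmod r = 1" "R = phi (of_complex r)"
proof -
  note o = matrix_inv_SO3(2,3)[OF assms(1)]
  have a: "R$1$2 = 0" "R$1$3 = 0" and b: "R$2$1 = 0" "R$3$1 = 0"
  proof -
    have "(R ** transpose R)$1$1 = 1" using o by (simp add: mat1_nth)
    hence "(R$1$2)\<^sup>2 + (R$1$3)\<^sup>2 = 0"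
      using assms by (simp add: mat3_mult_nth transpose_nth power2_eq_square)
    thus "R$1$2 = 0" "R$1$3 = 0" by (simp_all add: sum_power2_eq_zero_iff)
    have "(transpose R ** R)$1$1 = 1" using o by (simp add: mat1_nth)
    hence "(R$2$1)\<^sup>2 + (R$3$1)\<^sup>2 = 0"
      using assms by (simp add: mat3_mult_nth transpose_nth power2_eq_square)
    thus "R$2$1 = 0" "R$3$1 = 0" by (simp_all add: sum_power2_eq_zero_iff)
  qed
  have c: "(transpose R ** R)$2$2 = 1" "(transpose R ** R)$2$3 = 0" "(transpose R ** R)$3$3 = 1"
    using o by (simp_all add: mat1_nth)
  have d: "(R$2$2)\<^sup>2 + (R$3$2)\<^sup>2 = 1" "R$2$2 * R$2$3 + R$3$2 * R$3$3 = 0"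
    using c a b by (simp_all add: mat3_mult_nth transpose_nth power2_eq_square)
  have "det R = 1" using assms by (simp add: SO3_def rotation_matrix_def)
  hence e: "R$2$2 * R$3$3 - R$2$3 * R$3$2 = 1"
    using a b assms by (simp add: det_3)
  have f: "R$3$3 = R$2$2"
  proof -
    have "R$3$3 = R$3$3 * ((R$2$2)\<^sup>2 + (R$3$2)\<^sup>2)" using d by simp
    also have "\<dots> = R$2$2 * (R$2$2 * R$3$3 - R$2$3 * R$3$2) + R$3$2 * (R$2$2 * R$2$3 + R$3$2 * R$3$3)"
      by (simp add: algebra_simps power2_eq_square)
    finally show ?thesis using d e by simp
  qed
  have g: "R$2$3 = - R$3$2"
  proof -
    have "R$2$3 = R$2$3 * ((R$2$2)\<^sup>2 + (R$3$2)\<^sup>2)" using d by simp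
    also have "\<dots> = R$2$2 * (R$2$2 * R$2$3 + R$3$2 * R$3$3) - R$3$2 * (R$2$2 * R$3$3 - R$2$3 * R$3$2)"
      by (simp add: algebra_simps power2_eq_square)
    finally show ?thesis using d e by simp
  qed
  define r where "r = csqrt (Complex (R$2$2) (R$3$2))"
  have r2: "r\<^sup>2 = Complex (R$2$2) (R$3$2)" by (simp add: r_def)
  have "(cmod r)\<^sup>2 = cmod (Complex (R$2$2) (R$3$2))" by (simp add: norm_power flip: r2)
  also have "\<dots> = 1" using d by (simp add: cmod_def)
  finally have r1: "cmod r = 1" by (simp add: power2_eq_1_iff) (smt (verit) norm_ge_zero)
  have re: "(Re r)\<^sup>2 + (Im r)\<^sup>2 = 1" using r1 by (simp add: cmod_def)
  have "Re (r\<^sup>2) = R$2$2" "Im (r\<^sup>2) = R$3$2" by (simp_all add: r2)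
  hence rr: "(Re r)\<^sup>2 - (Im r)\<^sup>2 = R$2$2" "2 * (Re r * Im r) = R$3$2"
    by (simp_all add: power2_eq_square mult.commute)
  have "R = phi (of_complex r)"
    using a b f g rr re assms(2) by (simp add: mat3_eq_iff phi_nth of_complex_def)
  thus thesis using that r1 by blast
qed

text \<open>The map taking a unit quaternion to the first column of its rotation is the Hopf map onto the
  two-sphere. The witness is the half-way rotation from \<open>(1, 0, 0)\<close> to the given vector, with scalar
  part \<open>sqrt ((1 + x) / 2)\<close>; the antipode \<open>(-1, 0, 0)\<close> needs a separate choice of axis.\<close>

lemma SO3_first_column:
  assumes "x\<^sup>2 + y\<^sup>2 + t\<^sup>2 = (1::real)"
  obtains q where "q \<in> unit_quats" "phi q $ 1 $ 1 = x" "phi q $ 2 $ 1 = y" "phi q $ 3 $ 1 = t"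
proof (cases "x = -1")
  case True
  hence "y = 0" "t = 0" using assms by (simp_all add: sum_power2_eq_zero_iff)
  hence "phi (Quat 0 0 1 0) $ 1 $ 1 = x" "phi (Quat 0 0 1 0) $ 2 $ 1 = y" "phi (Quat 0 0 1 0) $ 3 $ 1 = t"
    using True by (simp_all add: phi_nth)
  moreover have "Quat 0 0 1 0 \<in> unit_quats" by (simp add: unit_quats_def qinner_def)
  ultimately show thesis using that by blast
next
  case False
  define a where "a = sqrt ((1 + x) / 2)"
  have "x\<^sup>2 \<le> 1" using assms by (smt (verit) zero_le_power2)
  hence "\<bar>x\<bar> \<le> 1" by (simp add: abs_square_le_1)
  hence x: "x > -1" using False by linarith
  hence a: "a > 0" "a\<^sup>2 = (1 + x) / 2" by (simp_all add: a_def)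
  let ?q = "Quat a 0 (- t / (2 * a)) (y / (2 * a))"
  have "(t / (2*a))\<^sup>2 + (y / (2*a))\<^sup>2 = (1 - x\<^sup>2) / (4 * a\<^sup>2)"
    using assms by (simp add: power_divide power_mult_distrib add_divide_distrib[symmetric])
  also have "\<dots> = (1 - x) / 2"
    unfolding a(2) using x by (simp add: field_simps power2_eq_square)
  finally have s: "(t / (2*a))\<^sup>2 + (y / (2*a))\<^sup>2 = (1 - x) / 2" .
  have "?q \<in> unit_quats"
    using s a by (simp add: unit_quats_def qinner_def flip: power2_eq_square)
  moreover have "phi ?q $ 1 $ 1 = x" using s a by (simp add: phi_nth)
  moreover have "phi ?q $ 2 $ 1 = y" "phi ?q $ 3 $ 1 = t" using a by (simp_all add: phi_nth)
  ultimately show thesis using that by blast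
qed

text \<open>Once the first columns agree, the quotient of the two rotations fixes the first axis and lies in
  the circle of \<open>SO3_stabilizer\<close>.\<close>

lemma phi_surj:
  assumes "R \<in> SO3"
  obtains q where "q \<in> unit_quats" "R = phi q"
proof -
  note o = matrix_inv_SO3(2,3)[OF assms(1)]
  have "(transpose R ** R)$1$1 = 1" using o by (simp add: mat1_nth)
  hence "(R$1$1)\<^sup>2 + (R$2$1)\<^sup>2 + (R$3$1)\<^sup>2 = 1"
    by (simp add: mat3_mult_nth transpose_nth power2_eq_square)
  then obtain g where g: "g \<in> unit_quats" "phi g $ 1 $ 1 = R$1$1" "phi g $ 2 $ 1 = R$2$1" "phi g $ 3 $ 1 = R$3$1"
    by (rule SO3_first_column)
  have "(transpose (phi g) ** R)$1$1 = (transpose R ** R)$1$1"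
    by (simp add: mat3_mult_nth transpose_nth g)
  hence "(transpose (phi g) ** R)$1$1 = 1" using o by (simp add: mat1_nth)
  moreover have "transpose (phi g) ** R \<in> SO3" using assms g by (simp add: SO3_mult phi_in_SO3)
  ultimately obtain r where r: "cmod r = 1" "transpose (phi g) ** R = phi (of_complex r)"
    by (metis SO3_stabilizer)
  have "R = phi g ** (transpose (phi g) ** R)"
    using matrix_inv_SO3(3)[OF phi_in_SO3[OF g(1)]] by (simp add: matrix_mul_assoc)
  also have "\<dots> = phi (g * of_complex r)" by (simp add: r phi_mult)
  finally show thesis using that g(1) r(1) by (metis unit_mult unit_of_complex)
qed

text \<open>The diagonal entries of \<open>phi (qcnj p * q) = mat 1\<close> annihilate the imaginary part of \<open>qcnj p * q\<close>,
  which leaves the real units \<open>1\<close> and \<open>-1\<close>.\<close>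

lemma phi_eq_imp:
  assumes "p \<in> unit_quats" "q \<in> unit_quats" "phi p = phi q"
  shows "q = p \<or> q = Quat (- q1 p) (- qi p) (- qj p) (- qk p)"
proof -
  obtain a b c d where h: "qcnj p * q = Quat a b c d" by (metis quat.exhaust)
  have u: "qcnj p * q \<in> unit_quats" using assms by simp
  have e: "phi (Quat a b c d) = mat 1"
    unfolding h[symmetric] phi_mult phi_qcnj using assms matrix_inv_SO3 phi_in_SO3 by metis
  have e1: "a\<^sup>2 + b\<^sup>2 - c\<^sup>2 - d\<^sup>2 = 1" "a\<^sup>2 - b\<^sup>2 + c\<^sup>2 - d\<^sup>2 = 1" "a\<^sup>2 - b\<^sup>2 - c\<^sup>2 + d\<^sup>2 = 1"
    using arg_cong[OF e, of "\<lambda>A. A$1$1"] arg_cong[OF e, of "\<lambda>A. A$2$2"] arg_cong[OF e, of "\<lambda>A. A$3$3"]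
    by (simp_all add: phi_nth mat1_nth)
  have "a\<^sup>2 + b\<^sup>2 + c\<^sup>2 + d\<^sup>2 = 1" using u h by (simp add: unit_quats_def qinner_def power2_eq_square)
  hence "b\<^sup>2 = 0" "c\<^sup>2 = 0" "d\<^sup>2 = 0" "a\<^sup>2 = 1" using e1 by argo+
  hence abcd: "b = 0" "c = 0" "d = 0" "a = 1 \<or> a = -1" by (auto simp: power2_eq_1_iff)
  have "q = p * Quat a b c d" using assms by (simp flip: h)
  thus ?thesis using abcd by (auto simp: times_quat_def quat.expand)
qed

section \<open>The matrix exponential and the geodesic distance\<close>

text \<open>Cross product with \<open>u\<close>, the infinitesimal rotation about the axis \<open>u\<close>.\<close>

definition skew :: "real^3 \<Rightarrow> mat3" where
  "skew v = vector [vector [0, - v$3, v$2], vector [v$3, 0, - v$1], vector [- v$2, v$1, 0]]"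

lemma skew_nth:
  "skew v $ 1 $ 1 = 0" "skew v $ 1 $ 2 = - v$3" "skew v $ 1 $ 3 = v$2"
  "skew v $ 2 $ 1 = v$3" "skew v $ 2 $ 2 = 0" "skew v $ 2 $ 3 = - v$1"
  "skew v $ 3 $ 1 = - v$2" "skew v $ 3 $ 2 = v$1" "skew v $ 3 $ 3 = 0"
  by (simp_all add: skew_def)

text \<open>The quaternion of the rotation about \<open>u\<close> through twice the angle \<open>\<alpha>\<close>.\<close>

definition qrot :: "real \<Rightarrow> real^3 \<Rightarrow> quat" where
  "qrot \<alpha> u = Quat (cos \<alpha>) (sin \<alpha> * u$1) (sin \<alpha> * u$2) (sin \<alpha> * u$3)"

lemma norm_vec3: "(norm (u::real^3))\<^sup>2 = (u$1)\<^sup>2 + (u$2)\<^sup>2 + (u$3)\<^sup>2"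
  by (simp add: norm_vec_def L2_set_def sum_3 sum_nonneg)

lemma norm_mat3: "(norm (A::mat3))\<^sup>2 = (norm (A$1))\<^sup>2 + (norm (A$2))\<^sup>2 + (norm (A$3))\<^sup>2"
  by (simp add: norm_vec_def[of A] L2_set_def sum_3 sum_nonneg)

lemma qrot_unit: "norm u = 1 \<Longrightarrow> qrot \<alpha> u \<in> unit_quats"
proof -
  assume "norm u = 1"
  hence u: "(u$1)\<^sup>2 + (u$2)\<^sup>2 + (u$3)\<^sup>2 = 1" using norm_vec3[of u] by simp
  have "qinner (qrot \<alpha> u) (qrot \<alpha> u) = (cos \<alpha>)\<^sup>2 + (sin \<alpha>)\<^sup>2 * ((u$1)\<^sup>2 + (u$2)\<^sup>2 + (u$3)\<^sup>2)"
    by (simp add: qinner_def qrot_def algebra_simps power2_eq_square)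
  thus ?thesis by (simp add: u unit_quats_def)
qed

lemma rodrigues:
  assumes "norm u = 1"
  shows "phi (qrot \<alpha> u) = mat 1 + sin (2 * \<alpha>) *\<^sub>R skew u + (1 - cos (2 * \<alpha>)) *\<^sub>R (skew u ** skew u)"
proof -
  have u: "u$3 * u$3 = 1 - u$1 * u$1 - u$2 * u$2"
    using assms norm_vec3[of u] by (simp add: power2_eq_square)
  have c: "(cos \<alpha>)\<^sup>2 = 1 - (sin \<alpha>)\<^sup>2" by (simp add: cos_squared_eq)
  have c2: "cos (2 * \<alpha>) = 1 - 2 * (sin \<alpha>)\<^sup>2" by (simp add: cos_double_sin)
  have s2: "sin (2 * \<alpha>) = 2 * sin \<alpha> * cos \<alpha>" by (simp add: sin_double)
  show ?thesis
    using u c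
    by (simp add: mat3_eq_iff phi_nth mat3_mult_nth skew_nth mat1_nth qrot_def c2 s2)
       (simp add: power_mult_distrib power2_eq_square u algebra_simps)
qed

lemma skew_cubed:
  assumes "norm u = 1"
  shows "skew u ** (skew u ** skew u) = - skew u"
proof -
  have u: "u$3 * u$3 = 1 - u$1 * u$1 - u$2 * u$2"
    using assms norm_vec3[of u] by (simp add: power2_eq_square)
  show ?thesis
    unfolding mat3_eq_iff
    by (simp add: mat3_mult_nth skew_nth) (use u in algebra)
qed

lemma mat_scaleR_assoc: "(c *\<^sub>R (A::mat3)) ** B = c *\<^sub>R (A ** B)" "A ** (c *\<^sub>R B) = c *\<^sub>R (A ** B)"
  by (simp_all add: vec_eq_iff mat3_mult_nth algebra_simps)

lemma matrix_diff_ldistrib: "(A::mat3) ** (B - C) = A ** B - A ** C"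
  by (simp add: vec_eq_iff mat3_mult_nth algebra_simps)

text \<open>Since \<open>(skew u)\<^sup>3 = - skew u\<close>, the exponential series splits into the series of sine and cosine,
  giving the formula of \<open>rodrigues\<close>.\<close>

lemma mat_exp_skew:
  assumes u: "norm u = 1"
  shows "mat_exp (\<theta> *\<^sub>R skew u) = phi (qrot (\<theta> / 2) u)"
proof -
  let ?K = "skew u" and ?A = "\<theta> *\<^sub>R skew u"
  note K3 = skew_cubed[OF u]
  \<comment> \<open>The relation \<open>K\<^sup>3 = - K\<close> turns the powers of \<open>\<theta> K\<close> into the coefficients of sine and cosine.\<close>
  have pow: "((**) ?A ^^ n) (mat 1) =
      (if n = 0 then mat 1 + ?K ** ?K else 0)
      + (fact n * sin_coeff n * \<theta> ^ n) *\<^sub>R ?K - (fact n * cos_coeff n * \<theta> ^ n) *\<^sub>R (?K ** ?K)" for n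
  proof (induction n)
    case 0
    show ?case by simp
  next
    case (Suc n)
    have s: "fact (Suc n) * sin_coeff (Suc n) = (fact n * cos_coeff n :: real)"
      by (simp add: sin_coeff_Suc del: of_nat_Suc)
    have c: "fact (Suc n) * cos_coeff (Suc n) = (- (fact n * sin_coeff n) :: real)"
      by (simp add: cos_coeff_Suc del: of_nat_Suc)
    have K1: "?K ** (mat 1 + ?K ** ?K) = 0" by (simp add: matrix_add_ldistrib K3)
    have z: "?K ** (if n = 0 then mat 1 + ?K ** ?K else 0) = 0"
      by (cases "n = 0") (simp_all add: mat_scaleR_assoc K1)
    show ?case
      unfolding funpow.simps comp_def Suc s c
      by (simp only: mat_scaleR_assoc matrix_add_ldistrib[of _ "_ + _"] matrix_diff_ldistrib
            matrix_add_ldistrib[of _ "If _ _ _"] z K3 scaleR_scaleR)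
         (simp add: algebra_simps)
  qed
  have sm: "(\<lambda>n. (if n = 0 then mat 1 + ?K ** ?K else 0) + (sin_coeff n *\<^sub>R \<theta> ^ n) *\<^sub>R ?K
        - (cos_coeff n *\<^sub>R \<theta> ^ n) *\<^sub>R (?K ** ?K))
      sums (mat 1 + ?K ** ?K + sin \<theta> *\<^sub>R ?K - cos \<theta> *\<^sub>R (?K ** ?K))"
    by (intro sums_add sums_diff sums_single[of 0 "\<lambda>n. mat 1 + ?K ** ?K"]
        bounded_linear.sums[OF bounded_linear_scaleR_left] sin_converges cos_converges)
  have "mat_exp ?A = mat 1 + ?K ** ?K + sin \<theta> *\<^sub>R ?K - cos \<theta> *\<^sub>R (?K ** ?K)"
    unfolding mat_exp_def pow
    by (rule sums_unique[symmetric], rule sums_cong[THEN iffD1, OF _ sm])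
       (auto simp: algebra_simps)
  also have "\<dots> = phi (qrot (\<theta> / 2) u)"
    by (simp add: rodrigues[OF u] algebra_simps)
  finally show ?thesis .
qed

lemma antisym_polar:
  assumes "transpose A = - A"
  obtains \<theta> u where "\<theta> \<ge> 0" "norm u = 1" "A = \<theta> *\<^sub>R skew u"
proof -
  have e: "A$j$i = - A$i$j" for i j
    using arg_cong[OF assms, of "\<lambda>B. B$i$j"] by (simp add: transpose_nth)
  have d: "A$i$i = 0" for i using e[of i i] by simp
  define v :: "real^3" where "v = vector [A$3$2, A$1$3, A$2$1]"
  have A: "A = skew v"
    using e[of 1 2] e[of 1 3] e[of 2 3] d[of 1] d[of 2] d[of 3]
    by (simp add: mat3_eq_iff skew_nth v_def)
  show thesis
  proof (cases "v = 0")
    case True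
    show thesis by (rule that[of 0 "axis 1 1"]) (simp_all add: A True mat3_eq_iff skew_nth)
  next
    case False
    show thesis
      by (rule that[of "norm v" "v /\<^sub>R norm v"]) (use False in \<open>simp_all add: A mat3_eq_iff skew_nth\<close>)
  qed
qed

lemma norm_skew: "norm u = 1 \<Longrightarrow> norm (\<theta> *\<^sub>R skew u) = sqrt 2 * \<bar>\<theta>\<bar>"
proof -
  assume "norm u = 1"
  hence u: "(u$1)\<^sup>2 + (u$2)\<^sup>2 + (u$3)\<^sup>2 = 1" using norm_vec3[of u] by simp
  have "(norm (skew u))\<^sup>2 = 2 * ((u$1)\<^sup>2 + (u$2)\<^sup>2 + (u$3)\<^sup>2)"
    by (simp add: norm_mat3 norm_vec3 skew_nth)
  hence "(norm (skew u))\<^sup>2 = 2" by (simp add: u)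
  hence "norm (skew u) = sqrt 2" by (simp add: real_sqrt_unique)
  thus ?thesis by simp
qed

lemma unit_q1_le: "q \<in> unit_quats \<Longrightarrow> \<bar>q1 q\<bar> \<le> 1"
  unfolding unit_quats_def qinner_def mem_Collect_eq power2_eq_square[symmetric] abs_square_le_1[symmetric]
  by (smt (verit) zero_le_power2)

text \<open>The sign \<open>s\<close> selects the lift with nonnegative scalar part, whose half-angle is at most \<open>\<pi> / 2\<close>.\<close>

lemma unit_polar_sign:
  assumes q: "q \<in> unit_quats" and s: "s = 1 \<or> s = -1" "s * q1 q \<ge> 0"
  obtains u where "norm u = 1" "qrot (arccos \<bar>q1 q\<bar>) u = Quat (s * q1 q) (s * qi q) (s * qj q) (s * qk q)"
proof -
  let ?\<alpha> = "arccos \<bar>q1 q\<bar>"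
  define v :: "real^3" where "v = vector [s * qi q, s * qj q, s * qk q]"
  have ab: "s * q1 q = \<bar>q1 q\<bar>" using s by auto
  have c: "cos ?\<alpha> = s * q1 q" using unit_q1_le[OF q] ab by (simp add: cos_arccos_abs)
  have ss: "s\<^sup>2 = 1" using s by auto
  have "(norm v)\<^sup>2 = s\<^sup>2 * ((qi q)\<^sup>2 + (qj q)\<^sup>2 + (qk q)\<^sup>2)"
    by (simp add: norm_vec3 v_def power_mult_distrib algebra_simps)
  also have "\<dots> = 1 - (q1 q)\<^sup>2" using q unfolding ss by (simp add: unit_quats_def qinner_def power2_eq_square)
  finally have nv: "norm v = sin ?\<alpha>"
    using unit_q1_le[OF q] by (simp add: sin_arccos_abs real_sqrt_unique[symmetric])
  show thesis
  proof (cases "sin ?\<alpha> = 0")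
    case True
    hence "v = 0" using nv by simp
    hence "s * qi q = 0" "s * qj q = 0" "s * qk q = 0"
      by (simp_all add: v_def vec_eq_iff forall_3)
    thus thesis using that[of "axis 1 1"] c True by (simp add: qrot_def)
  next
    case False
    show thesis
      by (rule that[of "v /\<^sub>R sin ?\<alpha>"]) (use False nv c norm_ge_zero[of v] in \<open>simp_all add: qrot_def v_def\<close>)
  qed
qed

lemma phi_sign: "s = 1 \<or> s = -1 \<Longrightarrow> phi (Quat (s * a) (s * b) (s * c) (s * d)) = phi (Quat a b c d)"
  by (auto simp: mat3_eq_iff phi_nth)

lemma arccos_abs_bounds: "\<bar>a\<bar> \<le> 1 \<Longrightarrow> 0 \<le> arccos \<bar>a\<bar> \<and> arccos \<bar>a\<bar> \<le> pi / 2"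
  using arccos_le_pi2[of "\<bar>a\<bar>"] arccos_lbound[of "\<bar>a\<bar>"] by simp

text \<open>A rotation \<open>phi q\<close> turns through the angle \<open>2 * arccos \<bar>Re q\<bar>\<close>, and an antisymmetric matrix
  of rotation angle \<open>\<theta>\<close> has Frobenius norm \<open>sqrt 2 * \<theta>\<close>.\<close>

lemma norm_rot_log:
  assumes q: "q \<in> unit_quats"
  shows "norm (rot_log (phi q)) = sqrt 2 * (2 * arccos \<bar>q1 q\<bar>)"
proof -
  let ?\<alpha> = "arccos \<bar>q1 q\<bar>"
  note ab = arccos_abs_bounds[OF unit_q1_le[OF q]]
  obtain s :: real where s: "s = 1 \<or> s = -1" "s * q1 q \<ge> 0"
    by (metis linorder_linear mult_1 mult_minus_left neg_0_le_iff_le)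
  obtain u where u: "norm u = 1" "qrot ?\<alpha> u = Quat (s * q1 q) (s * qi q) (s * qj q) (s * qk q)"
    using unit_polar_sign[OF q s] by blast
  let ?A = "(2 * ?\<alpha>) *\<^sub>R skew u"
  have A: "transpose ?A = - ?A" "mat_exp ?A = phi q"
    using mat_exp_skew[OF u(1), of "2 * ?\<alpha>"] phi_sign[OF s(1)] u(2)
    by (simp_all add: mat3_eq_iff transpose_nth skew_nth)
  have min: "norm ?A \<le> norm B" if B: "transpose B = - B" "mat_exp B = phi q" for B
  proof -
    obtain \<theta> v where v: "\<theta> \<ge> 0" "norm v = 1" "B = \<theta> *\<^sub>R skew v" by (rule antisym_polar[OF B(1)])
    have "phi (qrot (\<theta> / 2) v) = phi q" using B v mat_exp_skew by simp
    hence "\<bar>cos (\<theta> / 2)\<bar> = \<bar>q1 q\<bar>"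
      using phi_eq_imp[OF qrot_unit[OF v(2), of "\<theta> / 2"] q] by (auto simp: qrot_def)
    hence "?\<alpha> \<le> \<theta> / 2"
    proof (rule_tac ccontr)
      assume c: "\<bar>cos (\<theta> / 2)\<bar> = \<bar>q1 q\<bar>" "\<not> ?\<alpha> \<le> \<theta> / 2"
      hence "cos ?\<alpha> < cos (\<theta> / 2)" using v ab by (intro cos_monotone_0_pi) auto
      moreover have "cos ?\<alpha> = \<bar>q1 q\<bar>" using unit_q1_le[OF q] by (simp add: cos_arccos_abs)
      ultimately show False using c by simp
    qed
    thus ?thesis using norm_skew[OF u(1), of "2 * ?\<alpha>"] norm_skew[OF v(2), of \<theta>] v ab
      by (simp del: norm_scaleR)
  qed
  have "norm (rot_log (phi q)) = norm ?A"
    unfolding rot_log_def by (rule arg_min_equality) (use A min in auto)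
  thus ?thesis using norm_skew[OF u(1)] ab by simp
qed

definition expdiag :: "real^3 \<Rightarrow> mat3" where
  "expdiag x = (\<chi> i j. if i = j then exp (x $ i) else 0)"

lemma expdiag_nth: "expdiag x $ i $ j = (if i = j then exp (x $ i) else 0)"
  by (simp add: expdiag_def)

lemma expdiag_DiagPos [simp]: "expdiag x \<in> DiagPos"
  by (simp add: DiagPos_def expdiag_nth)

lemma DiagPos_expdiag:
  assumes "D \<in> DiagPos"
  obtains x where "D = expdiag x"
  by (rule that[of "\<chi> i. ln (D$i$i)"]) (use assms in \<open>auto simp: DiagPos_def vec_eq_iff expdiag_nth\<close>)

lemma expdiag_inject [simp]: "expdiag x = expdiag y \<longleftrightarrow> x = y"
  by (auto simp: vec_eq_iff expdiag_nth split: if_splits)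

lemma expdiag_add: "expdiag x ** expdiag y = expdiag (x + y)"
proof -
  have "expdiag 0 = mat 1" by (simp add: vec_eq_iff expdiag_nth mat1_nth)
  show ?thesis by (simp add: mat3_eq_iff mat3_mult_nth expdiag_nth exp_add)
qed

lemma matrix_inv_expdiag: "matrix_inv (expdiag x) = expdiag (- x)"
  by (rule matrix_inv_eqI) (simp_all add: expdiag_add, simp_all add: vec_eq_iff expdiag_nth mat1_nth)

lemma norm_diag_log_expdiag: "norm (diag_log (expdiag x)) = norm x"
proof -
  have "(norm (diag_log (expdiag x)))\<^sup>2 = (norm x)\<^sup>2"
    by (simp add: norm_mat3 norm_vec3 diag_log_def expdiag_nth)
  thus ?thesis by simp
qed

text \<open>The distance in the projective space of unit quaternions up to sign, which is half the angle of the
  rotation \<open>phi (qcnj g * h)\<close>.\<close>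

definition qangle :: "quat \<Rightarrow> quat \<Rightarrow> real" where
  "qangle g h = arccos \<bar>qinner g h\<bar>"

lemma dM_eq:
  assumes "g \<in> unit_quats" "h \<in> unit_quats"
  shows "dM k (phi g, expdiag x) (phi h, expdiag y) = sqrt (4 * k * (qangle g h)\<^sup>2 + (norm (y - x))\<^sup>2)"
proof -
  have "norm (rot_log (matrix_inv (phi g) ** phi h)) = sqrt 2 * (2 * qangle g h)"
    using norm_rot_log[of "qcnj g * h"] assms
    by (simp add: matrix_inv_phi qangle_def qinner_qcnj_mult flip: phi_mult)
  thus ?thesis
    by (simp add: dM_def matrix_inv_expdiag expdiag_add norm_diag_log_expdiag power_mult_distrib
        algebra_simps)
qed

lemma Mspace_cases:
  assumes "p \<in> Mspace"
  obtains g x where "g \<in> unit_quats" "p = (phi g, expdiag x)"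
  using assms unfolding Mspace_def by (metis DiagPos_expdiag SigmaE phi_surj)

lemma Mspace_point [simp]: "g \<in> unit_quats \<Longrightarrow> (phi g, expdiag x) \<in> Mspace"
  by (simp add: Mspace_def phi_in_SO3)

subsection \<open>The triangle inequality and its equality case\<close>

text \<open>The triangle inequality on the unit sphere: the parts of \<open>a\<close> and \<open>c\<close> orthogonal to \<open>b\<close> have norms
  equal to the sines of the two angles, so the Cauchy-Schwarz inequality for these parts is the addition
  theorem of the cosine.\<close>

lemma arccos_inner_triangle:
  fixes a b c :: "'a::real_inner"
  assumes "norm a = 1" "norm b = 1" "norm c = 1"
  shows "arccos (a \<bullet> c) \<le> arccos (a \<bullet> b) + arccos (b \<bullet> c)"
proof (cases "arccos (a \<bullet> b) + arccos (b \<bullet> c) \<le> pi")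
  case True
  have bd: "\<bar>v \<bullet> w\<bar> \<le> 1" if "norm v = 1" "norm w = 1" for v w :: 'a
    using Cauchy_Schwarz_ineq2[of v w] that by simp
  let ?x = "a \<bullet> b" and ?y = "b \<bullet> c"
  have aa: "a \<bullet> a = 1" "b \<bullet> b = 1" "c \<bullet> c = 1" using assms by (simp_all add: norm_eq_1)
  have "norm (a - ?x *\<^sub>R b) = sqrt (1 - ?x\<^sup>2)" "norm (c - ?y *\<^sub>R b) = sqrt (1 - ?y\<^sup>2)"
    using aa by (simp_all add: norm_eq_sqrt_inner inner_diff inner_commute power2_eq_square algebra_simps)
  hence "\<bar>(a - ?x *\<^sub>R b) \<bullet> (c - ?y *\<^sub>R b)\<bar> \<le> sqrt (1 - ?x\<^sup>2) * sqrt (1 - ?y\<^sup>2)"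
    by (metis Cauchy_Schwarz_ineq2)
  moreover have "(a - ?x *\<^sub>R b) \<bullet> (c - ?y *\<^sub>R b) = a \<bullet> c - ?x * ?y"
    using aa by (simp add: inner_diff inner_commute algebra_simps)
  moreover have "cos (arccos ?x + arccos ?y) = ?x * ?y - sqrt (1 - ?x\<^sup>2) * sqrt (1 - ?y\<^sup>2)"
    using bd assms by (simp add: cos_add cos_arccos_abs sin_arccos_abs)
  ultimately have "cos (arccos ?x + arccos ?y) \<le> a \<bullet> c" by linarith
  moreover have "0 \<le> arccos ?x + arccos ?y" using bd assms by (simp add: abs_le_iff arccos_lbound)
  ultimately have "arccos (a \<bullet> c) \<le> arccos (cos (arccos ?x + arccos ?y))"
    using bd[of a c] assms by (intro arccos_le_mono[THEN iffD2]) auto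
  thus ?thesis using True \<open>0 \<le> arccos ?x + arccos ?y\<close> by (simp add: arccos_cos)
next
  case False
  have "\<bar>a \<bullet> c\<bar> \<le> 1" using Cauchy_Schwarz_ineq2[of a c] assms by simp
  hence "arccos (a \<bullet> c) \<le> pi" by (simp add: abs_le_iff arccos_ubound)
  thus ?thesis using False by simp
qed

definition qvec :: "quat \<Rightarrow> complex \<times> complex" where
  "qvec q = (Complex (q1 q) (qi q), Complex (qj q) (qk q))"

lemma inner_qvec: "qvec p \<bullet> qvec q = qinner p q"
  by (simp add: qvec_def qinner_def inner_complex_def)

lemma norm_qvec: "q \<in> unit_quats \<Longrightarrow> norm (qvec q) = 1"
  by (simp add: norm_eq_sqrt_inner inner_qvec unit_quats_def)

lemma abs_qinner_le: "g \<in> unit_quats \<Longrightarrow> h \<in> unit_quats \<Longrightarrow> \<bar>qinner g h\<bar> \<le> 1"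
  using Cauchy_Schwarz_ineq2[of "qvec g" "qvec h"] by (simp add: inner_qvec norm_qvec)

text \<open>Replacing the outer two lifts by their negatives where necessary makes both scalar products with the
  middle one nonnegative; the spherical triangle inequality then applies.\<close>

lemma qangle_triangle:
  assumes "a \<in> unit_quats" "b \<in> unit_quats" "c \<in> unit_quats"
  shows "qangle a c \<le> qangle a b + qangle b c"
proof -
  define s where "s = (if qinner a b \<ge> 0 then 1 else -1 :: real)"
  define t where "t = (if qinner b c \<ge> 0 then 1 else -1 :: real)"
  have "arccos ((s *\<^sub>R qvec a) \<bullet> (t *\<^sub>R qvec c)) \<le>
      arccos ((s *\<^sub>R qvec a) \<bullet> qvec b) + arccos (qvec b \<bullet> (t *\<^sub>R qvec c))"
    by (rule arccos_inner_triangle) (use assms in \<open>simp_all add: norm_qvec s_def t_def\<close>)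
  moreover have "arccos \<bar>qinner a c\<bar> \<le> arccos ((s *\<^sub>R qvec a) \<bullet> (t *\<^sub>R qvec c))"
    using abs_qinner_le[OF assms(1,3)]
    by (intro arccos_le_mono[THEN iffD2]) (auto simp: inner_qvec s_def t_def)
  moreover have "(s *\<^sub>R qvec a) \<bullet> qvec b = \<bar>qinner a b\<bar>" "qvec b \<bullet> (t *\<^sub>R qvec c) = \<bar>qinner b c\<bar>"
    by (simp_all add: inner_qvec s_def t_def)
  ultimately show ?thesis by (simp add: qangle_def)
qed

text \<open>In this form the triangle inequality for \<open>dM\<close> is that of the plane, applied to the pairs of distances
  in the two factors.\<close>

lemma dM_cmod:
  assumes "k > 0" "g \<in> unit_quats" "h \<in> unit_quats"
  shows "dM k (phi g, expdiag x) (phi h, expdiag y) = cmod (Complex (2 * sqrt k * qangle g h) (norm (y - x)))"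
  using assms by (simp add: dM_eq cmod_def power_mult_distrib)

lemma qangle_bounds:
  assumes "g \<in> unit_quats" "h \<in> unit_quats"
  shows "0 \<le> qangle g h" "qangle g h \<le> pi / 2"
  using arccos_abs_bounds[OF abs_qinner_le[OF assms]] by (simp_all add: qangle_def)

lemma dM_triangle:
  assumes k: "k > 0" and "p \<in> Mspace" "q \<in> Mspace" "r \<in> Mspace"
  shows "dM k p r \<le> dM k p q + dM k q r"
proof -
  obtain g1 x1 where 1: "g1 \<in> unit_quats" "p = (phi g1, expdiag x1)" using assms Mspace_cases by metis
  obtain g2 x2 where 2: "g2 \<in> unit_quats" "q = (phi g2, expdiag x2)" using assms Mspace_cases by metis
  obtain g3 x3 where 3: "g3 \<in> unit_quats" "r = (phi g3, expdiag x3)" using assms Mspace_cases by metis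
  let ?c = "2 * sqrt k"
  have n: "norm (x3 - x1) \<le> norm (x2 - x1) + norm (x3 - x2)"
    using norm_triangle_ineq[of "x2 - x1" "x3 - x2"] by simp
  have q: "?c * qangle g1 g3 \<le> ?c * qangle g1 g2 + ?c * qangle g2 g3"
    using qangle_triangle[OF 1(1) 2(1) 3(1)] k by (simp flip: distrib_left)
  have "cmod (Complex (?c * qangle g1 g3) (norm (x3 - x1))) \<le>
        cmod (Complex (?c * qangle g1 g2 + ?c * qangle g2 g3) (norm (x2 - x1) + norm (x3 - x2)))"
    unfolding cmod_def complex.sel
    by (intro real_sqrt_le_mono add_mono power_mono n q)
       (use qangle_bounds[OF 1(1) 3(1)] k in auto)
  also have "\<dots> \<le> cmod (Complex (?c * qangle g1 g2) (norm (x2 - x1)))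
                + cmod (Complex (?c * qangle g2 g3) (norm (x3 - x2)))"
    by (metis complex_add norm_triangle_ineq)
  finally show ?thesis using k 1 2 3 by (simp add: dM_cmod)
qed

text \<open>Equality in Minkowski's inequality forces the two summands to be proportional. Here \<open>p\<close> and \<open>r\<close> hold
  the distances in the two factors from an intermediate point to the ends, and \<open>d\<close> those between the ends.\<close>

lemma minkowski_equality:
  fixes p1 p2 r1 r2 d1 d2 c t :: real
  assumes t: "0 \<le> t" "t \<le> 1" and nn: "0 \<le> d1" "0 \<le> d2" "c \<ge> 0"
    and p: "p1\<^sup>2 + p2\<^sup>2 \<le> (t * c)\<^sup>2" and r: "r1\<^sup>2 + r2\<^sup>2 \<le> ((1 - t) * c)\<^sup>2"
    and d: "d1 \<le> p1 + r1" "d2 \<le> p2 + r2" "d1\<^sup>2 + d2\<^sup>2 = c\<^sup>2"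
  shows "p1 = t * d1" "p2 = t * d2"
proof -
  have cs: "d1 * a + d2 * b \<le> c * e" if "a\<^sup>2 + b\<^sup>2 \<le> e\<^sup>2" "e \<ge> 0" for a b e :: real
  proof -
    have "(d1 * a + d2 * b)\<^sup>2 + (d1 * b - d2 * a)\<^sup>2 = (d1\<^sup>2 + d2\<^sup>2) * (a\<^sup>2 + b\<^sup>2)"
      by (simp add: algebra_simps power2_eq_square)
    hence "(d1 * a + d2 * b)\<^sup>2 \<le> c\<^sup>2 * (a\<^sup>2 + b\<^sup>2)"
      unfolding d(3) by (smt (verit) zero_le_power2)
    also have "\<dots> \<le> c\<^sup>2 * e\<^sup>2" by (intro mult_left_mono that) simp
    finally have "(d1 * a + d2 * b)\<^sup>2 \<le> (c * e)\<^sup>2" by (simp add: power_mult_distrib)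
    thus ?thesis using nn that by (simp add: abs_le_square_iff[symmetric])
  qed
  have "d1\<^sup>2 + d2\<^sup>2 \<le> d1 * (p1 + r1) + d2 * (p2 + r2)"
    unfolding power2_eq_square by (intro add_mono mult_left_mono d nn)
  hence 1: "c\<^sup>2 \<le> (d1 * p1 + d2 * p2) + (d1 * r1 + d2 * r2)" using d by (simp add: algebra_simps)
  have "d1 * r1 + d2 * r2 \<le> c * ((1 - t) * c)" by (rule cs) (use r t nn in auto)
  hence 2: "d1 * p1 + d2 * p2 \<ge> t * c\<^sup>2" using 1 by (simp add: algebra_simps power2_eq_square)
  have "(p1 - t * d1)\<^sup>2 + (p2 - t * d2)\<^sup>2 = p1\<^sup>2 + p2\<^sup>2 - 2 * t * (d1 * p1 + d2 * p2) + t\<^sup>2 * (d1\<^sup>2 + d2\<^sup>2)"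
    by (simp add: algebra_simps power2_eq_square)
  also have "\<dots> \<le> (t * c)\<^sup>2 - 2 * t * (t * c\<^sup>2) + t\<^sup>2 * c\<^sup>2"
    unfolding d(3) using p mult_left_mono[OF 2, of "2 * t"] t by simp
  also have "\<dots> = 0" by (simp add: power2_eq_square)
  finally have "(p1 - t * d1)\<^sup>2 + (p2 - t * d2)\<^sup>2 = 0" by (smt (verit) zero_le_power2)
  thus "p1 = t * d1" "p2 = t * d2" by (simp_all add: sum_power2_eq_zero_iff)
qed

text \<open>The square of \<open>norm (m - x - t *\<^sub>R (y - x))\<close>, expanded with the two given norms, vanishes.\<close>

lemma euclidean_between_unique:
  fixes x y m :: "'a::real_inner"
  assumes "norm (m - x) = t * norm (y - x)" "norm (y - m) = (1 - t) * norm (y - x)"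
  shows "m = (1 - t) *\<^sub>R x + t *\<^sub>R y"
proof -
  define a b where "a = m - x" and "b = y - x"
  have na: "a \<bullet> a = t\<^sup>2 * (b \<bullet> b)"
    using assms(1) unfolding a_def b_def by (simp add: power_mult_distrib flip: power2_norm_eq_inner)
  have "(b - a) \<bullet> (b - a) = (1 - t)\<^sup>2 * (b \<bullet> b)"
    using assms(2) unfolding a_def b_def by (simp add: power_mult_distrib flip: power2_norm_eq_inner)
  hence "a \<bullet> b = t * (b \<bullet> b)" using na
    by (simp add: inner_diff inner_commute algebra_simps power2_eq_square)
  hence "(a - t *\<^sub>R b) \<bullet> (a - t *\<^sub>R b) = 0"
    using na by (simp add: inner_diff inner_commute algebra_simps power2_eq_square)
  hence "a - t *\<^sub>R b = 0" by (simp only: inner_eq_zero_iff)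
  hence "m = x + t *\<^sub>R (y - x)" by (simp add: a_def b_def algebra_simps)
  thus ?thesis by (simp add: scaleR_diff_left scaleR_diff_right)
qed

section \<open>Minimal geodesics\<close>

text \<open>The point at time \<open>t\<close> on the shorter arc from \<open>1\<close> to \<open>\<plusminus>p\<close>; the sign of \<open>Re p\<close> selects the
  nearer of the two lifts \<open>p\<close> and \<open>-p\<close> of one rotation. For \<open>p = \<plusminus>1\<close> the quotient of sines is
  \<open>0\<close> by the convention on division, which is the correct value.\<close>

definition qpow :: "quat \<Rightarrow> real \<Rightarrow> quat" where
  "qpow p t = (let \<alpha> = arccos \<bar>q1 p\<bar>; m = sgn (q1 p) * sin (t * \<alpha>) / sin \<alpha>
               in Quat (cos (t * \<alpha>)) (m * qi p) (m * qj p) (m * qk p))"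

text \<open>Off the cut locus the nearer lift of \<open>phi p\<close> is unique, so that \<open>qpow p\<close> is a one-parameter group of
  rotations about the axis of that lift.\<close>

lemma qpow_polar:
  assumes p: "p \<in> unit_quats" and nz: "q1 p \<noteq> 0"
  obtains u where "norm u = 1" "phi p = phi (qrot (arccos \<bar>q1 p\<bar>) u)"
    "\<And>t. qpow p t = qrot (t * arccos \<bar>q1 p\<bar>) u"
    "\<And>q. \<bar>qinner q (qrot (arccos \<bar>q1 p\<bar>) u)\<bar> = \<bar>qinner q p\<bar>"
    "0 \<le> arccos \<bar>q1 p\<bar>" "arccos \<bar>q1 p\<bar> < pi / 2"
proof -
  let ?\<alpha> = "arccos \<bar>q1 p\<bar>"
  have a: "0 \<le> ?\<alpha>" "?\<alpha> < pi / 2"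
    using arccos_less_arccos[of 0 "\<bar>q1 p\<bar>"] unit_q1_le[OF p] nz arccos_abs_bounds[OF unit_q1_le[OF p]]
    by auto
  have s: "sgn (q1 p) = 1 \<or> sgn (q1 p) = -1" "sgn (q1 p) * q1 p \<ge> 0"
    using nz by (auto simp: sgn_real_def)
  obtain u where u: "norm u = 1"
    "qrot ?\<alpha> u = Quat (sgn (q1 p) * q1 p) (sgn (q1 p) * qi p) (sgn (q1 p) * qj p) (sgn (q1 p) * qk p)"
    using unit_polar_sign[OF p s] by blast
  have 2: "phi p = phi (qrot ?\<alpha> u)" unfolding u phi_sign[OF s(1)] by simp
  have 3: "qpow p t = qrot (t * ?\<alpha>) u" for t
  proof (cases "?\<alpha> = 0")
    case True
    thus ?thesis by (simp add: qpow_def qrot_def)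
  next
    case False
    hence "sin ?\<alpha> > 0" using a by (intro sin_gt_zero2) auto
    moreover have "sin ?\<alpha> * u$1 = sgn (q1 p) * qi p" "sin ?\<alpha> * u$2 = sgn (q1 p) * qj p"
        "sin ?\<alpha> * u$3 = sgn (q1 p) * qk p"
      using u(2) by (simp_all add: qrot_def)
    ultimately show ?thesis
      by (simp add: qpow_def qrot_def Let_def) (simp add: field_simps)
  qed
  have 4: "\<bar>qinner q (qrot ?\<alpha> u)\<bar> = \<bar>qinner q p\<bar>" for q
    unfolding u using s(1) by (auto simp: qinner_def)
  show thesis by (rule that[OF u(1) 2 3 4 a])
qed

lemma qinner_qrot: "norm u = 1 \<Longrightarrow> qinner (qrot a u) (qrot b u) = cos (a - b)"
proof -
  assume "norm u = 1"
  hence u: "(u$1)\<^sup>2 + (u$2)\<^sup>2 + (u$3)\<^sup>2 = 1" using norm_vec3[of u] by simp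
  have "qinner (qrot a u) (qrot b u) = cos a * cos b + sin a * sin b * ((u$1)\<^sup>2 + (u$2)\<^sup>2 + (u$3)\<^sup>2)"
    by (simp add: qinner_def qrot_def algebra_simps power2_eq_square)
  thus ?thesis by (simp add: u cos_diff)
qed

lemma unit_quat_eqI:
  assumes "p \<in> unit_quats" "q \<in> unit_quats" "qinner p q = 1"
  shows "p = q"
proof -
  have "(qvec p - qvec q) \<bullet> (qvec p - qvec q) = 0"
    using assms by (simp add: inner_diff inner_qvec qinner_commute unit_quats_def)
  hence "qvec p = qvec q" by simp
  thus ?thesis by (auto simp: qvec_def quat.expand)
qed

lemma qinner_translate_unit: "g \<in> unit_quats \<Longrightarrow> qinner (g * p) (g * q) = qinner p q"
  by (simp add: qinner_translate unit_quats_def)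

lemma qinner_one: "qinner 1 q = q1 q"
  by (simp add: qinner_def one_quat_def)

text \<open>Away from the cut locus (\<open>qinner g h \<noteq> 0\<close>) a rotation dividing the distance between two
  rotations in the ratio \<open>t : 1 - t\<close> lies on the shorter great-circle arc.\<close>

lemma qangle_between_unique:
  assumes u: "g \<in> unit_quats" "h \<in> unit_quats" "m \<in> unit_quats" and nz: "qinner g h \<noteq> 0"
    and t: "0 \<le> t" "t \<le> 1"
    and gm: "qangle g m = t * qangle g h" and mh: "qangle m h = (1 - t) * qangle g h"
  shows "phi m = phi (g * qpow (qcnj g * h) t)"
proof -
  define p m' where "p = qcnj g * h" and "m' = qcnj g * m"
  define \<alpha> where "\<alpha> = arccos \<bar>q1 p\<bar>"
  have pu: "p \<in> unit_quats" "m' \<in> unit_quats" using u by (simp_all add: p_def m'_def)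
  have g': "qcnj g \<in> unit_quats" using u by simp
  have q1p: "q1 p \<noteq> 0" using nz by (simp add: p_def qinner_qcnj_mult)
  obtain v where v: "norm v = 1" "phi p = phi (qrot \<alpha> v)" "\<And>t. qpow p t = qrot (t * \<alpha>) v"
    "\<And>q. \<bar>qinner q (qrot \<alpha> v)\<bar> = \<bar>qinner q p\<bar>" "0 \<le> \<alpha>" "\<alpha> < pi / 2"
    unfolding \<alpha>_def by (rule qpow_polar[OF pu(1) q1p]) blast
  have gh: "qangle g h = \<alpha>" by (simp add: qangle_def \<alpha>_def p_def qinner_qcnj_mult)
  have t\<alpha>: "0 \<le> t * \<alpha>" "t * \<alpha> \<le> \<alpha>" "0 \<le> (1 - t) * \<alpha>" "(1 - t) * \<alpha> \<le> \<alpha>"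
    using t v(5) by (simp_all add: mult_left_le_one_le)
  have b1: "\<bar>q1 m'\<bar> \<le> 1" by (rule unit_q1_le[OF pu(2)])
  have "arccos \<bar>q1 m'\<bar> = t * \<alpha>"
    using gm gh by (simp add: qangle_def m'_def qinner_qcnj_mult)
  hence c1: "\<bar>q1 m'\<bar> = cos (t * \<alpha>)" using b1 by (metis abs_abs cos_arccos_abs)
  have "\<bar>qinner m' p\<bar> = \<bar>qinner m h\<bar>" using qinner_translate_unit[OF g'] by (simp add: p_def m'_def)
  hence "arccos \<bar>qinner m' (qrot \<alpha> v)\<bar> = (1 - t) * \<alpha>" using mh gh by (simp add: qangle_def v(4))
  hence c2: "\<bar>qinner m' (qrot \<alpha> v)\<bar> = cos ((1 - t) * \<alpha>)"
    using abs_qinner_le[OF pu(2) qrot_unit[OF v(1)]] by (metis abs_abs cos_arccos_abs)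
  obtain s :: real where s: "s = 1 \<or> s = -1" "s * q1 m' \<ge> 0"
    by (metis linorder_linear mult_1 mult_minus_left neg_0_le_iff_le)
  define n where "n = Quat (s * q1 m') (s * qi m') (s * qj m') (s * qk m')"
  have n: "n \<in> unit_quats" "phi n = phi m'" using pu(2) s phi_sign[OF s(1), of "q1 m'"]
    by (auto simp: n_def unit_quats_def qinner_def)
  have q1n: "q1 n = cos (t * \<alpha>)" using c1 s by (auto simp: n_def)
  define e where "e = qinner n (qrot \<alpha> v)"
  have "\<bar>e\<bar> = \<bar>qinner m' (qrot \<alpha> v)\<bar>" using s(1) by (auto simp: e_def n_def qinner_def)
  hence ae: "\<bar>e\<bar> = cos ((1 - t) * \<alpha>)" using c2 by simp
  \<comment> \<open>Otherwise two arcs of total length \<open>\<alpha>\<close> would join \<open>1\<close> through \<open>n\<close> to the farther lift, whose distance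
     \<open>pi - \<alpha>\<close> exceeds \<open>\<alpha>\<close>.\<close>
  have "e \<ge> 0"
  proof (rule ccontr)
    assume "\<not> e \<ge> 0"
    hence e: "- e = cos ((1 - t) * \<alpha>)" using ae by simp
    have "arccos (qvec 1 \<bullet> (- qvec (qrot \<alpha> v))) \<le>
        arccos (qvec 1 \<bullet> qvec n) + arccos (qvec n \<bullet> (- qvec (qrot \<alpha> v)))"
      by (rule arccos_inner_triangle) (use n qrot_unit[OF v(1)] in \<open>simp_all add: norm_qvec\<close>)
    hence "arccos (- cos \<alpha>) \<le> arccos (cos (t * \<alpha>)) + arccos (cos ((1 - t) * \<alpha>))"
      by (simp add: inner_qvec qinner_one q1n e_def[symmetric] e) (simp add: qrot_def)
    hence "pi - \<alpha> \<le> t * \<alpha> + (1 - t) * \<alpha>"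
      using t\<alpha> v(5,6) arccos_cos[of "pi - \<alpha>"] by (simp add: arccos_cos)
    thus False using v(6) by (simp add: algebra_simps)
  qed
  hence e: "e = cos ((1 - t) * \<alpha>)" using ae by simp
  have "n = qrot (t * \<alpha>) v"
  proof (rule unit_quat_eqI[OF n(1) qrot_unit[OF v(1)]])
    show "qinner n (qrot (t * \<alpha>) v) = 1"
    proof (cases "\<alpha> = 0")
      case True
      thus ?thesis using q1n by (simp add: qinner_def qrot_def)
    next
      case False
      hence sp: "sin \<alpha> > 0" using v(5,6) by (intro sin_gt_zero2) auto
      have d: "sin ((1 - t) * \<alpha>) = sin \<alpha> * cos (t * \<alpha>) - cos \<alpha> * sin (t * \<alpha>)"
        using sin_diff[of \<alpha> "t * \<alpha>"] by (simp add: algebra_simps)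
      have "sin \<alpha> * qinner n (qrot (t * \<alpha>) v) = sin ((1 - t) * \<alpha>) * q1 n + sin (t * \<alpha>) * e"
        unfolding e_def d by (simp add: qinner_def qrot_def algebra_simps)
      also have "\<dots> = sin ((1 - t) * \<alpha> + t * \<alpha>)" by (simp add: q1n e sin_add)
      also have "\<dots> = sin \<alpha>" by (simp add: algebra_simps)
      finally show ?thesis using sp by simp
    qed
  qed
  hence "phi m' = phi (qpow p t)" using n v(3) by simp
  hence "phi (g * m') = phi (g * qpow p t)" by (simp add: phi_mult)
  thus ?thesis using u by (simp add: m'_def p_def)
qed

text \<open>The product of a great-circle arc of rotations and a straight segment of logarithmic diagonals, both
  run at constant pace over the unit interval.\<close>

definition garc :: "quat \<Rightarrow> real^3 \<Rightarrow> quat \<Rightarrow> real^3 \<Rightarrow> real \<Rightarrow> mpoint" where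
  "garc g x h y t = (phi (g * qpow (qcnj g * h) t), expdiag ((1 - t) *\<^sub>R x + t *\<^sub>R y))"

lemma expdiag_sum:
  "expdiag z = exp (z$1) *\<^sub>R diag3 1 0 0 + exp (z$2) *\<^sub>R diag3 0 1 0 + exp (z$3) *\<^sub>R diag3 0 0 1"
  by (simp add: mat3_eq_iff expdiag_nth diag3_def)

lemma
  assumes u: "g \<in> unit_quats" "h \<in> unit_quats" and nz: "qinner g h \<noteq> 0" and k: "k > 0"
  shows garc_0: "garc g x h y 0 = (phi g, expdiag x)"
    and garc_1: "garc g x h y 1 = (phi h, expdiag y)"
    and garc_Mspace: "garc g x h y t \<in> Mspace"
    and dM_garc: "\<lbrakk>0 \<le> s; s \<le> 1; 0 \<le> t; t \<le> 1\<rbrakk> \<Longrightarrow> dM k (garc g x h y s) (garc g x h y t)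
          = \<bar>t - s\<bar> * dM k (phi g, expdiag x) (phi h, expdiag y)"
    and garc_speed: "\<exists>\<gamma>'. continuous_on UNIV \<gamma>' \<and> (\<forall>t. (garc g x h y has_vector_derivative \<gamma>' t) (at t) \<and>
          gM k (garc g x h y t) (\<gamma>' t) (\<gamma>' t) = (dM k (phi g, expdiag x) (phi h, expdiag y))\<^sup>2)"
proof -
  define p where "p = qcnj g * h"
  define \<alpha> where "\<alpha> = arccos \<bar>q1 p\<bar>"
  have pu: "p \<in> unit_quats" using u by (simp add: p_def)
  have q1p: "q1 p \<noteq> 0" using nz by (simp add: p_def qinner_qcnj_mult)
  obtain v where v: "norm v = 1" "phi p = phi (qrot \<alpha> v)" "\<And>t. qpow p t = qrot (t * \<alpha>) v"
    "0 \<le> \<alpha>" "\<alpha> < pi / 2"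
    unfolding \<alpha>_def by (rule qpow_polar[OF pu q1p]) blast
  have gh: "qangle g h = \<alpha>" by (simp add: qangle_def \<alpha>_def p_def qinner_qcnj_mult)
  let ?\<gamma> = "garc g x h y" and ?d = "dM k (phi g, expdiag x) (phi h, expdiag y)"
  have d2: "?d\<^sup>2 = 4 * k * \<alpha>\<^sup>2 + (norm (y - x))\<^sup>2" using k by (simp add: dM_eq[OF u] gh)
  have \<gamma>: "?\<gamma> t = (phi (g * qrot (t * \<alpha>) v), expdiag ((1 - t) *\<^sub>R x + t *\<^sub>R y))" for t
    by (simp add: garc_def p_def[symmetric] v(3))
  have q0: "qrot 0 v = 1" by (simp add: qrot_def one_quat_def)
  show "?\<gamma> 0 = (phi g, expdiag x)" by (simp add: \<gamma> q0)
  show "?\<gamma> 1 = (phi h, expdiag y)"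
    using u by (simp add: \<gamma> phi_mult v(2)[symmetric]) (simp add: p_def flip: phi_mult)
  show M: "?\<gamma> t \<in> Mspace" for t using u qrot_unit[OF v(1)] by (simp add: \<gamma>)
  show "dM k (?\<gamma> s) (?\<gamma> t) = \<bar>t - s\<bar> * ?d" if st: "0 \<le> s" "s \<le> 1" "0 \<le> t" "t \<le> 1"
  proof -
    have "qinner (g * qrot (s * \<alpha>) v) (g * qrot (t * \<alpha>) v) = cos (\<bar>t - s\<bar> * \<alpha>)"
      using u v by (simp add: qinner_translate_unit qinner_qrot abs_if flip: left_diff_distrib)
        (metis cos_minus minus_diff_eq mult_minus_left)
    moreover have "\<bar>t - s\<bar> * \<alpha> \<le> 1 * \<alpha>" using st v by (intro mult_right_mono) auto
    hence "0 \<le> \<bar>t - s\<bar> * \<alpha>" "\<bar>t - s\<bar> * \<alpha> < pi / 2" using v by auto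
    ultimately have 1: "qangle (g * qrot (s * \<alpha>) v) (g * qrot (t * \<alpha>) v) = \<bar>t - s\<bar> * \<alpha>"
      using cos_ge_zero[of "\<bar>t - s\<bar> * \<alpha>"] by (simp add: qangle_def arccos_cos)
    have "((1 - t) *\<^sub>R x + t *\<^sub>R y) - ((1 - s) *\<^sub>R x + s *\<^sub>R y) = (t - s) *\<^sub>R (y - x)"
      by (simp add: algebra_simps)
    hence 2: "norm (((1 - t) *\<^sub>R x + t *\<^sub>R y) - ((1 - s) *\<^sub>R x + s *\<^sub>R y)) = \<bar>t - s\<bar> * norm (y - x)"
      by (metis norm_scaleR)
    have "dM k (?\<gamma> s) (?\<gamma> t) = sqrt (4 * k * (\<bar>t - s\<bar> * \<alpha>)\<^sup>2 + (\<bar>t - s\<bar> * norm (y - x))\<^sup>2)"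
      using u qrot_unit[OF v(1)] by (simp add: \<gamma> dM_eq 1 2)
    also have "\<dots> = sqrt (\<bar>t - s\<bar>\<^sup>2 * (4 * k * \<alpha>\<^sup>2 + (norm (y - x))\<^sup>2))"
      by (simp add: power_mult_distrib algebra_simps)
    also have "\<dots> = \<bar>t - s\<bar> * ?d"
      unfolding real_sqrt_mult by (simp add: dM_eq[OF u] gh)
    finally show ?thesis .
  qed
  let ?K = "skew v"
  define c where "c = 2 * \<alpha>"
  define R where "R t = phi (g * qrot (t * \<alpha>) v)" for t
  define Z where "Z t = (1 - t) *\<^sub>R x + t *\<^sub>R y" for t
  define L where "L t = (\<chi> i j. if i = j then exp (Z t $ i) * (y$i - x$i) else 0 :: real^3^3)" for t :: real
  define \<gamma>' where "\<gamma>' t = ((c * cos (t * c)) *\<^sub>R (phi g ** ?K) + (c * sin (t * c)) *\<^sub>R (phi g ** (?K ** ?K)), L t)" for t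
  have R: "R t = phi g + sin (t * c) *\<^sub>R (phi g ** ?K) + (1 - cos (t * c)) *\<^sub>R (phi g ** (?K ** ?K))" for t
  proof -
    have "2 * (t * \<alpha>) = t * c" by (simp add: c_def)
    thus ?thesis
      by (simp only: R_def phi_mult rodrigues[OF v(1)] matrix_add_ldistrib mat_scaleR_assoc matrix_mul_rid)
  qed
  have K3: "phi g ** (?K ** ?K) ** ?K = - (phi g ** ?K)"
    by (subst matrix_mul_assoc[symmetric], subst matrix_mul_assoc[symmetric], subst skew_cubed[OF v(1)])
       (simp add: vec_eq_iff mat3_mult_nth algebra_simps)
  have K2: "phi g ** ?K ** ?K = phi g ** (?K ** ?K)" by (simp add: matrix_mul_assoc)
  have add_rdistrib: "(A + B) ** C = A ** C + B ** C" for A B C :: mat3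
    by (simp add: vec_eq_iff mat3_mult_nth algebra_simps)
  have RK: "fst (\<gamma>' t) = c *\<^sub>R (R t ** ?K)" for t
    unfolding R \<gamma>'_def
    by (simp only: add_rdistrib mat_scaleR_assoc K2 K3 fst_conv) (simp add: algebra_simps)
  show "\<exists>\<gamma>'. continuous_on UNIV \<gamma>' \<and> (\<forall>t. (?\<gamma> has_vector_derivative \<gamma>' t) (at t) \<and> gM k (?\<gamma> t) (\<gamma>' t) (\<gamma>' t) = ?d\<^sup>2)"
  proof (intro exI[of _ \<gamma>'] conjI allI)
    have L: "L t = (exp (Z t $ 1) * (y$1 - x$1)) *\<^sub>R diag3 1 0 0 + (exp (Z t $ 2) * (y$2 - x$2)) *\<^sub>R diag3 0 1 0
        + (exp (Z t $ 3) * (y$3 - x$3)) *\<^sub>R diag3 0 0 1" for t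
      by (simp add: mat3_eq_iff L_def diag3_def)
    show "continuous_on UNIV \<gamma>'"
      unfolding \<gamma>'_def L Z_def by (intro continuous_intros)
    fix t
    have dZ: "((\<lambda>t. Z t $ i) has_real_derivative (y$i - x$i)) (at t)" for i
      unfolding Z_def by (auto intro!: derivative_eq_intros simp: algebra_simps)
    have "((\<lambda>t. exp (Z t $ 1) *\<^sub>R diag3 1 0 0 + exp (Z t $ 2) *\<^sub>R diag3 0 1 0 + exp (Z t $ 3) *\<^sub>R diag3 0 0 1)
        has_vector_derivative L t) (at t)"
      unfolding L by (auto intro!: derivative_eq_intros dZ simp: has_real_derivative_iff_has_vector_derivative[symmetric])
    hence 1: "((\<lambda>t. expdiag (Z t)) has_vector_derivative L t) (at t)" by (simp add: expdiag_sum)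
    have 2: "(R has_vector_derivative fst (\<gamma>' t)) (at t)"
      unfolding R[abs_def] \<gamma>'_def fst_conv
      by (auto intro!: derivative_eq_intros simp: algebra_simps)
    have "((\<lambda>t. (R t, expdiag (Z t))) has_vector_derivative (fst (\<gamma>' t), L t)) (at t)"
      by (rule has_vector_derivative_Pair[OF 2 1])
    thus "(?\<gamma> has_vector_derivative \<gamma>' t) (at t)"
      by (simp add: \<gamma>[abs_def] R_def[abs_def] Z_def[abs_def] \<gamma>'_def)
    have RS: "R t \<in> SO3" using u v by (simp add: R_def phi_in_SO3 qrot_unit)
    let ?R = "R t"
    have t0: "transpose ?R ** ?R = mat 1" using matrix_inv_SO3[OF RS] by simp
    have e: "?R ** ?K ** transpose ?R ** (?R ** ?K) ** transpose ?R = ?R ** (?K ** ?K) ** transpose ?R"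
      by (simp only: matrix_mul_assoc[symmetric]) (simp only: matrix_mul_assoc[of "transpose ?R" ?R] t0 matrix_mul_lid)
    have "trace (c *\<^sub>R (?R ** ?K) ** matrix_inv ?R ** (c *\<^sub>R (?R ** ?K)) ** matrix_inv ?R)
        = trace (c\<^sup>2 *\<^sub>R (?R ** (?K ** ?K) ** transpose ?R))"
      by (simp only: matrix_inv_SO3[OF RS] mat_scaleR_assoc e scaleR_scaleR power2_eq_square)
    also have "\<dots> = c\<^sup>2 * trace (?R ** (?K ** ?K) ** transpose ?R)"
      by (simp add: trace_def sum_distrib_left)
    also have "trace (?R ** (?K ** ?K) ** transpose ?R) = trace (?K ** ?K)"
      by (subst trace_mul_sym) (simp add: t0 matrix_mul_assoc)
    also have "trace (?K ** ?K) = - 2"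
      using norm_vec3[of v] v(1) by (simp add: trace_def sum_3 mat3_mult_nth skew_nth power2_eq_square)
    finally have T1: "- (k / 2) * trace (c *\<^sub>R (?R ** ?K) ** matrix_inv ?R ** (c *\<^sub>R (?R ** ?K)) ** matrix_inv ?R) = 4 * k * \<alpha>\<^sup>2"
      by (simp add: c_def power_mult_distrib)
    have T2: "trace (matrix_inv (expdiag (Z t)) ** L t ** matrix_inv (expdiag (Z t)) ** L t) = (norm (y - x))\<^sup>2"
      unfolding norm_vec3
      by (simp add: matrix_inv_expdiag trace_def sum_3 mat3_mult_nth expdiag_nth L_def exp_minus
          field_simps power2_eq_square)
    have \<gamma>'e: "\<gamma>' t = (c *\<^sub>R (?R ** ?K), L t)" using RK by (simp add: \<gamma>'_def)
    show "gM k (?\<gamma> t) (\<gamma>' t) (\<gamma>' t) = ?d\<^sup>2"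
      unfolding \<gamma>'e \<gamma> R_def[symmetric] Z_def[symmetric] gM_def d2 using T1 T2 by simp
  qed
qed

lemma speed_eq:
  assumes "(\<gamma> has_vector_derivative v) (at t within {0..1})" "0 \<le> a" "a < b" "b \<le> 1" "t \<in> {a..b}"
  shows "speed k \<gamma> a b t = sqrt (gM k (\<gamma> t) v v)"
proof -
  have "(\<gamma> has_vector_derivative v) (at t within {a..b})"
    by (rule has_vector_derivative_within_subset[OF assms(1)]) (use assms in auto)
  hence "vector_derivative \<gamma> (at t within {a..b}) = v"
    using assms by (intro vector_derivative_within_closed_interval) auto
  thus ?thesis by (simp add: speed_def)
qed

text \<open>Vector derivatives taken within subintervals agree with those taken within \<open>{0..1}\<close>, so the constant
  speed carries over to every subinterval.\<close>

lemma curve_length_const: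
  assumes "\<And>t. t \<in> {0..1} \<Longrightarrow> (\<gamma> has_vector_derivative \<gamma>' t) (at t within {0..1})"
    and "\<And>t. t \<in> {0..1} \<Longrightarrow> speed k \<gamma> 0 1 t = c" "0 \<le> a" "a \<le> b" "b \<le> 1"
  shows "curve_length k \<gamma> a b = c * (b - a)"
proof (cases "a = b")
  case True
  thus ?thesis by (simp add: curve_length_def)
next
  case False
  hence ab: "a < b" using assms by simp
  have "speed k \<gamma> a b t = c" if "t \<in> {a..b}" for t
  proof -
    have t: "t \<in> {0..1}" using that assms by auto
    show ?thesis
      using speed_eq[OF assms(1)[OF t] assms(3) ab assms(5) that, of k]
        speed_eq[OF assms(1)[OF t] _ _ _ t, of k] assms(2)[OF t] by simp
  qed
  hence "curve_length k \<gamma> a b = integral {a..b} (\<lambda>t. c)"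
    unfolding curve_length_def by (intro integral_cong) auto
  thus ?thesis using ab by simp
qed

lemma geodesic_garc:
  assumes u: "g \<in> unit_quats" "h \<in> unit_quats" and nz: "qinner g h \<noteq> 0" and k: "k > 0"
  shows "geodesic k (garc g x h y)"
    and "curve_length k (garc g x h y) 0 1 = dM k (phi g, expdiag x) (phi h, expdiag y)"
proof -
  let ?\<gamma> = "garc g x h y" and ?d = "dM k (phi g, expdiag x) (phi h, expdiag y)"
  have dpos: "?d \<ge> 0" using k by (simp add: dM_eq[OF u])
  obtain \<gamma>' where \<gamma>': "continuous_on UNIV \<gamma>'" "\<And>t. (?\<gamma> has_vector_derivative \<gamma>' t) (at t)"
      "\<And>t. gM k (?\<gamma> t) (\<gamma>' t) (\<gamma>' t) = ?d\<^sup>2"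
    using garc_speed[OF assms] by blast
  have w: "(?\<gamma> has_vector_derivative \<gamma>' t) (at t within {0..1})" for t
    by (rule has_vector_derivative_at_within[OF \<gamma>'(2)])
  have sp: "speed k ?\<gamma> 0 1 t = ?d" if "t \<in> {0..1}" for t
    using speed_eq[OF w, of 0 1 t k] that dpos by (simp add: \<gamma>'(3))
  have cl: "curve_length k ?\<gamma> a b = ?d * (b - a)" if "0 \<le> a" "a \<le> b" "b \<le> 1" for a b
    by (rule curve_length_const[OF w sp that])
  show "curve_length k ?\<gamma> 0 1 = ?d" using cl[of 0 1] by simp
  show "geodesic k ?\<gamma>"
    unfolding geodesic_def
  proof (intro conjI)
    show "?\<gamma> ` {0..1} \<subseteq> Mspace" using garc_Mspace[OF assms] by blast
    show "\<exists>\<gamma>'. continuous_on {0..1} \<gamma>' \<and>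
        (\<forall>t\<in>{0..1}. (?\<gamma> has_vector_derivative \<gamma>' t) (at t within {0..1}))"
      using w \<gamma>'(1) continuous_on_subset by blast
    show "\<exists>c. \<forall>t\<in>{0..1}. speed k ?\<gamma> 0 1 t = c" using sp by blast
    show "\<forall>t\<in>{0..1}. \<exists>\<epsilon>>0. \<forall>a\<in>{0..1}. \<forall>b\<in>{0..1}. \<bar>a - t\<bar> < \<epsilon> \<longrightarrow> \<bar>b - t\<bar> < \<epsilon> \<longrightarrow> a \<le> b \<longrightarrow>
        curve_length k ?\<gamma> a b = dM k (?\<gamma> a) (?\<gamma> b)"
      by (intro ballI exI[of _ 1]) (auto simp: cl dM_garc[OF assms])
  qed
qed

text \<open>A geodesic is only locally minimising. The inequality between distance and length holds on short
  intervals by definition and passes to unions of adjacent ones by the triangle inequality, hence to all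
  intervals by bisection.\<close>

lemma geodesic_length:
  assumes k: "k > 0" and geo: "geodesic k \<gamma>"
  obtains c where "\<And>a b. \<lbrakk>0 \<le> a; a \<le> b; b \<le> 1\<rbrakk> \<Longrightarrow> curve_length k \<gamma> a b = c * (b - a)"
    "\<And>a b. \<lbrakk>0 \<le> a; a \<le> b; b \<le> 1\<rbrakk> \<Longrightarrow> dM k (\<gamma> a) (\<gamma> b) \<le> c * (b - a)"
proof -
  note G = geo[unfolded geodesic_def]
  have g1: "\<gamma> ` {0..1} \<subseteq> Mspace" by (rule G[THEN conjunct1])
  obtain \<gamma>' where g2: "\<And>t. t\<in>{0..1} \<Longrightarrow> (\<gamma> has_vector_derivative \<gamma>' t) (at t within {0..1})"
    using G[THEN conjunct2, THEN conjunct1] by blast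
  obtain c where g3: "\<And>t. t\<in>{0..1} \<Longrightarrow> speed k \<gamma> 0 1 t = c"
    using G[THEN conjunct2, THEN conjunct2, THEN conjunct1] by blast
  note g4 = G[THEN conjunct2, THEN conjunct2, THEN conjunct2, rule_format]
  have cl: "curve_length k \<gamma> a b = c * (b - a)" if "0 \<le> a" "a \<le> b" "b \<le> 1" for a b
    by (rule curve_length_const[OF g2 g3 that])
  have "dM k (\<gamma> a) (\<gamma> b) \<le> c * (b - a)" if ab: "0 \<le> a" "a \<le> b" "b \<le> 1" for a b
  proof -
    define P where "P r s \<longleftrightarrow> (a \<le> r \<longrightarrow> r \<le> s \<longrightarrow> s \<le> b \<longrightarrow> dM k (\<gamma> r) (\<gamma> s) \<le> c * (s - r))" for r s
    have "P a b"
    proof (induction rule: Bolzano[OF ab(2)])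
      case (1 r s t)
      show ?case unfolding P_def
      proof (intro impI)
        assume *: "a \<le> r" "r \<le> t" "t \<le> b"
        have "\<gamma> r \<in> Mspace" "\<gamma> s \<in> Mspace" "\<gamma> t \<in> Mspace" using ab * 1(3,4) by (auto intro!: subsetD[OF g1] imageI)
        from dM_triangle[OF k this] 1 * show "dM k (\<gamma> r) (\<gamma> t) \<le> c * (t - r)"
          by (simp add: P_def algebra_simps)
      qed
    next
      case (2 t)
      hence "t \<in> {0..1}" using ab by auto
      then obtain \<epsilon> where e: "\<epsilon> > 0" "\<forall>a\<in>{0..1}. \<forall>b\<in>{0..1}. \<bar>a - t\<bar> < \<epsilon> \<longrightarrow> \<bar>b - t\<bar> < \<epsilon> \<longrightarrow> a \<le> b \<longrightarrow>
        curve_length k \<gamma> a b = dM k (\<gamma> a) (\<gamma> b)" using g4[of t] by metis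
      show ?case
      proof (intro exI[of _ \<epsilon>] conjI allI impI e(1))
        fix r s assume rs: "r \<le> t \<and> t \<le> s \<and> s - r < \<epsilon>"
        show "P r s" unfolding P_def
        proof (intro impI)
          assume "a \<le> r" "r \<le> s" "s \<le> b"
          with rs e(2) cl[of r s] ab show "dM k (\<gamma> r) (\<gamma> s) \<le> c * (s - r)" by auto
        qed
      qed
    qed
    thus ?thesis using ab by (simp add: P_def)
  qed
  with cl show thesis using that by blast
qed

text \<open>A geodesic whose length is the distance of its endpoints realises the distance between any
  two of its points, so that the equality case of the triangle inequality determines it.\<close>

lemma minimal_geodesic_unique:
  assumes u: "g \<in> unit_quats" "h \<in> unit_quats" and nz: "qinner g h \<noteq> 0" and k: "k > 0"
    and geo: "geodesic k \<gamma>" "\<gamma> 0 = (phi g, expdiag x)" "\<gamma> 1 = (phi h, expdiag y)"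
    and len: "curve_length k \<gamma> 0 1 = dM k (phi g, expdiag x) (phi h, expdiag y)"
    and t: "t \<in> {0..1}"
  shows "\<gamma> t = garc g x h y t"
proof -
  obtain c where c: "\<And>a b. \<lbrakk>0 \<le> a; a \<le> b; b \<le> 1\<rbrakk> \<Longrightarrow> curve_length k \<gamma> a b = c * (b - a)"
    "\<And>a b. \<lbrakk>0 \<le> a; a \<le> b; b \<le> 1\<rbrakk> \<Longrightarrow> dM k (\<gamma> a) (\<gamma> b) \<le> c * (b - a)"
    using geodesic_length[OF k geo(1)] by blast
  have t': "0 \<le> t" "t \<le> 1" using t by auto
  have cd: "c = dM k (phi g, expdiag x) (phi h, expdiag y)" using c(1)[of 0 1] len by simp
  have "\<gamma> t \<in> Mspace" using geo(1) t unfolding geodesic_def by blast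
  then obtain m z where m: "m \<in> unit_quats" "\<gamma> t = (phi m, expdiag z)" by (rule Mspace_cases)
  let ?s = "2 * sqrt k"
  define d1 d2 p1 p2 r1 r2 where "d1 = ?s * qangle g h" and "d2 = norm (y - x)"
    and "p1 = ?s * qangle g m" and "p2 = norm (z - x)"
    and "r1 = ?s * qangle m h" and "r2 = norm (y - z)"
  have sq: "(dM k (phi a, expdiag x') (phi b, expdiag y'))\<^sup>2 = (?s * qangle a b)\<^sup>2 + (norm (y' - x'))\<^sup>2"
    if "a \<in> unit_quats" "b \<in> unit_quats" for a b x' y'
    using that k by (simp add: dM_eq power_mult_distrib)
  have nn: "0 \<le> d1" "0 \<le> d2" "0 \<le> c"
    using k qangle_bounds[OF u] by (simp_all add: d1_def d2_def cd dM_eq[OF u])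
  have "p1\<^sup>2 + p2\<^sup>2 \<le> (t * c)\<^sup>2"
    unfolding p1_def p2_def sq[OF u(1) m(1), symmetric]
    using c(2)[of 0 t] t' k by (intro power_mono) (simp_all add: geo m dM_eq[OF u(1) m(1)] mult.commute)
  moreover have "r1\<^sup>2 + r2\<^sup>2 \<le> ((1 - t) * c)\<^sup>2"
    unfolding r1_def r2_def sq[OF m(1) u(2), symmetric]
    using c(2)[of t 1] t' k by (intro power_mono) (simp_all add: geo m dM_eq[OF m(1) u(2)] mult.commute)
  moreover have dp1: "d1 \<le> p1 + r1"
    unfolding d1_def p1_def r1_def using qangle_triangle[OF u(1) m(1) u(2)] k
    by (simp flip: distrib_left)
  moreover have dp2: "d2 \<le> p2 + r2"
    unfolding d2_def p2_def r2_def using norm_triangle_ineq[of "z - x" "y - z"] by simp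
  moreover have "d1\<^sup>2 + d2\<^sup>2 = c\<^sup>2" by (simp add: cd sq[OF u] d1_def d2_def)
  ultimately have "p1 = t * d1 \<and> p2 = t * d2" "r1 = (1 - t) * d1 \<and> r2 = (1 - t) * d2"
    using minkowski_equality[OF t' nn, of p1 p2 r1 r2]
      minkowski_equality[of "1 - t" d1 d2 c r1 r2 p1 p2] t' nn by (auto simp: add.commute)
  hence e: "qangle g m = t * qangle g h" "qangle m h = (1 - t) * qangle g h"
      "norm (z - x) = t * norm (y - x)" "norm (y - z) = (1 - t) * norm (y - x)"
    using k by (simp_all add: d1_def d2_def p1_def p2_def r1_def r2_def)
  show ?thesis
    using qangle_between_unique[OF u m(1) nz t' e(1,2)] euclidean_between_unique[OF e(3,4)]
    by (simp add: m garc_def)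
qed

text \<open>The scaling-rotation curve of the unique shortest geodesic.\<close>

definition src :: "quat \<Rightarrow> real^3 \<Rightarrow> quat \<Rightarrow> real^3 \<Rightarrow> real \<Rightarrow> mat3" where
  "src g x h y = scaling_rotation_curve (garc g x h y)"

lemma scaling_rotation_curve_minimal:
  assumes "g \<in> unit_quats" "h \<in> unit_quats" "qinner g h \<noteq> 0" "k > 0"
    "geodesic k \<gamma>" "\<gamma> 0 = (phi g, expdiag x)" "\<gamma> 1 = (phi h, expdiag y)"
    "curve_length k \<gamma> 0 1 = dM k (phi g, expdiag x) (phi h, expdiag y)"
  shows "scaling_rotation_curve \<gamma> = src g x h y"
  unfolding src_def scaling_rotation_curve_def
  using minimal_geodesic_unique[OF assms] by (intro restrict_ext) simp

lemma curve_length_ge_dM: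
  assumes "k > 0" "geodesic k \<gamma>"
  shows "curve_length k \<gamma> 0 1 \<ge> dM k (\<gamma> 0) (\<gamma> 1)"
  using geodesic_length[OF assms] by (metis order_refl zero_le_one)

lemma minimal_geodesic_curves:
  assumes u: "g \<in> unit_quats" "h \<in> unit_quats" "qinner g h \<noteq> 0" "k > 0"
  shows "{scaling_rotation_curve \<gamma> | \<gamma>. minimal_geodesic k \<gamma> (phi g, expdiag x) (phi h, expdiag y)}
    = {src g x h y}"
proof -
  have len: "curve_length k \<gamma> 0 1 = dM k (phi g, expdiag x) (phi h, expdiag y)"
    if "minimal_geodesic k \<gamma> (phi g, expdiag x) (phi h, expdiag y)" for \<gamma>
    using that curve_length_ge_dM[OF u(4), of \<gamma>] geodesic_garc[OF u, of x y] garc_0[OF u] garc_1[OF u]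
    unfolding minimal_geodesic_def by (metis order_antisym)
  have "minimal_geodesic k (garc g x h y) (phi g, expdiag x) (phi h, expdiag y)"
    unfolding minimal_geodesic_def
    using curve_length_ge_dM[OF u(4)] geodesic_garc[OF u, of x y] garc_0[OF u] garc_1[OF u] by metis
  moreover have "scaling_rotation_curve \<gamma> = src g x h y"
    if "minimal_geodesic k \<gamma> (phi g, expdiag x) (phi h, expdiag y)" for \<gamma>
    using scaling_rotation_curve_minimal[OF u, of \<gamma>] len[OF that] that
    unfolding minimal_geodesic_def by blast
  ultimately show ?thesis unfolding src_def by blast
qed

section \<open>Signed permutation matrices acting on eigen-decompositions\<close>

lemma signed_perm_of_unique:
  assumes "signed_perm_of P \<pi>" "signed_perm_of P \<sigma>"
  shows "\<pi> = \<sigma>"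
proof
  fix j
  have "P $ \<pi> j $ j \<noteq> 0" using assms(1) unfolding signed_perm_of_def by (metis zero_neq_neg_one zero_neq_one)
  thus "\<pi> j = \<sigma> j" using assms(2) unfolding signed_perm_of_def by metis
qed

lemma mat_perm_eq: "signed_perm_of P \<pi> \<Longrightarrow> mat_perm P = \<pi>"
  unfolding mat_perm_def using signed_perm_of_unique by (intro the_equality) auto

lemma SO3_row_norm: "G \<in> SO3 \<Longrightarrow> (G$i$1)\<^sup>2 + (G$i$2)\<^sup>2 + (G$i$3)\<^sup>2 = 1"
  using arg_cong[OF matrix_inv_SO3(3), of G "\<lambda>A. A$i$i"]
  by (simp add: mat3_mult_nth transpose_nth mat1_nth power2_eq_square)

lemma SO3_column_norm: "G \<in> SO3 \<Longrightarrow> (G$1$j)\<^sup>2 + (G$2$j)\<^sup>2 + (G$3$j)\<^sup>2 = 1"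
  using SO3_row_norm[of "transpose G" j] by (simp add: transpose_nth)

lemma signed_perms_entries:
  "P \<in> signed_perms \<Longrightarrow> P$i$j = 0 \<or> P$i$j = 1 \<or> P$i$j = -1"
  unfolding signed_perms_def signed_perm_of_def by (cases "i = (SOME \<pi>. signed_perm_of P \<pi>) j") (auto; metis)+

lemma signed_perms_SO3:
  assumes "P \<in> signed_perms" shows "P \<in> SO3"
proof -
  obtain \<pi> where \<pi>: "\<pi> permutes UNIV" "\<And>i j. i = \<pi> j \<Longrightarrow> P$i$j = 1 \<or> P$i$j = -1" "\<And>i j. i \<noteq> \<pi> j \<Longrightarrow> P$i$j = 0"
    using assms unfolding signed_perms_def signed_perm_of_def by (auto split: if_splits)
  have "(transpose P ** P)$i$j = (mat 1 :: mat3)$i$j" for i j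
  proof -
    have "(transpose P ** P)$i$j = (\<Sum>l\<in>UNIV. P$l$i * P$l$j)"
      by (simp add: matrix_matrix_mult_def transpose_nth)
    also have "\<dots> = (\<Sum>l\<in>UNIV. if l = \<pi> i then (if i = j then 1 else 0) else 0)"
    proof (rule sum.cong)
      fix l
      have "\<pi> i = \<pi> j \<longleftrightarrow> i = j" using \<pi>(1) by (metis permutes_inj injD)
      thus "P$l$i * P$l$j = (if l = \<pi> i then (if i = j then 1 else 0) else 0)"
        using \<pi>(2)[of l i] \<pi>(3)[of l i] \<pi>(3)[of l j] by auto
    qed simp
    finally show ?thesis by (simp add: mat1_nth)
  qed
  hence "transpose P ** P = mat 1" by (simp add: vec_eq_iff)
  thus ?thesis using assms
    by (simp add: SO3_def rotation_matrix_def orthogonal_matrix signed_perms_def)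
qed

lemma ex_3: "(\<exists>i::3. P i) \<longleftrightarrow> P 1 \<or> P 2 \<or> P 3"
  by (metis exhaust_3)

text \<open>A row or column of norm one with entries \<open>0\<close>, \<open>1\<close>, \<open>-1\<close> has exactly one nonzero entry; its position
  defines the permutation.\<close>

lemma signed_permsI:
  assumes "P \<in> SO3" "\<And>i j. P$i$j = 0 \<or> P$i$j = 1 \<or> P$i$j = -1"
  shows "P \<in> signed_perms"
proof -
  have sq: "(P$i$j)\<^sup>2 = (if P$i$j = 0 then 0 else 1)" for i j using assms(2)[of i j] by auto
  have c: "\<exists>!i. P$i$j \<noteq> 0" for j
    using SO3_column_norm[OF assms(1), of j] unfolding sq by (auto simp: Ex1_def ex_3 forall_3 split: if_splits)
  have r: "\<exists>!j. P$i$j \<noteq> 0" for i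
    using SO3_row_norm[OF assms(1), of i] unfolding sq by (auto simp: Ex1_def ex_3 forall_3 split: if_splits)
  define \<pi> where "\<pi> j = (THE i. P$i$j \<noteq> 0)" for j
  have \<pi>: "P$i$j \<noteq> 0 \<longleftrightarrow> i = \<pi> j" for i j
    using theI'[OF c[of j]] c[of j] unfolding \<pi>_def by blast
  have "inj \<pi>" by (rule injI) (metis r \<pi>)
  hence "bij \<pi>" using finite_UNIV_inj_surj[of \<pi>] by (simp add: bij_def)
  hence "\<pi> permutes UNIV" by (intro bij_imp_permutes) auto
  hence "signed_perm_of P \<pi>" unfolding signed_perm_of_def using \<pi> assms(2) by metis
  thus ?thesis using assms(1) by (auto simp: signed_perms_def SO3_def rotation_matrix_def)
qed

lemma signed_perms_transpose: "P \<in> signed_perms \<Longrightarrow> transpose P \<in> signed_perms"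
  by (rule signed_permsI) (use signed_perms_entries in \<open>auto simp: signed_perms_SO3 transpose_nth\<close>)

lemma signed_perms_mult:
  assumes "P \<in> signed_perms" "Q \<in> signed_perms"
  shows "P ** Q \<in> signed_perms"
proof (rule signed_permsI)
  show "P ** Q \<in> SO3" using assms by (simp add: SO3_mult signed_perms_SO3)
  fix i j
  obtain \<pi> where \<pi>: "\<And>i j. i \<noteq> \<pi> j \<Longrightarrow> Q$i$j = 0"
    using assms(2) unfolding signed_perms_def signed_perm_of_def by (auto split: if_splits)
  have "(P ** Q)$i$j = P$i$\<pi> j * Q$\<pi> j$j"
    using \<pi>[of _ j] exhaust_3[of "\<pi> j"] by (auto simp: mat3_mult_nth)
  thus "(P ** Q)$i$j = 0 \<or> (P ** Q)$i$j = 1 \<or> (P ** Q)$i$j = -1"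
    using signed_perms_entries[OF assms(1), of i "\<pi> j"] signed_perms_entries[OF assms(2), of "\<pi> j" j] by auto
qed

lemma signed_perm_conj:
  assumes "signed_perm_of P \<pi>" "D \<in> DiagPos"
  shows "P ** D ** transpose P = perm_act \<pi> D"
proof -
  have \<pi>: "\<pi> permutes UNIV" "\<And>i j. i = \<pi> j \<Longrightarrow> P$i$j = 1 \<or> P$i$j = -1" "\<And>i j. i \<noteq> \<pi> j \<Longrightarrow> P$i$j = 0"
    using assms unfolding signed_perm_of_def by (auto split: if_splits)
  have D: "D$i$j = 0" if "i \<noteq> j" for i j using assms that by (simp add: DiagPos_def)
  have "(P ** D ** transpose P)$i$j = perm_act \<pi> D$i$j" for i j
  proof -
    have PD: "(P ** D)$i$l = P$i$l * D$l$l" for l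
      using D[of _ l] exhaust_3[of l] by (auto simp: mat3_mult_nth)
    have "(P ** D ** transpose P)$i$j = (\<Sum>l\<in>UNIV. P$i$l * D$l$l * P$j$l)"
      using matrix_matrix_mult_def[of "P ** D" "transpose P"] by (simp add: PD transpose_nth)
    also have "\<dots> = (\<Sum>l\<in>UNIV. if l = inv \<pi> i then (if i = j then D$l$l else 0) else 0)"
    proof (rule sum.cong)
      fix l
      have "l = inv \<pi> i \<longleftrightarrow> i = \<pi> l" using \<pi>(1) by (metis permutes_inverses(1,2))
      thus "P$i$l * D$l$l * P$j$l = (if l = inv \<pi> i then (if i = j then D$l$l else 0) else 0)"
        using \<pi>(2)[of i l] \<pi>(3)[of i l] \<pi>(3)[of j l] by auto
    qed simp
    finally show ?thesis by (simp add: perm_act_def)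
  qed
  thus ?thesis by (simp add: vec_eq_iff)
qed

lemma sp_act_eq:
  assumes "P \<in> signed_perms" "D \<in> DiagPos"
  shows "sp_act P (U, D) = (U ** transpose P, P ** D ** transpose P)"
proof -
  obtain \<pi> where "signed_perm_of P \<pi>" using assms by (auto simp: signed_perms_def)
  thus ?thesis using assms
    by (simp add: sp_act_def matrix_inv_SO3 signed_perms_SO3 mat_perm_eq signed_perm_conj)
qed

lemma perm_act_DiagPos: "D \<in> DiagPos \<Longrightarrow> perm_act \<pi> D \<in> DiagPos"
  by (simp add: DiagPos_def perm_act_def)

lemma sp_act_Mspace: "P \<in> signed_perms \<Longrightarrow> p \<in> Mspace \<Longrightarrow> sp_act P p \<in> Mspace"
  by (cases p) (auto simp: Mspace_def sp_act_def matrix_inv_SO3 signed_perms_SO3 SO3_mult perm_act_DiagPos)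

lemma sp_act_mult:
  assumes "P \<in> signed_perms" "Q \<in> signed_perms" "p \<in> Mspace"
  shows "sp_act P (sp_act Q p) = sp_act (P ** Q) p"
proof -
  obtain U D where p: "p = (U, D)" "D \<in> DiagPos" using assms by (auto simp: Mspace_def)
  have "sp_act Q p \<in> Mspace" using assms by (simp add: sp_act_Mspace)
  hence "Q ** D ** transpose Q \<in> DiagPos" using assms p by (simp add: sp_act_eq Mspace_def)
  thus ?thesis using assms p
    by (simp add: sp_act_eq signed_perms_mult matrix_transpose_mul matrix_mul_assoc)
qed

lemma sp_act_inverse:
  assumes "P \<in> signed_perms" "p \<in> Mspace"
  shows "sp_act (transpose P) (sp_act P p) = p"
proof -
  obtain U D where p: "p = (U, D)" "D \<in> DiagPos" using assms by (auto simp: Mspace_def)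
  have "mat 1 \<in> signed_perms"
    using matrix_inv_SO3(2)[OF signed_perms_SO3[OF assms(1)]] signed_perms_mult[OF signed_perms_transpose[OF assms(1)] assms(1)]
    by simp
  thus ?thesis
    using assms p by (simp add: sp_act_mult signed_perms_transpose matrix_inv_SO3 signed_perms_SO3)
      (simp add: sp_act_eq)
qed

lemma Fmap_sp_act:
  assumes "P \<in> signed_perms" "p \<in> Mspace"
  shows "Fmap (sp_act P p) = Fmap p"
proof -
  obtain U D where p: "p = (U, D)" "D \<in> DiagPos" using assms by (auto simp: Mspace_def)
  have PP: "transpose P ** P = mat 1" using assms by (simp add: matrix_inv_SO3 signed_perms_SO3)
  have "U ** transpose P ** (P ** D ** transpose P) ** (P ** transpose U)
      = U ** (transpose P ** P) ** D ** (transpose P ** P) ** transpose U"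
    by (simp only: matrix_mul_assoc)
  thus ?thesis using assms p by (simp add: Fmap_def sp_act_eq matrix_transpose_mul PP)
qed

lemma sp_act_fiber: "P \<in> signed_perms \<Longrightarrow> p \<in> fiber X \<Longrightarrow> sp_act P p \<in> fiber X"
  by (simp add: fiber_def sp_act_Mspace Fmap_sp_act)

definition perm_vec :: "(3 \<Rightarrow> 3) \<Rightarrow> real^3 \<Rightarrow> real^3" where
  "perm_vec \<pi> x = (\<chi> i. x $ (inv \<pi> i))"

lemma perm_act_expdiag: "perm_act \<pi> (expdiag x) = expdiag (perm_vec \<pi> x)"
  by (simp add: vec_eq_iff perm_act_def expdiag_nth perm_vec_def)

lemma norm_perm_vec:
  assumes "\<pi> permutes UNIV" shows "norm (perm_vec \<pi> x) = norm x"
proof -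
  have "(\<Sum>i\<in>UNIV. (x $ inv \<pi> i)\<^sup>2) = (\<Sum>i\<in>UNIV. (x$i)\<^sup>2)"
    using permutes_inv[OF assms] by (rule sum.permute[symmetric, unfolded comp_def])
  thus ?thesis by (simp add: norm_vec_def L2_set_def perm_vec_def)
qed

lemma perm_vec_linear:
  "perm_vec \<pi> (x + y) = perm_vec \<pi> x + perm_vec \<pi> y" "perm_vec \<pi> (x - y) = perm_vec \<pi> x - perm_vec \<pi> y"
  "perm_vec \<pi> (c *\<^sub>R x) = c *\<^sub>R perm_vec \<pi> x"
  by (simp_all add: vec_eq_iff perm_vec_def)

lemma sp_act_point:
  assumes "phi h \<in> signed_perms" "h \<in> unit_quats"
  shows "sp_act (phi h) (phi g, expdiag x) = (phi (g * qcnj h), expdiag (perm_vec (mat_perm (phi h)) x))"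
  using assms by (simp add: sp_act_def perm_act_expdiag matrix_inv_phi phi_mult)

lemma qinner_translate_right: "h \<in> unit_quats \<Longrightarrow> qinner (p * h) (q * h) = qinner p q"
  by (simp add: qinner_translate unit_quats_def)

lemma qangle_phi_cong:
  assumes "g \<in> unit_quats" "h \<in> unit_quats" "g' \<in> unit_quats" "h' \<in> unit_quats"
    "phi g = phi g'" "phi h = phi h'"
  shows "\<bar>qinner g h\<bar> = \<bar>qinner g' h'\<bar>"
  using phi_eq_imp[OF assms(1,3,5)] phi_eq_imp[OF assms(2,4,6)] by (auto simp: qinner_def)

lemma src_cong:
  assumes u: "g \<in> unit_quats" "h \<in> unit_quats" "g' \<in> unit_quats" "h' \<in> unit_quats"
    and e: "phi g = phi g'" "phi h = phi h'" and nz: "qinner g h \<noteq> 0"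
  shows "src g x h y = src g' x h' y"
proof -
  have "qinner g' h' \<noteq> 0" using qangle_phi_cong[OF u e] nz by auto
  hence "{src g x h y} = {src g' x h' y}"
    using minimal_geodesic_curves[OF u(1,2) nz, of 1 x y] minimal_geodesic_curves[OF u(3,4), of 1 x y] e by simp
  thus ?thesis by simp
qed

text \<open>Conjugation by a unit quaternion fixes the scalar part and is linear on the imaginary part.\<close>

lemma qpow_conj:
  assumes h: "h \<in> unit_quats"
  shows "qpow (h * p * qcnj h) t = h * qpow p t * qcnj h"
proof -
  obtain a b c d where hh: "h = Quat a b c d" by (metis quat.exhaust)
  have n: "d * d = 1 - a * a - b * b - c * c" using h by (simp add: unit_quats_def qinner_def hh)
  have re: "q1 (h * p * qcnj h) = q1 p" for p
  proof -
    have "q1 (h * p * qcnj h) = q1 p * qinner h h"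
      by (simp add: times_quat_def qcnj_def qinner_def algebra_simps)
    thus ?thesis using h by (simp add: unit_quats_def)
  qed
  have im: "h * Quat C (m * qi p) (m * qj p) (m * qk p) * qcnj h =
      Quat C (m * qi (h * p * qcnj h)) (m * qj (h * p * qcnj h)) (m * qk (h * p * qcnj h))" (is "?L = _") for C m
  proof -
    have "q1 ?L = C" by (simp add: re)
    moreover have "qi ?L = m * qi (h * p * qcnj h)" "qj ?L = m * qj (h * p * qcnj h)" "qk ?L = m * qk (h * p * qcnj h)"
      by (simp_all add: times_quat_def qcnj_def algebra_simps)
    ultimately show ?thesis by (metis quat.collapse)
  qed
  show ?thesis unfolding qpow_def re Let_def im by simp
qed

text \<open>The action of \<open>phi h\<close> carries the whole geodesic between the old points to the geodesic between the
  new points, and \<open>Fmap\<close> is invariant under the action.\<close>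

lemma src_translate:
  assumes P: "phi h \<in> signed_perms" "h \<in> unit_quats"
    and u: "g \<in> unit_quats" "g' \<in> unit_quats" and nz: "qinner g g' \<noteq> 0"
  shows "src (g * qcnj h) (perm_vec (mat_perm (phi h)) x) (g' * qcnj h) (perm_vec (mat_perm (phi h)) y) = src g x g' y"
proof -
  have "Fmap (garc (g * qcnj h) (perm_vec (mat_perm (phi h)) x) (g' * qcnj h) (perm_vec (mat_perm (phi h)) y) t)
      = Fmap (garc g x g' y t)" for t
  proof -
    have "qpow (qcnj (g * qcnj h) * (g' * qcnj h)) t = h * qpow (qcnj g * g') t * qcnj h"
      using qpow_conj[OF P(2), of "qcnj g * g'" t] by (simp add: mult.assoc)
    hence "g * qcnj h * qpow (qcnj (g * qcnj h) * (g' * qcnj h)) t = g * qpow (qcnj g * g') t * qcnj h"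
      using P by (simp add: mult.assoc)
    hence "garc (g * qcnj h) (perm_vec (mat_perm (phi h)) x) (g' * qcnj h) (perm_vec (mat_perm (phi h)) y) t
        = sp_act (phi h) (garc g x g' y t)"
      by (simp add: garc_def sp_act_point[OF P] perm_vec_linear)
    moreover have "garc g x g' y t \<in> Mspace" using garc_Mspace[OF u nz, of 1] by simp
    ultimately show ?thesis using P by (simp add: Fmap_sp_act)
  qed
  thus ?thesis unfolding src_def scaling_rotation_curve_def by (intro restrict_ext) simp
qed

text \<open>The action preserves distances and, where minimal geodesics are unique, the curves that
  they project to; pairs of points may therefore be compared after a signed permutation.\<close>

lemma sp_act_invariance:
  assumes P: "P \<in> signed_perms"
    and u: "g \<in> unit_quats" "h \<in> unit_quats" "g' \<in> unit_quats" "h' \<in> unit_quats"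
    and e: "sp_act P (phi g, expdiag x) = (phi g', expdiag x')" "sp_act P (phi h, expdiag y) = (phi h', expdiag y')"
  shows "\<bar>qinner g' h'\<bar> = \<bar>qinner g h\<bar>"
    and "dM k (phi g', expdiag x') (phi h', expdiag y') = dM k (phi g, expdiag x) (phi h, expdiag y)"
    and "qinner g h \<noteq> 0 \<Longrightarrow> src g' x' h' y' = src g x h y"
proof -
  obtain p where p: "p \<in> unit_quats" "P = phi p" using phi_surj[OF signed_perms_SO3[OF P]] by metis
  let ?\<pi> = "mat_perm P"
  have \<pi>: "?\<pi> permutes UNIV"
    using P mat_perm_eq by (auto simp: signed_perms_def signed_perm_of_def)
  note sp = sp_act_point[OF P[unfolded p(2)] p(1), folded p(2)]
  have g: "phi g' = phi (g * qcnj p)" "x' = perm_vec ?\<pi> x" "phi h' = phi (h * qcnj p)" "y' = perm_vec ?\<pi> y"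
    using e by (simp_all add: sp)
  have gp: "g * qcnj p \<in> unit_quats" "h * qcnj p \<in> unit_quats" using u p by simp_all
  show a: "\<bar>qinner g' h'\<bar> = \<bar>qinner g h\<bar>"
    using qangle_phi_cong[OF u(3,4) gp g(1,3)] p by (simp add: qinner_translate_right)
  show "dM k (phi g', expdiag x') (phi h', expdiag y') = dM k (phi g, expdiag x) (phi h, expdiag y)"
    using norm_perm_vec[OF \<pi>, of "y - x"]
    by (simp add: dM_eq u qangle_def a g(2,4) flip: perm_vec_linear)
  show "src g' x' h' y' = src g x h y" if nz: "qinner g h \<noteq> 0"
    using src_cong[OF u(3,4) gp g(1,3), of x' y'] src_translate[OF P[unfolded p(2)] p(1) u(1,2) nz, of x y] nz a
    by (simp add: g(2,4) p(2))
qed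

section \<open>Fibers and their components\<close>

lemma D_J1_expdiag:
  assumes "D \<in> D_J1"
  obtains x where "D = expdiag x" "x$2 = x$3" "x$1 \<noteq> x$2"
proof -
  obtain a b where "D = diag3 a b b" "a > 0" "b > 0" "a \<noteq> b" using assms by (auto simp: D_J1_def)
  thus thesis
    by (intro that[of "vector [ln a, ln b, ln b]"]) (auto simp: mat3_eq_iff expdiag_nth diag3_def)
qed

lemma fiber_cases:
  assumes "q \<in> fiber X"
  obtains U' x' where "q = (U', expdiag x')" "(U', expdiag x') \<in> fiber X"
proof -
  obtain U' D' where q: "q = (U', D')" by (cases q)
  hence "D' \<in> DiagPos" using assms by (simp add: fiber_def Mspace_def)
  then obtain x' where "D' = expdiag x'" by (rule DiagPos_expdiag)
  thus thesis using that assms q by simp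
qed

lemma SO3_cancel:
  assumes "U \<in> SO3"
  shows "U ** (transpose U ** A) = A" "transpose U ** (U ** A) = A"
  by (simp_all only: matrix_mul_assoc matrix_inv_SO3[OF assms] matrix_mul_lid)

lemma SO3_conj_cancel:
  assumes "U \<in> SO3" "U ** A ** transpose U = U ** B ** transpose U"
  shows "A = B"
proof -
  have "transpose U ** (U ** C ** transpose U) ** U = C" for C
  proof -
    have "transpose U ** (U ** C ** transpose U) ** U = (transpose U ** U) ** C ** (transpose U ** U)"
      by (simp only: matrix_mul_assoc)
    thus ?thesis by (simp add: matrix_inv_SO3[OF assms(1)])
  qed
  thus ?thesis using assms(2) by metis
qed

text \<open>Two eigen-decompositions of one matrix are intertwined by \<open>transpose U ** U'\<close>, which therefore can
  have nonzero entries only where the eigenvalues agree.\<close>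

lemma fiber_entries:
  assumes "(U, expdiag x) \<in> fiber X" "(U', expdiag x') \<in> fiber X"
  shows "transpose U ** U' \<in> SO3"
    and "(transpose U ** U') $ i $ j \<noteq> 0 \<Longrightarrow> x' $ j = x $ i"
proof -
  let ?G = "transpose U ** U'"
  have U: "U \<in> SO3" "U' \<in> SO3" using assms by (simp_all add: fiber_def Mspace_def)
  note o = matrix_inv_SO3[OF U(1)] matrix_inv_SO3[OF U(2)]
  show "?G \<in> SO3" using U by (simp add: SO3_mult)
  have "U ** expdiag x ** transpose U = U' ** expdiag x' ** transpose U'"
    using assms by (simp add: fiber_def Fmap_def)
  hence "transpose U ** (U ** expdiag x ** transpose U) ** U' = transpose U ** (U' ** expdiag x' ** transpose U') ** U'"
    by simp
  hence "expdiag x ** ?G = ?G ** expdiag x'"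
    by (simp only: matrix_mul_assoc[symmetric] SO3_cancel[OF U(1)] o(5) matrix_mul_rid)
  hence "(expdiag x ** ?G) $ i $ j = (?G ** expdiag x') $ i $ j" by simp
  hence "exp (x$i) * ?G$i$j = ?G$i$j * exp (x'$j)"
    using exhaust_3[of i] exhaust_3[of j] by (auto simp: mat3_mult_nth expdiag_nth)
  thus "?G$i$j \<noteq> 0 \<Longrightarrow> x'$j = x$i" by simp
qed

lemma phi_of_complex_commute:
  assumes "x$2 = x$3"
  shows "phi (of_complex r) ** expdiag x = expdiag x ** phi (of_complex r)"
  using assms by (simp add: mat3_eq_iff mat3_mult_nth phi_nth expdiag_nth of_complex_def)

text \<open>A rotation about the first axis commutes with a diagonal matrix whose last two entries coincide.\<close>

lemma fiber_rotate:
  assumes "(U, expdiag x) \<in> fiber X" "x$2 = x$3" "cmod r = 1"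
  shows "(U ** phi (of_complex r), expdiag x) \<in> fiber X"
proof -
  have r: "phi (of_complex r) ** transpose (phi (of_complex r)) = mat 1"
    using assms matrix_inv_SO3 phi_in_SO3 by simp
  have "U ** phi (of_complex r) ** expdiag x ** transpose (U ** phi (of_complex r))
      = U ** (phi (of_complex r) ** expdiag x) ** transpose (phi (of_complex r)) ** transpose U"
    by (simp add: matrix_transpose_mul matrix_mul_assoc)
  also have "\<dots> = U ** expdiag x ** (phi (of_complex r) ** transpose (phi (of_complex r))) ** transpose U"
    by (simp only: phi_of_complex_commute[OF assms(2)] matrix_mul_assoc)
  finally show ?thesis using assms r by (simp add: fiber_def Mspace_def Fmap_def SO3_mult phi_in_SO3)
qed

lemma unit_zetas: "\<zeta> \<in> zetas_top \<Longrightarrow> \<zeta> \<in> unit_quats"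
  by (auto simp: zetas_top_def unit_quats_def qinner_def one_quat_def unit_j_def zeta_jp_def
      zeta_jm_def zeta_kp_def zeta_km_def)

lemma swap_simps:
  "swap13 1 = 3" "swap13 2 = 2" "swap13 3 = 1" "swap12 1 = 2" "swap12 2 = 1" "swap12 3 = 3"
  by (simp_all add: swap13_def swap12_def Transposition.transpose_def)

lemma swaps_permute: "swap13 permutes UNIV" "swap12 permutes UNIV" "inv swap13 = swap13" "inv swap12 = swap12"
  unfolding swap13_def swap12_def by (simp_all only: permutes_swap_id UNIV_I inv_swap_id inv_transpose_eq)

lemma phi_zeta_nth:
  "phi unit_j $ 1 $ 1 = -1" "phi unit_j $ 2 $ 2 = 1" "phi unit_j $ 3 $ 3 = -1" 
  "phi zeta_jp $ 1 $ 3 = 1" "phi zeta_jp $ 2 $ 2 = 1" "phi zeta_jp $ 3 $ 1 = -1" 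
  "phi zeta_jm $ 1 $ 3 = -1" "phi zeta_jm $ 2 $ 2 = 1" "phi zeta_jm $ 3 $ 1 = 1" 
  "phi zeta_kp $ 1 $ 2 = -1" "phi zeta_kp $ 2 $ 1 = 1" "phi zeta_kp $ 3 $ 3 = 1" 
  "phi zeta_km $ 1 $ 2 = 1" "phi zeta_km $ 2 $ 1 = -1" "phi zeta_km $ 3 $ 3 = 1" 
  "phi unit_j $ 1 $ 2 = 0" "phi unit_j $ 1 $ 3 = 0" "phi unit_j $ 2 $ 1 = 0" "phi unit_j $ 2 $ 3 = 0" "phi unit_j $ 3 $ 1 = 0" "phi unit_j $ 3 $ 2 = 0"
  "phi zeta_jp $ 1 $ 1 = 0" "phi zeta_jp $ 1 $ 2 = 0" "phi zeta_jp $ 2 $ 1 = 0" "phi zeta_jp $ 2 $ 3 = 0" "phi zeta_jp $ 3 $ 3 = 0" "phi zeta_jp $ 3 $ 2 = 0"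
  "phi zeta_jm $ 1 $ 1 = 0" "phi zeta_jm $ 1 $ 2 = 0" "phi zeta_jm $ 2 $ 1 = 0" "phi zeta_jm $ 2 $ 3 = 0" "phi zeta_jm $ 3 $ 3 = 0" "phi zeta_jm $ 3 $ 2 = 0"
  "phi zeta_kp $ 1 $ 1 = 0" "phi zeta_kp $ 1 $ 3 = 0" "phi zeta_kp $ 2 $ 2 = 0" "phi zeta_kp $ 2 $ 3 = 0" "phi zeta_kp $ 3 $ 1 = 0" "phi zeta_kp $ 3 $ 2 = 0"
  "phi zeta_km $ 1 $ 1 = 0" "phi zeta_km $ 1 $ 3 = 0" "phi zeta_km $ 2 $ 2 = 0" "phi zeta_km $ 2 $ 3 = 0" "phi zeta_km $ 3 $ 1 = 0" "phi zeta_km $ 3 $ 2 = 0"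
  by (simp_all add: phi_nth unit_j_def zeta_jp_def zeta_jm_def zeta_kp_def zeta_km_def power_divide)

lemma phi_zeta_signed_perm:
  "signed_perm_of (phi 1) id" "signed_perm_of (phi unit_j) id"
  "signed_perm_of (phi zeta_jp) swap13" "signed_perm_of (phi zeta_jm) swap13"
  "signed_perm_of (phi zeta_kp) swap12" "signed_perm_of (phi zeta_km) swap12"
  unfolding signed_perm_of_def forall_3
  by (simp_all add: swaps_permute permutes_id swap_simps phi_zeta_nth mat1_nth)

lemmas mat_perm_zeta = phi_zeta_signed_perm[THEN mat_perm_eq]

lemma phi_zeta_signed:
  assumes "\<zeta> \<in> zetas_top" shows "phi \<zeta> \<in> signed_perms"
proof -
  have "det (phi \<zeta>) = 1"
    using phi_in_SO3[OF unit_zetas[OF assms]] by (simp add: SO3_def rotation_matrix_def)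
  moreover have "\<exists>\<pi>. signed_perm_of (phi \<zeta>) \<pi>"
    using assms unfolding zetas_top_def insert_iff empty_iff by (metis phi_zeta_signed_perm)
  ultimately show ?thesis by (simp add: signed_perms_def)
qed

lemma perm_vec_swaps:
  "perm_vec id y = y" "perm_vec swap13 y = vector [y$3, y$2, y$1]" "perm_vec swap12 y = vector [y$2, y$1, y$3]"
  by (simp_all add: perm_vec_def vec_eq_iff forall_3 swaps_permute swap_simps)

text \<open>The six quaternions \<open>\<zeta>\<close> represent the cosets of the signed permutations modulo those that fix
  the first axis: the first rows of the matrices \<open>phi \<zeta>\<close> are the six vectors \<open>\<plusminus>e\<^sub>j\<close>.\<close>

lemma zeta_first_row:
  assumes "s = 1 \<or> s = -1"
  obtains \<zeta> where "\<zeta> \<in> zetas_top" "phi \<zeta> $ 1 $ j = s"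
proof -
  have "phi 1 $ 1 $ 1 = 1" "phi unit_j $ 1 $ 1 = -1" "phi zeta_jp $ 1 $ 3 = 1" "phi zeta_jm $ 1 $ 3 = -1"
    "phi zeta_kp $ 1 $ 2 = -1" "phi zeta_km $ 1 $ 2 = 1"
    by (simp_all add: phi_zeta_nth mat1_nth)
  moreover have "1 \<in> zetas_top" "unit_j \<in> zetas_top" "zeta_jp \<in> zetas_top" "zeta_jm \<in> zetas_top"
    "zeta_kp \<in> zetas_top" "zeta_km \<in> zetas_top"
    by (simp_all add: zetas_top_def)
  ultimately show thesis using that exhaust_3[of j] assms by metis
qed

lemma sum_squares_one:
  fixes a b c :: real
  assumes "a\<^sup>2 + b\<^sup>2 + c\<^sup>2 = 1" "a\<^sup>2 = 1"
  shows "b = 0" "c = 0"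
proof -
  have "b\<^sup>2 + c\<^sup>2 = 0" using assms by simp
  thus "b = 0" "c = 0" by (simp_all add: sum_power2_eq_zero_iff)
qed

lemma SO3_row_unit:
  assumes "G \<in> SO3" "(G$i$j)\<^sup>2 = 1" "l \<noteq> j"
  shows "G$i$l = 0"
proof -
  note n = SO3_row_norm[OF assms(1), of i]
  consider "j = 1" | "j = 2" | "j = 3" using exhaust_3[of j] by blast
  thus ?thesis
  proof cases
    case 1
    have "G$i$2 = 0" "G$i$3 = 0" using sum_squares_one[of "G$i$1" "G$i$2" "G$i$3"] n assms(2) 1 by simp_all
    thus ?thesis using assms(3) 1 exhaust_3[of l] by auto
  next
    case 2
    have "G$i$1 = 0" "G$i$3 = 0" using sum_squares_one[of "G$i$2" "G$i$1" "G$i$3"] n assms(2) 2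
      by (simp_all add: algebra_simps)
    thus ?thesis using assms(3) 2 exhaust_3[of l] by auto
  next
    case 3
    have "G$i$1 = 0" "G$i$2 = 0" using sum_squares_one[of "G$i$3" "G$i$1" "G$i$2"] n assms(2) 3
      by (simp_all add: algebra_simps)
    thus ?thesis using assms(3) 3 exhaust_3[of l] by auto
  qed
qed

lemma SO3_column_unit:
  assumes "G \<in> SO3" "\<And>l. l \<noteq> i \<Longrightarrow> G$l$j = 0"
  shows "(G$i$j)\<^sup>2 = 1"
proof -
  have "(\<Sum>l\<in>UNIV. (G$l$j)\<^sup>2) = (\<Sum>l\<in>UNIV. if l = i then (G$i$j)\<^sup>2 else 0)"
    using assms(2) by (intro sum.cong) auto
  also have "\<dots> = (G$i$j)\<^sup>2" by simp
  finally show ?thesis using SO3_column_norm[OF assms(1), of j] by (simp add: sum_3)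
qed

lemma SO3_row_unit':
  assumes "G \<in> SO3" "\<And>l. l \<noteq> j \<Longrightarrow> G$i$l = 0"
  shows "(G$i$j)\<^sup>2 = 1"
  using SO3_column_unit[of "transpose G" j i] assms by (simp add: transpose_nth)

lemma rows_agree:
  assumes "G \<in> SO3" "H \<in> SO3" "G$1$j = s" "H$1$j = s" "s = 1 \<or> s = -1"
  shows "(G ** transpose H) $ 1 $ 1 = 1"
proof -
  have "s\<^sup>2 = 1" using assms(5) by auto
  hence "G$1$l = 0" if "l \<noteq> j" for l using SO3_row_unit[OF assms(1) _ that] assms(3) by simp
  moreover have "s * s = 1" using assms(5) by auto
  moreover have "(G ** transpose H) $ 1 $ 1 = (\<Sum>l\<in>UNIV. G$1$l * H$1$l)"
    by (simp add: matrix_matrix_mult_def transpose_nth)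
  moreover have "(\<Sum>l\<in>UNIV. G$1$l * H$1$l) = (\<Sum>l\<in>UNIV. if l = j then s * s else 0)"
    using assms(3,4) calculation by (intro sum.cong) auto
  ultimately show ?thesis by simp
qed

lemma distinct_entries_inj:
  fixes y :: "real^3"
  assumes "y$1 \<noteq> y$2" "y$1 \<noteq> y$3" "y$2 \<noteq> y$3" "y$i = y$j"
  shows "i = j"
  using exhaust_3[of i] exhaust_3[of j] assms by (elim disjE) auto

text \<open>The isolated eigenvalue occupies exactly one diagonal position of any eigen-decomposition,
  and a suitable \<open>\<zeta>\<close> moves it to the first one.\<close>

lemma mid_fiber_normal_form:
  assumes F: "(U, expdiag x) \<in> fiber X" "q \<in> fiber X" and x: "x$2 = x$3" "x$1 \<noteq> x$2"
  obtains \<zeta> r where "\<zeta> \<in> zetas_top" "cmod r = 1" "sp_act (phi \<zeta>) q = (U ** phi (of_complex r), expdiag x)"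
proof -
  obtain U' x' where q: "q = (U', expdiag x')" by (rule fiber_cases[OF F(2)])
  let ?G = "transpose U ** U'"
  note G = fiber_entries[OF F(1) F(2)[unfolded q]]
  obtain j where j: "?G$1$j \<noteq> 0" using SO3_row_norm[OF G(1), of 1] by force
  have "x'$j = x$1" by (rule G(2)[OF j])
  hence "?G$2$j = 0" "?G$3$j = 0" using G(2)[of 2 j] G(2)[of 3 j] x by metis+
  hence "(?G$1$j)\<^sup>2 = 1" using SO3_column_norm[OF G(1), of j] by simp
  hence s: "?G$1$j = 1 \<or> ?G$1$j = -1" by (simp add: power2_eq_1_iff)
  obtain \<zeta> where z: "\<zeta> \<in> zetas_top" "phi \<zeta> $ 1 $ j = ?G$1$j" by (rule zeta_first_row[OF s])
  note zs = phi_zeta_signed[OF z(1)]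
  have R1: "(?G ** transpose (phi \<zeta>)) $ 1 $ 1 = 1"
    by (rule rows_agree[OF G(1) signed_perms_SO3[OF zs] refl z(2) s])
  have RS: "?G ** transpose (phi \<zeta>) \<in> SO3" using G(1) zs by (simp add: SO3_mult signed_perms_SO3)
  obtain r where r: "cmod r = 1" "?G ** transpose (phi \<zeta>) = phi (of_complex r)"
    by (rule SO3_stabilizer[OF RS R1])
  have "sp_act (phi \<zeta>) q \<in> fiber X" by (rule sp_act_fiber[OF zs F(2)])
  moreover obtain x'' where e: "sp_act (phi \<zeta>) q = (U' ** transpose (phi \<zeta>), expdiag x'')"
    using zs by (simp add: q sp_act_def perm_act_expdiag matrix_inv_SO3 signed_perms_SO3)
  ultimately have F3: "(U' ** transpose (phi \<zeta>), expdiag x'') \<in> fiber X" by simp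
  have g: "transpose U ** (U' ** transpose (phi \<zeta>)) = phi (of_complex r)"
    using r by (simp add: matrix_mul_assoc)
  have imp: "phi (of_complex r) $ i $ j \<noteq> 0 \<Longrightarrow> x'' $ j = x $ i" for i j
    using fiber_entries(2)[OF F(1) F3, of i j] g by simp
  have col: "(phi (of_complex r) $ 1 $ j)\<^sup>2 + (phi (of_complex r) $ 2 $ j)\<^sup>2 + (phi (of_complex r) $ 3 $ j)\<^sup>2 = 1" for j
    using SO3_column_norm phi_in_SO3 r(1) by simp
  have "phi (of_complex r) $ 1 $ 2 = 0" "phi (of_complex r) $ 1 $ 3 = 0" by (simp_all add: phi_nth of_complex_def)
  hence "x''$2 = x$2" "x''$3 = x$2"
    using imp[of 2 2] imp[of 3 2] imp[of 2 3] imp[of 3 3] col[of 2] col[of 3] x by force+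
  moreover have "x''$1 = x$1" using imp[of 1 1] R1 r(2) by simp
  ultimately have "x'' = x" using x by (simp add: vec_eq_iff forall_3)
  moreover have "U' ** transpose (phi \<zeta>) = U ** phi (of_complex r)"
  proof -
    have "U \<in> SO3" using F by (simp add: fiber_def Mspace_def)
    thus ?thesis using g SO3_cancel(1) by metis
  qed
  ultimately show thesis using that z(1) r(1) e by simp
qed

text \<open>With distinct eigenvalues the intertwining matrix of two decompositions has one nonzero entry in each
  row and column.\<close>

lemma top_fiber_normal_form:
  assumes F: "(V, expdiag y) \<in> fiber Y" "q \<in> fiber Y" and y: "y$1 \<noteq> y$2" "y$1 \<noteq> y$3" "y$2 \<noteq> y$3"
  obtains Q where "Q \<in> signed_perms" "q = sp_act Q (V, expdiag y)"
proof -
  obtain U' x' where q: "q = (U', expdiag x')" by (rule fiber_cases[OF F(2)])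
  let ?G = "transpose V ** U'"
  note G = fiber_entries[OF F(1) F(2)[unfolded q]]
  have V: "V \<in> SO3" using F by (simp add: fiber_def Mspace_def)
  have uniq: "i = i'" if "?G$i$j \<noteq> 0" "?G$i'$j \<noteq> 0" for i i' j
    by (rule distinct_entries_inj[OF y]) (use G(2)[OF that(1)] G(2)[OF that(2)] in simp)
  have ent: "?G$i$j = 0 \<or> ?G$i$j = 1 \<or> ?G$i$j = -1" for i j
  proof (cases "?G$i$j = 0")
    case False
    have "?G$i'$j = 0" if "i' \<noteq> i" for i' using uniq[of i j i'] False that by metis
    hence "(?G$i$j)\<^sup>2 = 1" by (rule SO3_column_unit[OF G(1)])
    thus ?thesis by (simp add: power2_eq_1_iff)
  qed simp
  have GS: "?G \<in> signed_perms" by (rule signed_permsI[OF G(1) ent])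
  let ?Q = "transpose ?G"
  have QS: "?Q \<in> signed_perms" by (rule signed_perms_transpose[OF GS])
  have "sp_act ?G q \<in> fiber Y" by (rule sp_act_fiber[OF GS F(2)])
  have "V ** ?G = U'" by (rule SO3_cancel[OF V])
  hence "sp_act ?Q (V, expdiag y) = (U', ?Q ** expdiag y ** ?G)"
    using QS by (simp add: sp_act_eq)
  moreover have "sp_act ?Q (V, expdiag y) \<in> fiber Y" by (rule sp_act_fiber[OF QS F(1)])
  ultimately have "U' ** (?Q ** expdiag y ** ?G) ** transpose U' = U' ** expdiag x' ** transpose U'"
    using F(2) by (simp add: fiber_def Fmap_def q)
  moreover have "U' \<in> SO3" using F(2) q by (simp add: fiber_def Mspace_def)
  ultimately have "?Q ** expdiag y ** ?G = expdiag x'" using SO3_conj_cancel by blast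
  thus thesis using that[OF QS] \<open>sp_act ?Q (V, expdiag y) = _\<close> q by simp
qed

lemma fiber_component_sub: "q \<in> fiber_component X p \<Longrightarrow> q \<in> fiber X"
  unfolding fiber_component_def using connected_component_subset by blast

text \<open>A connected set admits no nonconstant continuous function with finitely many values; this is how
  components of fibers are bounded from above.\<close>

lemma fiber_component_const:
  fixes f :: "mpoint \<Rightarrow> real"
  assumes "p \<in> fiber X" "q \<in> fiber_component X p"
    and "continuous_on (fiber_component X p) f" "finite (f ` fiber_component X p)"
  shows "f q = f p"
proof -
  have "connected (fiber_component X p)" by (simp add: fiber_component_def)
  hence "f constant_on fiber_component X p" by (rule continuous_finite_range_constant[OF _ assms(3,4)])
  moreover have "p \<in> fiber_component X p"
    using assms(1) by (simp add: fiber_component_def connected_component_refl_eq)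
  ultimately show ?thesis using assms(2) unfolding constant_on_def by metis
qed

text \<open>The diagonal entries vary continuously among the finitely many eigenvalues of \<open>Y\<close>.\<close>

lemma fiber_component_diag:
  assumes F: "(V, expdiag y) \<in> fiber Y" and q: "q \<in> fiber_component Y (V, expdiag y)"
  obtains V' where "q = (V', expdiag y)" "(V', expdiag y) \<in> fiber Y"
proof -
  let ?C = "fiber_component Y (V, expdiag y)"
  have vals: "\<exists>i. snd p $ j $ j = exp (y$i)" if p: "p \<in> ?C" for p j
  proof -
    obtain U' x' where p': "p = (U', expdiag x')" "(U', expdiag x') \<in> fiber Y" by (rule fiber_cases[OF fiber_component_sub[OF p]])
    note G = fiber_entries[OF F p'(2)]
    obtain i where "(transpose V ** U')$i$j \<noteq> 0" using SO3_column_norm[OF G(1), of j] by force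
    from G(2)[OF this] show ?thesis by (auto simp: p' expdiag_nth)
  qed
  have d: "snd q $ j $ j = exp (y$j)" for j
  proof -
    have "(\<lambda>p. snd p $ j $ j) ` ?C \<subseteq> (\<lambda>i. exp (y$i)) ` UNIV" using vals by blast
    hence fin: "finite ((\<lambda>p. snd p $ j $ j) ` ?C)" by (rule finite_subset) simp
    have "continuous_on ?C (\<lambda>p. snd p $ j $ j)" by (intro continuous_intros)
    from fiber_component_const[OF F q this fin] show ?thesis by (simp add: expdiag_nth)
  qed
  obtain U' x' where p': "q = (U', expdiag x')" "(U', expdiag x') \<in> fiber Y" by (rule fiber_cases[OF fiber_component_sub[OF q]])
  have "x' = y" using d by (simp add: p' expdiag_nth vec_eq_iff)
  thus thesis using that p' by simp
qed

text \<open>The quotient of two frames in one component is diagonal with entries \<open>1\<close> and \<open>-1\<close>, which cannot change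
  along the component.\<close>

lemma top_fiber_component:
  assumes F: "(V, expdiag y) \<in> fiber Y" and y: "y$1 \<noteq> y$2" "y$1 \<noteq> y$3" "y$2 \<noteq> y$3"
  shows "fiber_component Y (V, expdiag y) = {(V, expdiag y)}"
proof (intro equalityI subsetI)
  fix q assume q: "q \<in> fiber_component Y (V, expdiag y)"
  let ?C = "fiber_component Y (V, expdiag y)"
  let ?f = "\<lambda>i p. (transpose V ** fst p) $ i $ i"
  have V: "V \<in> SO3" using F by (simp add: fiber_def Mspace_def)
  have G: "transpose V ** fst p \<in> SO3" "i \<noteq> j \<Longrightarrow> (transpose V ** fst p)$i$j = 0"
    "?f i p = 1 \<or> ?f i p = -1" if p: "p \<in> ?C" for p i j
  proof -
    obtain V' where V': "p = (V', expdiag y)" "(V', expdiag y) \<in> fiber Y" by (rule fiber_component_diag[OF F p])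
    note e = fiber_entries[OF F V'(2)]
    have z: "(transpose V ** V')$i$j = 0" if "i \<noteq> j" for i j
    proof (rule ccontr)
      assume "(transpose V ** V')$i$j \<noteq> 0"
      from e(2)[OF this] have "j = i" by (rule distinct_entries_inj[OF y])
      with that show False by simp
    qed
    show "transpose V ** fst p \<in> SO3" "i \<noteq> j \<Longrightarrow> (transpose V ** fst p)$i$j = 0"
      using e z V' by auto
    have "((transpose V ** V')$i$i)\<^sup>2 = 1"
      by (rule SO3_row_unit'[OF e(1)]) (use z in auto)
    thus "?f i p = 1 \<or> ?f i p = -1" by (simp add: V' power2_eq_1_iff)
  qed
  have "?f i q = 1" for i
  proof -
    have "?f i ` ?C \<subseteq> {1, -1}" using G(3) by blast
    hence fin: "finite (?f i ` ?C)" by (rule finite_subset) simp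
    have "continuous_on ?C (?f i)" unfolding mat3_mult_nth by (intro continuous_intros)
    from fiber_component_const[OF F q this fin] show ?thesis
      using matrix_inv_SO3[OF V] by (simp add: mat1_nth)
  qed
  hence "transpose V ** fst q = mat 1" using G(2)[OF q] by (simp add: mat3_eq_iff mat1_nth)
  hence "fst q = V" using SO3_cancel(1)[OF V, of "fst q"] by simp
  moreover obtain V' where "q = (V', expdiag y)" by (rule fiber_component_diag[OF F q])
  ultimately show "q \<in> {(V, expdiag y)}" by simp
next
  fix q assume "q \<in> {(V, expdiag y)}"
  thus "q \<in> fiber_component Y (V, expdiag y)"
    using F by (simp add: fiber_component_def connected_component_refl_eq)
qed

text \<open>Along the component the corner entry of the quotient of the frames takes only the values \<open>1\<close> and \<open>-1\<close>,
  so it stays at \<open>1\<close> and the quotient fixes the first axis; conversely the rotations about that axis form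
  a connected set.\<close>

lemma mid_fiber_component:
  assumes F: "(U, expdiag x) \<in> fiber X" and x: "x$2 = x$3" "x$1 \<noteq> x$2"
  shows "fiber_component X (U, expdiag x) = {(U ** phi (of_complex r), expdiag x) | r. cmod r = 1}"
proof (intro equalityI subsetI)
  fix q assume q: "q \<in> fiber_component X (U, expdiag x)"
  let ?C = "fiber_component X (U, expdiag x)"
  let ?f = "\<lambda>p. (transpose U ** fst p) $ 1 $ 1"
  have U: "U \<in> SO3" using F by (simp add: fiber_def Mspace_def)
  have G: "transpose U ** fst p \<in> SO3" "?f p = 1 \<or> ?f p = -1" if p: "p \<in> ?C" for p
  proof -
    obtain V' where V': "p = (V', expdiag x)" "(V', expdiag x) \<in> fiber X" by (rule fiber_component_diag[OF F p])
    note e = fiber_entries[OF F V'(2)]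
    have z: "(transpose U ** V')$1$2 = 0" "(transpose U ** V')$1$3 = 0"
      using e(2)[of 1 2] e(2)[of 1 3] x by metis+
    show "transpose U ** fst p \<in> SO3" using e V' by simp
    have "((transpose U ** V')$1$1)\<^sup>2 = 1" using SO3_row_norm[OF e(1), of 1] z by simp
    thus "?f p = 1 \<or> ?f p = -1" by (simp add: V' power2_eq_1_iff)
  qed
  have "?f ` ?C \<subseteq> {1, -1}" using G(2) by blast
  hence fin: "finite (?f ` ?C)" by (rule finite_subset) simp
  have "continuous_on ?C ?f" unfolding mat3_mult_nth by (intro continuous_intros)
  from fiber_component_const[OF F q this fin] have "?f q = 1"
    using matrix_inv_SO3[OF U] by (simp add: mat1_nth)
  then obtain r where r: "cmod r = 1" "transpose U ** fst q = phi (of_complex r)"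
    by (rule SO3_stabilizer[OF G(1)[OF q]])
  hence "fst q = U ** phi (of_complex r)" using SO3_cancel(1)[OF U, of "fst q"] by simp
  moreover obtain V' where "q = (V', expdiag x)" by (rule fiber_component_diag[OF F q])
  ultimately show "q \<in> {(U ** phi (of_complex r), expdiag x) | r. cmod r = 1}" using r by auto
next
  fix q assume q: "q \<in> {(U ** phi (of_complex r), expdiag x) | r. cmod r = 1}"
  let ?g = "\<lambda>r. (U ** phi (of_complex r), expdiag x)"
  let ?S = "?g ` sphere (0::complex) 1"
  have "continuous_on (sphere 0 1) (\<lambda>r. phi (of_complex r))"
  proof -
    have eq: "phi (of_complex r) = mat 1 + (2 * Re r * Im r) *\<^sub>R skew (axis 1 1)
        - (2 * (Im r)\<^sup>2) *\<^sub>R diag3 0 1 1" if "r \<in> sphere 0 1" for r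
    proof -
      have "(Re r)\<^sup>2 = 1 - (Im r)\<^sup>2" using that by (simp add: cmod_def)
      thus ?thesis
        by (simp add: mat3_eq_iff phi_nth of_complex_def mat1_nth skew_nth diag3_def axis_def)
    qed
    have cont: "continuous_on (sphere 0 1) (\<lambda>r. mat 1 + (2 * Re r * Im r) *\<^sub>R skew (axis 1 1)
        - (2 * (Im r)\<^sup>2) *\<^sub>R diag3 0 1 1)"
      by (intro continuous_intros)
    show ?thesis by (rule continuous_on_eq[OF cont]) (simp add: eq)
  qed
  hence "continuous_on (sphere 0 1) ?g"
    unfolding matrix_matrix_mult_def by (intro continuous_intros)
  hence con: "connected ?S" by (intro connected_continuous_image) (simp_all add: connected_sphere)
  have sub: "?S \<subseteq> fiber X" using fiber_rotate[OF F x(1)] by auto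
  have "?g 1 \<in> ?S" by (rule imageI) simp
  hence "(U, expdiag x) \<in> ?S" by simp
  from connected_component_maximal[OF this con sub]
  have "?S \<subseteq> fiber_component X (U, expdiag x)" unfolding fiber_component_def .
  moreover have "q \<in> ?S" using q by auto
  ultimately show "q \<in> fiber_component X (U, expdiag x)" by (rule subsetD)
qed

text \<open>The entries of a diagonal factor are eigenvalues, so coinciding entries would leave at most two
  eigenvalues.\<close>

lemma S_top_distinct:
  assumes "Y \<in> S_top" "(V, expdiag y) \<in> fiber Y"
  shows "y$1 \<noteq> y$2" "y$1 \<noteq> y$3" "y$2 \<noteq> y$3"
proof -
  have V: "V \<in> SO3" "Y = V ** expdiag y ** transpose V" using assms by (auto simp: fiber_def Mspace_def Fmap_def)
  have "eigvals Y \<subseteq> (\<lambda>i. exp (y$i)) ` UNIV"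
  proof
    fix e assume "e \<in> eigvals Y"
    then obtain v where v: "v \<noteq> 0" "Y *v v = e *\<^sub>R v" by (auto simp: eigvals_def)
    let ?w = "transpose V *v v"
    have "V *v ?w = v" by (simp only: matrix_vector_mul_assoc matrix_inv_SO3[OF V(1)] matrix_vector_mul_lid)
    hence w: "?w \<noteq> 0" using v(1) by (metis matrix_vector_mult_0_right)
    have "transpose V ** Y = expdiag y ** transpose V"
      unfolding V(2) by (simp only: matrix_mul_assoc matrix_inv_SO3[OF V(1)] matrix_mul_lid)
    hence "expdiag y *v ?w = transpose V *v (Y *v v)" by (simp only: matrix_vector_mul_assoc)
    also have "\<dots> = e *\<^sub>R ?w" by (simp only: v(2) matrix_vector_mult_scaleR)
    finally have e: "expdiag y *v ?w = e *\<^sub>R ?w" .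
    obtain i where i: "?w $ i \<noteq> 0" using w by (auto simp: vec_eq_iff)
    have "(expdiag y *v ?w) $ i = exp (y$i) * ?w$i"
      using exhaust_3[of i] by (auto simp: matrix_vector_mult_def sum_3 expdiag_nth)
    hence "e * ?w$i = exp (y$i) * ?w$i" using arg_cong[OF e, of "\<lambda>a. a$i"] by auto
    hence "e = exp (y$i)" using i by simp
    thus "e \<in> (\<lambda>i. exp (y$i)) ` UNIV" by blast
  qed
  hence "3 \<le> card ((\<lambda>i. exp (y$i)) ` UNIV)"
    using assms(1) card_mono[of "(\<lambda>i. exp (y$i)) ` UNIV" "eigvals Y"] by (simp add: S_top_def)
  hence "card ((\<lambda>i. exp (y$i)) ` UNIV) = card (UNIV :: 3 set)"
    using card_image_le[of "UNIV :: 3 set" "\<lambda>i. exp (y$i)"] by simp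
  hence inj: "inj (\<lambda>i. exp (y$i))" by (intro eq_card_imp_inj_on) auto
  thus "y$1 \<noteq> y$2" "y$1 \<noteq> y$3" "y$2 \<noteq> y$3"
    using injD[OF inj, of 1 2] injD[OF inj, of 1 3] injD[OF inj, of 2 3] by auto
qed

section \<open>The optimal angles\<close>

text \<open>The origin of the data-triples for \<open>Y\<close> with three eigenvalues: the real part of \<open>cnj r * \<xi>\<close> is extremal
  exactly when \<open>r\<close> points along \<open>\<plusminus>\<xi>\<close>.\<close>

lemma abs_Re_le_cmod_iff:
  assumes "cmod r = 1"
  shows "\<bar>Re (cnj r * \<xi>)\<bar> \<le> cmod \<xi>"
    and "\<xi> \<noteq> 0 \<Longrightarrow> \<bar>Re (cnj r * \<xi>)\<bar> = cmod \<xi> \<longleftrightarrow> r = sgn \<xi> \<or> r = - sgn \<xi>"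
proof -
  have n: "cmod (cnj r * \<xi>) = cmod \<xi>" using assms by (simp add: norm_mult)
  show "\<bar>Re (cnj r * \<xi>)\<bar> \<le> cmod \<xi>" using abs_Re_le_cmod[of "cnj r * \<xi>"] n by simp
  have rr: "r * cnj r = 1" using assms by (simp add: complex_norm_square[symmetric])
  assume nz: "\<xi> \<noteq> 0"
  have ss: "\<xi> = cmod \<xi> * sgn \<xi>" using nz by (simp add: sgn_eq)
  have s1: "sgn \<xi> * cnj (sgn \<xi>) = 1" using nz by (simp add: norm_sgn flip: complex_norm_square)
  show "\<bar>Re (cnj r * \<xi>)\<bar> = cmod \<xi> \<longleftrightarrow> r = sgn \<xi> \<or> r = - sgn \<xi>"
  proof
    assume e: "\<bar>Re (cnj r * \<xi>)\<bar> = cmod \<xi>"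
    define \<eta> where "\<eta> = cnj r * sgn \<xi>"
    have n\<eta>: "cmod \<eta> = 1" using assms nz by (simp add: \<eta>_def norm_mult norm_sgn)
    have "cnj r * \<xi> = cmod \<xi> * \<eta>" using ss by (simp add: \<eta>_def algebra_simps)
    hence "\<bar>Re \<eta>\<bar> = 1" using e nz by (simp add: abs_mult)
    hence re: "(Re \<eta>)\<^sup>2 = 1" by (metis power2_abs one_power2)
    hence "(Im \<eta>)\<^sup>2 = 0" using n\<eta> by (simp add: cmod_def)
    hence "Im \<eta> = 0" by simp
    moreover have "Re \<eta> = 1 \<or> Re \<eta> = -1" using re by (simp add: power2_eq_1_iff)
    ultimately have "\<eta> = 1 \<or> \<eta> = -1" by (auto simp: complex_eq_iff)
    moreover have "sgn \<xi> = r * \<eta>" using rr by (simp add: \<eta>_def flip: mult.assoc)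
    ultimately show "r = sgn \<xi> \<or> r = - sgn \<xi>" by auto
  next
    assume "r = sgn \<xi> \<or> r = - sgn \<xi>"
    hence "cnj r * \<xi> = cmod \<xi> \<or> cnj r * \<xi> = - cmod \<xi>"
    proof
      assume r: "r = sgn \<xi>"
      have "cnj r * \<xi> = cmod \<xi> * (sgn \<xi> * cnj (sgn \<xi>))" by (subst ss) (simp add: r mult_ac)
      thus ?thesis using s1 by simp
    next
      assume r: "r = - sgn \<xi>"
      have "cnj r * \<xi> = - (cmod \<xi> * (sgn \<xi> * cnj (sgn \<xi>)))" by (subst ss) (simp add: r mult_ac)
      thus ?thesis using s1 by simp
    qed
    thus "\<bar>Re (cnj r * \<xi>)\<bar> = cmod \<xi>"
      by (elim disjE) (simp_all only: Re_complex_of_real uminus_complex.sel abs_minus_cancel abs_norm_cancel)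
  qed
qed

lemma arccos_half:
  assumes "0 \<le> c" "c \<le> 1"
  shows "arccos (2 * c\<^sup>2 - 1) / 2 = arccos c"
proof -
  have b: "0 \<le> arccos c" "arccos c \<le> pi / 2" using assms arccos_lbound arccos_le_pi2 by auto
  have "cos (2 * arccos c) = 2 * c\<^sup>2 - 1" using assms by (simp add: cos_double_cos)
  hence "arccos (2 * c\<^sup>2 - 1) = 2 * arccos c" using b by (metis arccos_cos mult_left_mono mult_nonneg_nonneg
      field_sum_of_halves mult_2 add_mono zero_le_numeral)
  thus ?thesis by simp
qed

text \<open>The length is a strictly decreasing function of the cosine of half the rotation angle.\<close>

lemma cost_le:
  assumes k: "k > 0" and c: "0 \<le> \<rho>" "\<rho> \<le> c" "c \<le> (1::real)"
  shows "sqrt (4 * k * (arccos c)\<^sup>2 + n) \<le> sqrt (4 * k * (arccos \<rho>)\<^sup>2 + n)"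
    and "sqrt (4 * k * (arccos \<rho>)\<^sup>2 + n) = sqrt (4 * k * (arccos c)\<^sup>2 + n) \<longleftrightarrow> \<rho> = c"
proof -
  have "0 \<le> arccos c" using c by (intro arccos_lbound) auto
  moreover have "arccos c \<le> arccos \<rho>" using c by (intro arccos_le_arccos) auto
  ultimately have "(arccos c)\<^sup>2 \<le> (arccos \<rho>)\<^sup>2" by (intro power_mono)
  thus "sqrt (4 * k * (arccos c)\<^sup>2 + n) \<le> sqrt (4 * k * (arccos \<rho>)\<^sup>2 + n)" using k by simp
  have "arccos \<rho> = arccos c" if "(arccos \<rho>)\<^sup>2 = (arccos c)\<^sup>2"
    using that c \<open>0 \<le> arccos c\<close> \<open>arccos c \<le> arccos \<rho>\<close> by (auto simp: power2_eq_iff)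
  moreover have "\<rho> = c" if "arccos \<rho> = arccos c"
    using that c by (metis cos_arccos order_trans neg_le_0_iff_le zero_le_one)
  ultimately show "sqrt (4 * k * (arccos \<rho>)\<^sup>2 + n) = sqrt (4 * k * (arccos c)\<^sup>2 + n) \<longleftrightarrow> \<rho> = c"
    using k by auto
qed

lemma cmod_sum_square: "(cmod (a + b))\<^sup>2 = (cmod a)\<^sup>2 + (cmod b)\<^sup>2 + 2 * Re (cnj a * b)"
  by (simp add: cmod_power2) (simp add: power2_eq_square algebra_simps)

context
  fixes z w :: complex
  assumes zw: "(cmod z)\<^sup>2 + (cmod w)\<^sup>2 = 1"
begin

lemma max_cmod_bounds: "0 < max (cmod z) (cmod w)" "max (cmod z) (cmod w) \<le> 1"
proof -
  have "(cmod z)\<^sup>2 \<le> 1" "(cmod w)\<^sup>2 \<le> 1" using zw by (smt (verit) zero_le_power2)+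
  thus "max (cmod z) (cmod w) \<le> 1" by (simp add: power_le_one_iff abs_square_le_1)
  have "z \<noteq> 0 \<or> w \<noteq> 0" using zw by auto
  thus "0 < max (cmod z) (cmod w)" by (auto simp: max_def)
qed

lemma cmod_pm:
  "(cmod (z + w))\<^sup>2 = 1 + 2 * Re (cnj z * w)" "(cmod (z - w))\<^sup>2 = 1 - 2 * Re (cnj z * w)"
  "(cmod (z - \<i> * w))\<^sup>2 = 1 + 2 * Im (cnj z * w)" "(cmod (z + \<i> * w))\<^sup>2 = 1 - 2 * Im (cnj z * w)"
  using zw cmod_sum_square[of z w] cmod_sum_square[of z "- w"] cmod_sum_square[of z "- (\<i> * w)"]
    cmod_sum_square[of z "\<i> * w"]
  by (simp_all add: norm_mult algebra_simps)

text \<open>The half-angle formula turns the arc cosine of twice a real or imaginary part into the arc cosine of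
  the larger of two moduli, as \<open>2 * c\<^sup>2 - 1 = 2 * \<bar>t\<bar>\<close> for \<open>c\<close> the larger modulus over \<open>sqrt 2\<close>.\<close>

lemma max_pm:
  assumes "(cmod a)\<^sup>2 = 1 + 2 * t" "(cmod b)\<^sup>2 = 1 - 2 * t"
  shows "arccos (2 * \<bar>t\<bar>) / 2 = arccos (max (cmod a) (cmod b) / sqrt 2)"
    "max (cmod a) (cmod b) / sqrt 2 \<le> 1" "max (cmod a) (cmod b) > 0"
    "cmod a \<ge> cmod b \<longleftrightarrow> t \<ge> 0" "cmod b \<ge> cmod a \<longleftrightarrow> t \<le> 0"
proof -
  show o: "cmod a \<ge> cmod b \<longleftrightarrow> t \<ge> 0" "cmod b \<ge> cmod a \<longleftrightarrow> t \<le> 0"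
    using assms abs_le_square_iff[of "cmod a" "cmod b"] abs_le_square_iff[of "cmod b" "cmod a"] by auto
  have m: "(max (cmod a) (cmod b))\<^sup>2 = 1 + 2 * \<bar>t\<bar>" using assms o by (auto simp: max_def abs_if)
  have t: "\<bar>2 * t\<bar> \<le> 1" using assms zero_le_power2[of "cmod a"] zero_le_power2[of "cmod b"] by simp
  let ?c = "max (cmod a) (cmod b) / sqrt 2"
  have c2: "?c\<^sup>2 = (1 + 2 * \<bar>t\<bar>) / 2" by (simp add: power_divide m)
  show c1: "?c \<le> 1"
  proof (rule power2_le_imp_le)
    show "?c\<^sup>2 \<le> 1\<^sup>2" unfolding c2 using t by auto
  qed simp
  have "2 * ?c\<^sup>2 - 1 = 2 * \<bar>t\<bar>" unfolding c2 by (simp add: field_simps)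
  thus "arccos (2 * \<bar>t\<bar>) / 2 = arccos ?c" using arccos_half[of ?c] c1 by (simp add: le_max_iff_disj)
  show "max (cmod a) (cmod b) > 0"
  proof (rule ccontr)
    assume "\<not> max (cmod a) (cmod b) > 0"
    hence "max (cmod a) (cmod b) = 0" by (smt (verit) norm_ge_zero)
    thus False using m by simp
  qed
qed

lemma angle_13_eq: "angle_13 z w = arccos (max (cmod (z + w)) (cmod (z - w)) / sqrt 2)"
  unfolding angle_13_def by (rule max_pm(1)) (rule cmod_pm)+

lemma angle_12_eq: "angle_12 z w = arccos (max (cmod (z - \<i> * w)) (cmod (z + \<i> * w)) / sqrt 2)"
  unfolding angle_12_def by (rule max_pm(1)) (rule cmod_pm)+

text \<open>With \<open>max (cmod z) (cmod w) = cos \<phi>\<close> and \<open>min (cmod z) (cmod w) = sin \<phi>\<close> this is the addition theorem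
  for \<open>cos (\<pi> / 4 - \<phi>)\<close>; both sides lie in the range of the arc cosine because \<open>\<phi> \<le> \<pi> / 4\<close>.\<close>

lemma angle_13_mid_eq:
  "pi / 4 - angle_id z w = arccos ((cmod z + cmod w) / sqrt 2)" "(cmod z + cmod w) / sqrt 2 \<le> 1"
proof -
  let ?m = "max (cmod z) (cmod w)" and ?n = "min (cmod z) (cmod w)"
  have mn: "?m\<^sup>2 + ?n\<^sup>2 = 1" using zw by (auto simp: max_def min_def)
  have n: "0 \<le> ?n" "?n \<le> ?m" by (auto simp: max_def min_def)
  let ?\<phi> = "arccos ?m"
  have c: "cos ?\<phi> = ?m" using max_cmod_bounds by simp
  have s: "sin ?\<phi> = ?n"
    using max_cmod_bounds mn n(1) by (simp add: sin_arccos real_sqrt_unique)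
  have "(1 / sqrt 2)\<^sup>2 \<le> ?m\<^sup>2" using mn power_mono[OF n(2) n(1), of 2] by (simp add: power_divide)
  hence "1 / sqrt 2 \<le> ?m" using max_cmod_bounds(1) by (simp add: abs_le_square_iff[symmetric])
  moreover have "- 1 \<le> 1 / sqrt 2" by (rule order.trans[of _ 0]) simp_all
  ultimately have "?\<phi> \<le> arccos (1 / sqrt 2)" using max_cmod_bounds by (intro arccos_le_arccos) auto
  also have "arccos (1 / sqrt 2) = pi / 4"
  proof -
    have "cos (pi / 4) = 1 / sqrt 2" unfolding cos_45 by (simp add: field_simps)
    thus ?thesis using arccos_cos[of "pi / 4"] by simp
  qed
  finally have \<phi>: "?\<phi> \<le> pi / 4" .
  have \<phi>0: "0 \<le> ?\<phi>" using max_cmod_bounds by (intro arccos_lbound) auto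
  have "cos (pi / 4 - ?\<phi>) = (?m + ?n) * (sqrt 2 / 2)"
    by (simp add: cos_diff c s cos_45 sin_45 algebra_simps)
  also have "?m + ?n = cmod z + cmod w" by (auto simp: max_def min_def)
  also have "(cmod z + cmod w) * (sqrt 2 / 2) = (cmod z + cmod w) / sqrt 2"
    by (simp add: field_simps)
  finally have C: "cos (pi / 4 - ?\<phi>) = (cmod z + cmod w) / sqrt 2" .
  show "pi / 4 - angle_id z w = arccos ((cmod z + cmod w) / sqrt 2)"
    unfolding angle_id_def C[symmetric] using \<phi> \<phi>0 pi_gt_zero by (intro arccos_cos[symmetric]) auto
  show "(cmod z + cmod w) / sqrt 2 \<le> 1" unfolding C[symmetric] by simp
qed

end

lemma qinner_zeta:
  "qinner 1 (quat_zw a b) = Re a" "qinner unit_j (quat_zw a b) = Re b"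
  "qinner zeta_jp (quat_zw a b) = (Re a + Re b) / sqrt 2" "qinner zeta_jm (quat_zw a b) = (Re a - Re b) / sqrt 2"
  "qinner zeta_kp (quat_zw a b) = (Re a + Im b) / sqrt 2" "qinner zeta_km (quat_zw a b) = (Re a - Im b) / sqrt 2"
  by (simp_all add: qinner_def quat_zw_eq one_quat_def unit_j_def zeta_jp_def zeta_jm_def zeta_kp_def
      zeta_km_def add_divide_distrib diff_divide_distrib)

text \<open>\<open>overlap z w (\<zeta>, r, s)\<close> is the scalar product of the quaternion lifts of the two rotations that
  a data-triple determines, so its absolute value is the cosine of half the rotation angle.\<close>

definition overlap :: "complex \<Rightarrow> complex \<Rightarrow> triple \<Rightarrow> real" where
  "overlap z w = (\<lambda>(\<zeta>, r, s). qinner \<zeta> (quat_zw (cnj r * z * s) (cnj r * w * cnj s)))"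

text \<open>The largest value of \<open>\<bar>overlap\<bar>\<close> over the triples with the quaternion of the class. It makes sense also
  where the class is undefined, which allows all classes to compete for the minimal length.\<close>

definition best :: "complex \<Rightarrow> complex \<Rightarrow> label \<Rightarrow> real" where
  "best z w l = (case l of A1 \<Rightarrow> cmod z | A2 \<Rightarrow> cmod w | B1 \<Rightarrow> cmod (z + w) / sqrt 2
     | B2 \<Rightarrow> cmod (z - w) / sqrt 2 | C1 \<Rightarrow> cmod (z - \<i> * w) / sqrt 2 | C2 \<Rightarrow> cmod (z + \<i> * w) / sqrt 2
     | A1' \<Rightarrow> cmod z | A2' \<Rightarrow> cmod w | B' \<Rightarrow> (cmod z + cmod w) / sqrt 2 | C' \<Rightarrow> (cmod z + cmod w) / sqrt 2)"

definition label_zeta :: "label \<Rightarrow> quat" where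
  "label_zeta l = (case l of A1 \<Rightarrow> 1 | A2 \<Rightarrow> unit_j | B1 \<Rightarrow> zeta_jp | B2 \<Rightarrow> zeta_jm
     | C1 \<Rightarrow> zeta_kp | C2 \<Rightarrow> zeta_km | A1' \<Rightarrow> 1 | A2' \<Rightarrow> unit_j | B' \<Rightarrow> zeta_jp | C' \<Rightarrow> zeta_jp)"

text \<open>Each overlap is the real part of \<open>cnj r\<close> times one of the six complex numbers that define the classes.\<close>

lemma overlap_top_le:
  assumes r: "cmod r = 1" and l: "l \<in> top_classes"
  shows "\<bar>overlap z w (label_zeta l, r, 1)\<bar> \<le> best z w l"
    and "class_defined z w l \<Longrightarrow>
      \<bar>overlap z w (label_zeta l, r, 1)\<bar> = best z w l \<longleftrightarrow> (label_zeta l, r, 1) \<in> triples z w l"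
proof -
  note a = abs_Re_le_cmod_iff[OF r]
  have 1: "overlap z w (1, r, 1) = Re (cnj r * z)" "overlap z w (unit_j, r, 1) = Re (cnj r * w)"
    "overlap z w (zeta_jp, r, 1) = Re (cnj r * (z + w)) / sqrt 2"
    "overlap z w (zeta_jm, r, 1) = Re (cnj r * (z - w)) / sqrt 2"
    "overlap z w (zeta_kp, r, 1) = Re (cnj r * (z - \<i> * w)) / sqrt 2"
    "overlap z w (zeta_km, r, 1) = Re (cnj r * (z + \<i> * w)) / sqrt 2"
    by (simp_all add: overlap_def qinner_zeta algebra_simps)
  have d: "x / sqrt 2 \<le> y / sqrt 2 \<longleftrightarrow> x \<le> y" "x / sqrt 2 = y / sqrt 2 \<longleftrightarrow> x = y" for x y :: real
    by (simp_all add: divide_le_cancel)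
  have s2: "\<bar>sqrt 2 :: real\<bar> = sqrt 2" by simp
  show "\<bar>overlap z w (label_zeta l, r, 1)\<bar> \<le> best z w l"
    using l a(1)[of z] a(1)[of w] a(1)[of "z + w"] a(1)[of "z - w"] a(1)[of "z - \<i> * w"] a(1)[of "z + \<i> * w"]
    unfolding top_classes_def by (elim insertE; simp only: label_zeta_def best_def label.case 1 abs_divide; simp add: d)
  show "\<bar>overlap z w (label_zeta l, r, 1)\<bar> = best z w l \<longleftrightarrow> (label_zeta l, r, 1) \<in> triples z w l"
    if c: "class_defined z w l"
  proof -
    have t: "(\<zeta>, r, 1) \<in> {(\<zeta>, s * \<xi>, 1) | s. s \<in> {1, -1}} \<longleftrightarrow> r = \<xi> \<or> r = - \<xi>" for \<zeta> :: quat and \<xi> :: complex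
      by (auto intro: exI[of _ "-1"])
    show ?thesis
      using l c unfolding top_classes_def triples_def if_P[OF c]
      by (elim insertE; simp only: label_zeta_def best_def label.case 1 abs_divide d s2
          class_defined.simps class_triples.simps t a(2) empty_iff)
  qed
qed

lemma Re_eq_cmod_iff:
  assumes "cmod r = 1" "\<xi> \<noteq> 0"
  shows "Re (cnj r * \<xi>) = cmod \<xi> \<longleftrightarrow> r = sgn \<xi>" "Re (cnj r * \<xi>) = - cmod \<xi> \<longleftrightarrow> r = - sgn \<xi>"
proof -
  have s: "Re (cnj (sgn \<xi>) * \<xi>) = cmod \<xi>"
  proof -
    have "\<xi> = cmod \<xi> * sgn \<xi>" using assms by (simp add: sgn_eq)
    hence "cnj (sgn \<xi>) * \<xi> = cmod \<xi> * (sgn \<xi> * cnj (sgn \<xi>))" by (metis mult.commute mult.left_commute)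
    also have "sgn \<xi> * cnj (sgn \<xi>) = 1" using assms by (simp add: norm_sgn flip: complex_norm_square)
    finally show ?thesis by (simp only: mult_1_right Re_complex_of_real)
  qed
  have m: "Re (cnj (- sgn \<xi>) * \<xi>) = - cmod \<xi>" using s by (simp only: complex_cnj_minus mult_minus_left uminus_complex.sel)
  note a = abs_Re_le_cmod_iff(2)[OF assms]
  have p: "cmod \<xi> > 0" using assms by simp
  show "Re (cnj r * \<xi>) = cmod \<xi> \<longleftrightarrow> r = sgn \<xi>"
  proof
    assume e: "Re (cnj r * \<xi>) = cmod \<xi>"
    hence "r = sgn \<xi> \<or> r = - sgn \<xi>" using a p by linarith
    thus "r = sgn \<xi>" using e m p by (metis less_irrefl neg_less_0_iff_less order_less_trans)
  qed (use s in simp)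
  show "Re (cnj r * \<xi>) = - cmod \<xi> \<longleftrightarrow> r = - sgn \<xi>"
  proof
    assume e: "Re (cnj r * \<xi>) = - cmod \<xi>"
    hence "r = sgn \<xi> \<or> r = - sgn \<xi>" using a p by linarith
    thus "r = - sgn \<xi>" using e s p by (metis less_irrefl neg_less_0_iff_less order_less_trans)
  qed (use m in simp)
qed

lemma unit_cnj_cancel:
  assumes "cmod r = 1"
  shows "r * cnj r = 1" "cnj r * r = 1" "r * (cnj r * c) = c" "cnj r * (r * c) = c"
proof -
  show a: "r * cnj r = 1" using assms by (simp flip: complex_norm_square)
  thus b: "cnj r * r = 1" by (simp add: mult.commute)
  show "r * (cnj r * c) = c" "cnj r * (r * c) = c" by (simp_all add: a b flip: mult.assoc)
qed

lemma sgn_unit: "cmod (r::complex) = 1 \<Longrightarrow> sgn r = r"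
  by (simp add: sgn_eq)

lemma common_sign:
  fixes a b c :: complex
  assumes "(a = b \<and> a = c) \<or> (a = - b \<and> a = - c)"
  shows "\<exists>\<sigma>. (\<sigma> = 1 \<or> \<sigma> = -1) \<and> a = \<sigma> * b \<and> a = \<sigma> * c"
  using assms by (metis mult_1 mult_minus1)

text \<open>For \<open>\<zeta> = 1\<close> or \<open>j\<close> a single real part is to be maximised. For \<open>\<zeta> = zeta_jp\<close> there is a sum of two real
  parts, and the bound \<open>cmod z + cmod w\<close> is attained only if both are extremal with the same sign. This
  fixes \<open>r * cnj s\<close> and \<open>r * s\<close> up to a common sign, whence the square roots in the triples; if \<open>z\<close> or \<open>w\<close> is
  zero, one of the two conditions disappears and a circle of solutions remains.\<close>

lemma overlap_mid_le:
  assumes r: "cmod r = 1" and s: "cmod s = 1" and l: "l \<in> mid_classes"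
  shows "\<bar>overlap z w (label_zeta l, r, s)\<bar> \<le> best z w l"
    and "\<lbrakk>class_defined z w l; (cmod z)\<^sup>2 + (cmod w)\<^sup>2 = 1\<rbrakk> \<Longrightarrow>
      \<bar>overlap z w (label_zeta l, r, s)\<bar> = best z w l \<longleftrightarrow> (label_zeta l, r, s) \<in> triples z w l"
proof -
  let ?p = "Re (cnj r * (z * s))" and ?q = "Re (cnj r * (w * cnj s))"
  have n: "cmod (z * s) = cmod z" "cmod (w * cnj s) = cmod w" using s by (simp_all add: norm_mult)
  have pq: "\<bar>?p\<bar> \<le> cmod z" "\<bar>?q\<bar> \<le> cmod w"
    using abs_Re_le_cmod_iff(1)[OF r, of "z * s"] abs_Re_le_cmod_iff(1)[OF r, of "w * cnj s"] n by simp_all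
  have 1: "overlap z w (1, r, s) = ?p" "overlap z w (unit_j, r, s) = ?q"
    "overlap z w (zeta_jp, r, s) = (?p + ?q) / sqrt 2"
    by (simp_all add: overlap_def qinner_zeta mult.assoc)
  have d: "x / sqrt 2 \<le> y / sqrt 2 \<longleftrightarrow> x \<le> y" "x / sqrt 2 = y / sqrt 2 \<longleftrightarrow> x = y" "\<bar>x / sqrt 2\<bar> = \<bar>x\<bar> / sqrt 2" for x y :: real
    by (simp_all add: divide_le_cancel)
  show "\<bar>overlap z w (label_zeta l, r, s)\<bar> \<le> best z w l"
  proof -
    have "\<bar>?p + ?q\<bar> \<le> cmod z + cmod w" using pq by linarith
    thus ?thesis
      using l pq unfolding mid_classes_def
      by (elim insertE; simp only: label_zeta_def best_def label.case 1 d empty_iff)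
  qed
  assume c: "class_defined z w l" and zw: "(cmod z)\<^sup>2 + (cmod w)\<^sup>2 = 1"
  note rc = unit_cnj_cancel[OF r] and sc = unit_cnj_cancel[OF s]
  have sg: "sgn (z * s) = sgn z * s" "sgn (w * cnj s) = sgn w * cnj s"
    using s by (simp_all add: sgn_mult sgn_unit)
  have zc: "z \<noteq> 0 \<Longrightarrow> cmod (sgn z) = 1" and wc: "w \<noteq> 0 \<Longrightarrow> cmod (sgn w) = 1" by (simp_all add: norm_sgn)
  note P = Re_eq_cmod_iff[OF r, of "z * s", unfolded n sg] and Q = Re_eq_cmod_iff[OF r, of "w * cnj s", unfolded n sg]
  have s0: "s \<noteq> 0" using s by auto
  have P': "\<bar>?p\<bar> = cmod z \<longleftrightarrow> r = sgn z * s \<or> r = - (sgn z * s)" if "z \<noteq> 0"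
    using abs_Re_le_cmod_iff(2)[OF r, of "z * s"] that s0 n sg by simp
  have Q': "\<bar>?q\<bar> = cmod w \<longleftrightarrow> r = sgn w * cnj s \<or> r = - (sgn w * cnj s)" if "w \<noteq> 0"
    using abs_Re_le_cmod_iff(2)[OF r, of "w * cnj s"] that s0 n sg by simp
  have eqs: "r = \<sigma> * (c * s) \<longleftrightarrow> s = \<sigma> * r * cnj c" if "\<sigma> = 1 \<or> \<sigma> = -1" "cmod c = 1" for \<sigma> c :: complex
  proof -
    note cc = unit_cnj_cancel[OF that(2)]
    have ss: "\<sigma> * (\<sigma> * a) = a" for a using that(1) by auto
    show ?thesis by (metis (no_types, opaque_lifting) cc(3,4) mult.commute mult.left_commute ss)
  qed
  have eqs': "r = \<sigma> * (c * cnj s) \<longleftrightarrow> s = \<sigma> * cnj r * c" if "\<sigma> = 1 \<or> \<sigma> = -1" for \<sigma> c :: complex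
  proof -
    have ss: "\<sigma> * (\<sigma> * a) = a" for a using that(1) by auto
    have "r = \<sigma> * (c * cnj s) \<longleftrightarrow> r * s = \<sigma> * c"
      by (metis (no_types, opaque_lifting) sc(1,2) mult.assoc mult_1_right)
    also have "\<dots> \<longleftrightarrow> s = \<sigma> * cnj r * c"
      by (metis (no_types, opaque_lifting) rc(3,4) mult.commute mult.left_commute)
    finally show ?thesis .
  qed
  have tA: "(\<zeta>, r, s) \<in> {(\<zeta>, r, s * f r * c) | r s. cmod r = 1 \<and> s \<in> {1, -1}} \<longleftrightarrow>
      s = 1 * f r * c \<or> s = (-1) * f r * c" for \<zeta> :: quat and f and c :: complex
    using r by blast
  have or1: "r = a \<or> r = - a \<longleftrightarrow> r = 1 * a \<or> r = (-1) * a" for a by simp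
  have A1: "\<bar>?p\<bar> = cmod z \<longleftrightarrow> (1, r, s) \<in> triples z w A1'" if "z \<noteq> 0"
    unfolding P'[OF that] or1 triples_def class_defined.simps class_triples.simps if_P[OF that]
    using tA[of 1 "\<lambda>r. r" "cnj (sgn z)"] eqs[of 1 "sgn z"] eqs[of "-1" "sgn z"] zc[OF that] by simp
  have A2: "\<bar>?q\<bar> = cmod w \<longleftrightarrow> (unit_j, r, s) \<in> triples z w A2'" if "w \<noteq> 0"
    unfolding Q'[OF that] or1 triples_def class_defined.simps class_triples.simps if_P[OF that]
    using tA[of unit_j cnj "sgn w"] eqs'[of 1 "sgn w"] eqs'[of "-1" "sgn w"] by simp
  have B: "\<bar>?p + ?q\<bar> = cmod z + cmod w \<longleftrightarrow> (zeta_jp, r, s) \<in> triples z w B'" if nz: "z \<noteq> 0" "w \<noteq> 0"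
  proof -
    have "\<bar>?p + ?q\<bar> = cmod z + cmod w \<longleftrightarrow> (?p = cmod z \<and> ?q = cmod w) \<or> (?p = - cmod z \<and> ?q = - cmod w)"
      using pq by (smt (verit))
    also have "\<dots> \<longleftrightarrow> (r = sgn z * s \<and> r = sgn w * cnj s) \<or> (r = - (sgn z * s) \<and> r = - (sgn w * cnj s))"
      using P Q nz s0 by simp
    also have "\<dots> \<longleftrightarrow> r\<^sup>2 = sgn w * sgn z \<and> s\<^sup>2 = sgn w * cnj (sgn z)"
    proof
      note zz = unit_cnj_cancel[OF zc[OF nz(1)]]
      assume "(r = sgn z * s \<and> r = sgn w * cnj s) \<or> (r = - (sgn z * s) \<and> r = - (sgn w * cnj s))"
      hence "\<exists>\<sigma>::complex. (\<sigma> = 1 \<or> \<sigma> = -1) \<and> r = \<sigma> * (sgn z * s) \<and> r = \<sigma> * (sgn w * cnj s)"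
        by (rule common_sign)
      then obtain \<sigma> :: complex where \<sigma>: "\<sigma> = 1 \<or> \<sigma> = -1" "r = \<sigma> * (sgn z * s)" "r = \<sigma> * (sgn w * cnj s)"
        by (elim exE conjE)
      have "r * r = \<sigma> * (sgn z * s) * (\<sigma> * (sgn w * cnj s))" using \<sigma> by metis
      also have "\<dots> = (\<sigma> * \<sigma>) * (sgn w * sgn z) * (s * cnj s)" by (simp only: mult_ac)
      finally have 1: "r\<^sup>2 = sgn w * sgn z" using \<sigma>(1) sc(1) by (auto simp: power2_eq_square)
      have "sgn z * s = sgn w * cnj s" using \<sigma> by auto
      hence "cnj (sgn z) * (sgn z * s) * s = cnj (sgn z) * (sgn w * cnj s) * s" by simp
      hence "s\<^sup>2 = cnj (sgn z) * sgn w * (cnj s * s)" by (simp add: zz power2_eq_square mult.assoc)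
      thus "r\<^sup>2 = sgn w * sgn z \<and> s\<^sup>2 = sgn w * cnj (sgn z)" using 1 sc(2) by (simp add: mult.commute)
    next
      note zz = unit_cnj_cancel[OF zc[OF nz(1)]] and ww = unit_cnj_cancel[OF wc[OF nz(2)]]
      assume rs: "r\<^sup>2 = sgn w * sgn z \<and> s\<^sup>2 = sgn w * cnj (sgn z)"
      have "(sgn z * s)\<^sup>2 = sgn w * sgn z * (sgn z * cnj (sgn z))"
        using rs by (simp add: power_mult_distrib power2_eq_square mult_ac)
      hence "(sgn z * s)\<^sup>2 = r\<^sup>2" using rs zz(1) by simp
      then obtain \<sigma> :: complex where \<sigma>: "\<sigma> = 1 \<or> \<sigma> = -1" "r = \<sigma> * (sgn z * s)"
        by (metis mult_1 mult_minus1 power2_eq_iff minus_minus)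
      have "sgn z * (\<sigma> * (r * s)) = r\<^sup>2" using \<sigma> by (simp add: power2_eq_square mult_ac)
      hence "cnj (sgn z) * (sgn z * (\<sigma> * (r * s))) = cnj (sgn z) * (sgn z * sgn w)" using rs by (simp add: mult.commute)
      hence "\<sigma> * (r * s) = sgn w" by (simp only: zz)
      have "r = (\<sigma> * \<sigma>) * r * (s * cnj s)" using \<sigma>(1) sc(1) by auto
      also have "\<dots> = \<sigma> * ((\<sigma> * (r * s)) * cnj s)" by (simp only: mult_ac)
      finally have "r = \<sigma> * (sgn w * cnj s)" by (simp only: \<open>\<sigma> * (r * s) = sgn w\<close>)
      thus "(r = sgn z * s \<and> r = sgn w * cnj s) \<or> (r = - (sgn z * s) \<and> r = - (sgn w * cnj s))"
        using \<sigma> by auto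
    qed
    finally show ?thesis using nz by (simp add: triples_def)
  qed
  have C: "\<bar>?p + ?q\<bar> = cmod z + cmod w \<longleftrightarrow> (zeta_jp, r, s) \<in> triples z w C'" if wz: "w = 0 \<or> z = 0"
  proof (cases "w = 0")
    case True
    hence z1: "cmod z = 1" using zw by (simp add: power2_eq_1_iff) (smt (verit) norm_ge_zero)
    hence z: "z \<noteq> 0" "sgn z = z" "cmod (cnj z) = 1" by (auto simp: sgn_unit)
    have ca: "a = \<sigma> * cnj z * b \<longleftrightarrow> a * cnj b = \<sigma> * cnj z" if "cmod b = 1" for a b \<sigma> :: complex
      using unit_cnj_cancel[OF that] by (metis (no_types, opaque_lifting) mult.assoc mult_1_right)
    have "\<bar>?p + ?q\<bar> = cmod z + cmod w \<longleftrightarrow> r = z * s \<or> r = - (z * s)"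
      using True P'[OF z(1)] z by simp
    also have "\<dots> \<longleftrightarrow> s = 1 * r * cnj z \<or> s = (-1) * r * cnj z"
      using eqs[of 1 z] eqs[of "-1" z] z1 by simp
    also have "\<dots> \<longleftrightarrow> s = 1 * cnj z * r \<or> s = (-1) * cnj z * r" by (simp only: mult_ac)
    also have "\<dots> \<longleftrightarrow> s * cnj r = cnj z \<or> s * cnj r = - cnj z" unfolding ca[OF r] by simp
    finally show ?thesis using True z r s by (simp add: triples_def)
  next
    case False
    hence z: "z = 0" using wz by simp
    hence w1: "cmod w = 1" using zw by (simp add: power2_eq_1_iff) (smt (verit) norm_ge_zero)
    have "\<bar>?p + ?q\<bar> = cmod z + cmod w \<longleftrightarrow> r = w * cnj s \<or> r = - (w * cnj s)"
      using z Q'[OF False] sgn_unit[OF w1] by simp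
    also have "\<dots> \<longleftrightarrow> s = 1 * cnj r * w \<or> s = (-1) * cnj r * w"
      using eqs'[of 1 w] eqs'[of "-1" w] by simp
    also have "\<dots> \<longleftrightarrow> s * r = 1 * w \<or> s * r = (-1) * w"
    proof -
      have "s = \<sigma> * cnj r * w \<longleftrightarrow> s * r = \<sigma> * w" for \<sigma>
      proof
        assume "s = \<sigma> * cnj r * w"
        hence "s * r = \<sigma> * w * (cnj r * r)" by (simp only: mult_ac)
        thus "s * r = \<sigma> * w" by (simp only: rc mult_1_right)
      next
        assume "s * r = \<sigma> * w"
        hence "s * r * cnj r = \<sigma> * w * cnj r" by simp
        thus "s = \<sigma> * cnj r * w" by (simp only: mult.assoc rc mult_1_right) (simp only: mult_ac)
      qed
      thus ?thesis by (simp only:)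
    qed
    also have "\<dots> \<longleftrightarrow> s * r = w \<or> s * r = - w" by simp
    finally show ?thesis using z False r s by (simp add: triples_def)
  qed
  show "\<bar>overlap z w (label_zeta l, r, s)\<bar> = best z w l \<longleftrightarrow> (label_zeta l, r, s) \<in> triples z w l"
    using l c A1 A2 B C unfolding mid_classes_def
    by (elim insertE; simp only: label_zeta_def best_def label.case 1 d class_defined.simps empty_iff simp_thms)
qed

section \<open>Minimal pairs and minimal curves\<close>

lemma of_complex_zw: "of_complex r = quat_zw r 0"
  by (simp add: of_complex_def quat_zw_eq)

lemma minimal_pair_dM:
  assumes k: "k > 0" and p: "p = (phi g, expdiag x)" "g \<in> unit_quats" and q: "q = (phi h, expdiag y)" "h \<in> unit_quats"
    and nz: "qinner g h \<noteq> 0" and F: "p \<in> fiber X" "q \<in> fiber Y" and d: "dM k p q = dSR k X Y"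
  shows "minimal_pair k X Y p q"
  unfolding minimal_pair_def
  using F geodesic_garc[OF p(2) q(2) nz k, of x y] garc_0[OF p(2) q(2) nz k] garc_1[OF p(2) q(2) nz k] d p q
  by (intro conjI exI[of _ "garc g x h y"]) auto

text \<open>The given points of the two fibers in quaternion and logarithmic coordinates.\<close>

locale eigen_pair =
  fixes k :: real and X Y :: mat3 and u v :: quat and x y :: "real^3" and z w :: complex
  assumes k: "k > 0" and u: "u \<in> unit_quats" and zw: "(cmod z)\<^sup>2 + (cmod w)\<^sup>2 = 1"
    and v: "v = u * quat_zw z w"
    and x: "x$2 = x$3" "x$1 \<noteq> x$2"
    and FX: "(phi u, expdiag x) \<in> fiber X" and FY: "(phi v, expdiag y) \<in> fiber Y"
begin

lemma v_unit: "v \<in> unit_quats"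
  using u zw by (simp add: v)

abbreviation (input) "fp \<equiv> first_point (phi u) (expdiag x)"
abbreviation (input) "sp \<equiv> second_point (phi v) (expdiag y)"
abbreviation (input) "curves \<equiv> triple_curves k (phi u) (expdiag x) (phi v) (expdiag y)"

definition zperm :: "quat \<Rightarrow> real^3" where
  "zperm \<zeta> = perm_vec (mat_perm (phi \<zeta>)) y"

definition fquat :: "triple \<Rightarrow> quat" where
  "fquat = (\<lambda>(\<zeta>, r, s). u * of_complex r)"

definition squat :: "triple \<Rightarrow> quat" where
  "squat = (\<lambda>(\<zeta>, r, s). v * of_complex s * qcnj \<zeta>)"

definition admissible :: "triple \<Rightarrow> bool" where
  "admissible = (\<lambda>(\<zeta>, r, s). \<zeta> \<in> zetas_top \<and> cmod r = 1 \<and> cmod s = 1)"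

lemma fquat_unit: "admissible \<tau> \<Longrightarrow> fquat \<tau> \<in> unit_quats"
  and squat_unit: "admissible \<tau> \<Longrightarrow> squat \<tau> \<in> unit_quats"
  using u v_unit unit_zetas by (auto simp: admissible_def fquat_def squat_def)

lemma first_point_eq: "fp \<tau> = (phi (fquat \<tau>), expdiag x)"
  by (cases \<tau>) (simp add: first_point_def fquat_def phi_mult)

lemma second_point_eq:
  "admissible \<tau> \<Longrightarrow> sp \<tau> = (phi (squat \<tau>), expdiag (zperm (fst \<tau>)))"
  using unit_zetas by (cases \<tau>)
    (auto simp: second_point_def squat_def phi_mult matrix_inv_phi admissible_def perm_act_expdiag zperm_def)

text \<open>Right and left translations preserve the scalar product, so the base quaternion \<open>u\<close> cancels and \<open>\<zeta>\<close>
  passes to the other side.\<close>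

lemma qinner_overlap:
  assumes "admissible \<tau>"
  shows "qinner (fquat \<tau>) (squat \<tau>) = overlap z w \<tau>"
proof -
  obtain \<zeta> r s where \<tau>: "\<tau> = (\<zeta>, r, s)" "\<zeta> \<in> unit_quats" "cmod r = 1"
    using assms unit_zetas by (cases \<tau>) (auto simp: admissible_def)
  let ?q = "quat_zw z w" and ?r = "of_complex r" and ?s = "of_complex s"
  have "qinner (fquat \<tau>) (squat \<tau>) = qinner (u * ?r) (u * (?q * ?s * qcnj \<zeta>))"
    by (simp add: \<tau> fquat_def squat_def) (simp add: v mult.assoc)
  also have "\<dots> = qinner (qcnj ?r * ?r) (qcnj ?r * (?q * ?s * qcnj \<zeta>))"
    using u \<tau> by (simp add: qinner_translate_unit)
  also have "\<dots> = qinner (1 * \<zeta>) (qcnj ?r * (?q * ?s * qcnj \<zeta>) * \<zeta>)"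
    using \<tau> by (subst qinner_translate_right[OF \<tau>(2)]) (simp add: unit_inverse)
  also have "qcnj ?r * (?q * ?s * qcnj \<zeta>) * \<zeta> = qcnj ?r * ?q * ?s"
    using \<tau>(2) by (simp add: mult.assoc unit_inverse)
  also have "\<dots> = quat_zw (cnj r * z * s) (cnj r * w * cnj s)"
    unfolding qcnj_of_complex unfolding of_complex_zw by (simp add: quat_zw_mult)
  finally show ?thesis by (simp add: \<tau> overlap_def)
qed

lemma first_point_fiber:
  assumes "admissible \<tau>"
  shows "fp \<tau> \<in> fiber X"
    and "fp \<tau> \<in> fiber_component X (phi u, expdiag x)"
proof -
  show "fp \<tau> \<in> fiber_component X (phi u, expdiag x)"
    unfolding mid_fiber_component[OF FX x] using assms by (auto simp: first_point_def admissible_def)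
  thus "fp \<tau> \<in> fiber X" by (rule fiber_component_sub)
qed

lemma dM_triple:
  assumes "admissible \<tau>"
  shows "dM k (fp \<tau>) (sp \<tau>)
    = sqrt (4 * k * (arccos \<bar>overlap z w \<tau>\<bar>)\<^sup>2 + (norm (zperm (fst \<tau>) - x))\<^sup>2)"
  by (simp add: first_point_eq second_point_eq[OF assms] dM_eq fquat_unit[OF assms] squat_unit[OF assms]
      qangle_def qinner_overlap[OF assms])

lemma triple_curves_eq:
  assumes "admissible \<tau>" "overlap z w \<tau> \<noteq> 0"
  shows "curves \<tau>
    = {src (fquat \<tau>) x (squat \<tau>) (zperm (fst \<tau>))}"
  unfolding triple_curves_def first_point_eq second_point_eq[OF assms(1)]
  using minimal_geodesic_curves[OF fquat_unit squat_unit _ k] assms qinner_overlap by simp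

text \<open>The length of the curves of a class, where \<open>best z w l\<close> is the cosine of half the angle of
  rotation that is optimal for the permutation of the class.\<close>

definition label_length :: "label \<Rightarrow> real" where
  "label_length l = sqrt (4 * k * (arccos (best z w l))\<^sup>2 + (norm (zperm (label_zeta l) - x))\<^sup>2)"

end

text \<open>The common treatment of the two kinds of \<open>Y\<close>. The set \<open>S\<close> holds the possible third components of the
  data-triples: it is trivial when the components of the fiber of \<open>Y\<close> are points, and the unit circle when
  they are circles. A class of smallest length may be undefined only if another class with the same
  quaternion and the same length takes its place, as \<open>B'\<close> and \<open>C'\<close> do for each other; this is
  \<open>optimal_defined\<close>.\<close>

locale class_pair = eigen_pair +
  fixes classes :: "label set" and S :: "complex set"
  assumes S: "S \<subseteq> sphere 0 1" and finite_classes: "finite classes" and classes_nonempty: "classes \<noteq> {}"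
    and zetas: "l \<in> classes \<Longrightarrow> label_zeta l \<in> zetas_top"
    and reduction: "\<lbrakk>p \<in> fiber X; q \<in> fiber Y\<rbrakk> \<Longrightarrow> \<exists>P\<in>signed_perms. \<exists>l\<in>classes. \<exists>r s. cmod r = 1 \<and> s \<in> S \<and>
        sp_act P p = fp (label_zeta l, r, s) \<and>
        sp_act P q = sp (label_zeta l, r, s)"
    and second_fiber: "\<lbrakk>l \<in> classes; s \<in> S\<rbrakk> \<Longrightarrow> sp (label_zeta l, r, s) \<in> fiber Y"
    and overlap_le: "\<lbrakk>l \<in> classes; cmod r = 1; s \<in> S\<rbrakk> \<Longrightarrow> \<bar>overlap z w (label_zeta l, r, s)\<bar> \<le> best z w l"
    and overlap_eq: "\<lbrakk>l \<in> classes; cmod r = 1; s \<in> S; class_defined z w l\<rbrakk> \<Longrightarrow>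
        \<bar>overlap z w (label_zeta l, r, s)\<bar> = best z w l \<longleftrightarrow> (label_zeta l, r, s) \<in> triples z w l"
    and best_le: "l \<in> classes \<Longrightarrow> best z w l \<le> 1"
    and best_pos: "\<lbrakk>l \<in> classes; class_defined z w l\<rbrakk> \<Longrightarrow> 0 < best z w l"
    and triples_nonempty: "\<lbrakk>l \<in> classes; class_defined z w l\<rbrakk> \<Longrightarrow> triples z w l \<noteq> {}"
    and triples_form: "\<lbrakk>l \<in> classes; \<tau> \<in> triples z w l\<rbrakk> \<Longrightarrow> \<exists>r s. \<tau> = (label_zeta l, r, s) \<and> cmod r = 1 \<and> s \<in> S"
    and optimal_defined: "\<lbrakk>l \<in> classes; \<forall>l'\<in>classes. label_length l \<le> label_length l'\<rbrakk> \<Longrightarrow>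
        \<exists>l'\<in>classes. class_defined z w l' \<and> label_zeta l' = label_zeta l \<and> best z w l' = best z w l"
begin

definition minimizers :: "label set" where
  "minimizers = {l \<in> classes. class_defined z w l \<and> (\<forall>l'\<in>classes. label_length l \<le> label_length l')}"

definition min_length :: real where
  "min_length = Min (label_length ` classes)"

lemma admissible_class:
  assumes "l \<in> classes" "cmod r = 1" "s \<in> S"
  shows "admissible (label_zeta l, r, s)"
  using assms zetas S by (auto simp: admissible_def)

lemma admissible_triples: "l \<in> classes \<Longrightarrow> \<tau> \<in> triples z w l \<Longrightarrow> admissible \<tau>"
  using triples_form admissible_class by metis

lemma triples_defined: "\<tau> \<in> triples z w l \<Longrightarrow> class_defined z w l"
  by (auto simp: triples_def split: if_splits)

lemma overlap_triples:
  assumes "l \<in> classes" "\<tau> \<in> triples z w l"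
  shows "\<bar>overlap z w \<tau>\<bar> = best z w l" "overlap z w \<tau> \<noteq> 0"
proof -
  show "\<bar>overlap z w \<tau>\<bar> = best z w l"
    using triples_form[OF assms] overlap_eq[OF assms(1)] triples_defined[OF assms(2)] assms(2) by metis
  thus "overlap z w \<tau> \<noteq> 0" using best_pos[OF assms(1) triples_defined[OF assms(2)]] by auto
qed

lemma min_length_le: "l \<in> classes \<Longrightarrow> min_length \<le> label_length l"
  unfolding min_length_def using finite_classes by simp

lemma min_length_attained:
  obtains l where "l \<in> classes" "label_length l = min_length"
proof -
  have "min_length \<in> label_length ` classes"
    unfolding min_length_def by (rule Min_in) (use finite_classes classes_nonempty in auto)
  thus thesis using that by auto
qed

lemma label_length_min_iff:
  assumes "l \<in> classes"
  shows "label_length l = min_length \<longleftrightarrow> (\<forall>l'\<in>classes. label_length l \<le> label_length l')"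
proof -
  obtain l0 where "l0 \<in> classes" "label_length l0 = min_length" by (rule min_length_attained)
  thus ?thesis using min_length_le assms by force
qed

lemma dM_label_length:
  assumes "l \<in> classes" "cmod r = 1" "s \<in> S"
  shows "label_length l \<le> dM k (fp (label_zeta l, r, s)) (sp (label_zeta l, r, s))"
    and "dM k (fp (label_zeta l, r, s)) (sp (label_zeta l, r, s)) = label_length l
      \<longleftrightarrow> \<bar>overlap z w (label_zeta l, r, s)\<bar> = best z w l"
  unfolding dM_triple[OF admissible_class[OF assms]] label_length_def fst_conv
  using cost_le[OF k abs_ge_zero overlap_le[OF assms] best_le[OF assms(1)]] by blast+

text \<open>A pair in standard form is of minimal length if and only if its class is optimal and its angle is the
  optimal one of that class.\<close>

lemma dM_min_length:
  assumes "l \<in> classes" "cmod r = 1" "s \<in> S"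
  shows "min_length \<le> dM k (fp (label_zeta l, r, s)) (sp (label_zeta l, r, s))"
    and "dM k (fp (label_zeta l, r, s)) (sp (label_zeta l, r, s)) = min_length
      \<longleftrightarrow> (\<exists>l'\<in>minimizers. (label_zeta l, r, s) \<in> triples z w l')"
proof -
  let ?d = "dM k (fp (label_zeta l, r, s)) (sp (label_zeta l, r, s))"
  note ll = dM_label_length[OF assms] min_length_le[OF assms(1)]
  show "min_length \<le> ?d" using ll by simp
  show "?d = min_length \<longleftrightarrow> (\<exists>l'\<in>minimizers. (label_zeta l, r, s) \<in> triples z w l')"
  proof
    assume d: "?d = min_length"
    hence lm: "label_length l = min_length" using ll by simp
    hence ov: "\<bar>overlap z w (label_zeta l, r, s)\<bar> = best z w l" using ll d by simp
    obtain l' where l': "l' \<in> classes" "class_defined z w l'" "label_zeta l' = label_zeta l" "best z w l' = best z w l"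
      using optimal_defined[OF assms(1)] lm label_length_min_iff[OF assms(1)] by blast
    have "label_length l' = min_length" using lm l' by (simp add: label_length_def)
    hence "l' \<in> minimizers" using l' label_length_min_iff by (simp add: minimizers_def)
    moreover have "(label_zeta l, r, s) \<in> triples z w l'"
      using overlap_eq[OF l'(1) assms(2,3) l'(2)] ov l' by simp
    ultimately show "\<exists>l'\<in>minimizers. (label_zeta l, r, s) \<in> triples z w l'" by blast
  next
    assume "\<exists>l'\<in>minimizers. (label_zeta l, r, s) \<in> triples z w l'"
    then obtain l' where l': "l' \<in> classes" "class_defined z w l'" "label_length l' = min_length"
        "(label_zeta l, r, s) \<in> triples z w l'"
      unfolding minimizers_def using label_length_min_iff by blast
    hence e: "label_zeta l = label_zeta l'" using triples_form[OF l'(1,4)] by auto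
    show "?d = min_length"
      using dM_label_length(2)[OF l'(1) assms(2,3)] overlap_eq[OF l'(1) assms(2,3) l'(2)] l' e by simp
  qed
qed

lemma minimizers_nonempty: "minimizers \<noteq> {}"
proof -
  obtain l where l: "l \<in> classes" "label_length l = min_length" by (rule min_length_attained)
  obtain l' where l': "l' \<in> classes" "class_defined z w l'" "label_zeta l' = label_zeta l" "best z w l' = best z w l"
    using optimal_defined[OF l(1)] l label_length_min_iff[OF l(1)] by blast
  have "label_length l' = min_length" using l l' by (simp add: label_length_def)
  thus ?thesis using l' label_length_min_iff by (auto simp: minimizers_def)
qed

lemma triple_fibers:
  assumes "l \<in> classes" "cmod r = 1" "s \<in> S"
  shows "fp (label_zeta l, r, s) \<in> fiber X" "sp (label_zeta l, r, s) \<in> fiber Y"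
  using first_point_fiber(1)[OF admissible_class[OF assms]] second_fiber[OF assms(1,3)] by auto

text \<open>This makes the infimum over the two fibers an infimum over triples, since the action is isometric.\<close>

lemma reduce_pair:
  assumes "p \<in> fiber X" "q \<in> fiber Y"
  obtains P l r s where "P \<in> signed_perms" "l \<in> classes" "cmod r = 1" "s \<in> S"
    "sp_act P p = fp (label_zeta l, r, s)" "sp_act P q = sp (label_zeta l, r, s)"
    "dM k p q = dM k (fp (label_zeta l, r, s)) (sp (label_zeta l, r, s))"
proof -
  obtain P l r s where P: "P \<in> signed_perms" "l \<in> classes" "cmod r = 1" "s \<in> S"
    "sp_act P p = fp (label_zeta l, r, s)" "sp_act P q = sp (label_zeta l, r, s)"
    using reduction[OF assms] by blast
  have "p \<in> Mspace" "q \<in> Mspace" using assms by (simp_all add: fiber_def)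
  then obtain g a h b where gh: "g \<in> unit_quats" "p = (phi g, expdiag a)" "h \<in> unit_quats" "q = (phi h, expdiag b)"
    by (metis Mspace_cases)
  note ad = admissible_class[OF P(2-4)]
  have "dM k p q = dM k (fp (label_zeta l, r, s)) (sp (label_zeta l, r, s))"
    unfolding gh first_point_eq second_point_eq[OF ad]
    by (rule sp_act_invariance(2)[OF P(1) gh(1,3) fquat_unit[OF ad] squat_unit[OF ad], symmetric])
       (use P(5,6) in \<open>simp_all add: first_point_eq second_point_eq[OF ad] gh\<close>)
  thus thesis using that P by blast
qed

lemma dSR_eq: "dSR k X Y = min_length"
proof -
  obtain l where l: "l \<in> minimizers" using minimizers_nonempty by blast
  hence lc: "l \<in> classes" "class_defined z w l" by (auto simp: minimizers_def)
  obtain \<tau> where t: "\<tau> \<in> triples z w l" using triples_nonempty[OF lc] by blast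
  then obtain r s where rs: "\<tau> = (label_zeta l, r, s)" "cmod r = 1" "s \<in> S" using triples_form[OF lc(1)] by blast
  have d: "dM k (fp \<tau>) (sp \<tau>) = min_length"
    using dM_min_length(2)[OF lc(1) rs(2,3)] l t rs(1) by blast
  have F: "(fp \<tau>, sp \<tau>) \<in> fiber X \<times> fiber Y" using triple_fibers[OF lc(1) rs(2,3)] rs(1) by simp
  have ge: "min_length \<le> dM k (fst pq) (snd pq)" if "pq \<in> fiber X \<times> fiber Y" for pq
  proof -
    have "fst pq \<in> fiber X" "snd pq \<in> fiber Y" using that by auto
    then obtain l r s where P: "l \<in> classes" "cmod r = 1" "s \<in> S"
      "dM k (fst pq) (snd pq) = dM k (fp (label_zeta l, r, s)) (sp (label_zeta l, r, s))"
      using reduce_pair by blast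
    show ?thesis using dM_min_length(1)[OF P(1-3)] P(4) by simp
  qed
  show ?thesis
    unfolding dSR_def
  proof (rule antisym)
    have "bdd_below ((\<lambda>pq. dM k (fst pq) (snd pq)) ` (fiber X \<times> fiber Y))" using ge by (intro bdd_belowI2)
    from cINF_lower[OF this F] show "(INF pq\<in>fiber X \<times> fiber Y. dM k (fst pq) (snd pq)) \<le> min_length"
      by (simp add: d)
    show "min_length \<le> (INF pq\<in>fiber X \<times> fiber Y. dM k (fst pq) (snd pq))"
      using F ge by (intro cINF_greatest) auto
  qed
qed

text \<open>A geodesic is at least as long as the distance of its ends, which in turn is at least the infimum;
  equality of the outer two gives equality with the middle one.\<close>

lemma geodesic_min_length:
  assumes "geodesic k \<gamma>" "\<gamma> 0 \<in> fiber X" "\<gamma> 1 \<in> fiber Y" "curve_length k \<gamma> 0 1 = dSR k X Y"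
  shows "dM k (\<gamma> 0) (\<gamma> 1) = min_length"
proof -
  obtain l r s where P: "l \<in> classes" "cmod r = 1" "s \<in> S"
      "dM k (\<gamma> 0) (\<gamma> 1) = dM k (fp (label_zeta l, r, s)) (sp (label_zeta l, r, s))"
    using reduce_pair[OF assms(2,3)] by blast
  have "min_length \<le> dM k (\<gamma> 0) (\<gamma> 1)" using dM_min_length(1)[OF P(1-3)] P(4) by simp
  thus ?thesis using curve_length_ge_dM[OF k assms(1)] assms(4) dSR_eq by simp
qed

lemma minimal_pair_triple:
  assumes "l \<in> minimizers" "\<tau> \<in> triples z w l"
  shows "minimal_pair k X Y (fp \<tau>) (sp \<tau>)" "fp \<tau> \<in> fiber_component X (phi u, expdiag x)"
proof -
  have lc: "l \<in> classes" using assms by (simp add: minimizers_def)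
  note ad = admissible_triples[OF lc assms(2)]
  obtain r s where rs: "\<tau> = (label_zeta l, r, s)" "cmod r = 1" "s \<in> S" using triples_form[OF lc assms(2)] by blast
  show "minimal_pair k X Y (fp \<tau>) (sp \<tau>)"
  proof (rule minimal_pair_dM[OF k first_point_eq fquat_unit[OF ad] second_point_eq[OF ad] squat_unit[OF ad]])
    show "qinner (fquat \<tau>) (squat \<tau>) \<noteq> 0"
      using overlap_triples[OF lc assms(2)] qinner_overlap[OF ad] by simp
    show "fp \<tau> \<in> fiber X" "sp \<tau> \<in> fiber Y" using triple_fibers[OF lc rs(2,3)] rs(1) by simp_all
    show "dM k (fp \<tau>) (sp \<tau>) = dSR k X Y"
      using dM_min_length(2)[OF lc rs(2,3)] assms unfolding dSR_eq rs(1) by blast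
  qed
  show "fp \<tau> \<in> fiber_component X (phi u, expdiag x)" by (rule first_point_fiber(2)[OF ad])
qed

lemma minimal_pair_imp_dM:
  assumes "minimal_pair k X Y p q"
  shows "p \<in> fiber X" "q \<in> fiber Y" "dM k p q = min_length"
  using assms geodesic_min_length unfolding minimal_pair_def by auto

lemma minimal_pair_reduce:
  assumes "minimal_pair k X Y p q"
  obtains P l \<tau> where "P \<in> signed_perms" "l \<in> minimizers" "\<tau> \<in> triples z w l" "sp_act P p = fp \<tau>" "sp_act P q = sp \<tau>"
proof -
  note m = minimal_pair_imp_dM[OF assms]
  obtain P l r s where P: "P \<in> signed_perms" "l \<in> classes" "cmod r = 1" "s \<in> S"
    "sp_act P p = fp (label_zeta l, r, s)" "sp_act P q = sp (label_zeta l, r, s)"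
    "dM k p q = dM k (fp (label_zeta l, r, s)) (sp (label_zeta l, r, s))"
    by (rule reduce_pair[OF m(1,2)])
  then obtain l' where "l' \<in> minimizers" "(label_zeta l, r, s) \<in> triples z w l'"
    using dM_min_length(2)[OF P(2-4)] m(3) by auto
  thus thesis using that P by blast
qed

text \<open>A minimal geodesic is moved by a signed permutation to one that joins the points of a triple. Both
  have the same projection, and the second is the only minimal geodesic between its ends.\<close>

lemma MSSR_eq: "MSSR k X Y = (\<Union>l\<in>minimizers. class_curves k (phi u) (expdiag x) (phi v) (expdiag y) z w l)"
proof (intro equalityI subsetI)
  fix c assume "c \<in> MSSR k X Y"
  then obtain \<gamma> where g: "c = scaling_rotation_curve \<gamma>" "geodesic k \<gamma>" "\<gamma> 0 \<in> fiber X" "\<gamma> 1 \<in> fiber Y"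
      "curve_length k \<gamma> 0 1 = dSR k X Y"
    unfolding MSSR_def by blast
  have mp: "minimal_pair k X Y (\<gamma> 0) (\<gamma> 1)" using g unfolding minimal_pair_def by blast
  obtain P l \<tau> where P: "P \<in> signed_perms" "l \<in> minimizers" "\<tau> \<in> triples z w l" "sp_act P (\<gamma> 0) = fp \<tau>" "sp_act P (\<gamma> 1) = sp \<tau>"
    by (rule minimal_pair_reduce[OF mp])
  have lc: "l \<in> classes" using P by (simp add: minimizers_def)
  note ad = admissible_triples[OF lc P(3)]
  have "\<gamma> 0 \<in> Mspace" "\<gamma> 1 \<in> Mspace" using g by (simp_all add: fiber_def)
  then obtain a b a' b' where ab: "a \<in> unit_quats" "\<gamma> 0 = (phi a, expdiag b)" "a' \<in> unit_quats" "\<gamma> 1 = (phi a', expdiag b')"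
    by (metis Mspace_cases)
  note inv = sp_act_invariance[OF P(1) ab(1,3) fquat_unit[OF ad] squat_unit[OF ad], of b x b' "zperm (fst \<tau>)"]
  have e: "sp_act P (phi a, expdiag b) = (phi (fquat \<tau>), expdiag x)"
    "sp_act P (phi a', expdiag b') = (phi (squat \<tau>), expdiag (zperm (fst \<tau>)))"
    using P(4,5) by (simp_all add: ab first_point_eq second_point_eq[OF ad])
  have nz: "overlap z w \<tau> \<noteq> 0" by (rule overlap_triples(2)[OF lc P(3)])
  hence nz': "qinner a a' \<noteq> 0" using inv(1)[OF e] qinner_overlap[OF ad] by auto
  have "curve_length k \<gamma> 0 1 = dM k (phi a, expdiag b) (phi a', expdiag b')"
    using geodesic_min_length[OF g(2-5)] g(5) dSR_eq ab by simp
  from scaling_rotation_curve_minimal[OF ab(1,3) nz' k g(2) ab(2,4) this]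
  have "c = src (fquat \<tau>) x (squat \<tau>) (zperm (fst \<tau>))" using inv(3)[OF e nz'] g(1) by simp
  hence "c \<in> curves \<tau>" using triple_curves_eq[OF ad nz] by simp
  thus "c \<in> (\<Union>l\<in>minimizers. class_curves k (phi u) (expdiag x) (phi v) (expdiag y) z w l)"
    using P(2,3) by (auto simp: class_curves_def)
next
  fix c assume "c \<in> (\<Union>l\<in>minimizers. class_curves k (phi u) (expdiag x) (phi v) (expdiag y) z w l)"
  then obtain l \<tau> where l: "l \<in> minimizers" "\<tau> \<in> triples z w l" "c \<in> curves \<tau>"
    by (auto simp: class_curves_def)
  have lc: "l \<in> classes" using l by (simp add: minimizers_def)
  note ad = admissible_triples[OF lc l(2)]
  have nz: "overlap z w \<tau> \<noteq> 0" by (rule overlap_triples(2)[OF lc l(2)])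
  hence nz': "qinner (fquat \<tau>) (squat \<tau>) \<noteq> 0" using qinner_overlap[OF ad] by simp
  note U = fquat_unit[OF ad] squat_unit[OF ad]
  have c: "c = scaling_rotation_curve (garc (fquat \<tau>) x (squat \<tau>) (zperm (fst \<tau>)))"
    using l(3) triple_curves_eq[OF ad nz] by (simp add: src_def)
  have F: "fp \<tau> \<in> fiber X" "sp \<tau> \<in> fiber Y" "dM k (fp \<tau>) (sp \<tau>) = min_length"
    using minimal_pair_imp_dM[OF minimal_pair_triple(1)[OF l(1,2)]] by simp_all
  show "c \<in> MSSR k X Y"
    unfolding MSSR_def c
    using geodesic_garc[OF U nz' k, of x "zperm (fst \<tau>)"] F garc_0[OF U nz' k] garc_1[OF U nz' k]
    by (auto simp: dSR_eq first_point_eq second_point_eq[OF ad])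
qed

end

section \<open>When two curves agree\<close>

lemma garc_continuous:
  assumes "g \<in> unit_quats" "h \<in> unit_quats" "qinner g h \<noteq> 0"
  shows "continuous_on A (garc g x h y)"
proof -
  obtain \<gamma>' where "\<And>t. (garc g x h y has_vector_derivative \<gamma>' t) (at t)"
    using garc_speed[OF assms, of 1 x y] by auto
  hence "continuous (at t) (garc g x h y)" for t by (rule has_vector_derivative_continuous)
  thus ?thesis by (simp add: continuous_at_imp_continuous_on)
qed

text \<open>Right multiplication of both ends by \<open>r\<close> multiplies the whole lifted geodesic by \<open>r\<close>, and \<open>phi r\<close> commutes
  with the diagonal matrices on the path.\<close>

lemma src_rotate:
  assumes u: "g \<in> unit_quats" "h \<in> unit_quats" and nz: "qinner g h \<noteq> 0" and r: "cmod r = 1"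
    and xy: "x$2 = x$3" "y$2 = y$3"
  shows "src (g * of_complex r) x (h * of_complex r) y = src g x h y"
proof -
  let ?r = "of_complex r"
  have "Fmap (garc (g * ?r) x (h * ?r) y t) = Fmap (garc g x h y t)" for t
  proof -
    have ru: "qcnj ?r \<in> unit_quats" using r by simp
    have "qcnj (g * ?r) * (h * ?r) = qcnj ?r * (qcnj g * h) * qcnj (qcnj ?r)" by (simp add: mult.assoc)
    hence "qpow (qcnj (g * ?r) * (h * ?r)) t = qcnj ?r * qpow (qcnj g * h) t * ?r"
      using qpow_conj[OF ru, of "qcnj g * h" t] by (simp add: mult.assoc)
    hence "g * ?r * qpow (qcnj (g * ?r) * (h * ?r)) t = g * qpow (qcnj g * h) t * ?r"
      using r by (simp add: mult.assoc)
    hence e: "garc (g * ?r) x (h * ?r) y t = (fst (garc g x h y t) ** phi ?r, expdiag ((1 - t) *\<^sub>R x + t *\<^sub>R y))"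
      by (simp add: garc_def phi_mult)
    have "garc g x h y t \<in> fiber (Fmap (garc g x h y t))"
      using garc_Mspace[OF u nz, of 1] by (simp add: fiber_def)
    hence "(fst (garc g x h y t), expdiag ((1 - t) *\<^sub>R x + t *\<^sub>R y)) \<in> fiber (Fmap (garc g x h y t))"
      by (simp add: garc_def)
    from fiber_rotate[OF this _ r] show ?thesis using xy by (simp add: e fiber_def)
  qed
  thus ?thesis unfolding src_def scaling_rotation_curve_def by (intro restrict_ext) simp
qed

text \<open>Two curves with the same projection have frames that differ by a matrix with few nonzero
  entries: an entry can be nonzero only while the corresponding eigenvalues agree. Logarithms of
  eigenvalues are affine in time, so by continuity an entry vanishes at all times unless two
  eigenvalues agree at both ends.\<close>

lemma src_eq_entries:
  assumes u: "g1 \<in> unit_quats" "h1 \<in> unit_quats" "g2 \<in> unit_quats" "h2 \<in> unit_quats"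
    and nz: "qinner g1 h1 \<noteq> 0" "qinner g2 h2 \<noteq> 0"
    and eq: "src g1 x1 h1 y1 = src g2 x2 h2 y2"
    and ne: "x1$j \<noteq> x2$i \<or> y1$j \<noteq> y2$i" and t: "t \<in> {0..1}"
  shows "(transpose (fst (garc g2 x2 h2 y2 t)) ** fst (garc g1 x1 h1 y1 t)) $ i $ j = 0"
proof (rule ccontr)
  define P where "P t = (transpose (fst (garc g2 x2 h2 y2 t)) ** fst (garc g1 x1 h1 y1 t)) $ i $ j" for t
  assume "\<not> ?thesis"
  hence nz0: "P t \<noteq> 0" by (simp add: P_def)
  define \<alpha> \<beta> where "\<alpha> = x1$j - x2$i" and "\<beta> = y1$j - y2$i"
  have aff: "(1 - s) * \<alpha> + s * \<beta> = 0" if s: "s \<in> {0..1}" "P s \<noteq> 0" for s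
  proof -
    have "Fmap (garc g1 x1 h1 y1 s) = Fmap (garc g2 x2 h2 y2 s)"
      using fun_cong[OF eq, of s] s by (simp add: src_def scaling_rotation_curve_def)
    hence "garc g1 x1 h1 y1 s \<in> fiber (Fmap (garc g2 x2 h2 y2 s))" "garc g2 x2 h2 y2 s \<in> fiber (Fmap (garc g2 x2 h2 y2 s))"
      using garc_Mspace[OF u(1,2) nz(1), of 1] garc_Mspace[OF u(3,4) nz(2), of 1] by (simp_all add: fiber_def)
    hence "((1 - s) *\<^sub>R x1 + s *\<^sub>R y1) $ j = ((1 - s) *\<^sub>R x2 + s *\<^sub>R y2) $ i"
      using fiber_entries(2)[of "fst (garc g2 x2 h2 y2 s)" "(1 - s) *\<^sub>R x2 + s *\<^sub>R y2" _
          "fst (garc g1 x1 h1 y1 s)" "(1 - s) *\<^sub>R x1 + s *\<^sub>R y1" i j] s(2)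
      by (simp add: garc_def P_def)
    thus ?thesis by (simp add: \<alpha>_def \<beta>_def algebra_simps)
  qed
  have "continuous_on {0..1} P"
    unfolding P_def mat3_mult_nth transpose_nth
    by (intro continuous_intros garc_continuous[OF u(1,2) nz(1)] garc_continuous[OF u(3,4) nz(2)])
  hence "\<exists>d>0. \<forall>s\<in>{0..1}. dist s t < d \<longrightarrow> dist (P s) (P t) < \<bar>P t\<bar>"
    using t nz0 unfolding continuous_on_iff by (metis zero_less_abs_iff)
  then obtain d where d: "d > 0" "\<And>s. s \<in> {0..1} \<Longrightarrow> \<bar>s - t\<bar> < d \<Longrightarrow> \<bar>P s - P t\<bar> < \<bar>P t\<bar>"
    by (auto simp: dist_real_def)
  define s where "s = (if t < 1 then min 1 (t + d / 2) else max 0 (t - d / 2))"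
  have s: "s \<in> {0..1}" "s \<noteq> t" "\<bar>s - t\<bar> < d" using d(1) t by (auto simp: s_def)
  have "P s \<noteq> 0" using d(2)[OF s(1,3)] by auto
  hence "(1 - s) * \<alpha> + s * \<beta> = 0" "(1 - t) * \<alpha> + t * \<beta> = 0" using aff s t nz0 by auto
  hence "(s - t) * (\<beta> - \<alpha>) = 0" "(1 - t) * \<alpha> + t * \<beta> = 0" by (simp_all add: algebra_simps)
  hence "\<beta> = \<alpha>" "(1 - t) * \<alpha> + t * \<alpha> = 0" using s(2) by auto
  hence "\<alpha> = 0" "\<beta> = 0" by (simp_all add: algebra_simps)
  thus False using ne by (auto simp: \<alpha>_def \<beta>_def)
qed

text \<open>The first row of the quotient of the two frames reduces to its corner entry, which is \<open>\<plusminus>1\<close> at all times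
  and, by continuity, equal to its value \<open>1\<close> at time \<open>0\<close>.\<close>

lemma src_eq_imp:
  assumes u: "g \<in> unit_quats" "h1 \<in> unit_quats" "h2 \<in> unit_quats" and r: "cmod r1 = 1" "cmod r2 = 1"
    and nz: "qinner (g * of_complex r1) h1 \<noteq> 0" "qinner (g * of_complex r2) h2 \<noteq> 0"
    and x: "x$2 = x$3" "x$1 \<noteq> x$2"
    and eq: "src (g * of_complex r1) x h1 y1 = src (g * of_complex r2) x h2 y2"
  shows "y1$1 = y2$1" "phi (qcnj h2 * h1) $ 1 $ 1 = 1"
proof -
  let ?c1 = "garc (g * of_complex r1) x h1 y1" and ?c2 = "garc (g * of_complex r2) x h2 y2"
  have U: "g * of_complex r1 \<in> unit_quats" "g * of_complex r2 \<in> unit_quats" using u r by simp_all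
  define P where "P t = transpose (fst (?c2 t)) ** fst (?c1 t)" for t
  note ent = src_eq_entries[OF U(1) u(2) U(2) u(3) nz eq, folded P_def]
  have sq: "(P t $ 1 $ 1)\<^sup>2 = 1" if t: "t \<in> {0..1}" for t
  proof (rule SO3_row_unit')
    show "P t \<in> SO3"
      using garc_Mspace[OF U(1) u(2) nz(1), of 1 x y1 t] garc_Mspace[OF U(2) u(3) nz(2), of 1 x y2 t]
      unfolding P_def by (auto simp: Mspace_def)
    show "P t $ 1 $ l = 0" if "l \<noteq> 1" for l
    proof -
      have "x$l \<noteq> x$1" using that exhaust_3[of l] x by auto
      thus ?thesis using ent t by blast
    qed
  qed
  have "P t $ 1 $ 1 \<in> {1, -1}" if "t \<in> {0..1}" for t using sq[OF that] by (simp add: power2_eq_1_iff)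
  hence "(\<lambda>t. P t $ 1 $ 1) ` {0..1} \<subseteq> {1, -1}" by (rule image_subsetI)
  hence fin: "finite ((\<lambda>t. P t $ 1 $ 1) ` {0..1})" by (rule finite_subset) simp
  have "continuous_on {0..1} (\<lambda>t. P t $ 1 $ 1)"
    unfolding P_def mat3_mult_nth transpose_nth
    by (intro continuous_intros garc_continuous U u nz)
  from continuous_finite_range_constant[OF _ this fin]
  have "P 1 $ 1 $ 1 = P 0 $ 1 $ 1" unfolding constant_on_def by auto
  moreover have "P 0 = phi (qcnj (of_complex r2) * of_complex r1)"
    using u by (simp add: P_def garc_0[OF U(1) u(2) nz(1), of 1] garc_0[OF U(2) u(3) nz(2), of 1] mult.assoc
        flip: phi_qcnj phi_mult)
  moreover have "phi (qcnj (of_complex r2) * of_complex r1) $ 1 $ 1 = 1"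
  proof -
    have "cmod (cnj r2 * r1) = 1" using r by (simp add: norm_mult)
    hence "(Re (cnj r2 * r1))\<^sup>2 + (Im (cnj r2 * r1))\<^sup>2 = 1" by (simp only: cmod_power2[symmetric]) simp
    thus ?thesis unfolding qcnj_of_complex of_complex_mult[symmetric] by (simp only: phi_nth) (simp add: of_complex_def)
  qed
  ultimately have P1: "P 1 $ 1 $ 1 = 1" by simp
  have "P 1 = phi (qcnj h2 * h1)"
    by (simp add: P_def garc_1[OF U(1) u(2) nz(1), of 1] garc_1[OF U(2) u(3) nz(2), of 1] flip: phi_qcnj phi_mult)
  with P1 show "phi (qcnj h2 * h1) $ 1 $ 1 = 1" by simp
  show "y1$1 = y2$1" using ent[of 1 1 1] P1 by force
qed

section \<open>Reduction to data-triples\<close>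

context eigen_pair
begin

lemma zperm_simps:
  "zperm 1 = y" "zperm unit_j = y" "zperm zeta_jp = vector [y$3, y$2, y$1]" "zperm zeta_jm = vector [y$3, y$2, y$1]"
  "zperm zeta_kp = vector [y$2, y$1, y$3]" "zperm zeta_km = vector [y$2, y$1, y$3]"
  by (simp_all add: zperm_def mat_perm_zeta perm_vec_swaps del: phi_one)

lemma second_point_sp_act:
  "sp (\<zeta>, r, s) = sp_act (phi \<zeta>) (phi v ** phi (of_complex s), expdiag y)"
  by (simp add: second_point_def sp_act_def)

lemma sp_act_circle:
  assumes "phi (of_complex c) \<in> signed_perms" "cmod c = 1" "a$2 = a$3"
  shows "sp_act (phi (of_complex c)) (U ** phi (of_complex r), expdiag a) = (U ** phi (of_complex (r * cnj c)), expdiag a)"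
proof -
  have "phi (of_complex c) ** transpose (phi (of_complex c)) = mat 1"
    using assms(2) by (simp add: matrix_inv_SO3 phi_in_SO3)
  hence "phi (of_complex c) ** expdiag a ** transpose (phi (of_complex c)) = expdiag a"
    unfolding phi_of_complex_commute[OF assms(3)] by (simp only: matrix_mul_assoc[symmetric] matrix_mul_rid)
  thus ?thesis using assms(1)
    by (simp add: sp_act_eq phi_mult of_complex_mult matrix_mul_assoc flip: phi_qcnj qcnj_of_complex)
qed

lemma first_point_reduction:
  assumes "p \<in> fiber X"
  obtains \<zeta> r where "\<zeta> \<in> zetas_top" "cmod r = 1" "sp_act (phi \<zeta>) p = (phi u ** phi (of_complex r), expdiag x)"
  using mid_fiber_normal_form[OF FX assms x] by metis

text \<open>A signed permutation first moves \<open>p\<close> into the component of \<open>phi u\<close>. Then the second point is the image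
  of the base point of \<open>Y\<close> under some signed permutation \<open>Q\<close>. Multiplication from the left by a signed
  permutation fixing the first axis keeps \<open>p\<close> in the component and turns \<open>Q\<close> into the representative \<open>\<zeta>\<close>
  with the same first row.\<close>

lemma reduction_top:
  assumes y: "y$1 \<noteq> y$2" "y$1 \<noteq> y$3" "y$2 \<noteq> y$3" and F: "p \<in> fiber X" "q \<in> fiber Y"
  shows "\<exists>P\<in>signed_perms. \<exists>\<zeta>\<in>zetas_top. \<exists>r. cmod r = 1 \<and>
    sp_act P p = fp (\<zeta>, r, 1) \<and> sp_act P q = sp (\<zeta>, r, 1)"
proof -
  obtain \<zeta>0 r0 where 0: "\<zeta>0 \<in> zetas_top" "cmod r0 = 1" "sp_act (phi \<zeta>0) p = (phi u ** phi (of_complex r0), expdiag x)"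
    by (rule first_point_reduction[OF F(1)])
  note s0 = phi_zeta_signed[OF 0(1)]
  obtain Q where Q: "Q \<in> signed_perms" "sp_act (phi \<zeta>0) q = sp_act Q (phi v, expdiag y)"
    by (rule top_fiber_normal_form[OF FY sp_act_fiber[OF s0 F(2)] y])
  note QS = signed_perms_SO3[OF Q(1)]
  obtain j where "Q$1$j \<noteq> 0" using SO3_row_norm[OF QS, of 1] by force
  hence s: "Q$1$j = 1 \<or> Q$1$j = -1" using signed_perms_entries[OF Q(1), of 1 j] by simp
  obtain \<zeta> where z: "\<zeta> \<in> zetas_top" "phi \<zeta> $ 1 $ j = Q$1$j" by (rule zeta_first_row[OF s])
  note zs = phi_zeta_signed[OF z(1)]
  let ?P = "phi \<zeta> ** transpose Q"
  have Ps: "?P \<in> signed_perms" by (rule signed_perms_mult[OF zs signed_perms_transpose[OF Q(1)]])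
  have "?P $ 1 $ 1 = 1" by (rule rows_agree[OF signed_perms_SO3[OF zs] QS z(2) refl s])
  then obtain c where c: "cmod c = 1" "?P = phi (of_complex c)" by (rule SO3_stabilizer[OF signed_perms_SO3[OF Ps]])
  have M: "p \<in> Mspace" "q \<in> Mspace" "(phi v, expdiag y) \<in> Mspace" using F FY by (simp_all add: fiber_def)
  have PQ: "?P ** Q = phi \<zeta>"
    using matrix_inv_SO3(2)[OF QS] by (simp only: matrix_mul_assoc[symmetric] matrix_mul_rid)
  have "sp_act (?P ** phi \<zeta>0) p = sp_act ?P (sp_act (phi \<zeta>0) p)" by (rule sp_act_mult[OF Ps s0 M(1), symmetric])
  also have "\<dots> = (phi u ** phi (of_complex (r0 * cnj c)), expdiag x)"
    using sp_act_circle[OF _ c(1) x(1), of "phi u" r0] Ps c(2) by (simp add: 0(3))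
  finally have 1: "sp_act (?P ** phi \<zeta>0) p = fp (\<zeta>, r0 * cnj c, 1)"
    by (simp add: first_point_def)
  have "sp_act (?P ** phi \<zeta>0) q = sp_act ?P (sp_act (phi \<zeta>0) q)" by (rule sp_act_mult[OF Ps s0 M(2), symmetric])
  also have "\<dots> = sp_act (?P ** Q) (phi v, expdiag y)" unfolding Q(2) by (rule sp_act_mult[OF Ps Q(1) M(3)])
  also have "\<dots> = sp (\<zeta>, r0 * cnj c, 1)"
    unfolding PQ second_point_sp_act by simp
  finally have 2: "sp_act (?P ** phi \<zeta>0) q = sp (\<zeta>, r0 * cnj c, 1)" .
  have "cmod (r0 * cnj c) = 1" using 0(2) c(1) by (simp add: norm_mult)
  thus ?thesis using 1 2 z(1) signed_perms_mult[OF Ps s0] by blast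
qed

text \<open>The rotation of a power of \<open>exp (i \<pi> / 4)\<close> is a signed permutation fixing the first axis; conjugation by
  such a power turns each of \<open>zeta_jm\<close>, \<open>zeta_kp\<close>, \<open>zeta_km\<close> into \<open>zeta_jp\<close>.\<close>

lemma zeta_conj_circle:
  assumes "\<zeta> \<in> zetas_top"
  obtains c \<zeta>' where "cmod c = 1" "phi (of_complex c) \<in> signed_perms" "\<zeta>' \<in> zetas_mid"
    "of_complex c * \<zeta> = \<zeta>' * of_complex c"
proof -
  let ?e = "Complex (1 / sqrt 2) (1 / sqrt 2)"
  have n: "cmod \<i> = 1" "cmod ?e = 1" "cmod (cnj ?e) = 1" by (simp_all add: cmod_def power_divide)
  have signed: "phi (of_complex c) \<in> signed_perms" if "c \<in> {1, \<i>, ?e, cnj ?e}" for c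
  proof (rule signed_permsI)
    show "phi (of_complex c) \<in> SO3" using that n by (intro phi_in_SO3) auto
    fix i j
    show "phi (of_complex c) $ i $ j = 0 \<or> phi (of_complex c) $ i $ j = 1 \<or> phi (of_complex c) $ i $ j = -1"
      using that exhaust_3[of i] exhaust_3[of j]
      by (elim insertE disjE emptyE; simp add: phi_nth of_complex_def power_divide)
  qed
  have eqs: "of_complex \<i> * zeta_jm = zeta_jp * of_complex \<i>"
    "of_complex (cnj ?e) * zeta_kp = zeta_jp * of_complex (cnj ?e)"
    "of_complex ?e * zeta_km = zeta_jp * of_complex ?e"
    by (simp_all add: times_quat_def of_complex_def zeta_jp_def zeta_jm_def zeta_kp_def zeta_km_def)
  from assms consider "\<zeta> \<in> zetas_mid" | "\<zeta> = zeta_jm" | "\<zeta> = zeta_kp" | "\<zeta> = zeta_km"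
    by (auto simp: zetas_top_def zetas_mid_def)
  thus thesis
  proof cases
    case 1
    thus thesis using that[of 1 \<zeta>] signed[of 1] by simp
  next
    case 2
    thus thesis using that[of \<i> zeta_jp] signed[of \<i>] eqs(1) n by (simp add: zetas_mid_def)
  next
    case 3
    thus thesis using that[of "cnj ?e" zeta_jp] signed[of "cnj ?e"] eqs(2) n by (simp add: zetas_mid_def)
  next
    case 4
    thus thesis using that[of ?e zeta_jp] signed[of ?e] eqs(3) n by (simp add: zetas_mid_def)
  qed
qed

lemma transpose_phi_zeta:
  assumes "\<zeta> \<in> zetas_top"
  obtains \<zeta>' where "\<zeta>' \<in> zetas_top" "transpose (phi \<zeta>) = phi \<zeta>'"
proof -
  have e: "phi (qcnj 1) = phi 1" "phi (qcnj unit_j) = phi unit_j"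
    by (simp_all add: qcnj_def unit_j_def mat3_eq_iff phi_nth one_quat_def)
  have f: "qcnj zeta_jp = zeta_jm" "qcnj zeta_jm = zeta_jp" "qcnj zeta_kp = zeta_km" "qcnj zeta_km = zeta_kp"
    by (simp_all add: qcnj_def zeta_jp_def zeta_jm_def zeta_kp_def zeta_km_def)
  from assms have "\<exists>\<zeta>'\<in>zetas_top. phi (qcnj \<zeta>) = phi \<zeta>'"
    unfolding zetas_top_def insert_iff empty_iff bex_simps by (elim disjE) (simp_all add: e f del: qcnj_simps)
  thus thesis using that by (auto simp: phi_qcnj)
qed

text \<open>Once \<open>p\<close> is in place, some representative carries the second point into its component; read
  backwards, that point comes from the component by a \<open>\<zeta>\<close>, as the inverse of a representative acts like
  a representative. A quarter or half turn about the first axis preserves both components and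
  conjugates \<open>\<zeta>\<close> into \<open>zetas_mid\<close>.\<close>

lemma reduction_mid:
  assumes y: "y$2 = y$3" "y$1 \<noteq> y$2" and F: "p \<in> fiber X" "q \<in> fiber Y"
  shows "\<exists>P\<in>signed_perms. \<exists>\<zeta>\<in>zetas_mid. \<exists>r s. cmod r = 1 \<and> cmod s = 1 \<and>
    sp_act P p = fp (\<zeta>, r, s) \<and> sp_act P q = sp (\<zeta>, r, s)"
proof -
  obtain \<zeta>0 r0 where 0: "\<zeta>0 \<in> zetas_top" "cmod r0 = 1" "sp_act (phi \<zeta>0) p = (phi u ** phi (of_complex r0), expdiag x)"
    by (rule first_point_reduction[OF F(1)])
  note s0 = phi_zeta_signed[OF 0(1)]
  let ?q = "sp_act (phi \<zeta>0) q"
  have Fq: "?q \<in> fiber Y" by (rule sp_act_fiber[OF s0 F(2)])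
  obtain \<zeta>1 s where 1: "\<zeta>1 \<in> zetas_top" "cmod s = 1" "sp_act (phi \<zeta>1) ?q = (phi v ** phi (of_complex s), expdiag y)"
    by (rule mid_fiber_normal_form[OF FY Fq y])
  note s1 = phi_zeta_signed[OF 1(1)]
  obtain \<zeta>2 where 2: "\<zeta>2 \<in> zetas_top" "transpose (phi \<zeta>1) = phi \<zeta>2" by (rule transpose_phi_zeta[OF 1(1)])
  note s2 = phi_zeta_signed[OF 2(1)]
  obtain c \<zeta> where c: "cmod c = 1" "phi (of_complex c) \<in> signed_perms" "\<zeta> \<in> zetas_mid"
    "of_complex c * \<zeta>2 = \<zeta> * of_complex c"
    by (rule zeta_conj_circle[OF 2(1)])
  have "\<zeta> \<in> zetas_top" using c(3) by (auto simp: zetas_mid_def zetas_top_def)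
  note s3 = phi_zeta_signed[OF this]
  let ?P = "phi (of_complex c) ** phi \<zeta>0" and ?V = "(phi v ** phi (of_complex s), expdiag y)"
  have M: "p \<in> Mspace" "q \<in> Mspace" "?q \<in> Mspace" "?V \<in> Mspace"
    using F Fq v_unit 1(2) by (simp_all add: fiber_def flip: phi_mult)
  have q: "?q = sp_act (phi \<zeta>2) ?V"
    using sp_act_inverse[OF s1 M(3)] by (simp add: 1(3) 2(2))
  have "sp_act ?P p = sp_act (phi (of_complex c)) (sp_act (phi \<zeta>0) p)" by (rule sp_act_mult[OF c(2) s0 M(1), symmetric])
  also have "\<dots> = fp (\<zeta>, r0 * cnj c, s * cnj c)"
    unfolding 0(3) sp_act_circle[OF c(2,1) x(1)] by (simp add: first_point_def)
  finally have e1: "sp_act ?P p = fp (\<zeta>, r0 * cnj c, s * cnj c)" .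
  have "sp_act ?P q = sp_act (phi (of_complex c)) ?q" by (rule sp_act_mult[OF c(2) s0 M(2), symmetric])
  also have "\<dots> = sp_act (phi (of_complex c) ** phi \<zeta>2) ?V" unfolding q by (rule sp_act_mult[OF c(2) s2 M(4)])
  also have "phi (of_complex c) ** phi \<zeta>2 = phi \<zeta> ** phi (of_complex c)" by (simp add: c(4) flip: phi_mult)
  also have "sp_act (phi \<zeta> ** phi (of_complex c)) ?V = sp_act (phi \<zeta>) (sp_act (phi (of_complex c)) ?V)"
    by (rule sp_act_mult[OF s3 c(2) M(4), symmetric])
  also have "\<dots> = sp (\<zeta>, r0 * cnj c, s * cnj c)"
    unfolding sp_act_circle[OF c(2,1) y(1)] second_point_sp_act by simp
  finally have e2: "sp_act ?P q = sp (\<zeta>, r0 * cnj c, s * cnj c)" .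
  have "cmod (r0 * cnj c) = 1" "cmod (s * cnj c) = 1" using 0(2) 1(2) c(1) by (simp_all add: norm_mult)
  thus ?thesis using e1 e2 c(3) signed_perms_mult[OF c(2) s0] by blast
qed

end

section \<open>The listed classes are the minimising ones\<close>

text \<open>Comparing lengths for one permutation amounts to comparing the cosines of half-angles.\<close>

lemma max_length:
  fixes a b n :: real
  assumes k: "k > 0" and ab: "0 \<le> a" "a \<le> 1" "0 \<le> b" "b \<le> 1"
  defines "L \<equiv> \<lambda>c. sqrt (4 * k * (arccos c)\<^sup>2 + n)"
  shows "L (max a b) \<le> L a" "L (max a b) \<le> L b"
    "L a = L (max a b) \<longleftrightarrow> b \<le> a" "L b = L (max a b) \<longleftrightarrow> a \<le> b"
proof -
  have m: "a \<le> max a b" "b \<le> max a b" "max a b \<le> 1" using ab by auto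
  show "L (max a b) \<le> L a" "L (max a b) \<le> L b"
    unfolding L_def using cost_le(1)[OF k ab(1) m(1,3)] cost_le(1)[OF k ab(3) m(2,3)] by blast+
  show "L a = L (max a b) \<longleftrightarrow> b \<le> a" "L b = L (max a b) \<longleftrightarrow> a \<le> b"
    unfolding L_def cost_le(2)[OF k ab(1) m(1,3)] cost_le(2)[OF k ab(3) m(2,3)] by auto
qed

lemma max_divide_sqrt2: "max a b / sqrt 2 = max (a / sqrt 2) (b / sqrt 2)"
  by (simp add: max_def divide_le_cancel)

lemma listed_top_eq:
  "listed_top a b c z w = (if a \<le> b \<and> a \<le> c then labels_A z w else {})
     \<union> (if b \<le> a \<and> b \<le> c then labels_B z w else {}) \<union> (if c \<le> a \<and> c \<le> b then labels_C z w else {})"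
  unfolding listed_top_def by (auto simp: min_def)

lemma listed_mid_eq:
  assumes "(cmod z)\<^sup>2 + (cmod w)\<^sup>2 = 1"
  shows "listed_mid a b z w = (if a \<le> b then labels_A' z w else {})
     \<union> (if b \<le> a then (if z \<noteq> 0 \<and> w \<noteq> 0 then {B'} else {C'}) else {})"
proof -
  have "w = 0 \<Longrightarrow> z \<noteq> 0" using assms by auto
  thus ?thesis unfolding listed_mid_def labels_A'_def by auto
qed

lemma labels_iff:
    "l \<in> labels_A z w \<longleftrightarrow> (l = A1 \<and> cmod w \<le> cmod z) \<or> (l = A2 \<and> cmod z \<le> cmod w)"
    "l \<in> labels_B z w \<longleftrightarrow> (l = B1 \<and> 0 \<le> Re (cnj z * w)) \<or> (l = B2 \<and> Re (cnj z * w) \<le> 0)"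
    "l \<in> labels_C z w \<longleftrightarrow> (l = C1 \<and> 0 \<le> Im (cnj z * w)) \<or> (l = C2 \<and> Im (cnj z * w) \<le> 0)"
    "l \<in> labels_A' z w \<longleftrightarrow> (l = A1' \<and> cmod w \<le> cmod z) \<or> (l = A2' \<and> cmod z \<le> cmod w)"
  unfolding labels_A_def labels_B_def labels_C_def labels_A'_def by auto

context eigen_pair
begin

lemma norm_diag_log_quotient: "norm (diag_log (expdiag a ** matrix_inv (expdiag b))) = norm (a - b)"
  by (simp add: matrix_inv_expdiag expdiag_add norm_diag_log_expdiag)

lemma len_id_eq: "len_id k (expdiag x) (expdiag y) z w = sqrt (4 * k * (arccos (max (cmod z) (cmod w)))\<^sup>2 + (norm (y - x))\<^sup>2)"
  by (simp add: len_id_def angle_id_def norm_diag_log_quotient)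

lemma len_13_top_eq: "len_13_top k (expdiag x) (expdiag y) z w
    = sqrt (4 * k * (arccos (max (cmod (z + w) / sqrt 2) (cmod (z - w) / sqrt 2)))\<^sup>2 + (norm (zperm zeta_jp - x))\<^sup>2)"
  by (simp add: len_13_top_def angle_13_eq[OF zw] perm_act_expdiag norm_diag_log_quotient max_divide_sqrt2
      zperm_def mat_perm_zeta)

lemma len_12_top_eq: "len_12_top k (expdiag x) (expdiag y) z w
    = sqrt (4 * k * (arccos (max (cmod (z - \<i> * w) / sqrt 2) (cmod (z + \<i> * w) / sqrt 2)))\<^sup>2 + (norm (zperm zeta_kp - x))\<^sup>2)"
  by (simp add: len_12_top_def angle_12_eq[OF zw] perm_act_expdiag norm_diag_log_quotient max_divide_sqrt2
      zperm_def mat_perm_zeta)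

lemma len_13_mid_eq: "len_13_mid k (expdiag x) (expdiag y) z w
    = sqrt (4 * k * (arccos ((cmod z + cmod w) / sqrt 2))\<^sup>2 + (norm (zperm zeta_jp - x))\<^sup>2)"
  by (simp add: len_13_mid_def angle_13_mid_eq(1)[OF zw] perm_act_expdiag norm_diag_log_quotient
      zperm_def mat_perm_zeta)

lemma best_bounds: "0 \<le> best z w l" "best z w l \<le> 1"
proof -
  have m: "cmod z \<le> 1" "cmod w \<le> 1" using max_cmod_bounds[OF zw] by auto
  have t: "max (cmod (z + w)) (cmod (z - w)) / sqrt 2 \<le> 1"
    "max (cmod (z - \<i> * w)) (cmod (z + \<i> * w)) / sqrt 2 \<le> 1"
    by (rule max_pm(2)[OF zw cmod_pm(1,2)[OF zw]], rule max_pm(2)[OF zw cmod_pm(3,4)[OF zw]])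
  show "0 \<le> best z w l" by (cases l) (simp_all add: best_def)
  show "best z w l \<le> 1"
    using m t[unfolded max_divide_sqrt2] angle_13_mid_eq(2)[OF zw] by (cases l) (simp_all add: best_def)
qed

abbreviation (input) "lid \<equiv> len_id k (expdiag x) (expdiag y) z w"
abbreviation (input) "l13 \<equiv> len_13_top k (expdiag x) (expdiag y) z w"
abbreviation (input) "l12 \<equiv> len_12_top k (expdiag x) (expdiag y) z w"
abbreviation (input) "l13m \<equiv> len_13_mid k (expdiag x) (expdiag y) z w"

lemma lengths_A:
  "lid \<le> label_length A1" "lid \<le> label_length A2"
  "label_length A1 = lid \<longleftrightarrow> cmod w \<le> cmod z" "label_length A2 = lid \<longleftrightarrow> cmod z \<le> cmod w"
  using max_length[OF k best_bounds[of A1] best_bounds[of A2], of "(norm (y - x))\<^sup>2"]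
  unfolding len_id_eq label_length_def by (simp_all add: label_zeta_def best_def zperm_simps)

lemma lengths_B:
  "l13 \<le> label_length B1" "l13 \<le> label_length B2"
  "label_length B1 = l13 \<longleftrightarrow> 0 \<le> Re (cnj z * w)" "label_length B2 = l13 \<longleftrightarrow> Re (cnj z * w) \<le> 0"
proof -
  note m = max_length[OF k best_bounds[of B1] best_bounds[of B2], of "(norm (zperm zeta_jp - x))\<^sup>2"]
  have ll: "label_length B1 = sqrt (4 * k * (arccos (best z w B1))\<^sup>2 + (norm (zperm zeta_jp - x))\<^sup>2)"
    "label_length B2 = sqrt (4 * k * (arccos (best z w B2))\<^sup>2 + (norm (zperm zeta_jp - x))\<^sup>2)"
    "l13 = sqrt (4 * k * (arccos (max (best z w B1) (best z w B2)))\<^sup>2 + (norm (zperm zeta_jp - x))\<^sup>2)"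
    by (simp_all add: label_length_def label_zeta_def zperm_simps len_13_top_eq best_def)
  have o: "best z w B2 \<le> best z w B1 \<longleftrightarrow> 0 \<le> Re (cnj z * w)" "best z w B1 \<le> best z w B2 \<longleftrightarrow> Re (cnj z * w) \<le> 0"
    using max_pm(4,5)[OF zw cmod_pm(1,2)[OF zw]] unfolding best_def label.case by (simp_all only: divide_le_cancel) simp_all
  show "l13 \<le> label_length B1" "l13 \<le> label_length B2" unfolding ll by (rule m(1), rule m(2))
  show "label_length B1 = l13 \<longleftrightarrow> 0 \<le> Re (cnj z * w)" "label_length B2 = l13 \<longleftrightarrow> Re (cnj z * w) \<le> 0"
    unfolding ll m(3,4) by (rule o(1), rule o(2))
qed

lemma lengths_C:
  "l12 \<le> label_length C1" "l12 \<le> label_length C2"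
  "label_length C1 = l12 \<longleftrightarrow> 0 \<le> Im (cnj z * w)" "label_length C2 = l12 \<longleftrightarrow> Im (cnj z * w) \<le> 0"
proof -
  note m = max_length[OF k best_bounds[of C1] best_bounds[of C2], of "(norm (zperm zeta_kp - x))\<^sup>2"]
  have ll: "label_length C1 = sqrt (4 * k * (arccos (best z w C1))\<^sup>2 + (norm (zperm zeta_kp - x))\<^sup>2)"
    "label_length C2 = sqrt (4 * k * (arccos (best z w C2))\<^sup>2 + (norm (zperm zeta_kp - x))\<^sup>2)"
    "l12 = sqrt (4 * k * (arccos (max (best z w C1) (best z w C2)))\<^sup>2 + (norm (zperm zeta_kp - x))\<^sup>2)"
    by (simp_all add: label_length_def label_zeta_def zperm_simps len_12_top_eq best_def)
  have o: "best z w C2 \<le> best z w C1 \<longleftrightarrow> 0 \<le> Im (cnj z * w)" "best z w C1 \<le> best z w C2 \<longleftrightarrow> Im (cnj z * w) \<le> 0"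
    using max_pm(4,5)[OF zw cmod_pm(3,4)[OF zw]] unfolding best_def label.case by (simp_all only: divide_le_cancel) simp_all
  show "l12 \<le> label_length C1" "l12 \<le> label_length C2" unfolding ll by (rule m(1), rule m(2))
  show "label_length C1 = l12 \<longleftrightarrow> 0 \<le> Im (cnj z * w)" "label_length C2 = l12 \<longleftrightarrow> Im (cnj z * w) \<le> 0"
    unfolding ll m(3,4) by (rule o(1), rule o(2))
qed

lemma lengths_mid:
  "label_length A1' = label_length A1" "label_length A2' = label_length A2"
  "label_length B' = l13m" "label_length C' = l13m"
  by (simp_all add: label_length_def label_zeta_def best_def len_13_mid_eq)

lemma labels_lengths:
  "l \<in> labels_A z w \<longleftrightarrow> (l = A1 \<or> l = A2) \<and> label_length l = lid"
  "l \<in> labels_B z w \<longleftrightarrow> (l = B1 \<or> l = B2) \<and> label_length l = l13"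
  "l \<in> labels_C z w \<longleftrightarrow> (l = C1 \<or> l = C2) \<and> label_length l = l12"
  "l \<in> labels_A' z w \<longleftrightarrow> (l = A1' \<or> l = A2') \<and> label_length l = lid"
proof -
  note labels_iff[of l z w]
  thus
    "l \<in> labels_A z w \<longleftrightarrow> (l = A1 \<or> l = A2) \<and> label_length l = lid"
    "l \<in> labels_B z w \<longleftrightarrow> (l = B1 \<or> l = B2) \<and> label_length l = l13"
    "l \<in> labels_C z w \<longleftrightarrow> (l = C1 \<or> l = C2) \<and> label_length l = l12"
    "l \<in> labels_A' z w \<longleftrightarrow> (l = A1' \<or> l = A2') \<and> label_length l = lid"
    using lengths_A(3,4) lengths_B(3,4) lengths_C(3,4) lengths_mid(1,2) by metis+
qed

text \<open>Each of the three numbers is the smaller length of two classes, so the smallest of the six lengths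
  is the smallest of the three numbers.\<close>

lemma listed_top_minimal:
  "l \<in> listed_top lid l13 l12 z w \<longleftrightarrow> l \<in> top_classes \<and> (\<forall>l'\<in>top_classes. label_length l \<le> label_length l')"
proof -
  have A: "\<exists>l\<in>{A1, A2}. label_length l = lid" using lengths_A(3,4) by (cases "cmod w \<le> cmod z") auto
  have B: "\<exists>l\<in>{B1, B2}. label_length l = l13" using lengths_B(3,4) by (cases "0 \<le> Re (cnj z * w)") auto
  have C: "\<exists>l\<in>{C1, C2}. label_length l = l12" using lengths_C(3,4) by (cases "0 \<le> Im (cnj z * w)") auto
  have *: "(\<forall>l'\<in>top_classes. a \<le> label_length l') \<longleftrightarrow> a \<le> lid \<and> a \<le> l13 \<and> a \<le> l12" for a
  proof
    assume "\<forall>l'\<in>top_classes. a \<le> label_length l'"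
    thus "a \<le> lid \<and> a \<le> l13 \<and> a \<le> l12"
      using A B C unfolding top_classes_def by (metis insert_iff)
  next
    assume "a \<le> lid \<and> a \<le> l13 \<and> a \<le> l12"
    thus "\<forall>l'\<in>top_classes. a \<le> label_length l'"
      using lengths_A(1,2) lengths_B(1,2) lengths_C(1,2) unfolding top_classes_def by auto
  qed
  have e: "l \<in> (if P then S else {}) \<longleftrightarrow> P \<and> l \<in> S" for P and S :: "label set" by simp
  have key: "a \<le> b \<and> a \<le> c \<and> t = a \<longleftrightarrow> t \<le> a \<and> t \<le> b \<and> t \<le> c" if "a \<le> t" for a b c t :: real
    using that by auto
  consider (A) "l = A1 \<or> l = A2" "lid \<le> label_length l" | (B) "l = B1 \<or> l = B2" "l13 \<le> label_length l"
    | (C) "l = C1 \<or> l = C2" "l12 \<le> label_length l" | (N) "l \<notin> top_classes"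
    using lengths_A(1,2) lengths_B(1,2) lengths_C(1,2) unfolding top_classes_def by blast
  hence "((lid \<le> l13 \<and> lid \<le> l12) \<and> (l = A1 \<or> l = A2) \<and> label_length l = lid \<or>
        (l13 \<le> lid \<and> l13 \<le> l12) \<and> (l = B1 \<or> l = B2) \<and> label_length l = l13) \<or>
        (l12 \<le> lid \<and> l12 \<le> l13) \<and> (l = C1 \<or> l = C2) \<and> label_length l = l12 \<longleftrightarrow>
        l \<in> top_classes \<and> label_length l \<le> lid \<and> label_length l \<le> l13 \<and> label_length l \<le> l12"
  proof cases
    case A
    hence "l \<in> top_classes" "\<not> (l = B1 \<or> l = B2)" "\<not> (l = C1 \<or> l = C2)" by (auto simp: top_classes_def)
    thus ?thesis
      using key[OF A(2), of l13 l12] A(1) by blast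
  next
    case B
    hence "l \<in> top_classes" "\<not> (l = A1 \<or> l = A2)" "\<not> (l = C1 \<or> l = C2)" by (auto simp: top_classes_def)
    thus ?thesis
      using key[OF B(2), of lid l12] B(1) by blast
  next
    case C
    hence "l \<in> top_classes" "\<not> (l = A1 \<or> l = A2)" "\<not> (l = B1 \<or> l = B2)" by (auto simp: top_classes_def)
    thus ?thesis
      using key[OF C(2), of lid l13] C(1) by blast
  next
    case N
    hence "\<not> (l = A1 \<or> l = A2)" "\<not> (l = B1 \<or> l = B2)" "\<not> (l = C1 \<or> l = C2)" by (auto simp: top_classes_def)
    thus ?thesis
      using N by blast
  qed
  thus ?thesis unfolding * listed_top_eq Un_iff e labels_lengths .
qed

text \<open>Classes \<open>B'\<close> and \<open>C'\<close> share the length \<open>l13m\<close>, and exactly one of them is defined.\<close>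

lemma listed_mid_minimal:
  "l \<in> listed_mid lid l13m z w \<longleftrightarrow> l \<in> mid_classes \<and> class_defined z w l \<and> (\<forall>l'\<in>mid_classes. label_length l \<le> label_length l')"
proof -
  have A: "\<exists>l\<in>{A1', A2'}. label_length l = lid"
    using lengths_A(3,4) lengths_mid(1,2) by (cases "cmod w \<le> cmod z") auto
  have *: "(\<forall>l'\<in>mid_classes. a \<le> label_length l') \<longleftrightarrow> a \<le> lid \<and> a \<le> l13m" for a
  proof
    assume "\<forall>l'\<in>mid_classes. a \<le> label_length l'"
    thus "a \<le> lid \<and> a \<le> l13m"
      using A lengths_mid(3) unfolding mid_classes_def by (metis insert_iff)
  next
    assume "a \<le> lid \<and> a \<le> l13m"
    thus "\<forall>l'\<in>mid_classes. a \<le> label_length l'"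
      using lengths_A(1,2) lengths_mid unfolding mid_classes_def by auto
  qed
  have d: "label_length A1' = lid \<Longrightarrow> z \<noteq> 0" "label_length A2' = lid \<Longrightarrow> w \<noteq> 0"
    using lengths_A(3,4) lengths_mid(1,2) zw by auto
  have e: "l \<in> (if P then S else {}) \<longleftrightarrow> P \<and> l \<in> S" for P and S :: "label set" by simp
  have e': "l \<in> (if z \<noteq> 0 \<and> w \<noteq> 0 then {B'} else {C'}) \<longleftrightarrow> (l = B' \<or> l = C') \<and> class_defined z w l"
    by auto
  have key: "a \<le> b \<and> t = a \<longleftrightarrow> t \<le> a \<and> t \<le> b" if "a \<le> t" for a b t :: real
    using that by auto
  consider (A) "l = A1' \<or> l = A2'" "lid \<le> label_length l" | (B) "l = B' \<or> l = C'" "label_length l = l13m"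
    | (N) "l \<notin> mid_classes"
    using lengths_A(1,2)[folded lengths_mid] lengths_mid(3,4) unfolding mid_classes_def by blast
  hence "(lid \<le> l13m \<and> (l = A1' \<or> l = A2') \<and> label_length l = lid) \<or>
        (l13m \<le> lid \<and> (l = B' \<or> l = C') \<and> class_defined z w l) \<longleftrightarrow>
        l \<in> mid_classes \<and> class_defined z w l \<and> label_length l \<le> lid \<and> label_length l \<le> l13m"
  proof cases
    case A
    hence m: "l \<in> mid_classes" "\<not> (l = B' \<or> l = C')" by (auto simp: mid_classes_def)
    have "label_length l = lid \<Longrightarrow> class_defined z w l" using A(1) d by auto
    thus ?thesis
      using key[OF A(2), of l13m] A(1) m by blast
  next
    case B
    hence m: "l \<in> mid_classes" "\<not> (l = A1' \<or> l = A2')" by (auto simp: mid_classes_def)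
    show ?thesis
      unfolding B(2) using B(1) m by blast
  next
    case N
    hence "\<not> (l = A1' \<or> l = A2')" "\<not> (l = B' \<or> l = C')" by (auto simp: mid_classes_def)
    thus ?thesis
      using N by blast
  qed
  thus ?thesis unfolding * listed_mid_eq[OF zw] Un_iff e e' labels_lengths .
qed

text \<open>The complex number behind an undefined class is \<open>0\<close>, which makes the angle of the class \<open>\<pi> / 2\<close>, more
  than that of its companion with the same permutation.\<close>

lemma top_minimal_defined:
  assumes "l \<in> top_classes" "\<forall>l'\<in>top_classes. label_length l \<le> label_length l'"
  shows "class_defined z w l"
proof -
  have "l \<in> labels_A z w \<or> l \<in> labels_B z w \<or> l \<in> labels_C z w"
    using listed_top_minimal[of l] assms unfolding listed_top_eq by (auto split: if_splits)
  moreover have "cmod w \<le> cmod z \<Longrightarrow> z \<noteq> 0" "cmod z \<le> cmod w \<Longrightarrow> w \<noteq> 0" using zw by auto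
  moreover have "0 \<le> Re (cnj z * w) \<Longrightarrow> z + w \<noteq> 0" "Re (cnj z * w) \<le> 0 \<Longrightarrow> z - w \<noteq> 0"
    "0 \<le> Im (cnj z * w) \<Longrightarrow> z - \<i> * w \<noteq> 0" "Im (cnj z * w) \<le> 0 \<Longrightarrow> z + \<i> * w \<noteq> 0"
  proof -
    have p: "a \<noteq> 0" if "(cmod a)\<^sup>2 > 0" for a using that by auto
    show "0 \<le> Re (cnj z * w) \<Longrightarrow> z + w \<noteq> 0" "Re (cnj z * w) \<le> 0 \<Longrightarrow> z - w \<noteq> 0"
      "0 \<le> Im (cnj z * w) \<Longrightarrow> z - \<i> * w \<noteq> 0" "Im (cnj z * w) \<le> 0 \<Longrightarrow> z + \<i> * w \<noteq> 0"
      by (rule p; simp only: cmod_pm[OF zw])+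
  qed
  ultimately show ?thesis
    unfolding labels_iff by (elim disjE conjE) (simp_all only: class_defined.simps simp_thms)
qed

lemma label_zeta_top: "label_zeta ` top_classes = zetas_top"
  by (auto simp: top_classes_def label_zeta_def zetas_top_def)

lemma label_zeta_mid: "label_zeta ` mid_classes = zetas_mid"
  by (auto simp: mid_classes_def label_zeta_def zetas_mid_def)

text \<open>Proof obligations that need an argument are numbered in the order of the assumptions of \<open>class_pair\<close>:
  5 is \<open>reduction\<close>, 6 is \<open>second_fiber\<close>, 7 and 8 bound the overlap, 10 to 13 run from \<open>best_pos\<close> to
  \<open>optimal_defined\<close>.\<close>

lemma top_class_pair:
  assumes y: "y$1 \<noteq> y$2" "y$1 \<noteq> y$3" "y$2 \<noteq> y$3"
  shows "class_pair k X Y u v x y z w top_classes {1}"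
proof (unfold_locales, goal_cases)
  case (5 p q)
  have "\<exists>P\<in>signed_perms. \<exists>\<zeta>\<in>label_zeta ` top_classes. \<exists>r. cmod r = 1 \<and>
    sp_act P p = fp (\<zeta>, r, 1) \<and> sp_act P q = sp (\<zeta>, r, 1)"
    unfolding label_zeta_top by (rule reduction_top[OF y 5])
  thus ?case by auto
next
  case (6 l s r)
  have "phi (label_zeta l) \<in> signed_perms" using phi_zeta_signed label_zeta_top 6(1) by blast
  from sp_act_fiber[OF this FY] show ?case using 6(2) by (simp add: second_point_sp_act)
next
  case (7 l r s)
  thus ?case using overlap_top_le(1) by simp
next
  case (8 l r s)
  thus ?case using overlap_top_le(2) by simp
next
  case (10 l)
  thus ?case by (auto simp: top_classes_def best_def)
next
  case (11 l)
  thus ?case by (auto simp: top_classes_def triples_def)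
next
  case (12 l \<tau>)
  thus ?case
    by (auto simp: top_classes_def triples_def label_zeta_def norm_mult norm_sgn split: if_splits)
next
  case (13 l)
  thus ?case using top_minimal_defined by blast
qed (use label_zeta_top best_bounds in \<open>auto simp: top_classes_def\<close>)

lemma mid_class_pair:
  assumes y: "y$2 = y$3" "y$1 \<noteq> y$2"
  shows "class_pair k X Y u v x y z w mid_classes (sphere 0 1)"
proof (unfold_locales, goal_cases)
  case (4 l)
  thus ?case by (auto simp: mid_classes_def label_zeta_def zetas_top_def)
next
  case (5 p q)
  have "\<exists>P\<in>signed_perms. \<exists>\<zeta>\<in>label_zeta ` mid_classes. \<exists>r s. cmod r = 1 \<and> cmod s = 1 \<and>
    sp_act P p = fp (\<zeta>, r, s) \<and> sp_act P q = sp (\<zeta>, r, s)"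
    unfolding label_zeta_mid by (rule reduction_mid[OF y 5])
  thus ?case by auto
next
  case (6 l s r)
  have "label_zeta l \<in> zetas_top" using 6(1) by (auto simp: mid_classes_def label_zeta_def zetas_top_def)
  from sp_act_fiber[OF phi_zeta_signed[OF this] fiber_rotate[OF FY y(1), of s]] show ?case
    using 6(2) by (simp add: second_point_sp_act)
next
  case (7 l r s)
  thus ?case using overlap_mid_le(1) by simp
next
  case (8 l r s)
  thus ?case using overlap_mid_le(2)[OF _ _ _ _ zw] by simp
next
  case (10 l)
  have "0 < cmod z + cmod w" using max_cmod_bounds(1)[OF zw] norm_ge_zero[of z] norm_ge_zero[of w] by linarith
  hence "0 < (cmod z + cmod w) / sqrt 2" by simp
  thus ?case using 10 by (auto simp: mid_classes_def best_def)
next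
  case (11 l)
  have sq: "\<exists>r::complex. r\<^sup>2 = a" for a using power2_csqrt by blast
  have nz: "cmod z = 1" if "w = 0" using zw that by (simp add: power2_eq_1_iff) (smt (verit) norm_ge_zero)
  have nw: "cmod w = 1" if "z = 0" using zw that by (simp add: power2_eq_1_iff) (smt (verit) norm_ge_zero)
  have "class_triples z w C' \<noteq> {}" if "w = 0 \<or> z = 0"
  proof (cases "w = 0")
    case True
    hence "(zeta_jp, 1, cnj z) \<in> class_triples z w C'" using nz by simp
    thus ?thesis by blast
  next
    case False
    hence "(zeta_jp, 1, w) \<in> class_triples z w C'" using nw that by simp
    thus ?thesis by blast
  qed
  moreover have "class_triples z w B' \<noteq> {}" using sq by auto
  moreover have "class_triples z w A1' \<noteq> {}" "class_triples z w A2' \<noteq> {}" by (auto intro: exI[of _ 1])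
  ultimately have "class_triples z w l \<noteq> {}"
    using 11 unfolding mid_classes_def
    by (elim insertE emptyE) (simp_all only: class_defined.simps simp_thms)
  thus ?case using 11(2) by (simp add: triples_def)
next
  case (12 l \<tau>)
  have n: "cmod r = 1" if "r\<^sup>2 = a" "cmod a = 1" for r a
    using that by (metis norm_power norm_ge_zero power2_eq_1_iff order.trans not_one_le_zero neg_0_le_iff_le zero_le_one le_minus_one_simps(3))
  have T: "class_defined z w l" "\<tau> \<in> class_triples z w l" using 12(2) by (auto simp: triples_def split: if_splits)
  from 12(1) consider "l = A1'" | "l = A2'" | "l = B'" | "l = C'" by (auto simp: mid_classes_def)
  thus ?case
  proof cases
    case 1
    then obtain r s where "\<tau> = (1, r, s * r * cnj (sgn z))" "cmod r = 1" "s = 1 \<or> s = -1" "z \<noteq> 0" using T by auto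
    thus ?thesis using 1 by (auto simp: label_zeta_def norm_mult norm_sgn)
  next
    case 2
    then obtain r s where "\<tau> = (unit_j, r, s * cnj r * sgn w)" "cmod r = 1" "s = 1 \<or> s = -1" "w \<noteq> 0" using T by auto
    thus ?thesis using 2 by (auto simp: label_zeta_def norm_mult norm_sgn)
  next
    case 3
    then obtain r s where rs: "\<tau> = (zeta_jp, r, s)" "r\<^sup>2 = sgn w * sgn z" "s\<^sup>2 = sgn w * cnj (sgn z)" "z \<noteq> 0" "w \<noteq> 0"
      using T by auto
    have "cmod r = 1" by (rule n[OF rs(2)]) (use rs in \<open>simp add: norm_mult norm_sgn\<close>)
    moreover have "cmod s = 1" by (rule n[OF rs(3)]) (use rs in \<open>simp add: norm_mult norm_sgn\<close>)
    ultimately show ?thesis using rs(1) 3 by (simp add: label_zeta_def)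
  next
    case 4
    then obtain r s where "\<tau> = (zeta_jp, r, s)" "cmod r = 1" "cmod s = 1" using T by auto
    thus ?thesis using 4 by (simp add: label_zeta_def)
  qed
next
  case (13 l)
  have d: "z \<noteq> 0 \<and> w \<noteq> 0 \<or> (w = 0 \<or> z = 0)" by blast
  have "label_length A1' = lid \<Longrightarrow> z \<noteq> 0" "label_length A2' = lid \<Longrightarrow> w \<noteq> 0"
    using lengths_A(3,4) lengths_mid(1,2) zw by auto
  moreover have "label_length A1' = lid \<or> label_length A2' = lid"
    using lengths_A(3,4) lengths_mid(1,2) by (cases "cmod w \<le> cmod z") auto
  moreover have "lid \<le> label_length A1'" "lid \<le> label_length A2'" using lengths_A(1,2) lengths_mid(1,2) by simp_all
  ultimately have "l = A1' \<Longrightarrow> z \<noteq> 0" "l = A2' \<Longrightarrow> w \<noteq> 0"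
    using 13(2) unfolding mid_classes_def by force+
  moreover have "best z w B' = best z w C'" "label_zeta B' = label_zeta C'" by (simp_all add: best_def label_zeta_def)
  ultimately show ?case using 13(1) d unfolding mid_classes_def
    by (elim insertE emptyE) (auto simp: mid_classes_def)
qed (use best_bounds in \<open>auto simp: mid_classes_def\<close>)

end

section \<open>Changing the chosen components\<close>

lemma best_rotate:
  assumes "cmod c = 1"
  shows "best (c * z) (c * w) l = best z w l" "class_defined (c * z) (c * w) l \<longleftrightarrow> class_defined z w l"
proof -
  have n: "cmod (c * a) = cmod a" for a using assms by (simp add: norm_mult)
  have c0: "c \<noteq> 0" using assms by auto
  have e: "c * z + c * w = c * (z + w)" "c * z - c * w = c * (z - w)" "c * z - \<i> * (c * w) = c * (z - \<i> * w)"
    "c * z + \<i> * (c * w) = c * (z + \<i> * w)" by (simp_all add: algebra_simps)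
  show "best (c * z) (c * w) l = best z w l"
    unfolding best_def e n by (rule refl)
  show "class_defined (c * z) (c * w) l \<longleftrightarrow> class_defined z w l"
    by (cases l; simp only: class_defined.simps e mult_eq_0_iff c0 simp_thms)
qed

lemma best_mid_cong:
  assumes "l \<in> mid_classes" "cmod z' = cmod z" "cmod w' = cmod w"
  shows "best z' w' l = best z w l" "class_defined z' w' l \<longleftrightarrow> class_defined z w l"
proof -
  have "z' = 0 \<longleftrightarrow> z = 0" "w' = 0 \<longleftrightarrow> w = 0" using assms by (metis norm_eq_zero)+
  thus "best z' w' l = best z w l" "class_defined z' w' l \<longleftrightarrow> class_defined z w l"
    using assms by (auto simp: mid_classes_def best_def)
qed

lemma triple_curves_neg:
  assumes "\<sigma> = 1 \<or> \<sigma> = -1" "\<rho> = 1 \<or> \<rho> = -1"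
  shows "triple_curves k U D V \<Lambda> (\<zeta>, \<rho> * r, \<sigma> * s) = triple_curves k U D V \<Lambda> (\<zeta>, r, s)"
proof -
  have "phi (of_complex (- a)) = phi (of_complex a)" for a
    by (simp add: mat3_eq_iff phi_nth of_complex_def)
  hence "phi (of_complex (\<sigma> * s)) = phi (of_complex s)" "phi (of_complex (\<rho> * r)) = phi (of_complex r)"
    using assms by auto
  thus ?thesis by (simp add: triple_curves_def first_point_def second_point_def)
qed

text \<open>The quaternion between the moved base points is \<open>cnj \<rho> * (z + w j) * \<sigma>\<close> up to sign, and \<open>j\<close> conjugates
  complex numbers as they pass it.\<close>

lemma covers_change:
  assumes U: "U \<in> SO3" "V \<in> SO3" and c: "covers z w U V" "covers z' w' (U ** phi (of_complex \<rho>)) (V ** phi (of_complex \<sigma>))"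
    and n: "cmod \<rho> = 1" "cmod \<sigma> = 1"
  obtains e :: complex where "e = 1 \<or> e = -1" "z' = e * (cnj \<rho> * z * \<sigma>)" "w' = e * (cnj \<rho> * w * cnj \<sigma>)"
proof -
  let ?r = "of_complex \<rho>" and ?s = "of_complex \<sigma>"
  have W: "U ** phi ?r \<in> SO3" using U n by (simp add: SO3_mult phi_in_SO3)
  have "phi (quat_zw z' w') = transpose (U ** phi ?r) ** (V ** phi ?s)"
    using c(2) by (simp add: covers_def matrix_inv_SO3[OF W])
  also have "\<dots> = transpose (phi ?r) ** (transpose U ** V) ** phi ?s"
    by (simp only: matrix_transpose_mul matrix_mul_assoc)
  also have "transpose U ** V = phi (quat_zw z w)" using c(1) by (simp add: covers_def matrix_inv_SO3[OF U(1)])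
  also have "transpose (phi ?r) ** phi (quat_zw z w) ** phi ?s = phi (qcnj ?r * quat_zw z w * ?s)"
    by (simp add: phi_mult phi_qcnj)
  also have "qcnj ?r * quat_zw z w * ?s = quat_zw (cnj \<rho> * z * \<sigma>) (cnj \<rho> * w * cnj \<sigma>)"
    unfolding qcnj_of_complex unfolding of_complex_zw by (simp add: quat_zw_mult)
  finally have e: "phi (quat_zw (cnj \<rho> * z * \<sigma>) (cnj \<rho> * w * cnj \<sigma>)) = phi (quat_zw z' w')" by simp
  have "quat_zw (cnj \<rho> * z * \<sigma>) (cnj \<rho> * w * cnj \<sigma>) \<in> unit_quats" "quat_zw z' w' \<in> unit_quats"
    using c n by (simp_all add: covers_def norm_mult)
  from phi_eq_imp[OF this e]
  have "(z' = cnj \<rho> * z * \<sigma> \<and> w' = cnj \<rho> * w * cnj \<sigma>) \<or> (z' = - (cnj \<rho> * z * \<sigma>) \<and> w' = - (cnj \<rho> * w * cnj \<sigma>))"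
    unfolding quat_zw_eq quat.inject quat.sel by (auto simp: complex_eq_iff)
  thus thesis using that[of 1] that[of "-1"] by auto
qed

lemma overlap_change:
  assumes "e = 1 \<or> e = -1"
  shows "\<bar>overlap (e * (cnj \<rho> * z * \<sigma>)) (e * (cnj \<rho> * w * cnj \<sigma>)) (\<zeta>, r, s)\<bar> = \<bar>overlap z w (\<zeta>, \<rho> * r, \<sigma> * s)\<bar>"
proof -
  have "cnj r * (e * (cnj \<rho> * z * \<sigma>)) * s = e * (cnj (\<rho> * r) * z * (\<sigma> * s))"
    "cnj r * (e * (cnj \<rho> * w * cnj \<sigma>)) * cnj s = e * (cnj (\<rho> * r) * w * cnj (\<sigma> * s))"
    by (simp_all add: mult_ac)
  moreover have "\<bar>qinner \<zeta> (quat_zw (e * a) (e * b))\<bar> = \<bar>qinner \<zeta> (quat_zw a b)\<bar>" for a b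
    using assms by (auto simp: qinner_def quat_zw_eq)
  ultimately show ?thesis by (simp only: overlap_def prod.case)
qed

context class_pair
begin

lemma triples_iff:
  assumes "l \<in> classes"
  shows "(\<zeta>, r, s) \<in> triples z w l \<longleftrightarrow> class_defined z w l \<and> \<zeta> = label_zeta l \<and> cmod r = 1 \<and> s \<in> S \<and>
    \<bar>overlap z w (\<zeta>, r, s)\<bar> = best z w l"
  using triples_form[OF assms, of "(\<zeta>, r, s)"] overlap_eq[OF assms] triples_defined by blast

text \<open>Moving the base points inside their components rotates \<open>r\<close> and \<open>s\<close> by unit complex numbers,
  which maps the triples of the new base points onto those of the old ones.\<close>

lemma component_change:
  assumes c: "class_pair k X Y u' v' x y z' w' classes S"
    and UV: "phi u' = phi u ** phi (of_complex \<rho>)" "phi v' = phi v ** phi (of_complex \<sigma>)"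
    and n: "cmod \<rho> = 1" "cmod \<sigma> = 1" and S_rot: "\<And>s. s \<in> S \<longleftrightarrow> \<sigma> * s \<in> S"
    and e: "e = 1 \<or> e = -1" "z' = e * (cnj \<rho> * z * \<sigma>)" "w' = e * (cnj \<rho> * w * cnj \<sigma>)"
    and l: "l \<in> classes" and b: "best z' w' l = best z w l" "class_defined z' w' l \<longleftrightarrow> class_defined z w l"
  shows "class_curves k (phi u') (expdiag x) (phi v') (expdiag y) z' w' l
    = class_curves k (phi u) (expdiag x) (phi v) (expdiag y) z w l"
proof -
  have tr: "(\<zeta>, r, s) \<in> triples z' w' l \<longleftrightarrow> (\<zeta>, \<rho> * r, \<sigma> * s) \<in> triples z w l" for \<zeta> r s
    unfolding class_pair.triples_iff[OF c l] triples_iff[OF l] b S_rot[of s] unfolding e(2,3) overlap_change[OF e(1)]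
    using n by (simp add: norm_mult)
  have cu: "triple_curves k (phi u') (expdiag x) (phi v') (expdiag y) (\<zeta>, r, s) = curves (\<zeta>, \<rho> * r, \<sigma> * s)" for \<zeta> r s
    by (simp add: triple_curves_def first_point_def second_point_def UV of_complex_mult phi_mult matrix_mul_assoc)
  show ?thesis
  proof (intro equalityI subsetI)
    fix \<kappa> assume "\<kappa> \<in> class_curves k (phi u') (expdiag x) (phi v') (expdiag y) z' w' l"
    then obtain \<zeta> r s where "(\<zeta>, r, s) \<in> triples z' w' l"
        "\<kappa> \<in> triple_curves k (phi u') (expdiag x) (phi v') (expdiag y) (\<zeta>, r, s)"
      by (auto simp: class_curves_def)
    thus "\<kappa> \<in> class_curves k (phi u) (expdiag x) (phi v) (expdiag y) z w l"
      unfolding cu tr class_curves_def by blast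
  next
    fix \<kappa> assume "\<kappa> \<in> class_curves k (phi u) (expdiag x) (phi v) (expdiag y) z w l"
    then obtain \<zeta> r s where rs: "(\<zeta>, r, s) \<in> triples z w l" "\<kappa> \<in> curves (\<zeta>, r, s)" by (auto simp: class_curves_def)
    have "\<rho> * (cnj \<rho> * r) = r" "\<sigma> * (cnj \<sigma> * s) = s" using unit_cnj_cancel n by simp_all
    with rs tr[of \<zeta> "cnj \<rho> * r" "cnj \<sigma> * s"] cu[of \<zeta> "cnj \<rho> * r" "cnj \<sigma> * s"]
    have "(\<zeta>, cnj \<rho> * r, cnj \<sigma> * s) \<in> triples z' w' l"
        "\<kappa> \<in> triple_curves k (phi u') (expdiag x) (phi v') (expdiag y) (\<zeta>, cnj \<rho> * r, cnj \<sigma> * s)" by simp_all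
    thus "\<kappa> \<in> class_curves k (phi u') (expdiag x) (phi v') (expdiag y) z' w' l"
      unfolding class_curves_def by blast
  qed
qed

lemma curves_eq:
  assumes "l \<in> classes" "\<tau> \<in> triples z w l"
  shows "curves \<tau> = {src (fquat \<tau>) x (squat \<tau>) (zperm (fst \<tau>))}"
  by (rule triple_curves_eq[OF admissible_triples[OF assms] overlap_triples(2)[OF assms]])

text \<open>The curves of two triples start in the same component, which is the situation of \<open>src_eq_imp\<close>.\<close>

lemma curves_meet:
  assumes l: "l1 \<in> classes" "l2 \<in> classes" and \<tau>: "\<tau>1 \<in> triples z w l1" "\<tau>2 \<in> triples z w l2"
    and c: "curves \<tau>1 = curves \<tau>2"
  shows "zperm (label_zeta l1) $ 1 = zperm (label_zeta l2) $ 1" "phi (qcnj (squat \<tau>2) * squat \<tau>1) $ 1 $ 1 = 1"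
proof -
  obtain r1 s1 r2 s2 where f: "\<tau>1 = (label_zeta l1, r1, s1)" "cmod r1 = 1" "\<tau>2 = (label_zeta l2, r2, s2)" "cmod r2 = 1"
    using triples_form[OF l(1) \<tau>(1)] triples_form[OF l(2) \<tau>(2)] by blast
  note a = admissible_triples[OF l(1) \<tau>(1)] admissible_triples[OF l(2) \<tau>(2)]
  have q: "fquat \<tau>1 = u * of_complex r1" "fquat \<tau>2 = u * of_complex r2" by (simp_all add: fquat_def f)
  have nz: "qinner (fquat \<tau>1) (squat \<tau>1) \<noteq> 0" "qinner (fquat \<tau>2) (squat \<tau>2) \<noteq> 0"
    using qinner_overlap[OF a(1)] qinner_overlap[OF a(2)] overlap_triples(2)[OF l(1) \<tau>(1)] overlap_triples(2)[OF l(2) \<tau>(2)]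
    by simp_all
  have "src (fquat \<tau>1) x (squat \<tau>1) (zperm (fst \<tau>1)) = src (fquat \<tau>2) x (squat \<tau>2) (zperm (fst \<tau>2))"
    using c unfolding curves_eq[OF l(1) \<tau>(1)] curves_eq[OF l(2) \<tau>(2)] by simp
  from src_eq_imp[OF u squat_unit[OF a(1)] squat_unit[OF a(2)] f(2,4) nz[unfolded q] x this[unfolded q]]
  show "zperm (label_zeta l1) $ 1 = zperm (label_zeta l2) $ 1" "phi (qcnj (squat \<tau>2) * squat \<tau>1) $ 1 $ 1 = 1"
    by (simp_all add: f)
qed

lemma class_curves_single:
  assumes "l \<in> classes" "class_defined z w l" "\<And>\<tau> \<tau>'. \<lbrakk>\<tau> \<in> triples z w l; \<tau>' \<in> triples z w l\<rbrakk> \<Longrightarrow> curves \<tau> = curves \<tau>'"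
  shows "\<exists>c. class_curves k (phi u) (expdiag x) (phi v) (expdiag y) z w l = {c} \<and> (\<forall>\<tau>\<in>triples z w l. curves \<tau> = {c})"
proof -
  obtain \<tau> where t: "\<tau> \<in> triples z w l" using triples_nonempty[OF assms(1,2)] by blast
  obtain c where c: "curves \<tau> = {c}" using curves_eq[OF assms(1) t] by blast
  have e: "curves \<tau>' = {c}" if "\<tau>' \<in> triples z w l" for \<tau>' using assms(3)[OF that t] c by simp
  have "class_curves k (phi u) (expdiag x) (phi v) (expdiag y) z w l = {c}"
    unfolding class_curves_def using e t by auto
  thus ?thesis using e by blast
qed

text \<open>If the second point already lies in the component of a standard second point, the pair is in standard
  form without the help of the group.\<close>

lemma minimal_pair_component:
  assumes comp: "\<And>l q. \<lbrakk>l \<in> classes; q \<in> fiber_component Y (sp (label_zeta l, 1, 1))\<rbrakk> \<Longrightarrow>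
      \<exists>s\<in>S. \<forall>r. q = sp (label_zeta l, r, s)"
    and mp: "minimal_pair k X Y p q" and p: "p \<in> fiber_component X (phi u, expdiag x)"
    and l: "l \<in> classes" and q: "q \<in> fiber_component Y (sp (label_zeta l, 1, 1))"
  shows "\<exists>l\<in>minimizers. \<exists>\<tau>\<in>triples z w l. p = fp \<tau> \<and> q = sp \<tau>"
proof -
  obtain r where r: "cmod r = 1" "p = (phi u ** phi (of_complex r), expdiag x)"
    using p unfolding mid_fiber_component[OF FX x] by blast
  obtain s where s: "s \<in> S" "\<And>r. q = sp (label_zeta l, r, s)" using comp[OF l q] by blast
  have pe: "p = fp (label_zeta l, r, s)" using r(2) by (simp add: first_point_def)
  have "dM k p q = min_length" by (rule minimal_pair_imp_dM(3)[OF mp])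
  hence "\<exists>l'\<in>minimizers. (label_zeta l, r, s) \<in> triples z w l'"
    using dM_min_length(2)[OF l r(1) s(1)] pe s(2)[of r] by simp
  thus ?thesis using pe s(2)[of r] by blast
qed

end

section \<open>Classes of single curves\<close>

context eigen_pair
begin

lemma top_component:
  assumes y: "y$1 \<noteq> y$2" "y$1 \<noteq> y$3" "y$2 \<noteq> y$3" and z: "\<zeta> \<in> zetas_top"
    and q: "q \<in> fiber_component Y (sp (\<zeta>, 1, 1))"
  shows "q = sp (\<zeta>, r, 1)"
proof -
  have e: "sp (\<zeta>, r, 1) = (phi v ** matrix_inv (phi \<zeta>), expdiag (zperm \<zeta>))" for r
    by (simp add: second_point_def perm_act_expdiag zperm_def)
  have F: "sp (\<zeta>, 1, 1) \<in> fiber Y"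
    using sp_act_fiber[OF phi_zeta_signed[OF z] FY] by (simp add: second_point_sp_act)
  have "zperm \<zeta> $ 1 \<noteq> zperm \<zeta> $ 2" "zperm \<zeta> $ 1 \<noteq> zperm \<zeta> $ 3" "zperm \<zeta> $ 2 \<noteq> zperm \<zeta> $ 3"
    using z y unfolding zetas_top_def by (auto simp: zperm_simps)
  from top_fiber_component[OF F[unfolded e] this] show ?thesis using q unfolding e by simp
qed

lemma continuous_sp_act: "continuous_on A (sp_act P)"
proof -
  have "continuous_on A (\<lambda>p. perm_act \<pi> (snd p))" for \<pi>
    unfolding perm_act_def
  proof (intro continuous_on_vec_lambda)
    fix i j :: 3
    show "continuous_on A (\<lambda>p. if i = j then snd p $ inv \<pi> i $ inv \<pi> i else 0)"
      by (cases "i = j") (simp_all add: continuous_intros)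
  qed
  thus ?thesis unfolding sp_act_def matrix_matrix_mult_def by (intro continuous_intros)
qed

text \<open>The component is the image under the homeomorphism \<open>sp_act (phi \<zeta>)\<close> of the circle through the base point.\<close>

lemma mid_component:
  assumes y: "y$2 = y$3" "y$1 \<noteq> y$2" and z: "\<zeta> \<in> zetas_top"
    and q: "q \<in> fiber_component Y (sp (\<zeta>, 1, 1))"
  shows "\<exists>s\<in>sphere 0 1. \<forall>r. q = sp (\<zeta>, r, s)"
proof -
  note zs = phi_zeta_signed[OF z]
  let ?T = "sp_act (transpose (phi \<zeta>))" and ?p = "sp_act (phi \<zeta>) (phi v, expdiag y)"
  have p: "sp (\<zeta>, 1, 1) = ?p" by (simp add: second_point_sp_act)
  let ?C = "fiber_component Y ?p"
  have M: "(phi v, expdiag y) \<in> Mspace" using FY by (simp add: fiber_def)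
  have T: "?T ?p = (phi v, expdiag y)" by (rule sp_act_inverse[OF zs M])
  have pC: "?p \<in> ?C" using sp_act_fiber[OF zs FY] by (simp add: fiber_component_def connected_component_refl_eq)
  have "connected (?T ` ?C)"
    by (intro connected_continuous_image continuous_sp_act) (simp add: fiber_component_def)
  moreover have "?T ` ?C \<subseteq> fiber Y"
    using sp_act_fiber[OF signed_perms_transpose[OF zs]] fiber_component_sub by blast
  moreover have "(phi v, expdiag y) \<in> ?T ` ?C" using T pC by (metis imageI)
  ultimately have "?T ` ?C \<subseteq> fiber_component Y (phi v, expdiag y)"
    unfolding fiber_component_def by (intro connected_component_maximal)
  hence "?T q \<in> fiber_component Y (phi v, expdiag y)" using q unfolding p by blast
  then obtain s where s: "cmod s = 1" "?T q = (phi v ** phi (of_complex s), expdiag y)"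
    unfolding mid_fiber_component[OF FY y] by blast
  have "q \<in> Mspace" using fiber_component_sub[OF q] by (simp add: fiber_def)
  from sp_act_inverse[OF signed_perms_transpose[OF zs] this]
  have "q = sp_act (phi \<zeta>) (phi v ** phi (of_complex s), expdiag y)" by (simp add: s)
  thus ?thesis using s(1) by (intro bexI[of _ s]) (simp_all add: second_point_sp_act)
qed

lemma top_single:
  assumes y: "y$1 \<noteq> y$2" "y$1 \<noteq> y$3" "y$2 \<noteq> y$3" and l: "l \<in> top_classes" and t: "\<tau> \<in> triples z w l" "\<tau>' \<in> triples z w l"
  shows "triple_curves k U D V \<Lambda> \<tau> = triple_curves k U D V \<Lambda> \<tau>'"
proof -
  have "\<exists>\<zeta> \<xi> s s'. (s = 1 \<or> s = -1) \<and> (s' = 1 \<or> s' = -1) \<and> \<tau> = (\<zeta>, s * \<xi>, 1 * 1) \<and> \<tau>' = (\<zeta>, s' * \<xi>, 1 * 1)"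
    using l t unfolding top_classes_def triples_def by (elim insertE emptyE) (auto split: if_splits)
  thus ?thesis using triple_curves_neg by (metis (no_types, lifting))
qed

lemma B'_single:
  assumes t: "\<tau> \<in> triples z w B'" "\<tau>' \<in> triples z w B'"
  shows "triple_curves k U D V \<Lambda> \<tau> = triple_curves k U D V \<Lambda> \<tau>'"
proof -
  obtain r s r' s' where rs: "\<tau> = (zeta_jp, r, s)" "\<tau>' = (zeta_jp, r', s')" "r\<^sup>2 = r'\<^sup>2" "s\<^sup>2 = s'\<^sup>2"
    using t by (auto simp: triples_def split: if_splits)
  obtain \<rho> :: complex where "\<rho> = 1 \<or> \<rho> = -1" "r = \<rho> * r'" using rs(3) by (metis power2_eq_iff mult_1 mult_minus1)
  moreover obtain \<sigma> :: complex where "\<sigma> = 1 \<or> \<sigma> = -1" "s = \<sigma> * s'" using rs(4) by (metis power2_eq_iff mult_1 mult_minus1)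
  ultimately show ?thesis unfolding rs(1,2) by (simp only: triple_curves_neg)
qed

lemma unit_j_commute: "of_complex (cnj r) * qcnj unit_j = qcnj unit_j * of_complex r"
  by (simp add: of_complex_def qcnj_def unit_j_def times_quat_def)

text \<open>All curves of class \<open>A1'\<close>, and of class \<open>A2'\<close>, agree: passing from \<open>r = 1\<close> to \<open>r\<close> multiplies both
  ends of the lifted geodesic by \<open>r\<close> on the right, and \<open>phi r\<close> commutes with all diagonal matrices
  on the path because their last two entries coincide.\<close>

lemma A'_single:
  assumes y: "y$2 = y$3" "y$1 \<noteq> y$2"
  shows "\<tau> \<in> triples z w A1' \<Longrightarrow> curves \<tau>
      = curves (1, 1, cnj (sgn z))"
    and "\<tau> \<in> triples z w A2' \<Longrightarrow> curves \<tau>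
      = curves (unit_j, 1, sgn w)"
proof -
  interpret class_pair k X Y u v x y z w mid_classes "sphere 0 1" by (rule mid_class_pair[OF y])
  have mem: "A1' \<in> mid_classes" "A2' \<in> mid_classes" by (simp_all add: mid_classes_def)
  show "curves \<tau> = curves (1, 1, cnj (sgn z))" if t: "\<tau> \<in> triples z w A1'"
  proof -
    obtain r s where rs: "\<tau> = (1, r, s * r * cnj (sgn z))" "cmod r = 1" "s = 1 \<or> s = -1" "z \<noteq> 0"
      using t by (auto simp: triples_def split: if_splits)
    let ?t = "(1, r, r * cnj (sgn z))" and ?t1 = "(1, 1, cnj (sgn z)) :: triple"
    have m: "(1, r, s' * r * cnj (sgn z)) \<in> triples z w A1'" if "cmod r = 1" "s' = 1 \<or> s' = -1" for r s'
      using that rs(4) by (auto simp: triples_def)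
    have t: "?t \<in> triples z w A1'" "?t1 \<in> triples z w A1'" using m[of r 1] m[of 1 1] rs(2) by simp_all
    note ad = admissible_triples[OF mem(1) t(2)]
    have "fquat ?t = fquat ?t1 * of_complex r" by (simp add: fquat_def)
    moreover have "squat ?t = squat ?t1 * of_complex r"
      by (simp add: squat_def mult.assoc flip: of_complex_mult) (simp add: mult.commute)
    ultimately have "curves ?t = curves ?t1"
      unfolding curves_eq[OF mem(1) t(1)] curves_eq[OF mem(1) t(2)]
      using src_rotate[OF fquat_unit[OF ad] squat_unit[OF ad] _ rs(2) x(1), of "zperm 1"]
        qinner_overlap[OF ad] overlap_triples(2)[OF mem(1) t(2)] y(1) by (simp add: zperm_simps)
    moreover have "curves \<tau> = curves ?t"
      using triple_curves_neg[OF rs(3), of 1, of k "phi u" "expdiag x" "phi v" "expdiag y" 1 r "r * cnj (sgn z)"]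
      by (simp add: rs(1) mult.assoc)
    ultimately show ?thesis by simp
  qed
  show "curves \<tau> = curves (unit_j, 1, sgn w)" if t: "\<tau> \<in> triples z w A2'"
  proof -
    obtain r s where rs: "\<tau> = (unit_j, r, s * cnj r * sgn w)" "cmod r = 1" "s = 1 \<or> s = -1" "w \<noteq> 0"
      using t by (auto simp: triples_def split: if_splits)
    let ?t = "(unit_j, r, cnj r * sgn w)" and ?t1 = "(unit_j, 1, sgn w) :: triple"
    have m: "(unit_j, r, s' * cnj r * sgn w) \<in> triples z w A2'" if "cmod r = 1" "s' = 1 \<or> s' = -1" for r s'
      using that rs(4) by (auto simp: triples_def)
    have t: "?t \<in> triples z w A2'" "?t1 \<in> triples z w A2'" using m[of r 1] m[of 1 1] rs(2) by simp_all
    note ad = admissible_triples[OF mem(2) t(2)]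
    have "fquat ?t = fquat ?t1 * of_complex r" by (simp add: fquat_def)
    moreover have "squat ?t = squat ?t1 * of_complex r"
    proof -
      have "squat ?t = v * of_complex (sgn w) * (of_complex (cnj r) * qcnj unit_j)"
        by (simp add: squat_def mult.commute[of "cnj r"]) (simp add: of_complex_mult mult.assoc)
      thus ?thesis unfolding unit_j_commute by (simp add: squat_def mult.assoc)
    qed
    ultimately have "curves ?t = curves ?t1"
      unfolding curves_eq[OF mem(2) t(1)] curves_eq[OF mem(2) t(2)]
      using src_rotate[OF fquat_unit[OF ad] squat_unit[OF ad] _ rs(2) x(1), of "zperm unit_j"]
        qinner_overlap[OF ad] overlap_triples(2)[OF mem(2) t(2)] y(1) by (simp add: zperm_simps)
    moreover have "curves \<tau> = curves ?t"
      using triple_curves_neg[OF rs(3), of 1, of k "phi u" "expdiag x" "phi v" "expdiag y" unit_j r "cnj r * sgn w"]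
      by (simp add: rs(1) mult.assoc)
    ultimately show ?thesis by simp
  qed
qed

end

section \<open>Distinct classes and the circle of curves\<close>

context eigen_pair
begin

text \<open>The first entry of the permuted \<open>y\<close> recovers the permutation, and the corner entry of the frame
  quotient separates the two classes with the same permutation.\<close>

lemma top_distinct:
  assumes y: "y$1 \<noteq> y$2" "y$1 \<noteq> y$3" "y$2 \<noteq> y$3" and l: "l1 \<in> top_classes" "l2 \<in> top_classes"
    and t: "\<tau>1 \<in> triples z w l1" "\<tau>2 \<in> triples z w l2"
    and c: "curves \<tau>1 = curves \<tau>2"
  shows "l1 = l2"
proof -
  interpret class_pair k X Y u v x y z w top_classes "{1}" by (rule top_class_pair[OF y])
  note m = curves_meet[OF l t c]
  obtain r1 r2 where r: "\<tau>1 = (label_zeta l1, r1, 1)" "\<tau>2 = (label_zeta l2, r2, 1)"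
    using triples_form[OF l(1) t(1)] triples_form[OF l(2) t(2)] by auto
  have p: "phi (label_zeta l2 * qcnj (label_zeta l1)) $ 1 $ 1 = 1"
    using m(2) v_unit by (simp add: r squat_def mult.assoc)
  have n: "phi (unit_j * qcnj 1) $ 1 $ 1 \<noteq> 1" "phi (1 * qcnj unit_j) $ 1 $ 1 \<noteq> 1"
    "phi (zeta_jp * qcnj zeta_jm) $ 1 $ 1 \<noteq> 1" "phi (zeta_jm * qcnj zeta_jp) $ 1 $ 1 \<noteq> 1"
    "phi (zeta_kp * qcnj zeta_km) $ 1 $ 1 \<noteq> 1" "phi (zeta_km * qcnj zeta_kp) $ 1 $ 1 \<noteq> 1"
    by (simp_all add: phi_nth times_quat_def qcnj_def one_quat_def unit_j_def zeta_jp_def zeta_jm_def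
        zeta_kp_def zeta_km_def power_divide)
  show ?thesis
    using l m(1) p n y unfolding top_classes_def
    by (elim insertE emptyE) (simp_all add: label_zeta_def zperm_simps del: mult_1 mult_1_right qcnj_simps)
qed

lemma phi_j_circle:
  assumes "cmod c = 1"
  shows "phi (unit_j * of_complex c) $ 1 $ 1 = -1" "phi (of_complex c * qcnj unit_j) $ 1 $ 1 = -1"
proof -
  have "(Re c)\<^sup>2 + (Im c)\<^sup>2 = 1" using assms by (simp add: cmod_def)
  thus "phi (unit_j * of_complex c) $ 1 $ 1 = -1" "phi (of_complex c * qcnj unit_j) $ 1 $ 1 = -1"
    by (simp_all add: phi_nth times_quat_def qcnj_def unit_j_def of_complex_def)
qed

text \<open>The first entry of the permuted \<open>y\<close> separates the identity from the transposition. Between \<open>A1'\<close> and \<open>A2'\<close>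
  the factor \<open>j\<close> reverses the first axis, so the corner entry would be \<open>-1\<close>.\<close>

lemma mid_distinct:
  assumes y: "y$2 = y$3" "y$1 \<noteq> y$2" and l: "l1 \<in> mid_classes" "l2 \<in> mid_classes"
    and t: "\<tau>1 \<in> triples z w l1" "\<tau>2 \<in> triples z w l2"
    and c: "curves \<tau>1 = curves \<tau>2"
  shows "l1 = l2 \<or> (l1 \<in> {B', C'} \<and> l2 \<in> {B', C'})"
proof -
  interpret class_pair k X Y u v x y z w mid_classes "sphere 0 1" by (rule mid_class_pair[OF y])
  note m = curves_meet[OF l t c]
  obtain r1 s1 r2 s2 where r: "\<tau>1 = (label_zeta l1, r1, s1)" "cmod s1 = 1" "\<tau>2 = (label_zeta l2, r2, s2)" "cmod s2 = 1"
    using triples_form[OF l(1) t(1)] triples_form[OF l(2) t(2)] by auto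
  have p: "phi (label_zeta l2 * of_complex (cnj s2 * s1) * qcnj (label_zeta l1)) $ 1 $ 1 = 1"
    using m(2) v_unit by (simp add: r squat_def mult.assoc of_complex_mult qcnj_of_complex)
  have "cmod (cnj s2 * s1) = 1" using r by (simp add: norm_mult)
  note j = phi_j_circle[OF this]
  have "\<not> (l1 = A1' \<and> l2 = A2')"
  proof
    assume "l1 = A1' \<and> l2 = A2'"
    thus False using p j(1) by (simp add: label_zeta_def)
  qed
  moreover have "\<not> (l1 = A2' \<and> l2 = A1')"
  proof
    assume "l1 = A2' \<and> l2 = A1'"
    thus False using p j(2) by (simp add: label_zeta_def)
  qed
  moreover have "\<not> (l1 \<in> {A1', A2'} \<and> l2 \<in> {B', C'})" "\<not> (l1 \<in> {B', C'} \<and> l2 \<in> {A1', A2'})"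
    using m(1) y by (auto simp: label_zeta_def zperm_simps)
  ultimately show ?thesis using l unfolding mid_classes_def by blast
qed

abbreviation (input) "C'_curves \<equiv> class_curves k (phi u) (expdiag x) (phi v) (expdiag y) z w C'"

text \<open>In class \<open>C'\<close> the third component of a triple is, up to sign, determined by the second one, which
  itself matters only up to sign; so the square of the second component parametrises the curves.\<close>

lemma C'_circle:
  assumes y: "y$2 = y$3" "y$1 \<noteq> y$2" and wz: "w = 0 \<or> z = 0"
  shows "\<exists>h. bij_betw h (sphere (0::complex) 1) C'_curves \<and> (\<forall>(\<zeta>, rU, rV)\<in>triples z w C'.
      curves (\<zeta>, rU, rV) = {h (rU\<^sup>2)})"
proof -
  interpret class_pair k X Y u v x y z w mid_classes "sphere 0 1" by (rule mid_class_pair[OF y])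
  have mem: "C' \<in> mid_classes" by (simp add: mid_classes_def)
  \<comment> \<open>\<open>g r\<close> is one of the two third components compatible with \<open>r\<close>, and \<open>t c\<close> a triple with \<open>r\<^sup>2 = c\<close>.\<close>
  define g where "g r = (if w = 0 then cnj z * r else w * cnj r)" for r
  define t where "t c = (zeta_jp, csqrt c, g (csqrt c))" for c
  have nz: "cmod z = 1" if "w = 0" using zw that by (simp add: power2_eq_1_iff) (smt (verit) norm_ge_zero)
  have nw: "cmod w = 1" if "z = 0" using zw that by (simp add: power2_eq_1_iff) (smt (verit) norm_ge_zero)
  have csq: "cmod (csqrt c) = 1" if "cmod c = 1" for c
    using that by (metis norm_power norm_ge_zero power2_csqrt power2_eq_1_iff order.trans neg_0_le_iff_le not_one_le_zero)
  have gn: "cmod (g r) = 1" if "cmod r = 1" for r using that nz nw wz by (auto simp: g_def norm_mult)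
  have tT: "t c \<in> triples z w C'" if "cmod c = 1" for c
  proof -
    note cs = unit_cnj_cancel[OF csq[OF that]]
    show ?thesis
    proof (cases "w = 0")
      case True
      have "g (csqrt c) * cnj (csqrt c) = cnj z" using cs(1) True by (simp add: g_def mult.assoc)
      thus ?thesis using True csq[OF that] gn[OF csq[OF that]] by (simp add: triples_def t_def)
    next
      case False
      have "g (csqrt c) * csqrt c = w" using cs(2) False by (simp add: g_def mult.assoc)
      thus ?thesis using False wz csq[OF that] gn[OF csq[OF that]] by (simp add: triples_def t_def)
    qed
  qed
  define h where "h c = the_elem (curves (t c))" for c
  have h: "curves (t c) = {h c}" if "cmod c = 1" for c
    using curves_eq[OF mem tT[OF that]] by (simp add: h_def)
  have tr: "curves (\<zeta>, rU, rV) = {h (rU\<^sup>2)} \<and> cmod (rU\<^sup>2) = 1" if T: "(\<zeta>, rU, rV) \<in> triples z w C'" for \<zeta> rU rV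
  proof -
    have T': "\<zeta> = zeta_jp" "cmod rU = 1" "cmod rV = 1"
        "w = 0 \<and> (rV * cnj rU = cnj z \<or> rV * cnj rU = - cnj z) \<or> z = 0 \<and> (rV * rU = w \<or> rV * rU = - w)"
      using T by (auto simp: triples_def split: if_splits)
    note rc = unit_cnj_cancel[OF T'(2)]
    have n: "cmod (rU\<^sup>2) = 1" using T'(2) by (simp add: norm_power)
    have sg: "\<exists>\<sigma>. (\<sigma> = 1 \<or> \<sigma> = -1) \<and> a = \<sigma> * b" if "a = b \<or> a = - b" for a b :: complex
      using that by (metis mult_1 mult_minus1)
    have "rU\<^sup>2 = (csqrt (rU\<^sup>2))\<^sup>2" by simp
    hence "rU = csqrt (rU\<^sup>2) \<or> rU = - csqrt (rU\<^sup>2)" by (simp only: power2_eq_iff)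
    then obtain \<rho> where \<rho>: "\<rho> = 1 \<or> \<rho> = -1" "rU = \<rho> * csqrt (rU\<^sup>2)" using sg by blast
    have "rV = g rU \<or> rV = - g rU"
    proof (cases "w = 0")
      case True
      hence "rV * cnj rU = cnj z \<or> rV * cnj rU = - cnj z" using T'(4) zw by auto
      hence "rV * cnj rU * rU = cnj z * rU \<or> rV * cnj rU * rU = - (cnj z * rU)" by (metis mult_minus_left)
      thus ?thesis using True rc(2) by (simp add: g_def mult.assoc)
    next
      case False
      hence "rV * rU = w \<or> rV * rU = - w" using T'(4) by auto
      hence "rV * rU * cnj rU = w * cnj rU \<or> rV * rU * cnj rU = - (w * cnj rU)" by (metis mult_minus_left)
      thus ?thesis using False rc(1) by (simp add: g_def mult.assoc)
    qed
    moreover have "g rU = g (csqrt (rU\<^sup>2)) \<or> g rU = - g (csqrt (rU\<^sup>2))"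
    proof -
      have "g (\<rho> * a) = \<rho> * g a" for a using \<rho>(1) by (auto simp: g_def)
      hence "g rU = \<rho> * g (csqrt (rU\<^sup>2))" using \<rho>(2) by metis
      thus ?thesis using \<rho>(1) by auto
    qed
    ultimately have "rV = g (csqrt (rU\<^sup>2)) \<or> rV = - g (csqrt (rU\<^sup>2))" by auto
    then obtain \<sigma> where \<sigma>: "\<sigma> = 1 \<or> \<sigma> = -1" "rV = \<sigma> * g (csqrt (rU\<^sup>2))" using sg by blast
    have "curves (\<zeta>, rU, rV) = curves (zeta_jp, \<rho> * csqrt (rU\<^sup>2), \<sigma> * g (csqrt (rU\<^sup>2)))"
      using T'(1) \<rho>(2) \<sigma>(2) by metis
    also have "\<dots> = curves (t (rU\<^sup>2))" unfolding t_def by (rule triple_curves_neg[OF \<sigma>(1) \<rho>(1)])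
    finally show ?thesis using h[OF n] n by simp
  qed
  have sq: "qcnj (squat (t c2)) * squat (t c1) = zeta_jp * of_complex (cnj (g (csqrt c2)) * g (csqrt c1)) * qcnj zeta_jp" for c1 c2
    using v_unit by (simp add: squat_def t_def mult.assoc of_complex_mult qcnj_of_complex)
  have "inj_on h (sphere 0 1)"
  proof (rule inj_onI)
    fix c1 c2 :: complex assume c: "c1 \<in> sphere 0 1" "c2 \<in> sphere 0 1" "h c1 = h c2"
    hence n: "cmod c1 = 1" "cmod c2 = 1" by simp_all
    let ?r1 = "csqrt c1" and ?r2 = "csqrt c2"
    let ?\<sigma> = "cnj (g ?r2) * g ?r1"
    have "curves (t c1) = curves (t c2)" using h[OF n(1)] h[OF n(2)] c(3) by simp
    from curves_meet(2)[OF mem mem tT[OF n(1)] tT[OF n(2)] this]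
    have p: "phi (zeta_jp * of_complex ?\<sigma> * qcnj zeta_jp) $ 1 $ 1 = 1" unfolding sq .
    \<comment> \<open>Conjugation by \<open>zeta_jp\<close> turns the rotation about the first axis by twice the argument of \<open>\<sigma>\<close> into one
       about the third axis, which moves the first axis unless \<open>\<sigma> = \<plusminus>1\<close>.\<close>
    have "phi (zeta_jp * of_complex \<sigma> * qcnj zeta_jp) $ 1 $ 1 = (Re \<sigma>)\<^sup>2 - (Im \<sigma>)\<^sup>2" for \<sigma>
      by (simp add: phi_nth times_quat_def qcnj_def zeta_jp_def of_complex_def field_simps power2_eq_square)
    hence "(Re ?\<sigma>)\<^sup>2 - (Im ?\<sigma>)\<^sup>2 = 1" using p by simp
    moreover have "cmod ?\<sigma> = 1" using gn[OF csq[OF n(1)]] gn[OF csq[OF n(2)]] by (simp add: norm_mult)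
    hence "(Re ?\<sigma>)\<^sup>2 + (Im ?\<sigma>)\<^sup>2 = 1" by (simp only: cmod_power2[symmetric]) simp
    ultimately have "(Im ?\<sigma>)\<^sup>2 = 0" "(Re ?\<sigma>)\<^sup>2 = 1" by linarith+
    hence s2: "?\<sigma>\<^sup>2 = 1" by (simp only: complex_eq_iff) (simp add: power2_eq_square)
    show "c1 = c2"
    proof (cases "w = 0")
      case True
      have "?\<sigma> = (z * cnj z) * (cnj ?r2 * ?r1)" using True by (simp add: g_def mult_ac)
      hence "?\<sigma> = cnj ?r2 * ?r1" using unit_cnj_cancel(1)[OF nz[OF True]] by simp
      hence "(cnj ?r2 * ?r1)\<^sup>2 = 1" using s2 by simp
      hence "(?r2 * (cnj ?r2 * ?r1))\<^sup>2 = ?r2\<^sup>2" by (simp add: power_mult_distrib)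
      thus ?thesis using unit_cnj_cancel(3)[OF csq[OF n(2)]] by simp
    next
      case False
      hence z: "z = 0" using wz by simp
      have "?\<sigma> = (w * cnj w) * (?r2 * cnj ?r1)" using False by (simp add: g_def mult_ac)
      hence "?\<sigma> = ?r2 * cnj ?r1" using unit_cnj_cancel(1)[OF nw[OF z]] by simp
      hence "(?r2 * cnj ?r1)\<^sup>2 = 1" using s2 by simp
      hence "(?r1 * (cnj ?r1 * ?r2))\<^sup>2 = ?r1\<^sup>2" by (simp add: power_mult_distrib mult_ac)
      thus ?thesis using unit_cnj_cancel(3)[OF csq[OF n(1)]] by simp
    qed
  qed
  moreover have "h ` sphere 0 1 = C'_curves"
  proof (intro equalityI subsetI)
    fix c assume "c \<in> h ` sphere 0 1"
    then obtain a where "cmod a = 1" "c = h a" by auto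
    thus "c \<in> C'_curves" using h tT unfolding class_curves_def by blast
  next
    fix c assume "c \<in> C'_curves"
    then obtain \<zeta> rU rV where T: "(\<zeta>, rU, rV) \<in> triples z w C'" "c \<in> curves (\<zeta>, rU, rV)"
      by (auto simp: class_curves_def)
    thus "c \<in> h ` sphere 0 1" using tr[OF T(1)] by auto
  qed
  ultimately have "bij_betw h (sphere 0 1) C'_curves" by (simp add: bij_betw_def)
  thus ?thesis using tr by blast
qed

text \<open>Class \<open>C'\<close> can be described without reference to the chosen components: it consists of the
  curves of all pairs with the right diagonal parts at the distance of the class.\<close>

lemma C'_intrinsic:
  assumes y: "y$2 = y$3" "y$1 \<noteq> y$2" and wz: "w = 0 \<or> z = 0"
  shows "C'_curves = {src g x h (vector [y$3, y$2, y$1]) | g h. g \<in> unit_quats \<and> h \<in> unit_quats \<and>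
    (phi g, expdiag x) \<in> fiber X \<and> (phi h, expdiag (vector [y$3, y$2, y$1])) \<in> fiber Y \<and> \<bar>qinner g h\<bar> = 1 / sqrt 2}"
    (is "_ = ?R")
proof -
  interpret class_pair k X Y u v x y z w mid_classes "sphere 0 1" by (rule mid_class_pair[OF y])
  have mem: "C' \<in> mid_classes" by (simp add: mid_classes_def)
  have nz: "cmod z = 1" if "w = 0" using zw that by (simp add: power2_eq_1_iff) (smt (verit) norm_ge_zero)
  have nw: "cmod w = 1" if "z = 0" using zw that by (simp add: power2_eq_1_iff) (smt (verit) norm_ge_zero)
  have bst: "best z w C' = 1 / sqrt 2" using wz nz nw by (auto simp: best_def)
  have zp: "zperm (label_zeta C') = vector [y$3, y$2, y$1]" by (simp add: label_zeta_def zperm_simps)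
  show ?thesis
  proof (intro equalityI subsetI)
    fix c assume "c \<in> C'_curves"
    then obtain \<tau> where T: "\<tau> \<in> triples z w C'" "c \<in> curves \<tau>" by (auto simp: class_curves_def)
    obtain r s where rs: "\<tau> = (label_zeta C', r, s)" "cmod r = 1" "s \<in> sphere 0 1" using triples_form[OF mem T(1)] by blast
    note ad = admissible_triples[OF mem T(1)]
    have "c = src (fquat \<tau>) x (squat \<tau>) (vector [y$3, y$2, y$1])"
      using T(2) curves_eq[OF mem T(1)] rs(1) zp by simp
    moreover have "(phi (fquat \<tau>), expdiag x) \<in> fiber X" "(phi (squat \<tau>), expdiag (vector [y$3, y$2, y$1])) \<in> fiber Y"
      using triple_fibers[OF mem rs(2,3)] rs(1) first_point_eq[of \<tau>] second_point_eq[OF ad] zp by simp_all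
    moreover have "\<bar>qinner (fquat \<tau>) (squat \<tau>)\<bar> = 1 / sqrt 2"
      using qinner_overlap[OF ad] overlap_triples(1)[OF mem T(1)] bst by simp
    ultimately show "c \<in> ?R" using fquat_unit[OF ad] squat_unit[OF ad] by blast
  next
    fix c assume "c \<in> ?R"
    then obtain g h where g: "c = src g x h (vector [y$3, y$2, y$1])" "g \<in> unit_quats" "h \<in> unit_quats"
      "(phi g, expdiag x) \<in> fiber X" "(phi h, expdiag (vector [y$3, y$2, y$1])) \<in> fiber Y" "\<bar>qinner g h\<bar> = 1 / sqrt 2"
      by blast
    obtain P l r s where P: "P \<in> signed_perms" "l \<in> mid_classes" "cmod r = 1" "s \<in> sphere 0 1"
      "sp_act P (phi g, expdiag x) = fp (label_zeta l, r, s)"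
      "sp_act P (phi h, expdiag (vector [y$3, y$2, y$1])) = sp (label_zeta l, r, s)"
      "dM k (phi g, expdiag x) (phi h, expdiag (vector [y$3, y$2, y$1])) = dM k (fp (label_zeta l, r, s)) (sp (label_zeta l, r, s))"
      by (rule reduce_pair[OF g(4,5)])
    note ad = admissible_class[OF P(2-4)]
    let ?\<pi> = "mat_perm P" and ?y = "vector [y$3, y$2, y$1] :: real^3"
    have px: "perm_vec ?\<pi> x = x" using P(5) by (simp add: sp_act_def first_point_eq perm_act_expdiag)
    have py: "perm_vec ?\<pi> ?y = zperm (label_zeta l)"
      using P(6) by (simp add: sp_act_def second_point_eq[OF ad] perm_act_expdiag)
    \<comment> \<open>\<open>P\<close> fixes the isolated entry of \<open>x\<close>, so it cannot carry the permuted \<open>y\<close> back to \<open>y\<close>.\<close>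
    have "x $ (inv ?\<pi> 1) = x $ 1" using arg_cong[OF px, of "\<lambda>a. a$1"] by (simp add: perm_vec_def)
    hence "inv ?\<pi> 1 = 1" using x exhaust_3[of "inv ?\<pi> 1"] by auto
    hence "zperm (label_zeta l) $ 1 = y$3" using arg_cong[OF py, of "\<lambda>a. a$1"] by (simp add: perm_vec_def)
    hence lz: "label_zeta l = label_zeta C'"
      using P(2) y unfolding mid_classes_def by (auto simp: label_zeta_def zperm_simps)
    let ?t = "(label_zeta C', r, s)"
    have adt: "admissible ?t" using ad lz by simp
    have e: "sp_act P (phi g, expdiag x) = (phi (fquat ?t), expdiag x)"
      "sp_act P (phi h, expdiag ?y) = (phi (squat ?t), expdiag ?y)"
      using P(5,6) lz first_point_eq[of ?t] second_point_eq[OF adt] zp by simp_all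
    note inv = sp_act_invariance[OF P(1) g(2,3) fquat_unit[OF adt] squat_unit[OF adt] e]
    have "\<bar>overlap z w ?t\<bar> = best z w C'" using inv(1) g(6) bst qinner_overlap[OF adt] by simp
    hence T: "?t \<in> triples z w C'" using overlap_eq[OF mem P(3,4)] wz by simp
    have "qinner g h \<noteq> 0" using g(6) by auto
    hence "c = src (fquat ?t) x (squat ?t) ?y" using inv(3) g(1) by simp
    hence "c \<in> curves ?t" using curves_eq[OF mem T] zp by simp
    thus "c \<in> C'_curves" using T unfolding class_curves_def by blast
  qed
qed

lemma covers_self: "covers z w (phi u) (phi v)"
  using zw u by (simp add: covers_def matrix_inv_phi v phi_mult[symmetric])

lemma other_pair:
  assumes "u' \<in> unit_quats" "(phi u', expdiag x) \<in> fiber X" "(V', expdiag y) \<in> fiber Y" "covers z' w' (phi u') V'"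
  shows "eigen_pair k X Y u' (u' * quat_zw z' w') x y z' w'" "phi (u' * quat_zw z' w') = V'"
proof -
  have "phi (quat_zw z' w') = transpose (phi u') ** V'"
    using assms(1,4) by (simp add: covers_def matrix_inv_SO3 phi_in_SO3)
  thus e: "phi (u' * quat_zw z' w') = V'" using assms(1) by (simp add: phi_mult SO3_cancel phi_in_SO3)
  show "eigen_pair k X Y u' (u' * quat_zw z' w') x y z' w'"
    using assms k x by unfold_locales (simp_all add: e covers_def)
qed

lemma top_component_change:
  assumes y: "y$1 \<noteq> y$2" "y$1 \<noteq> y$3" "y$2 \<noteq> y$3"
    and U: "(U', D') \<in> fiber_component X (phi u, expdiag x)" and V: "(V', \<Lambda>') \<in> fiber_component Y (phi v, expdiag y)"
    and c: "covers z' w' U' V'" and l: "l \<in> top_classes"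
  shows "class_defined z' w' l \<longleftrightarrow> class_defined z w l"
    and "class_curves k U' D' V' \<Lambda>' z' w' l = class_curves k (phi u) (expdiag x) (phi v) (expdiag y) z w l"
proof -
  interpret class_pair k X Y u v x y z w top_classes "{1}" by (rule top_class_pair[OF y])
  obtain \<rho> where \<rho>: "cmod \<rho> = 1" "U' = phi u ** phi (of_complex \<rho>)" "D' = expdiag x"
    using U unfolding mid_fiber_component[OF FX x] by auto
  have V': "V' = phi v" "\<Lambda>' = expdiag y" using V unfolding top_fiber_component[OF FY y] by auto
  let ?u = "u * of_complex \<rho>"
  have U': "U' = phi ?u" by (simp add: \<rho>(2) phi_mult)
  have uu: "?u \<in> unit_quats" using u \<rho>(1) by simp
  have F: "(phi ?u, expdiag x) \<in> fiber X" "(phi v, expdiag y) \<in> fiber Y"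
    using fiber_component_sub[OF U] fiber_component_sub[OF V] U' V' \<rho>(3) by simp_all
  note o = other_pair[OF uu F c[unfolded U' V']]
  have cc: "covers z' w' (phi u ** phi (of_complex \<rho>)) (phi v ** phi (of_complex 1))"
    using c by (simp add: \<rho>(2) V')
  obtain e where e: "e = 1 \<or> e = -1" "z' = e * (cnj \<rho> * z * 1)" "w' = e * (cnj \<rho> * w * cnj 1)"
    by (rule covers_change[OF phi_in_SO3[OF u] phi_in_SO3[OF v_unit] covers_self cc \<rho>(1)]) simp_all
  have ne: "cmod (e * cnj \<rho>) = 1" using e(1) \<rho>(1) by (auto simp: norm_mult)
  have zw': "z' = (e * cnj \<rho>) * z" "w' = (e * cnj \<rho>) * w" using e by simp_all
  note b = best_rotate[OF ne, of z w l, folded zw']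
  show "class_defined z' w' l \<longleftrightarrow> class_defined z w l" by (rule b(2))
  show "class_curves k U' D' V' \<Lambda>' z' w' l = class_curves k (phi u) (expdiag x) (phi v) (expdiag y) z w l"
  proof -
    have "phi ?u = phi u ** phi (of_complex \<rho>)" by (rule phi_mult)
    moreover have "phi (?u * quat_zw z' w') = phi v ** phi (of_complex 1)" unfolding o(2) by simp
    ultimately have "class_curves k (phi ?u) (expdiag x) (phi (?u * quat_zw z' w')) (expdiag y) z' w' l
        = class_curves k (phi u) (expdiag x) (phi v) (expdiag y) z w l"
      by (rule component_change[OF eigen_pair.top_class_pair[OF o(1) y] _ _ \<rho>(1) _ _ e l b(1,2)]) simp_all
    thus ?thesis unfolding o(2) by (simp only: U' V' \<rho>(3))
  qed
qed

lemma mid_component_change: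
  assumes y: "y$2 = y$3" "y$1 \<noteq> y$2"
    and U: "(U', D') \<in> fiber_component X (phi u, expdiag x)" and V: "(V', \<Lambda>') \<in> fiber_component Y (phi v, expdiag y)"
    and c: "covers z' w' U' V'" and l: "l \<in> mid_classes"
  shows "class_defined z' w' l \<longleftrightarrow> class_defined z w l"
    and "class_curves k U' D' V' \<Lambda>' z' w' l = class_curves k (phi u) (expdiag x) (phi v) (expdiag y) z w l"
proof -
  interpret class_pair k X Y u v x y z w mid_classes "sphere 0 1" by (rule mid_class_pair[OF y])
  obtain \<rho> where \<rho>: "cmod \<rho> = 1" "U' = phi u ** phi (of_complex \<rho>)" "D' = expdiag x"
    using U unfolding mid_fiber_component[OF FX x] by auto
  obtain \<sigma> where \<sigma>: "cmod \<sigma> = 1" "V' = phi v ** phi (of_complex \<sigma>)" "\<Lambda>' = expdiag y"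
    using V unfolding mid_fiber_component[OF FY y] by auto
  let ?u = "u * of_complex \<rho>"
  have U': "U' = phi ?u" by (simp add: \<rho>(2) phi_mult)
  have uu: "?u \<in> unit_quats" using u \<rho>(1) by simp
  have F: "(phi ?u, expdiag x) \<in> fiber X" "(V', expdiag y) \<in> fiber Y"
    using fiber_component_sub[OF U] fiber_component_sub[OF V] U' \<rho>(3) \<sigma>(3) by simp_all
  note o = other_pair[OF uu F c[unfolded U']]
  have cc: "covers z' w' (phi u ** phi (of_complex \<rho>)) (phi v ** phi (of_complex \<sigma>))"
    using c by (simp add: \<rho>(2) \<sigma>(2))
  obtain e where e: "e = 1 \<or> e = -1" "z' = e * (cnj \<rho> * z * \<sigma>)" "w' = e * (cnj \<rho> * w * cnj \<sigma>)"
    by (rule covers_change[OF phi_in_SO3[OF u] phi_in_SO3[OF v_unit] covers_self cc \<rho>(1) \<sigma>(1)])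
  have "cmod z' = cmod z" "cmod w' = cmod w" using e \<rho>(1) \<sigma>(1) by (auto simp: norm_mult)
  note b = best_mid_cong[OF l this]
  show "class_defined z' w' l \<longleftrightarrow> class_defined z w l" by (rule b(2))
  show "class_curves k U' D' V' \<Lambda>' z' w' l = class_curves k (phi u) (expdiag x) (phi v) (expdiag y) z w l"
  proof -
    have "phi ?u = phi u ** phi (of_complex \<rho>)" by (rule phi_mult)
    moreover have "phi (?u * quat_zw z' w') = phi v ** phi (of_complex \<sigma>)" unfolding o(2) by (rule \<sigma>(2))
    ultimately have "class_curves k (phi ?u) (expdiag x) (phi (?u * quat_zw z' w')) (expdiag y) z' w' l
        = class_curves k (phi u) (expdiag x) (phi v) (expdiag y) z w l"
      by (rule component_change[OF eigen_pair.mid_class_pair[OF o(1) y] _ _ \<rho>(1) \<sigma>(1) _ e l b(1,2)])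
         (simp add: norm_mult \<sigma>(1))
    thus ?thesis unfolding o(2) by (simp only: U' \<sigma>(3) \<rho>(3))
  qed
qed

end

text \<open>The isolated eigenvalue is the one whose eigenspace is a line, which determines the first entry; the
  other eigenvalue fills the remaining two places.\<close>

lemma mid_diagonal_unique:
  assumes F: "(U, expdiag x) \<in> fiber X" "(U', expdiag x') \<in> fiber X"
    and x: "x$2 = x$3" "x$1 \<noteq> x$2" and x': "x'$2 = x'$3" "x'$1 \<noteq> x'$2"
  shows "x' = x"
proof -
  let ?G = "transpose U ** U'"
  note G = fiber_entries[OF F]
  have z: "?G$i$j = 0" if "x'$j \<noteq> x$i" for i j using G(2) that by blast
  have "x'$1 = x$1"
  proof (rule ccontr)
    assume ne: "x'$1 \<noteq> x$1"
    obtain j where "?G$1$j \<noteq> 0" using SO3_row_norm[OF G(1), of 1] by force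
    hence "x'$j = x$1" using z by blast
    hence "x'$2 = x$1" using ne x' exhaust_3[of j] by auto
    hence "?G$2$2 = 0" "?G$3$2 = 0" "?G$2$3 = 0" "?G$3$3 = 0" using z x x' by auto
    hence "(?G$1$2)\<^sup>2 = 1" "(?G$1$3)\<^sup>2 = 1" using SO3_column_norm[OF G(1), of 2] SO3_column_norm[OF G(1), of 3] by simp_all
    thus False using SO3_row_norm[OF G(1), of 1] zero_le_power2[of "?G$1$1"] by simp
  qed
  moreover have "x'$2 = x$2"
  proof -
    obtain i where "?G$i$2 \<noteq> 0" using SO3_column_norm[OF G(1), of 2] by force
    hence "x'$2 = x$i" using z by blast
    thus ?thesis using x x' \<open>x'$1 = x$1\<close> exhaust_3[of i] by auto
  qed
  ultimately show ?thesis using x x' by (simp add: vec_eq_iff forall_3)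
qed

text \<open>The corner entry is \<open>(cmod z)\<^sup>2 - (cmod w)\<^sup>2\<close>. When the first columns of \<open>U\<close> and \<open>V\<close> span the eigenlines
  of the isolated eigenvalues, its square is intrinsic, while \<open>z\<close> and \<open>w\<close> are not.\<close>

lemma covers_degenerate_iff:
  assumes "covers z w U V" "U \<in> SO3"
  shows "w = 0 \<or> z = 0 \<longleftrightarrow> ((transpose U ** V) $ 1 $ 1)\<^sup>2 = 1"
proof -
  have n: "(cmod z)\<^sup>2 + (cmod w)\<^sup>2 = 1" using assms by (simp add: covers_def)
  have "(transpose U ** V) $ 1 $ 1 = phi (quat_zw z w) $ 1 $ 1"
    using assms by (simp add: covers_def matrix_inv_SO3)
  also have "\<dots> = (cmod z)\<^sup>2 - (cmod w)\<^sup>2" by (simp add: phi_nth quat_zw_eq cmod_power2)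
  finally have e: "(transpose U ** V) $ 1 $ 1 = (cmod z)\<^sup>2 - (cmod w)\<^sup>2" .
  have "((cmod z)\<^sup>2 - (cmod w)\<^sup>2)\<^sup>2 = ((cmod z)\<^sup>2 + (cmod w)\<^sup>2)\<^sup>2 - 4 * ((cmod z)\<^sup>2 * (cmod w)\<^sup>2)"
    by (simp add: power2_eq_square algebra_simps)
  thus ?thesis unfolding e n by auto
qed

text \<open>Both the condition \<open>w = 0 \<or> z = 0\<close> and the description of the class in \<open>C'_intrinsic\<close> are free of the
  choice of base points.\<close>

lemma (in eigen_pair) C'_independent:
  assumes y: "y$2 = y$3" "y$1 \<noteq> y$2" and wz: "w = 0 \<or> z = 0"
    and U: "(U', D') \<in> fiber X" "D' \<in> D_J1" and V: "(V', \<Lambda>') \<in> fiber Y" "\<Lambda>' \<in> D_J1" and c: "covers z' w' U' V'"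
  shows "w' = 0 \<or> z' = 0" "class_curves k U' D' V' \<Lambda>' z' w' C' = C'_curves"
proof -
  obtain x' where x': "D' = expdiag x'" "x'$2 = x'$3" "x'$1 \<noteq> x'$2" by (rule D_J1_expdiag[OF U(2)])
  obtain y' where y': "\<Lambda>' = expdiag y'" "y'$2 = y'$3" "y'$1 \<noteq> y'$2" by (rule D_J1_expdiag[OF V(2)])
  have D: "D' = expdiag x" using mid_diagonal_unique[OF FX U(1)[unfolded x'(1)] x x'(2,3)] x'(1) by simp
  have L: "\<Lambda>' = expdiag y" using mid_diagonal_unique[OF FY V(1)[unfolded y'(1)] y y'(2,3)] y'(1) by simp
  note FU = U(1)[unfolded D] and FV = V(1)[unfolded L]
  have S: "U' \<in> SO3" "V' \<in> SO3" using U V by (simp_all add: fiber_def Mspace_def)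
  have S0: "phi u \<in> SO3" "phi v \<in> SO3" using u v_unit by (simp_all add: phi_in_SO3)
  let ?G = "transpose (phi u) ** U'" and ?H = "transpose (phi v) ** V'" and ?W = "transpose (phi u) ** phi v"
  note G = fiber_entries[OF FX FU] and H = fiber_entries[OF FY FV]
  have g: "?G$2$1 = 0" "?G$3$1 = 0" "(?G$1$1)\<^sup>2 = 1"
    using G(2)[of 2 1] G(2)[of 3 1] x SO3_column_norm[OF G(1), of 1] by (metis, metis, metis add.right_neutral zero_power2)
  have h: "?H$2$1 = 0" "?H$3$1 = 0" "(?H$1$1)\<^sup>2 = 1"
    using H(2)[of 2 1] H(2)[of 3 1] y SO3_column_norm[OF H(1), of 1] by (metis, metis, metis add.right_neutral zero_power2)
  have "transpose U' ** V' = transpose ?G ** (?W ** ?H)"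
    by (simp only: matrix_transpose_mul transpose_transpose matrix_mul_assoc[symmetric] SO3_cancel[OF S0(1)] SO3_cancel[OF S0(2)])
  hence "(transpose U' ** V') $ 1 $ 1 = ?G$1$1 * (?W ** ?H)$1$1"
    using g(1,2) by (simp only: mat3_mult_nth[of "transpose ?G"] transpose_nth)
  also have "(?W ** ?H)$1$1 = ?W$1$1 * ?H$1$1" using h(1,2) by (simp add: mat3_mult_nth[of ?W])
  finally have "((transpose U' ** V') $ 1 $ 1)\<^sup>2 = (?W$1$1)\<^sup>2" using g(3) h(3) by (simp add: power_mult_distrib)
  thus wz': "w' = 0 \<or> z' = 0"
    using wz covers_degenerate_iff[OF c S(1)] covers_degenerate_iff[OF covers_self S0(1)] by simp
  obtain u' where u': "u' \<in> unit_quats" "U' = phi u'" by (rule phi_surj[OF S(1)])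
  note o = other_pair[OF u'(1) FU[unfolded u'(2)] FV c[unfolded u'(2)]]
  show "class_curves k U' D' V' \<Lambda>' z' w' C' = C'_curves"
    using eigen_pair.C'_intrinsic[OF o(1) y wz'] C'_intrinsic[OF y wz] by (simp add: o(2) u'(2) D L)
qed

section \<open>Ties and counting\<close>

lemma infinite_unit_circle: "infinite (sphere (0::complex) 1)"
proof
  assume fin: "finite (sphere (0::complex) 1)"
  have "(\<lambda>t. Complex t (sqrt (1 - t\<^sup>2))) ` {0..1} \<subseteq> sphere 0 1"
    by (auto simp: cmod_def abs_square_le_1 power_le_one)
  hence "finite ((\<lambda>t. Complex t (sqrt (1 - t\<^sup>2))) ` {0..1::real})" using fin finite_subset by blast
  hence "finite {0..1::real}" by (rule finite_imageD) (auto intro: inj_onI)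
  thus False using infinite_Icc[of 0 "1::real"] by simp
qed

lemma card_labels:
  "card (labels_A z w) = (if cmod z = cmod w then 2 else 1)"
  "card (labels_B z w) = (if Re (cnj z * w) = 0 then 2 else 1)"
  "card (labels_C z w) = (if Im (cnj z * w) = 0 then 2 else 1)"
  "card (labels_A' z w) = (if cmod z = cmod w then 2 else 1)"
  unfolding labels_A_def labels_B_def labels_C_def labels_A'_def by auto

lemma finite_labels: "finite (L :: label set)"
proof -
  have "(UNIV :: label set) \<subseteq> {A1, A2, B1, B2, C1, C2, A1', A2', B', C'}" using label.exhaust by blast
  thus ?thesis by (meson finite.emptyI finite.insertI finite_subset subset_UNIV)
qed

context eigen_pair
begin

text \<open>When two optimal angles are both \<open>\<pi> / 4\<close>, a tie of the lengths would equate the distances of two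
  different rearrangements of \<open>y\<close> from \<open>x\<close>; these differ by a product of differences of distinct entries.\<close>

lemma no_double_ties:
  assumes y: "y$1 \<noteq> y$2" "y$1 \<noteq> y$3" "y$2 \<noteq> y$3"
  shows "lid = l13 \<Longrightarrow> \<not> (cmod z = cmod w \<and> Re (cnj z * w) = 0)"
    and "lid = l12 \<Longrightarrow> \<not> (cmod z = cmod w \<and> Im (cnj z * w) = 0)"
    and "l13 = l12 \<Longrightarrow> \<not> (Re (cnj z * w) = 0 \<and> Im (cnj z * w) = 0)"
proof -
  have A: "max (cmod z) (cmod w) = 1 / sqrt 2" if "cmod z = cmod w"
  proof -
    have "(cmod w)\<^sup>2 = (1 / sqrt 2)\<^sup>2" using zw that by (simp add: power_divide)
    hence "cmod w = 1 / sqrt 2" by (simp only: power2_eq_iff_nonneg norm_ge_zero zero_le_divide_1_iff real_sqrt_ge_zero zero_le_numeral)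
    thus ?thesis using that by simp
  qed
  have one: "cmod a = 1" if "(cmod a)\<^sup>2 = 1" for a using that by (simp add: power2_eq_1_iff) (smt (verit) norm_ge_zero)
  have B: "max (cmod (z + w) / sqrt 2) (cmod (z - w) / sqrt 2) = 1 / sqrt 2" if "Re (cnj z * w) = 0"
  proof -
    have "(cmod (z + w))\<^sup>2 = 1" "(cmod (z - w))\<^sup>2 = 1" unfolding cmod_pm[OF zw] that by simp_all
    thus ?thesis by (simp add: one)
  qed
  have C: "max (cmod (z - \<i> * w) / sqrt 2) (cmod (z + \<i> * w) / sqrt 2) = 1 / sqrt 2" if "Im (cnj z * w) = 0"
  proof -
    have "(cmod (z - \<i> * w))\<^sup>2 = 1" "(cmod (z + \<i> * w))\<^sup>2 = 1" unfolding cmod_pm[OF zw] that by simp_all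
    thus ?thesis by (simp add: one)
  qed
  have sq: "a = b" if "sqrt (c + a) = sqrt (c + b)" for a b c :: real using that by simp
  have x3: "x$3 = x$2" using x by simp
  have ne: "(norm (y - x))\<^sup>2 \<noteq> (norm (zperm zeta_jp - x))\<^sup>2" "(norm (y - x))\<^sup>2 \<noteq> (norm (zperm zeta_kp - x))\<^sup>2"
    "(norm (zperm zeta_jp - x))\<^sup>2 \<noteq> (norm (zperm zeta_kp - x))\<^sup>2"
  proof -
    have p: "(y$1 - y$3) * (x$1 - x$2) \<noteq> 0" "(y$1 - y$2) * (x$1 - x$2) \<noteq> 0" "(y$2 - y$3) * (x$1 - x$2) \<noteq> 0"
      using y x(2) by auto
    have d: "(norm (y - x))\<^sup>2 - (norm (zperm zeta_jp - x))\<^sup>2 = - 2 * ((y$1 - y$3) * (x$1 - x$2))"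
      "(norm (y - x))\<^sup>2 - (norm (zperm zeta_kp - x))\<^sup>2 = - 2 * ((y$1 - y$2) * (x$1 - x$2))"
      "(norm (zperm zeta_jp - x))\<^sup>2 - (norm (zperm zeta_kp - x))\<^sup>2 = 2 * ((y$2 - y$3) * (x$1 - x$2))"
      unfolding norm_vec3 zperm_simps by (simp_all add: x3) (simp_all add: power2_eq_square algebra_simps)
    show "(norm (y - x))\<^sup>2 \<noteq> (norm (zperm zeta_jp - x))\<^sup>2"
      "(norm (y - x))\<^sup>2 \<noteq> (norm (zperm zeta_kp - x))\<^sup>2"
      "(norm (zperm zeta_jp - x))\<^sup>2 \<noteq> (norm (zperm zeta_kp - x))\<^sup>2"
      using p d by (metis diff_self mult_eq_0_iff neg_equal_0_iff_equal zero_neq_numeral)+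
  qed
  show "lid = l13 \<Longrightarrow> \<not> (cmod z = cmod w \<and> Re (cnj z * w) = 0)"
    unfolding len_id_eq len_13_top_eq using A B sq ne(1) by metis
  show "lid = l12 \<Longrightarrow> \<not> (cmod z = cmod w \<and> Im (cnj z * w) = 0)"
    unfolding len_id_eq len_12_top_eq using A C sq ne(2) by metis
  show "l13 = l12 \<Longrightarrow> \<not> (Re (cnj z * w) = 0 \<and> Im (cnj z * w) = 0)"
    unfolding len_13_top_eq len_12_top_eq using B C sq ne(3) by metis
qed

text \<open>The exclusion of double ties keeps the number at four or less: of the lengths that tie for the minimum, at most
  one contributes two classes.\<close>

lemma card_listed_top:
  assumes y: "y$1 \<noteq> y$2" "y$1 \<noteq> y$3" "y$2 \<noteq> y$3"
  shows "card (listed_top lid l13 l12 z w) \<in> {1, 2, 3, 4}"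
proof -
  let ?L = "listed_top lid l13 l12 z w"
  note t = no_double_ties[OF y]
  have "card ?L \<le> (if lid \<le> l13 \<and> lid \<le> l12 then card (labels_A z w) else 0)
     + (if l13 \<le> lid \<and> l13 \<le> l12 then card (labels_B z w) else 0) + (if l12 \<le> lid \<and> l12 \<le> l13 then card (labels_C z w) else 0)"
    unfolding listed_top_eq
    by (rule order.trans[OF card_Un_le add_mono[OF order.trans[OF card_Un_le add_mono]]]) simp_all
  also have "\<dots> \<le> 4"
    unfolding card_labels using t by (cases "lid = l13 \<and> l13 = l12") auto
  finally have "card ?L \<le> 4" .
  moreover have "?L \<noteq> {}"
    unfolding listed_top_def by (auto simp: labels_A_def labels_B_def labels_C_def)
  hence "card ?L \<noteq> 0" using finite_labels by simp
  ultimately have "card ?L = 1 \<or> card ?L = 2 \<or> card ?L = 3 \<or> card ?L = 4" by linarith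
  thus ?thesis by simp
qed

end

section \<open>The classification of minimal curves\<close>

theorem theorem6p3:
  fixes k :: real and X Y U D V \<Lambda> :: mat3 and z w :: complex
    and classes listed :: "label set" and zetas :: "quat set"
    and M :: "label \<Rightarrow> (real \<Rightarrow> mat3) set" and chi :: "label \<Rightarrow> (real \<Rightarrow> mat3)"
    and lid l13 l12 l13m :: real
  assumes k: "k > 0"
    and X: "X \<in> S_mid"
    and Y: "Y \<in> S_top \<union> S_mid"
    and UD: "(U, D) \<in> fiber X" "D \<in> D_J1"
    and VL: "(V, \<Lambda>) \<in> fiber Y" "Y \<in> S_mid \<Longrightarrow> \<Lambda> \<in> D_J1"
    and zw: "covers z w U V"
  defines "M \<equiv> class_curves k U D V \<Lambda> z w"
    and "chi \<equiv> \<lambda>l. the_elem (M l)"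
    and "lid \<equiv> len_id k D \<Lambda> z w"
    and "l13 \<equiv> len_13_top k D \<Lambda> z w"
    and "l12 \<equiv> len_12_top k D \<Lambda> z w"
    and "l13m \<equiv> len_13_mid k D \<Lambda> z w"
    and "classes \<equiv> (if Y \<in> S_top then top_classes else mid_classes)"
    and "zetas \<equiv> (if Y \<in> S_top then zetas_top else zetas_mid)"
    and "listed \<equiv> (if Y \<in> S_top then listed_top lid l13 l12 z w else listed_mid lid l13m z w)"
  shows
    "\<comment> \<open>(i)\<close>
     ((\<forall>l\<in>classes - {C'}. class_defined z w l \<longrightarrow> (\<exists>c. M l = {c}))
     \<and> (\<forall>U' D' V' \<Lambda>' z' w'.
          (U', D') \<in> fiber_component X (U, D) \<longrightarrow> (V', \<Lambda>') \<in> fiber_component Y (V, \<Lambda>) \<longrightarrow>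
          covers z' w' U' V' \<longrightarrow>
          (\<forall>l\<in>classes. (class_defined z' w' l \<longleftrightarrow> class_defined z w l)
                      \<and> class_curves k U' D' V' \<Lambda>' z' w' l = M l))
     \<and> (Y \<in> S_mid \<and> (w = 0 \<or> z = 0) \<longrightarrow>
          infinite (M C')
          \<and> (\<exists>h. bij_betw h (sphere (0::complex) 1) (M C')
                \<and> (\<forall>(\<zeta>, rU, rV)\<in>triples z w C'. triple_curves k U D V \<Lambda> (\<zeta>, rU, rV) = {h (rU\<^sup>2)}))
          \<and> (\<forall>U' D' V' \<Lambda>' z' w'.
                (U', D') \<in> fiber X \<longrightarrow> D' \<in> D_J1 \<longrightarrow> (V', \<Lambda>') \<in> fiber Y \<longrightarrow> \<Lambda>' \<in> D_J1 \<longrightarrow>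
                covers z' w' U' V' \<longrightarrow>
                (w' = 0 \<or> z' = 0) \<and> class_curves k U' D' V' \<Lambda>' z' w' C' = M C')))
     \<and> \<comment> \<open>(ii)\<close>
     ((\<forall>l\<in>listed. class_defined z w l \<and>
        (\<forall>\<tau>\<in>triples z w l.
            minimal_pair k X Y (first_point U D \<tau>) (second_point V \<Lambda> \<tau>)
            \<and> first_point U D \<tau> \<in> fiber_component X (U, D)))
     \<and> (\<forall>p q. minimal_pair k X Y p q \<longrightarrow> p \<in> fiber_component X (U, D) \<longrightarrow>
          (\<exists>P\<in>signed_perms. sp_act P p \<in> fiber_component X (U, D) \<and>
             (\<exists>l\<in>listed. \<exists>\<tau>\<in>triples z w l.
                 sp_act P p = first_point U D \<tau> \<and> sp_act P q = second_point V \<Lambda> \<tau>)))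
     \<and> (\<forall>p q. minimal_pair k X Y p q \<longrightarrow> p \<in> fiber_component X (U, D) \<longrightarrow>
          (\<exists>\<zeta>\<in>zetas. q \<in> fiber_component Y (second_point V \<Lambda> (\<zeta>, 1, 1))) \<longrightarrow>
          (\<exists>l\<in>listed. \<exists>\<tau>\<in>triples z w l. p = first_point U D \<tau> \<and> q = second_point V \<Lambda> \<tau>)))
     \<and> \<comment> \<open>(iii)\<close>
     (Y \<in> S_top \<longrightarrow>
       (lid < min l13 l12 \<longrightarrow> MSSR k X Y = chi ` labels_A z w)
     \<and> (l13 < min lid l12 \<longrightarrow> MSSR k X Y = chi ` labels_B z w)
     \<and> (l12 < min lid l13 \<longrightarrow> MSSR k X Y = chi ` labels_C z w)
     \<and> (lid = l13 \<and> l13 < l12 \<longrightarrow>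
          MSSR k X Y = chi ` labels_A z w \<union> chi ` labels_B z w
          \<and> \<not> (cmod z = cmod w \<and> Re (cnj z * w) = 0))
     \<and> (lid = l12 \<and> l12 < l13 \<longrightarrow>
          MSSR k X Y = chi ` labels_A z w \<union> chi ` labels_C z w
          \<and> \<not> (cmod z = cmod w \<and> Im (cnj z * w) = 0))
     \<and> (l13 = l12 \<and> l12 < lid \<longrightarrow>
          MSSR k X Y = chi ` labels_B z w \<union> chi ` labels_C z w
          \<and> \<not> (Re (cnj z * w) = 0 \<and> Im (cnj z * w) = 0))
     \<and> (lid = l13 \<and> l13 = l12 \<longrightarrow>
          MSSR k X Y = chi ` labels_A z w \<union> chi ` labels_B z w \<union> chi ` labels_C z w
          \<and> \<not> (cmod z = cmod w \<and> Re (cnj z * w) = 0)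
          \<and> \<not> (cmod z = cmod w \<and> Im (cnj z * w) = 0)
          \<and> \<not> (Re (cnj z * w) = 0 \<and> Im (cnj z * w) = 0))
     \<and> inj_on chi listed
     \<and> card (MSSR k X Y) = card listed \<and> card (MSSR k X Y) \<in> {1, 2, 3, 4}
     \<and> (card (MSSR k X Y) = 1 \<longleftrightarrow> (\<exists>!c. c \<in> MSSR k X Y)))
     \<and> \<comment> \<open>(iv)\<close>
     (Y \<in> S_mid \<longrightarrow>
       (card (MSSR k X Y) \<in> {1, 2, 3} \<or> infinite (MSSR k X Y))
     \<and> (lid < l13m \<longrightarrow>
          MSSR k X Y = chi ` labels_A' z w
          \<and> card (MSSR k X Y) = (if cmod z = cmod w then 2 else 1))
     \<and> (lid > l13m \<longrightarrow>
          (z \<noteq> 0 \<and> w \<noteq> 0 \<longrightarrow> MSSR k X Y = {chi B'} \<and> card (MSSR k X Y) = 1)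
          \<and> (w = 0 \<or> z = 0 \<longrightarrow> MSSR k X Y = M C' \<and> infinite (MSSR k X Y)))
     \<and> (lid = l13m \<longrightarrow>
          (z \<noteq> 0 \<and> w \<noteq> 0 \<longrightarrow>
             MSSR k X Y = chi ` labels_A' z w \<union> {chi B'}
             \<and> card (MSSR k X Y) = (if cmod z = cmod w then 3 else 2))
          \<and> (w = 0 \<longrightarrow> MSSR k X Y = {chi A1'} \<union> M C' \<and> infinite (MSSR k X Y))
          \<and> (z = 0 \<longrightarrow> MSSR k X Y = {chi A2'} \<union> M C' \<and> infinite (MSSR k X Y)))
     \<and> (cmod z \<ge> cmod w \<longrightarrow>
          (1, 1, cnj (sgn z)) \<in> triples z w A1'
          \<and> triple_curves k U D V \<Lambda> (1, 1, cnj (sgn z)) = {chi A1'}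
          \<and> (\<forall>\<tau>\<in>triples z w A1'. triple_curves k U D V \<Lambda> \<tau> = {chi A1'}))
     \<and> (cmod z \<le> cmod w \<longrightarrow>
          (unit_j, 1, sgn w) \<in> triples z w A2'
          \<and> triple_curves k U D V \<Lambda> (unit_j, 1, sgn w) = {chi A2'}
          \<and> (\<forall>\<tau>\<in>triples z w A2'. triple_curves k U D V \<Lambda> \<tau> = {chi A2'})))"
proof -
  have US: "U \<in> SO3" "V \<in> SO3" and \<Lambda>P: "\<Lambda> \<in> DiagPos" using UD(1) VL(1) by (simp_all add: fiber_def Mspace_def)
  obtain u where u: "u \<in> unit_quats" and U: "U = phi u" by (rule phi_surj[OF US(1)])
  obtain x where D: "D = expdiag x" and x: "x$2 = x$3" "x$1 \<noteq> x$2" by (rule D_J1_expdiag[OF UD(2)])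
  obtain y where L: "\<Lambda> = expdiag y" by (rule DiagPos_expdiag[OF \<Lambda>P])
  define v where "v = u * quat_zw z w"
  have nzw: "(cmod z)\<^sup>2 + (cmod w)\<^sup>2 = 1" using zw by (simp add: covers_def)
  have "phi (quat_zw z w) = transpose (phi u) ** V" using zw US(1) by (simp add: covers_def matrix_inv_SO3 U)
  hence V: "V = phi v" using u by (simp add: v_def phi_mult SO3_cancel phi_in_SO3)
  have FX: "(phi u, expdiag x) \<in> fiber X" and FY: "(phi v, expdiag y) \<in> fiber Y"
    using UD(1) VL(1) by (simp_all add: U V D L)
  interpret E: eigen_pair k X Y u v x y z w
    by unfold_locales (use k u nzw x FX FY in \<open>simp_all add: v_def\<close>)
  have M: "M = class_curves k (phi u) (expdiag x) (phi v) (expdiag y) z w" by (simp add: M_def U V D L)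
  have lens: "lid = len_id k (expdiag x) (expdiag y) z w" "l13 = len_13_top k (expdiag x) (expdiag y) z w"
    "l12 = len_12_top k (expdiag x) (expdiag y) z w" "l13m = len_13_mid k (expdiag x) (expdiag y) z w"
    by (simp_all add: lid_def l13_def l12_def l13m_def D L)
  let ?sp = "second_point (phi v) (expdiag y)" and ?curves = "triple_curves k (phi u) (expdiag x) (phi v) (expdiag y)"
  have excl: "Y \<in> S_top \<Longrightarrow> Y \<notin> S_mid" by (auto simp: S_top_def S_mid_def)
  have ytop: "y$1 \<noteq> y$2" "y$1 \<noteq> y$3" "y$2 \<noteq> y$3" if "Y \<in> S_top" using S_top_distinct[OF that FY] .
  have ymid: "y$2 = y$3 \<and> y$1 \<noteq> y$2" if m: "Y \<in> S_mid"
  proof -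
    obtain y' where "\<Lambda> = expdiag y'" "y'$2 = y'$3" "y'$1 \<noteq> y'$2" by (rule D_J1_expdiag[OF VL(2)[OF m]])
    thus ?thesis by (simp add: L)
  qed
  \<comment> \<open>The two kinds of \<open>Y\<close> are treated together from here on; they differ in the classes and in \<open>S\<close>.\<close>
  obtain S where CP: "class_pair k X Y u v x y z w classes S"
    and comp: "\<And>l q. \<lbrakk>l \<in> classes; q \<in> fiber_component Y (?sp (label_zeta l, 1, 1))\<rbrakk> \<Longrightarrow>
      \<exists>s\<in>S. \<forall>r. q = ?sp (label_zeta l, r, s)"
    and listed_iff: "\<And>l. l \<in> listed \<longleftrightarrow> l \<in> classes \<and> class_defined z w l \<and> (\<forall>l'\<in>classes. E.label_length l \<le> E.label_length l')"
    and zetas_eq: "zetas = label_zeta ` classes"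
    and agree: "\<And>l \<tau> \<tau>'. \<lbrakk>l \<in> classes; l \<noteq> C'; \<tau> \<in> triples z w l; \<tau>' \<in> triples z w l\<rbrakk> \<Longrightarrow> ?curves \<tau> = ?curves \<tau>'"
    and change: "\<And>U' D' V' \<Lambda>' z' w' l. \<lbrakk>(U', D') \<in> fiber_component X (phi u, expdiag x);
        (V', \<Lambda>') \<in> fiber_component Y (phi v, expdiag y); covers z' w' U' V'; l \<in> classes\<rbrakk> \<Longrightarrow>
        (class_defined z' w' l \<longleftrightarrow> class_defined z w l) \<and> class_curves k U' D' V' \<Lambda>' z' w' l = M l"
    and distinct: "\<And>l1 l2 \<tau>1 \<tau>2. \<lbrakk>l1 \<in> classes - {C'}; l2 \<in> classes - {C'}; \<tau>1 \<in> triples z w l1; \<tau>2 \<in> triples z w l2;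
        ?curves \<tau>1 = ?curves \<tau>2\<rbrakk> \<Longrightarrow> l1 = l2"
  proof (cases "Y \<in> S_top")
    case True
    note y = ytop[OF True]
    have cls: "classes = top_classes" "zetas = zetas_top" "listed = listed_top lid l13 l12 z w"
      using True by (simp_all add: classes_def zetas_def listed_def)
    show thesis
    proof (rule that[of "{1}"], unfold cls, goal_cases)
      case 1
      show ?case by (rule E.top_class_pair[OF y])
    next
      case (2 l q)
      have "label_zeta l \<in> zetas_top" using 2(1) E.label_zeta_top by blast
      thus ?case using E.top_component[OF y _ 2(2)] by blast
    next
      case (3 l)
      show ?case
        using E.listed_top_minimal[of l] E.top_minimal_defined[of l] unfolding lens by blast
    next
      case 4
      show ?case by (rule E.label_zeta_top[symmetric])
    next
      case (5 l \<tau> \<tau>')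
      show ?case by (rule E.top_single[OF y 5(1,3,4)])
    next
      case (6 U' D' V' \<Lambda>' z' w' l)
      show ?case using E.top_component_change[OF y 6] unfolding M by blast
    next
      case (7 l1 l2 \<tau>1 \<tau>2)
      show ?case by (rule E.top_distinct[OF y _ _ 7(3-5)]) (use 7(1,2) in auto)
    qed
  next
    case False
    hence mid: "Y \<in> S_mid" using Y by simp
    note y = ymid[OF mid, THEN conjunct1] ymid[OF mid, THEN conjunct2]
    have cls: "classes = mid_classes" "zetas = zetas_mid" "listed = listed_mid lid l13m z w"
      using False by (simp_all add: classes_def zetas_def listed_def)
    show thesis
    proof (rule that[of "sphere 0 1"], unfold cls, goal_cases)
      case 1
      show ?case by (rule E.mid_class_pair[OF y])
    next
      case (2 l q)
      have "label_zeta l \<in> zetas_mid" using 2(1) E.label_zeta_mid by blast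
      hence "label_zeta l \<in> zetas_top" by (auto simp: zetas_mid_def zetas_top_def)
      thus ?case by (rule E.mid_component[OF y _ 2(2)])
    next
      case (3 l)
      show ?case using E.listed_mid_minimal[of l] unfolding lens by blast
    next
      case 4
      show ?case by (rule E.label_zeta_mid[symmetric])
    next
      case (5 l \<tau> \<tau>')
      consider "l = A1'" | "l = A2'" | "l = B'" using 5(1,2) by (auto simp: mid_classes_def)
      thus ?case
      proof cases
        case 1
        thus ?thesis using E.A'_single(1)[OF y, of \<tau>] E.A'_single(1)[OF y, of \<tau>'] 5(3,4) by simp
      next
        case 2
        thus ?thesis using E.A'_single(2)[OF y, of \<tau>] E.A'_single(2)[OF y, of \<tau>'] 5(3,4) by simp
      next
        case 3
        thus ?thesis using E.B'_single[of \<tau> \<tau>'] 5(3,4) by simp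
      qed
    next
      case (6 U' D' V' \<Lambda>' z' w' l)
      show ?case using E.mid_component_change[OF y 6] unfolding M by blast
    next
      case (7 l1 l2 \<tau>1 \<tau>2)
      have "l1 \<in> mid_classes" "l2 \<in> mid_classes" using 7(1,2) by auto
      from E.mid_distinct[OF y this 7(3-5)] show ?case using 7(1,2) by auto
    qed
  qed
  interpret C: class_pair k X Y u v x y z w classes S by (rule CP)
  have listed_min: "listed = C.minimizers" unfolding C.minimizers_def using listed_iff by blast
  have listed_classes: "l \<in> classes" "class_defined z w l" if "l \<in> listed" for l using that listed_iff by auto
  have single: "M l = {chi l}" "\<And>\<tau>. \<tau> \<in> triples z w l \<Longrightarrow> ?curves \<tau> = {chi l}"
    if l: "l \<in> classes" "l \<noteq> C'" "class_defined z w l" for l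
  proof -
    obtain c where c: "M l = {c}" "\<forall>\<tau>\<in>triples z w l. ?curves \<tau> = {c}"
      unfolding M using C.class_curves_single[OF l(1,3) agree[OF l(1,2)]] by blast
    have "chi l = c" using c(1) by (simp add: chi_def)
    thus "M l = {chi l}" "\<And>\<tau>. \<tau> \<in> triples z w l \<Longrightarrow> ?curves \<tau> = {chi l}" using c by simp_all
  qed
  have inj: "inj_on chi (listed - {C'})"
  proof (rule inj_onI)
    fix l1 l2 assume l: "l1 \<in> listed - {C'}" "l2 \<in> listed - {C'}" "chi l1 = chi l2"
    obtain \<tau>1 \<tau>2 where t: "\<tau>1 \<in> triples z w l1" "\<tau>2 \<in> triples z w l2"
      using C.triples_nonempty[of l1] C.triples_nonempty[of l2] listed_classes l by blast
    have "?curves \<tau>1 = ?curves \<tau>2" using single(2)[OF _ _ _ t(1)] single(2)[OF _ _ _ t(2)] listed_classes l by simp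
    thus "l1 = l2" using distinct[OF _ _ t] listed_classes l by blast
  qed
  have MSSR: "MSSR k X Y = (\<Union>l\<in>listed. M l)" unfolding listed_min M by (rule C.MSSR_eq)
  have MSSR_chi: "MSSR k X Y = chi ` listed" "card (MSSR k X Y) = card listed" if "C' \<notin> listed"
  proof -
    have "M l = {chi l}" if "l \<in> listed" for l using single(1) listed_classes[OF that] that \<open>C' \<notin> listed\<close> by metis
    thus e: "MSSR k X Y = chi ` listed" unfolding MSSR by auto
    have "inj_on chi listed" using inj that by simp
    thus "card (MSSR k X Y) = card listed" unfolding e by (rule card_image)
  qed
  have circle: "\<exists>h. bij_betw h (sphere (0::complex) 1) (M C') \<and> (\<forall>(\<zeta>, rU, rV)\<in>triples z w C'. ?curves (\<zeta>, rU, rV) = {h (rU\<^sup>2)})"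
    "infinite (M C')" if a: "Y \<in> S_mid" "w = 0 \<or> z = 0"
  proof -
    show ex: "\<exists>h. bij_betw h (sphere (0::complex) 1) (M C') \<and> (\<forall>(\<zeta>, rU, rV)\<in>triples z w C'. ?curves (\<zeta>, rU, rV) = {h (rU\<^sup>2)})"
      unfolding M using E.C'_circle ymid[OF a(1)] a(2) by blast
    thus "infinite (M C')" using bij_betw_finite infinite_unit_circle by blast
  qed
  show ?thesis
  proof (rule conjI[OF _ conjI[OF _ conjI]], goal_cases)
    case 1
    show ?case
    proof (rule conjI[OF _ conjI], goal_cases)
      case 1
      show ?case using single(1) by blast
    next
      case 2
      show ?case unfolding U V D L using change by blast
    next
      case 3
      show ?case
      proof (rule impI, goal_cases)
        case 1
        note y = ymid[OF 1[THEN conjunct1], THEN conjunct1] ymid[OF 1[THEN conjunct1], THEN conjunct2]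
        have "(w' = 0 \<or> z' = 0) \<and> class_curves k U' D' V' \<Lambda>' z' w' C' = M C'"
          if "(U', D') \<in> fiber X" "D' \<in> D_J1" "(V', \<Lambda>') \<in> fiber Y" "\<Lambda>' \<in> D_J1" "covers z' w' U' V'"
          for U' D' V' \<Lambda>' z' w'
          using E.C'_independent[OF y 1[THEN conjunct2] that] unfolding M by blast
        thus ?case using circle[OF 1[THEN conjunct1] 1[THEN conjunct2]] unfolding U V D L by blast
      qed
    qed
  next
    case 2
    show ?case
      unfolding U V D L
    proof (rule conjI[OF _ conjI], goal_cases)
      case 1
      show ?case using C.minimal_pair_triple listed_min listed_classes by blast
    next
      case 2
      show ?case
      proof (intro allI impI, goal_cases)
        case (1 p q)
        \<comment> \<open>The matrix that brings the pair into standard form is the one asked for.\<close>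
        obtain P l \<tau> where P: "P \<in> signed_perms" "l \<in> C.minimizers" "\<tau> \<in> triples z w l"
          "sp_act P p = first_point (phi u) (expdiag x) \<tau>" "sp_act P q = ?sp \<tau>"
          by (rule C.minimal_pair_reduce[OF 1(1)])
        thus ?case using C.minimal_pair_triple(2)[OF P(2,3)] listed_min by metis
      qed
    next
      case 3
      show ?case using C.minimal_pair_component[OF comp] unfolding zetas_eq listed_min by blast
    qed
  next
    case 3
    show ?case
    proof (rule impI, goal_cases)
      case top: 1
      note y = ytop[OF top]
      have Ldef: "listed = listed_top lid l13 l12 z w" using top by (simp add: listed_def)
      have nC: "C' \<notin> listed" using listed_classes(1)[of C'] top by (auto simp: classes_def top_classes_def)
      note ties = E.no_double_ties[OF y, folded lens]
      have R: "MSSR k X Y = chi ` listed_top lid l13 l12 z w" using MSSR_chi(1)[OF nC] Ldef by simp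
      have card: "card (MSSR k X Y) = card listed" by (rule MSSR_chi(2)[OF nC])
      have g0: "card (MSSR k X Y) \<in> {1, 2, 3, 4}" unfolding card Ldef using E.card_listed_top[OF y, folded lens] .
      have g1: "inj_on chi listed" using inj nC by simp
      have g2: "card (MSSR k X Y) = 1 \<longleftrightarrow> (\<exists>!c. c \<in> MSSR k X Y)"
        by (auto simp: card_1_singleton_iff)
      have g3: "lid < min l13 l12 \<longrightarrow> MSSR k X Y = chi ` labels_A z w"
        "l13 < min lid l12 \<longrightarrow> MSSR k X Y = chi ` labels_B z w"
        "l12 < min lid l13 \<longrightarrow> MSSR k X Y = chi ` labels_C z w"
        unfolding R by (auto simp: listed_top_eq)
      have U: "lid = l13 \<and> l13 < l12 \<longrightarrow> MSSR k X Y = chi ` labels_A z w \<union> chi ` labels_B z w"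
        "lid = l12 \<and> l12 < l13 \<longrightarrow> MSSR k X Y = chi ` labels_A z w \<union> chi ` labels_C z w"
        "l13 = l12 \<and> l12 < lid \<longrightarrow> MSSR k X Y = chi ` labels_B z w \<union> chi ` labels_C z w"
        "lid = l13 \<and> l13 = l12 \<longrightarrow> MSSR k X Y = chi ` labels_A z w \<union> chi ` labels_B z w \<union> chi ` labels_C z w"
        unfolding R by (auto simp: listed_top_eq image_Un)
      have g4: "lid = l13 \<and> l13 < l12 \<longrightarrow>
            MSSR k X Y = chi ` labels_A z w \<union> chi ` labels_B z w
            \<and> \<not> (cmod z = cmod w \<and> Re (cnj z * w) = 0)"
        using U(1) ties(1) by (intro impI conjI) (simp_all only: simp_thms)
      have g5: "lid = l12 \<and> l12 < l13 \<longrightarrow>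
            MSSR k X Y = chi ` labels_A z w \<union> chi ` labels_C z w
            \<and> \<not> (cmod z = cmod w \<and> Im (cnj z * w) = 0)"
        using U(2) ties(2) by (intro impI conjI) (simp_all only: simp_thms)
      have g6: "l13 = l12 \<and> l12 < lid \<longrightarrow>
            MSSR k X Y = chi ` labels_B z w \<union> chi ` labels_C z w
            \<and> \<not> (Re (cnj z * w) = 0 \<and> Im (cnj z * w) = 0)"
        using U(3) ties(3) by (intro impI conjI) (simp_all only: simp_thms)
      have g7: "lid = l13 \<and> l13 = l12 \<longrightarrow>
            MSSR k X Y = chi ` labels_A z w \<union> chi ` labels_B z w \<union> chi ` labels_C z w
            \<and> \<not> (cmod z = cmod w \<and> Re (cnj z * w) = 0)
            \<and> \<not> (cmod z = cmod w \<and> Im (cnj z * w) = 0)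
            \<and> \<not> (Re (cnj z * w) = 0 \<and> Im (cnj z * w) = 0)"
        using U(4) ties by (intro impI conjI) (simp_all only: simp_thms)
      show ?case
        using g0 g1 g2 g3 g4 g5 g6 g7 card by (intro conjI)
    qed
  next
    case 4
    show ?case
    proof (rule impI, goal_cases)
      case mid: 1
      have nt: "Y \<notin> S_top" using excl mid by blast
      have Ldef: "listed = listed_mid lid l13m z w" and cls: "classes = mid_classes"
        using nt by (simp_all add: listed_def classes_def)
      have w0: "w = 0 \<Longrightarrow> z \<noteq> 0" using nzw by auto
      note inf = circle(2)[OF mid]
      have C'A: "C' \<notin> labels_A' z w" "B' \<notin> labels_A' z w" by (auto simp: labels_A'_def)
      have 1: "MSSR k X Y = chi ` labels_A' z w \<and> card (MSSR k X Y) = (if cmod z = cmod w then 2 else 1)" if "lid < l13m"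
      proof -
        have e: "listed = labels_A' z w" using that by (simp add: Ldef listed_mid_def)
        have "C' \<notin> listed" unfolding e by (rule C'A)
        from MSSR_chi[OF this] show ?thesis by (simp add: e card_labels)
      qed
      have 2: "z \<noteq> 0 \<and> w \<noteq> 0 \<longrightarrow> MSSR k X Y = {chi B'} \<and> card (MSSR k X Y) = 1" if lm: "lid > l13m"
      proof
        assume wz: "z \<noteq> 0 \<and> w \<noteq> 0"
        have e: "listed = {B'}" using lm wz by (simp add: Ldef listed_mid_def)
        have "C' \<notin> listed" unfolding e by simp
        from MSSR_chi[OF this] show "MSSR k X Y = {chi B'} \<and> card (MSSR k X Y) = 1" by (simp add: e)
      qed
      have 3: "w = 0 \<or> z = 0 \<longrightarrow> MSSR k X Y = M C' \<and> infinite (MSSR k X Y)" if lm: "lid > l13m"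
      proof
        assume wz: "w = 0 \<or> z = 0"
        have e: "listed = {C'}" using lm wz by (auto simp: Ldef listed_mid_def)
        show "MSSR k X Y = M C' \<and> infinite (MSSR k X Y)" using inf[OF wz] by (simp add: MSSR e)
      qed
      have 4: "z \<noteq> 0 \<and> w \<noteq> 0 \<longrightarrow> MSSR k X Y = chi ` labels_A' z w \<union> {chi B'} \<and> card (MSSR k X Y) = (if cmod z = cmod w then 3 else 2)"
        if lm: "lid = l13m"
      proof
        assume wz: "z \<noteq> 0 \<and> w \<noteq> 0"
        have e: "listed = labels_A' z w \<union> {B'}" using lm wz by (simp add: Ldef listed_mid_def)
        have "C' \<notin> listed" unfolding e using C'A by simp
        from MSSR_chi[OF this] show "MSSR k X Y = chi ` labels_A' z w \<union> {chi B'} \<and> card (MSSR k X Y) = (if cmod z = cmod w then 3 else 2)" using C'A(2) by (simp add: e card_labels finite_labels)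
      qed
      have 5: "w = 0 \<longrightarrow> MSSR k X Y = {chi A1'} \<union> M C' \<and> infinite (MSSR k X Y)" if lm: "lid = l13m"
      proof
        assume wz: "w = 0"
        have e: "listed = {A1', C'}" using lm wz by (simp add: Ldef listed_mid_def)
        have "M A1' = {chi A1'}" by (rule single(1)) (use listed_classes[of A1'] e in auto)
        thus "MSSR k X Y = {chi A1'} \<union> M C' \<and> infinite (MSSR k X Y)" using inf wz by (simp add: MSSR e)
      qed
      have 6: "z = 0 \<longrightarrow> MSSR k X Y = {chi A2'} \<union> M C' \<and> infinite (MSSR k X Y)" if lm: "lid = l13m"
      proof
        assume wz: "z = 0"
        have e: "listed = {A2', C'}" using lm wz w0 by (auto simp: Ldef listed_mid_def)
        have "M A2' = {chi A2'}" by (rule single(1)) (use listed_classes[of A2'] e in auto)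
        thus "MSSR k X Y = {chi A2'} \<union> M C' \<and> infinite (MSSR k X Y)" using inf wz by (simp add: MSSR e)
      qed
      have 7: "(1, 1, cnj (sgn z)) \<in> triples z w A1' \<and> triple_curves k U D V \<Lambda> (1, 1, cnj (sgn z)) = {chi A1'}
            \<and> (\<forall>\<tau>\<in>triples z w A1'. triple_curves k U D V \<Lambda> \<tau> = {chi A1'})" if "cmod z \<ge> cmod w"
      proof -
        have z: "z \<noteq> 0" using that nzw by auto
        have "(1, 1, 1 * 1 * cnj (sgn z)) \<in> class_triples z w A1'"
          unfolding class_triples.simps by (intro CollectI exI[of _ 1]) simp
        hence t: "(1, 1, cnj (sgn z)) \<in> triples z w A1'" using z by (simp add: triples_def)
        have "\<forall>\<tau>\<in>triples z w A1'. triple_curves k U D V \<Lambda> \<tau> = {chi A1'}"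
          unfolding U V D L using single(2)[of A1'] z by (simp add: cls mid_classes_def)
        thus ?thesis using t by blast
      qed
      have 8: "(unit_j, 1, sgn w) \<in> triples z w A2' \<and> triple_curves k U D V \<Lambda> (unit_j, 1, sgn w) = {chi A2'}
            \<and> (\<forall>\<tau>\<in>triples z w A2'. triple_curves k U D V \<Lambda> \<tau> = {chi A2'})" if "cmod z \<le> cmod w"
      proof -
        have w: "w \<noteq> 0" using that nzw by auto
        have "(unit_j, 1, 1 * cnj 1 * sgn w) \<in> class_triples z w A2'"
          unfolding class_triples.simps by (intro CollectI exI[of _ 1]) simp
        hence t: "(unit_j, 1, sgn w) \<in> triples z w A2'" using w by (simp add: triples_def)
        have "\<forall>\<tau>\<in>triples z w A2'. triple_curves k U D V \<Lambda> \<tau> = {chi A2'}"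
          unfolding U V D L using single(2)[of A2'] w by (simp add: cls mid_classes_def)
        thus ?thesis using t by blast
      qed
      have 0: "card (MSSR k X Y) \<in> {1, 2, 3} \<or> infinite (MSSR k X Y)"
      proof -
        consider "lid < l13m" | "lid > l13m" "z \<noteq> 0 \<and> w \<noteq> 0" | "lid > l13m" "w = 0 \<or> z = 0"
          | "lid = l13m" "z \<noteq> 0 \<and> w \<noteq> 0" | "lid = l13m" "w = 0" | "lid = l13m" "z = 0" by linarith
        thus ?thesis
          by cases (use 1 2 3 4 5 6 in \<open>auto split: if_splits\<close>)
      qed
      show ?case
        by (rule conjI[OF 0 conjI[OF impI[OF 1] conjI[OF impI conjI[OF impI conjI[OF impI[OF 7] impI[OF 8]]]]]])
          (assumption | rule conjI[OF 2 3] | rule conjI[OF 4 conjI[OF 5 6]])+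
    qed
  qed
qed

end
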